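(* Let $g\in \mathbb{R}[x_1,\dots,x_{n}]$ be a nonzero homogeneous polynomial of degree $d-2$. Then $g$ is dually Lorentzian if and only if for all $H,H',H_1,\dots,H_n\in \mathrm{Herm}_d$ with $H,H_1,\dots,H_n$ positive definite and $H'\notin \mathbb{R} H$, we have $\mathrm{MD}(H,H,g(H_1,\dots,H_n))> 0$ and $$\mathrm{MD}(H,H',g(H_1,\dots,H_n))^2>\mathrm{MD}(H,H,g(H_1,\dots,H_n))\,\mathrm{MD}(H',H',g(H_1,\dots,H_n)).$$
   Context: $\mathrm{Herm}_d$ is the real vector space of Hermitian $d\times d$ complex matrices and $\det\colon\mathrm{Herm}_d\to\mathbb{R}$ is the determinant, a homogeneous polynomial function of degree $d$. For a homogeneous polynomial $g\in\mathbb{R}[x_1,\dots,x_n]$ of degree $d-2$ and $H,H',H_1,\dots,H_n\in\mathrm{Herm}_d$, the generalized mixed discriminant is $$\mathrm{MD}(H,H',g(H_1,\dots,H_n)):=\frac{1}{d!}D_{H}D_{H'}\,g(D_{H_1},\dots,D_{H_n})\det\in\mathbb{R},$$ where $D_H$ denotes directional derivative along $H$. A homogeneous $f\in\mathbb{R}[x_1,\dots,x_n]$ of degree $k$ is Lorentzian if for all $v_1,\dots,v_k\in\mathbb{R}_{\ge0}^n\setminus\{0\}$ one has $D_{v_1}\cdots D_{v_k}f\ge0$ and, if $k\ge2$, the symmetric bilinear form $(x,y)\mapsto D_xD_yD_{v_3}\cdots D_{v_k}f$ on $\mathbb{R}^n$ has at most one positive eigenvalue. A homogeneous $f$ of degree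 at most $\kappa_i$ in $x_i$ is dually Lorentzian if $f^\vee=N\big(x_1^{\kappa_1}\cdots x_n^{\kappa_n}f(x_1^{-1},\dots,x_n^{-1})\big)$ is Lorentzian, where $N$ is the linear operator with $N(x^\alpha)=x^\alpha/\alpha!$, $\alpha!=\alpha_1!\cdots\alpha_n!$ (this is independent of the choice of $\kappa$). *)

theory Defs
  imports
    "HOL-Analysis.Derivative"
    "HOL-Library.Poly_Mapping"
    "Jordan_Normal_Form.Char_Poly"
    "Jordan_Normal_Form.Schur_Decomposition"
begin

subsection \<open>Multivariate polynomials\<close>

text \<open>
  A polynomial in \<open>x\<^sub>1, \<dots>, x\<^sub>n\<close> is a finitely supported map from exponent vectors to
  coefficients; variables are indexed by \<open>0, \<dots>, n - 1\<close>.
\<close>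

type_synonym mpoly = "(nat \<Rightarrow>\<^sub>0 nat) \<Rightarrow>\<^sub>0 real"

definition in_vars :: "nat \<Rightarrow> mpoly \<Rightarrow> bool" where
  "in_vars n f \<longleftrightarrow> (\<forall>\<alpha>\<in>Poly_Mapping.keys f. Poly_Mapping.keys \<alpha> \<subseteq> {..<n})"

definition homogeneous :: "nat \<Rightarrow> mpoly \<Rightarrow> bool" where
  "homogeneous k f \<longleftrightarrow>
     (\<forall>\<alpha>\<in>Poly_Mapping.keys f. (\<Sum>i\<in>Poly_Mapping.keys \<alpha>. Poly_Mapping.lookup \<alpha> i) = k)"

definition partial_deriv :: "nat \<Rightarrow> mpoly \<Rightarrow> mpoly" where
  "partial_deriv i f =
     (\<Sum>\<alpha>\<in>Poly_Mapping.keys f.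
        Poly_Mapping.single (\<alpha> - Poly_Mapping.single i 1)
          (real (Poly_Mapping.lookup \<alpha> i) * Poly_Mapping.lookup f \<alpha>))"

definition poly_dir_deriv :: "real vec \<Rightarrow> mpoly \<Rightarrow> mpoly" where
  "poly_dir_deriv v f =
     (\<Sum>i<dim_vec v. Poly_Mapping.single 0 (vec_index v i) * partial_deriv i f)"

text \<open>
  \<open>D\<^sub>v\<^sub>1 \<dots> D\<^sub>v\<^sub>k f\<close> for a list of \<open>k\<close> vectors and \<open>f\<close> homogeneous of degree \<open>k\<close>. This is a
  constant polynomial, identified with its constant coefficient.
\<close>

definition full_dir_deriv :: "real vec list \<Rightarrow> mpoly \<Rightarrow> real" where
  "full_dir_deriv vs f = Poly_Mapping.lookup (foldr poly_dir_deriv vs f) 0"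


subsection \<open>Lorentzian and dually Lorentzian polynomials\<close>

definition nonneg_nonzero_vecs :: "nat \<Rightarrow> real vec set" where
  "nonneg_nonzero_vecs n =
     {v \<in> carrier_vec n. (\<forall>i<n. 0 \<le> vec_index v i) \<and> v \<noteq> 0\<^sub>v n}"

text \<open>
  The eigenvalues of a symmetric bilinear form on \<open>\<real>\<^sup>n\<close> are those of its Gram matrix in the
  standard basis, counted with multiplicity.
\<close>

definition gram_matrix :: "nat \<Rightarrow> (real vec \<Rightarrow> real vec \<Rightarrow> real) \<Rightarrow> real mat" where
  "gram_matrix n B = Matrix.mat n n (\<lambda>(i, j). B (unit_vec n i) (unit_vec n j))"

definition num_pos_eigenvalues :: "real mat \<Rightarrow> nat" where
  "num_pos_eigenvalues A = size (filter_mset (\<lambda>x. 0 < x) (proots (char_poly A)))"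

definition lorentzian :: "nat \<Rightarrow> mpoly \<Rightarrow> bool" where
  "lorentzian n f \<longleftrightarrow> in_vars n f \<and>
     (\<exists>k. homogeneous k f \<and>
        (\<forall>vs. length vs = k \<and> set vs \<subseteq> nonneg_nonzero_vecs n \<longrightarrow> 0 \<le> full_dir_deriv vs f) \<and>
        (2 \<le> k \<longrightarrow>
          (\<forall>vs. length vs = k - 2 \<and> set vs \<subseteq> nonneg_nonzero_vecs n \<longrightarrow>
             num_pos_eigenvalues (gram_matrix n (\<lambda>x y. full_dir_deriv (x # y # vs) f)) \<le> 1)))"

text \<open>
  The polynomial \<open>x\<^sub>1\<^sup>\<kappa>\<^sup>1 \<dots> x\<^sub>n\<^sup>\<kappa>\<^sup>n f(x\<^sub>1\<^sup>-\<^sup>1, \<dots>, x\<^sub>n\<^sup>-\<^sup>1)\<close>. The subtraction of exponents is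
  truncated, so this is meaningful only if \<open>f\<close> has degree at most \<open>\<kappa>\<^sub>i\<close> in \<open>x\<^sub>i\<close>.
\<close>

definition reciprocal :: "(nat \<Rightarrow>\<^sub>0 nat) \<Rightarrow> mpoly \<Rightarrow> mpoly" where
  "reciprocal \<kappa> f =
     (\<Sum>\<alpha>\<in>Poly_Mapping.keys f. Poly_Mapping.single (\<kappa> - \<alpha>) (Poly_Mapping.lookup f \<alpha>))"

definition multi_fact :: "(nat \<Rightarrow>\<^sub>0 nat) \<Rightarrow> real" where
  "multi_fact \<alpha> = (\<Prod>i\<in>Poly_Mapping.keys \<alpha>. fact (Poly_Mapping.lookup \<alpha> i))"

definition normalization_op :: "mpoly \<Rightarrow> mpoly" where
  "normalization_op f = Poly_Mapping.mapp (\<lambda>\<alpha> c. c / multi_fact \<alpha>) f"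

definition bounded_degrees :: "nat \<Rightarrow> (nat \<Rightarrow>\<^sub>0 nat) \<Rightarrow> mpoly \<Rightarrow> bool" where
  "bounded_degrees n \<kappa> f \<longleftrightarrow>
     Poly_Mapping.keys \<kappa> \<subseteq> {..<n} \<and>
     (\<forall>\<alpha>\<in>Poly_Mapping.keys f. \<forall>i. Poly_Mapping.lookup \<alpha> i \<le> Poly_Mapping.lookup \<kappa> i)"

text \<open>
  Whether the dual polynomial is Lorentzian does not depend on the choice of admissible
  \<open>\<kappa>\<close>, so the existential quantifier may equivalently be read as a universal one.
\<close>

definition dually_lorentzian :: "nat \<Rightarrow> mpoly \<Rightarrow> bool" where
  "dually_lorentzian n f \<longleftrightarrow>
     (\<exists>\<kappa>. bounded_degrees n \<kappa> f \<and> lorentzian n (normalization_op (reciprocal \<kappa> f)))"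


subsection \<open>Hermitian matrices and generalized mixed discriminants\<close>

definition Herm :: "nat \<Rightarrow> complex mat set" where
  "Herm d = {A \<in> carrier_mat d d. mat_adjoint A = A}"

definition pos_def :: "complex mat \<Rightarrow> bool" where
  "pos_def A \<longleftrightarrow>
     (\<forall>v\<in>carrier_vec (dim_row A). v \<noteq> 0\<^sub>v (dim_row A) \<longrightarrow> 0 < Re ((A *\<^sub>v v) \<bullet>c v))"

definition dir_deriv :: "complex mat \<Rightarrow> (complex mat \<Rightarrow> real) \<Rightarrow> (complex mat \<Rightarrow> real)" where
  "dir_deriv H F = (\<lambda>X. deriv (\<lambda>t::real. F (X + complex_of_real t \<cdot>\<^sub>m H)) 0)"

text \<open>
  \<open>g(D\<^sub>H\<^sub>1, \<dots>, D\<^sub>H\<^sub>n) F\<close>. The order of composition is immaterial for the smooth function \<open>F\<close>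
  below, since directional derivatives commute.
\<close>

definition monom_dir_deriv ::
  "nat \<Rightarrow> (nat \<Rightarrow> complex mat) \<Rightarrow> (nat \<Rightarrow>\<^sub>0 nat) \<Rightarrow> (complex mat \<Rightarrow> real) \<Rightarrow> (complex mat \<Rightarrow> real)"
where
  "monom_dir_deriv n Hs \<alpha> F =
     foldr (\<lambda>i. dir_deriv (Hs i) ^^ Poly_Mapping.lookup \<alpha> i) [0..<n] F"

definition mpoly_dir_deriv ::
  "nat \<Rightarrow> mpoly \<Rightarrow> (nat \<Rightarrow> complex mat) \<Rightarrow> (complex mat \<Rightarrow> real) \<Rightarrow> (complex mat \<Rightarrow> real)"
where
  "mpoly_dir_deriv n g Hs F =
     (\<lambda>X. \<Sum>\<alpha>\<in>Poly_Mapping.keys g. Poly_Mapping.lookup g \<alpha> * monom_dir_deriv n Hs \<alpha> F X)"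

text \<open>
  The determinant is real on Hermitian matrices, and only its values there enter when all
  directions are Hermitian. If \<open>g\<close> is homogeneous of degree \<open>d - 2\<close>, the function obtained by
  differentiating is constant; its value is taken at the zero matrix.
\<close>

definition MD ::
  "nat \<Rightarrow> nat \<Rightarrow> complex mat \<Rightarrow> complex mat \<Rightarrow> mpoly \<Rightarrow> (nat \<Rightarrow> complex mat) \<Rightarrow> real"
where
  "MD d n H H' g Hs =
     1 / fact d *
     dir_deriv H (dir_deriv H' (mpoly_dir_deriv n g Hs (\<lambda>X. Re (Determinant.det X)))) (0\<^sub>m d d)"

end

theory Submission
  imports Defs "HOL-Library.Function_Algebras" "HOL-Analysis.Product_Vector" "HOL-Analysis.Function_Topology"
begin

text \<open>
  A symmetric bilinear form \<open>B\<close> has at most one positive eigenvalue iff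
  \<open>B x x * B p p \<le> (B x p)\<^sup>2\<close> whenever \<open>0 < B p p\<close>; in this shape the condition makes sense on
  real vectors and on Hermitian matrices alike. The engine is a local-to-global principle: if a
  symmetric trilinear form is nonnegative on a cone and its slices in the generating directions are
  Lorentzian, then so are all slices in directions of the cone.

  A positive definite matrix is a sum of rank-one matrices, in each of which the determinant is
  affine. Expanding in such a frame writes the generalized mixed discriminant as a pairing of the
  multi-affine polarization of the dual of \<open>g\<close> with the polarized determinant, and the principle
  shows that the pairing is Lorentzian. Equality is ruled out by induction on the degree of \<open>g\<close>: a
  null vector that is orthogonal to a positive one has null compressions in every orthonormal frame
  and hence vanishes.

  Conversely, for diagonal \<open>H\<^sub>i\<close> with disjoint supports the generalized mixed discriminant of
  diagonal matrices is a second derivative of the polarized dual of \<open>g\<close>. So the inequality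
  contains the quadratic case, and the local-to-global principle gives all other derivatives.
\<close>

section \<open>Lorentzian bilinear forms\<close>

text \<open>The local-to-global step passes from one direction to the next only across a strictly
  positive value of the cubic form, while polarized determinants and duals have many zero values.
  Squarefree forms therefore start from three isotropic directions at once, and most other arguments
  run on a perturbed object: nearby positive linear forms replace the variables, or a small multiple
  of the identity is added. The non-strict inequality survives the limit; strictness has to be
  regained separately.

  It is regained by a sign argument. The pairing of \<open>X\<close> and \<open>P\<close> is a sum
  over \<open>i\<close> of pairings for the \<open>i\<close>-th derivative of \<open>g\<close> with
  \<open>H i\<close> as extra direction. If \<open>X\<close> is nonzero, none of those for a nonzero
  derivative vanishes, and since directions of differentiation and positive definite matrices range
  over convex cones, they have a common sign and cannot add up to 0.

  Between the dual of \<open>g\<close> and its polarization, second derivatives are compared by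
  averaging over the copies of a variable. This is done with at least \<open>m + 2\<close> copies of
  each, \<open>m\<close> being the degree of \<open>g\<close>; \<open>\<kappa>\<close> is first
  raised by antidifferentiation.\<close>

instantiation "fun" :: (type, real_vector) real_vector
begin
definition scaleR_fun :: "real \<Rightarrow> ('a \<Rightarrow> 'b) \<Rightarrow> 'a \<Rightarrow> 'b" where
  "scaleR_fun r f = (\<lambda>x. r *\<^sub>R f x)"
instance by standard (auto simp: scaleR_fun_def fun_eq_iff algebra_simps)
end

lemma scaleR_fun_apply [simp]: "(r *\<^sub>R f) x = r *\<^sub>R f x"
  by (simp add: scaleR_fun_def)

abbreviation linsub :: "'v::real_vector set \<Rightarrow> bool" where
  "linsub \<equiv> Real_Vector_Spaces.subspace"

definition symm_bilin :: "('v::real_vector \<Rightarrow> 'v \<Rightarrow> real) \<Rightarrow> bool" where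
  "symm_bilin B \<longleftrightarrow> (\<forall>x y. B x y = B y x) \<and> (\<forall>x. linear (B x))"

text \<open>The set \<open>U\<close> is carried along because Hermitian matrices form only a real
  subspace of the type of entry functions.\<close>

definition lorentz :: "'v::real_vector set \<Rightarrow> ('v \<Rightarrow> 'v \<Rightarrow> real) \<Rightarrow> bool" where
  "lorentz U B \<longleftrightarrow> (\<forall>p\<in>U. \<forall>x\<in>U. 0 < B p p \<longrightarrow> B x x * B p p \<le> (B x p)\<^sup>2)"

lemma symm_bilin_sym: "symm_bilin B \<Longrightarrow> B x y = B y x"
  by (simp add: symm_bilin_def)

lemma symm_bilin_simps:
  assumes "symm_bilin B"
  shows "B (x + y) z = B x z + B y z" "B z (x + y) = B z x + B z y"
    "B (x - y) z = B x z - B y z" "B z (x - y) = B z x - B z y"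
    "B (c *\<^sub>R x) z = c * B x z" "B z (c *\<^sub>R x) = c * B z x"
    "B 0 z = 0" "B z 0 = 0"
    "B (- x) z = - B x z" "B z (- x) = - B z x"
proof -
  have s: "\<And>x y. B x y = B y x" and l: "\<And>x. linear (B x)" using assms by (auto simp: symm_bilin_def)
  show "B z (x + y) = B z x + B z y" "B z (x - y) = B z x - B z y" "B z (c *\<^sub>R x) = c * B z x"
    "B z 0 = 0" "B z (- x) = - B z x"
    using l[of z] by (simp_all add: linear_add linear_diff linear_scale linear_0 linear_neg)
  then show "B (x + y) z = B x z + B y z" "B (x - y) z = B x z - B y z" "B (c *\<^sub>R x) z = c * B x z"
    "B 0 z = 0" "B (- x) z = - B x z"
    by (metis s l linear_add linear_diff linear_scale linear_0 linear_neg real_scaleR_def)+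
qed

lemma lorD: "lorentz U B \<Longrightarrow> p \<in> U \<Longrightarrow> x \<in> U \<Longrightarrow> 0 < B p p \<Longrightarrow> B x x * B p p \<le> (B x p)\<^sup>2"
  by (auto simp: lorentz_def)

lemma lorD_orth: "lorentz U B \<Longrightarrow> p \<in> U \<Longrightarrow> x \<in> U \<Longrightarrow> 0 < B p p \<Longrightarrow> B x p = 0 \<Longrightarrow> B x x \<le> 0"
  using lorD[of U B p x] by (simp add: mult_le_0_iff)

lemma lorentz_zero [simp]: "lorentz U (\<lambda>x y. 0)"
  by (simp add: lorentz_def)

lemma lorentz_scale: "0 \<le> c \<Longrightarrow> lorentz U B \<Longrightarrow> lorentz U (\<lambda>x y. c * B x y)"
  unfolding lorentz_def
proof (intro ballI impI)
  fix p x assume c: "0 \<le> c" and l: "\<forall>p\<in>U. \<forall>x\<in>U. 0 < B p p \<longrightarrow> B x x * B p p \<le> (B x p)\<^sup>2"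
    and "p \<in> U" "x \<in> U" and pos: "0 < c * B p p"
  then have "0 < B p p" using zero_less_mult_pos by (metis less_eq_real_def mult_zero_left)
  then have "B x x * B p p \<le> (B x p)\<^sup>2" using l \<open>p \<in> U\<close> \<open>x \<in> U\<close> by auto
  then have "c\<^sup>2 * (B x x * B p p) \<le> c\<^sup>2 * (B x p)\<^sup>2" by (intro mult_left_mono) auto
  then show "c * B x x * (c * B p p) \<le> (c * B x p)\<^sup>2" by (simp add: power2_eq_square algebra_simps)
qed

lemma lorentz_if_nonneg_cong:
  assumes "lorentz U B" "0 < c" "\<And>x y. B' x y = c * B x y"
  shows "lorentz U B'"
proof -
  have "B' = (\<lambda>x y. c * B x y)" using assms by (auto simp: fun_eq_iff)
  then show ?thesis using lorentz_scale[of c U B] assms by auto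
qed

text \<open>Completing the square: multiplied by \<open>B p p\<close>, the value at
  \<open>x - l *\<^sub>R p\<close> is \<open>B x x * B p p - (B x p)^2\<close> plus the square of
  \<open>B x p - l * B p p\<close>. So any shift that works is enough, not only the orthogonal
  projection.\<close>

lemma lorentz_point_crit:
  assumes B: "symm_bilin B" and U: "linsub U"
    and cr: "\<And>p x. p \<in> U \<Longrightarrow> x \<in> U \<Longrightarrow> 0 < B p p \<Longrightarrow> \<exists>l. B (x - l *\<^sub>R p) (x - l *\<^sub>R p) \<le> 0"
  shows "lorentz U B"
  unfolding lorentz_def
proof (intro ballI impI)
  fix p x assume "p \<in> U" "x \<in> U" and pos: "0 < B p p"
  then obtain l where "B (x - l *\<^sub>R p) (x - l *\<^sub>R p) \<le> 0" using cr by blast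
  then have "B x x - 2 * l * B x p + l\<^sup>2 * B p p \<le> 0"
    by (simp add: symm_bilin_simps[OF B] symm_bilin_sym[OF B, of p x] power2_eq_square algebra_simps)
  then have "(B x x - 2 * l * B x p + l\<^sup>2 * B p p) * B p p \<le> 0"
    using pos by (simp add: mult_le_0_iff)
  moreover have "(B x x - 2 * l * B x p + l\<^sup>2 * B p p) * B p p
      = B x x * B p p - (B x p)\<^sup>2 + (B x p - l * B p p)\<^sup>2"
    by (simp add: power2_eq_square algebra_simps)
  moreover have "(B x p - l * B p p)\<^sup>2 \<ge> 0" by simp
  ultimately show "B x x * B p p \<le> (B x p)\<^sup>2" by linarith
qed

lemma lorentz_crit:
  assumes B: "symm_bilin B" and U: "linsub U" and "lorentz U B" "p \<in> U" "x \<in> U" "0 < B p p"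
  shows "\<exists>l. B (x - l *\<^sub>R p) (x - l *\<^sub>R p) \<le> 0"
proof -
  let ?l = "B x p / B p p"
  have "B (x - ?l *\<^sub>R p) p = 0" using assms by (simp add: symm_bilin_simps[OF B])
  then have "B (x - ?l *\<^sub>R p) (x - ?l *\<^sub>R p) \<le> 0"
    using assms by (intro lorD_orth[of U B p]) (auto intro: subspace_diff subspace_scale)
  then show ?thesis by blast
qed

text \<open>Every positive \<open>p\<close> has \<open>B p p0 \<noteq> 0\<close>, as otherwise
  \<open>neg\<close> would make \<open>B p p\<close> nonpositive. Hence each \<open>x\<close> can be
  moved along \<open>p\<close> into the hyperplane orthogonal to \<open>p0\<close>, where the form
  is nonpositive.\<close>

lemma lorentz_from_point:
  assumes B: "symm_bilin B" and U: "linsub U" and p0: "p0 \<in> U" "0 < B p0 p0"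
    and neg: "\<And>x. x \<in> U \<Longrightarrow> B x p0 = 0 \<Longrightarrow> B x x \<le> 0"
  shows "lorentz U B"
proof (rule lorentz_point_crit[OF B U])
  fix p x assume "p \<in> U" "x \<in> U" and pos: "0 < B p p"
  then have "B p p0 \<noteq> 0" using neg[of p] by auto
  then have "B (x - (B x p0 / B p p0) *\<^sub>R p) p0 = 0" by (simp add: symm_bilin_simps[OF B])
  then show "\<exists>l. B (x - l *\<^sub>R p) (x - l *\<^sub>R p) \<le> 0"
    using neg \<open>p \<in> U\<close> \<open>x \<in> U\<close> U by (meson subspace_diff subspace_scale)
qed

text \<open>On the hyperplane orthogonal to \<open>p\<close> the form is negative semidefinite, so a
  vector of value 0 there is orthogonal to the whole hyperplane, and to \<open>p\<close> by
  assumption. This equality case drives the strictness proof.\<close>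

lemma lorentz_ker:
  assumes B: "symm_bilin B" and U: "linsub U" and l: "lorentz U B" and p: "p \<in> U" "0 < B p p"
    and x: "x \<in> U" "B x p = 0" "0 \<le> B x x" and y: "y \<in> U"
  shows "B x y = 0"
proof -
  let ?y = "y - (B y p / B p p) *\<^sub>R p"
  have yU: "?y \<in> U" using U y p by (simp add: subspace_diff subspace_scale)
  have yp: "B ?y p = 0" using p by (simp add: symm_bilin_simps[OF B])
  have xy: "B ?y x = B x y" using x by (simp add: symm_bilin_simps[OF B] symm_bilin_sym[OF B, of p x] symm_bilin_sym[OF B, of y x])
  have *: "B ?y ?y + 2 * s * B x y \<le> 0" for s
  proof -
    have "B (?y + s *\<^sub>R x) (?y + s *\<^sub>R x) \<le> 0"
      using U yU x p yp by (intro lorD_orth[OF l p(1) _ p(2)])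
        (auto simp: subspace_add subspace_scale symm_bilin_simps(1,5)[OF B])
    moreover have "B (?y + s *\<^sub>R x) (?y + s *\<^sub>R x) = B ?y ?y + 2 * s * B ?y x + s\<^sup>2 * B x x"
      unfolding symm_bilin_simps(1,2,5,6)[OF B] using symm_bilin_sym[OF B, of x ?y] by (simp add: power2_eq_square algebra_simps)
    moreover have "s\<^sup>2 * B x x \<ge> 0" using x by simp
    ultimately have "B ?y ?y + 2 * s * B ?y x \<le> 0" by linarith
    then show ?thesis by (simp only: xy)
  qed
  show ?thesis
  proof (rule ccontr)
    assume n: "B x y \<noteq> 0"
    show False using *[of "(1 - B ?y ?y) / (2 * B x y)"] n by (simp add: field_simps)
  qed
qed

text \<open>A shift that makes the larger form nonpositive does the same for the smaller one. In
  this way domination by a pulled-back form replaces an eigenvalue count.\<close>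

lemma lorentz_dom:
  assumes B: "symm_bilin B" and B': "symm_bilin B'" and U: "linsub U" and U': "linsub U'"
    and L: "linear L" "\<And>x. x \<in> U \<Longrightarrow> L x \<in> U'"
    and l: "lorentz U' B'" and le: "\<And>x. x \<in> U \<Longrightarrow> B x x \<le> B' (L x) (L x)"
  shows "lorentz U B"
proof (rule lorentz_point_crit[OF B U])
  fix p x assume px: "p \<in> U" "x \<in> U" and pos: "0 < B p p"
  then have "0 < B' (L p) (L p)" using le[of p] by linarith
  then obtain r where r: "B' (L x - r *\<^sub>R L p) (L x - r *\<^sub>R L p) \<le> 0"
    using lorentz_crit[OF B' U' l, of "L p" "L x"] px L by blast
  have "B (x - r *\<^sub>R p) (x - r *\<^sub>R p) \<le> B' (L (x - r *\<^sub>R p)) (L (x - r *\<^sub>R p))"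
    using le px U by (simp add: subspace_diff subspace_scale)
  then show "\<exists>r. B (x - r *\<^sub>R p) (x - r *\<^sub>R p) \<le> 0"
    using r L(1) by (auto simp: linear_diff linear_scale intro!: exI[of _ r])
qed

text \<open>The inequality is closed and its premise \<open>0 < B p p\<close> is open, so both
  behave well under pointwise limits. Perturbations of Lorentzian forms are removed in this
  way.\<close>

lemma lorentz_limit:
  assumes ne: "F \<noteq> bot" and lim: "\<And>x y. ((\<lambda>e. B e x y) \<longlongrightarrow> B0 x y) F"
    and ev: "eventually (\<lambda>e. lorentz U (B e)) F"
  shows "lorentz U B0"
  unfolding lorentz_def
proof (intro ballI impI)
  fix p x assume px: "p \<in> U" "x \<in> U" and pos: "0 < B0 p p"
  have "eventually (\<lambda>e. 0 < B e p p) F" using lim pos by (rule order_tendstoD)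
  with ev have "eventually (\<lambda>e. B e x x * B e p p \<le> (B e x p)\<^sup>2) F"
    by eventually_elim (use px in \<open>auto simp: lorentz_def\<close>)
  then show "B0 x x * B0 p p \<le> (B0 x p)\<^sup>2"
    by (intro tendsto_le[OF ne _ _ ]) (auto intro!: tendsto_intros lim)
qed

text \<open>A product of two linear forms has at most one positive square; the gap in the inequality
  is the square of a 2 by 2 determinant.\<close>

lemma lorentz_rank2: "lorentz U (\<lambda>x y. f x * g y + f y * (g x :: real))"
  unfolding lorentz_def
proof (intro ballI impI)
  fix p x
  have "0 \<le> (f x * g p - f p * g x)\<^sup>2" by simp
  then show "(f x * g x + f x * g x) * (f p * g p + f p * g p) \<le> (f x * g p + f p * g x)\<^sup>2"
    by (simp add: power2_eq_square algebra_simps)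
qed

lemma lorentz_pullback:
  assumes "lorentz U' B" "\<And>x. x \<in> U \<Longrightarrow> L x \<in> U'"
  shows "lorentz U (\<lambda>x y. B (L x) (L y))"
  using assms by (auto simp: lorentz_def)

section \<open>Trilinear forms and the local-to-global principle\<close>

definition symm_trilin :: "('v::real_vector \<Rightarrow> 'v \<Rightarrow> 'v \<Rightarrow> real) \<Rightarrow> bool" where
  "symm_trilin T \<longleftrightarrow> (\<forall>x y z. T x y z = T y x z) \<and> (\<forall>x y z. T x y z = T x z y) \<and> (\<forall>x y. linear (T x y))"

lemma symm_trilin_symm_bilin: "symm_trilin T \<Longrightarrow> symm_bilin (\<lambda>x y. T x y z)" "symm_trilin T \<Longrightarrow> symm_bilin (T z)"
proof -
  assume T: "symm_trilin T"
  show "symm_bilin (\<lambda>x y. T x y z)"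
    unfolding symm_bilin_def
  proof safe
    show "T x y z = T y x z" for x y using T by (auto simp: symm_trilin_def)
    have "(\<lambda>y. T x y z) = T x z" for x using T by (auto simp: symm_trilin_def)
    then show "linear (\<lambda>y. T x y z)" for x using T unfolding symm_trilin_def by (metis (no_types))
  qed
  show "symm_bilin (T z)" using T by (auto simp: symm_trilin_def symm_bilin_def)
qed

lemma symm_trilin_sym: "symm_trilin T \<Longrightarrow> T x y z = T y x z" "symm_trilin T \<Longrightarrow> T x y z = T x z y" "symm_trilin T \<Longrightarrow> T x y z = T z y x"
  by (metis symm_trilin_def)+

lemma symm_trilin_simps:
  assumes "symm_trilin T"
  shows "T (x + y) z w = T x z w + T y z w" "T z (x + y) w = T z x w + T z y w" "T z w (x + y) = T z w x + T z w y"
    "T (x - y) z w = T x z w - T y z w" "T z (x - y) w = T z x w - T z y w" "T z w (x - y) = T z w x - T z w y"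
    "T (c *\<^sub>R x) z w = c * T x z w" "T z (c *\<^sub>R x) w = c * T z x w" "T z w (c *\<^sub>R x) = c * T z w x"
    "T 0 z w = 0" "T z 0 w = 0" "T z w 0 = 0"
  using symm_bilin_simps[OF symm_trilin_symm_bilin(1)[OF assms]] symm_bilin_simps[OF symm_trilin_symm_bilin(2)[OF assms]] by auto

text \<open>Applying both slices at \<open>z = w + h\<close> bounds \<open>T x x z\<close> by a sum
  of two squares (\<open>bochner\<close>). For \<open>x\<close> orthogonal to \<open>z\<close> both
  squares contain the same number up to sign, and shifting \<open>x\<close> along the vector
  \<open>k\<close> of the plane of \<open>w\<close> and \<open>h\<close> that is orthogonal to
  \<open>z\<close> disposes of them.\<close>

lemma lorentz_merge:
  fixes T :: "'v::real_vector \<Rightarrow> 'v \<Rightarrow> 'v \<Rightarrow> real"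
  assumes T: "symm_trilin T" and U: "linsub U" and wU: "w \<in> U" and hU: "h \<in> U"
    and lw: "lorentz U (\<lambda>x y. T x y w)" and lh: "lorentz U (\<lambda>x y. T x y h)"
    and n: "0 \<le> T w w w" "0 \<le> T w w h" "0 \<le> T w h h" "0 \<le> T h h h"
    and pos: "0 < T w w h + T w h h"
  shows "lorentz U (\<lambda>x y. T x y (w + h))"
proof -
  note Ts = symm_trilin_simps[OF T] and Tsy = symm_trilin_sym[OF T]
  define z where "z = w + h"
  define a b c d where "a = T w w w" "b = T w w h" "c = T w h h" "d = T h h h"
  have perm: "T w h w = b" "T h w w = b" "T h w h = c" "T h h w = c" "T w w h = b" "T w h h = c" "T w w w = a" "T h h h = d"
    unfolding a_b_c_d_def using Tsy by metis+
  have zU: "z \<in> U" using U wU hU by (simp add: z_def subspace_add)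
  have nn: "0 \<le> a" "0 \<le> b" "0 \<le> c" "0 \<le> d" "0 < b + c" using n pos by (auto simp: a_b_c_d_def)
  define D1 D2 where "D1 = a + 2 * b + c" "D2 = b + 2 * c + d"
  have D: "0 < D1" "0 < D2" using nn by (auto simp: D1_D2_def)
  have Dz: "T z z w = D1" "T z z h = D2" unfolding z_def D1_D2_def by (simp_all add: Ts perm)
  have ac: "a * c \<le> b\<^sup>2"
  proof (cases "a = 0")
    case False
    then have "T h h w * T w w w \<le> (T h w w)\<^sup>2" using nn by (intro lorD[OF lw wU hU]) (auto simp: perm)
    then show ?thesis by (simp add: perm mult.commute)
  qed simp
  have bd: "b * d \<le> c\<^sup>2"
  proof (cases "d = 0")
    case False
    then have "T w w h * T h h h \<le> (T w h h)\<^sup>2" using nn by (intro lorD[OF lh hU wU]) (auto simp: perm)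
    then show ?thesis by (simp add: perm mult.commute)
  qed simp
  \<comment> \<open>The sequence \<open>a, b, c, d\<close> is log-concave by \<open>ac\<close> and
    \<open>bd\<close>; \<open>0 < b + c\<close> excludes the internal zeros for which this product
    inequality could fail.\<close>
  have ad: "a * d \<le> b * c"
  proof (cases "b = 0 \<or> c = 0")
    case True
    then show ?thesis
    proof
      assume "b = 0" then have "a * c \<le> 0" "c > 0" using ac nn by auto
      then have "a = 0" using nn by (simp add: mult_le_0_iff)
      then show ?thesis using nn by simp
    next
      assume "c = 0" then have "b * d \<le> 0" "b > 0" using bd nn by auto
      then have "d = 0" using nn by (simp add: mult_le_0_iff)
      then show ?thesis using nn by simp
    qed
  next
    case False
    then have bc: "0 < b * c" using nn by auto
    have "(a * c) * (b * d) \<le> b\<^sup>2 * c\<^sup>2" using ac bd nn by (intro mult_mono) auto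
    then have "(b * c) * (a * d) \<le> (b * c) * (b * c)" by (simp add: power2_eq_square algebra_simps)
    then show ?thesis using bc by (simp only: mult_le_cancel_left_pos)
  qed
  \<comment> \<open>\<open>- \<Delta>\<close> is the determinant of the slice \<open>z\<close> on
    the plane of \<open>w\<close> and \<open>h\<close>, and \<open>\<Delta>\<close> is the sum of
    the three gaps in \<open>ac\<close>, \<open>bd\<close> and \<open>ad\<close>.\<close>
  define \<Delta> where "\<Delta> = (b + c)\<^sup>2 - (a + b) * (c + d)"
  have \<Delta>: "0 \<le> \<Delta>" unfolding \<Delta>_def power2_eq_square using ac bd ad by (simp add: power2_eq_square algebra_simps)
  define K where "K = 1 / D1 + 1 / D2"
  have bochner: "T x x z \<le> (T x z w)\<^sup>2 / D1 + (T x z h)\<^sup>2 / D2" if "x \<in> U" for x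
  proof -
    have "T x x w * D1 \<le> (T x z w)\<^sup>2" using lorD[OF lw zU that] Dz D by auto
    moreover have "T x x h * D2 \<le> (T x z h)\<^sup>2" using lorD[OF lh zU that] Dz D by auto
    ultimately have "T x x w \<le> (T x z w)\<^sup>2 / D1" "T x x h \<le> (T x z h)\<^sup>2 / D2"
      using D by (simp_all add: field_simps)
    then show ?thesis by (simp add: z_def Ts)
  qed
  have "T x x z \<le> 0" if xU: "x \<in> U" and xz: "T x z z = 0" for x
  proof -
    \<comment> \<open>Orthogonal to \<open>z\<close> in the slice \<open>z\<close>, since
      \<open>T z z w = D1\<close> and \<open>T z z h = D2\<close>.\<close>
    define k where "k = D2 *\<^sub>R w - D1 *\<^sub>R h"
    define A where "A = T x z w"
    have Ah: "T x z h = - A" using xz unfolding A_def z_def by (simp add: Ts)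
    have kU: "k \<in> U" using U wU hU by (simp add: k_def subspace_diff subspace_scale)
    have kw: "T k z w = - \<Delta>" "T k z h = \<Delta>"
      unfolding k_def z_def \<Delta>_def D1_D2_def by (simp_all add: Ts perm power2_eq_square algebra_simps)
    have xk: "T x k z = (D1 + D2) * A" "T k x z = (D1 + D2) * A"
    proof -
      have "T x k z = D2 * T x w z - D1 * T x h z" unfolding k_def by (simp add: Ts)
      also have "\<dots> = D2 * T x z w - D1 * T x z h" using Tsy by metis
      finally show "T x k z = (D1 + D2) * A" using Ah by (simp add: A_def algebra_simps)
      then show "T k x z = (D1 + D2) * A" using Tsy by metis
    qed
    have kk: "T k k z = - (D1 + D2) * \<Delta>"
    proof -
      have "T k k z = D2 * T k w z - D1 * T k h z" by (subst (2) k_def) (simp add: Ts)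
      also have "\<dots> = D2 * T k z w - D1 * T k z h" using Tsy by metis
      finally show ?thesis by (simp add: kw algebra_simps)
    qed
    have main: "T x x z - 2 * s * (D1 + D2) * A - s\<^sup>2 * (D1 + D2) * \<Delta> \<le> (A + s * \<Delta>)\<^sup>2 * K" for s
    proof -
      have "T (x - s *\<^sub>R k) (x - s *\<^sub>R k) z
          \<le> (T (x - s *\<^sub>R k) z w)\<^sup>2 / D1 + (T (x - s *\<^sub>R k) z h)\<^sup>2 / D2"
        using U xU kU by (intro bochner) (simp add: subspace_diff subspace_scale)
      moreover have "T (x - s *\<^sub>R k) (x - s *\<^sub>R k) z = T x x z - 2 * s * (D1 + D2) * A - s\<^sup>2 * (D1 + D2) * \<Delta>"
        by (simp add: Ts xk kk power2_eq_square algebra_simps)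
      moreover have "T (x - s *\<^sub>R k) z w = A + s * \<Delta>" "T (x - s *\<^sub>R k) z h = - (A + s * \<Delta>)"
        by (simp_all add: Ts kw Ah A_def[symmetric])
      ultimately have "T x x z - 2 * s * (D1 + D2) * A - s\<^sup>2 * (D1 + D2) * \<Delta>
          \<le> (A + s * \<Delta>)\<^sup>2 / D1 + (- (A + s * \<Delta>))\<^sup>2 / D2" by metis
      then show ?thesis by (simp only: K_def power2_minus distrib_left) simp
    qed
    show ?thesis
    proof (cases "\<Delta> = 0")
      \<comment> \<open>Now the left side of \<open>main\<close> is affine in \<open>s\<close> and
        the right side is constant, which forces the slope, hence \<open>A\<close>, to be 0.\<close>
      case True
      have "A = 0"
      proof (rule ccontr)
        assume A: "A \<noteq> 0"
        define q where "q = 2 * (D1 + D2) * A"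
        define s where "s = (T x x z - A\<^sup>2 * K - 1) / q"
        have "q \<noteq> 0" using A D by (auto simp: q_def)
        then have "s * q = T x x z - A\<^sup>2 * K - 1" by (simp add: s_def)
        moreover have "2 * s * (D1 + D2) * A = s * q" by (simp add: q_def)
        ultimately show False using main[of s] True by simp
      qed
      then show ?thesis using main[of 0] by simp
    next
      case False
      then have d: "0 < \<Delta>" using \<Delta> by simp
      \<comment> \<open>This shift makes the right side of \<open>main\<close> vanish.\<close>
      define s where "s = - A / \<Delta>"
      have s: "s * \<Delta> = - A" using d by (simp add: s_def)
      have "s\<^sup>2 * (D1 + D2) * \<Delta> = s * (D1 + D2) * (s * \<Delta>)" by (simp add: power2_eq_square)
      then have "T x x z - s * (D1 + D2) * A \<le> 0" using main[of s] unfolding s by (simp add: algebra_simps)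
      moreover have "s * (D1 + D2) * A = - ((D1 + D2) * (A\<^sup>2 / \<Delta>))" by (simp add: s_def power2_eq_square)
      ultimately have "T x x z + (D1 + D2) * (A\<^sup>2 / \<Delta>) \<le> 0" by linarith
      moreover have "(D1 + D2) * (A\<^sup>2 / \<Delta>) \<ge> 0" using d D by simp
      ultimately show ?thesis by linarith
    qed
  qed
  moreover have "0 < T z z z" using Dz D Ts(3)[of z z w h] by (simp add: z_def[symmetric])
  ultimately have "lorentz U (\<lambda>x y. T x y z)"
    using zU by (intro lorentz_from_point[OF symm_trilin_symm_bilin(1)[OF T] U, of z]) auto
  then show ?thesis by (simp add: z_def)
qed


text \<open>A squarefree cubic offers no pair of its directions to start
  \<open>lorentz_merge\<close>, because \<open>T w w h + T w h h = 0\<close> for them; three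
  isotropic directions are treated at once. Subtracting from \<open>x\<close> a vector
  \<open>y\<close> of their span leaves a part orthogonal to \<open>u\<close> in all three slices,
  and on the span the form is a positive multiple of the elementary symmetric polynomial of degree
  2, evaluated at numbers of sum 0.\<close>

lemma lorentz_triple:
  fixes T :: "'v::real_vector \<Rightarrow> 'v \<Rightarrow> 'v \<Rightarrow> real"
  assumes T: "symm_trilin T" and U: "linsub U" and eU: "e1 \<in> U" "e2 \<in> U" "e3 \<in> U"
    and l: "lorentz U (\<lambda>x y. T x y e1)" "lorentz U (\<lambda>x y. T x y e2)" "lorentz U (\<lambda>x y. T x y e3)"
    and z: "T e1 e1 e1 = 0" "T e1 e1 e2 = 0" "T e1 e1 e3 = 0" "T e2 e2 e1 = 0" "T e2 e2 e2 = 0"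
      "T e2 e2 e3 = 0" "T e3 e3 e1 = 0" "T e3 e3 e2 = 0" "T e3 e3 e3 = 0"
    and t: "0 < T e1 e2 e3" and abc: "0 < a" "0 < b" "0 < c"
  shows "lorentz U (\<lambda>x y. T x y (a *\<^sub>R e1 + b *\<^sub>R e2 + c *\<^sub>R e3))"
proof -
  note Ts = symm_trilin_simps[OF T] and Tsy = symm_trilin_sym[OF T]
  define u where "u = a *\<^sub>R e1 + b *\<^sub>R e2 + c *\<^sub>R e3"
  define t where "t = T e1 e2 e3"
  have t0: "0 < t" using assms by (simp add: t_def)
  have perm: "T e1 e2 e3 = t" "T e1 e3 e2 = t" "T e2 e1 e3 = t" "T e2 e3 e1 = t" "T e3 e1 e2 = t" "T e3 e2 e1 = t"
    "T e1 e2 e1 = 0" "T e2 e1 e1 = 0" "T e1 e3 e1 = 0" "T e3 e1 e1 = 0"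
    "T e2 e1 e2 = 0" "T e1 e2 e2 = 0" "T e2 e3 e2 = 0" "T e3 e2 e2 = 0"
    "T e3 e1 e3 = 0" "T e1 e3 e3 = 0" "T e3 e2 e3 = 0" "T e2 e3 e3 = 0"
    using z Tsy t_def by metis+
  have uU: "u \<in> U" using U eU by (simp add: u_def subspace_add subspace_scale)
  have pu: "T e1 e1 u = 0" "T e2 e2 u = 0" "T e3 e3 u = 0" "T e1 e2 u = c * t" "T e1 e3 u = b * t" "T e2 e3 u = a * t"
    "T e2 e1 u = c * t" "T e3 e1 u = b * t" "T e3 e2 u = a * t"
    unfolding u_def by (simp_all add: Ts perm z)
  have uu: "T e1 u u = 2 * b * c * t" "T e2 u u = 2 * a * c * t" "T e3 u u = 2 * a * b * t"
    by (subst (2) u_def, simp add: Ts pu z, simp add: u_def Ts perm z)+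
  have uuu: "T u u u = 6 * a * b * c * t"
    by (subst u_def) (simp add: Ts uu)
  have "T x x u \<le> 0" if xU: "x \<in> U" and xu: "T x u u = 0" for x
  proof -
    define R1 R2 R3 where "R1 = T x e1 u / (t * b * c)" "R2 = T x e2 u / (t * a * c)" "R3 = T x e3 u / (t * a * b)"
    \<comment> \<open>Solves \<open>h2 + h3 = R1\<close>, \<open>h1 + h3 = R2\<close>,
      \<open>h1 + h2 = R3\<close>, so that \<open>y\<close> and \<open>x\<close> pair equally with
      \<open>e1\<close>, \<open>e2\<close>, \<open>e3\<close> in the slice \<open>u\<close>.\<close>
    define h1 h2 h3 where "h1 = (R2 + R3 - R1) / 2" "h2 = (R1 + R3 - R2) / 2" "h3 = (R1 + R2 - R3) / 2"
    define y where "y = (a * h1) *\<^sub>R e1 + (b * h2) *\<^sub>R e2 + (c * h3) *\<^sub>R e3"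
    define v where "v = x - y"
    have yU: "y \<in> U" using U eU by (simp add: y_def subspace_add subspace_scale)
    then have vU: "v \<in> U" using U xU by (simp add: v_def subspace_diff)
    have xe: "T x e1 u = t * b * c * (h2 + h3)" "T x e2 u = t * a * c * (h1 + h3)" "T x e3 u = t * a * b * (h1 + h2)"
      unfolding h1_h2_h3_def R1_R2_R3_def using abc t0 by (simp_all add: field_simps)
    have ye: "T y e1 u = t * b * c * (h2 + h3)" "T y e2 u = t * a * c * (h1 + h3)" "T y e3 u = t * a * b * (h1 + h2)"
      unfolding y_def by (simp_all add: Ts pu algebra_simps)
    have ve: "T v e1 u = 0" "T v e2 u = 0" "T v e3 u = 0"
      by (simp_all add: v_def Ts xe ye)
    have ve': "T v u e1 = 0" "T v u e2 = 0" "T v u e3 = 0"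
      using ve Tsy by metis+
    have "T u u e1 > 0" "T u u e2 > 0" "T u u e3 > 0"
      using uu Tsy(3) t0 abc by (metis mult_pos_pos zero_less_numeral)+
    then have "T v v e1 \<le> 0" "T v v e2 \<le> 0" "T v v e3 \<le> 0"
      using lorD_orth[OF l(1) uU vU] lorD_orth[OF l(2) uU vU] lorD_orth[OF l(3) uU vU] ve' by auto
    then have vv: "T v v u \<le> 0"
      using abc by (simp add: u_def Ts) (smt (verit) mult_nonneg_nonpos)
    have vy: "T v y u = 0" by (simp add: y_def Ts ve)
    have yy: "T y y u = 2 * t * a * b * c * (h1 * h2 + h1 * h3 + h2 * h3)"
      by (subst (2) y_def) (simp add: Ts ye algebra_simps)
    have "T x u u = 2 * t * a * b * c * (h1 + h2 + h3)"
      by (subst u_def) (simp add: Ts xe algebra_simps)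
    then have h0: "h1 + h2 + h3 = 0" using xu t0 abc by simp
    have "h1 * h2 + h1 * h3 + h2 * h3 = - (h1\<^sup>2 + h2\<^sup>2 + h3\<^sup>2) / 2"
    proof -
      have "(h1 + h2 + h3)\<^sup>2 = 0" using h0 by simp
      then show ?thesis by (simp add: power2_eq_square algebra_simps)
    qed
    moreover have "0 \<le> h1\<^sup>2 + h2\<^sup>2 + h3\<^sup>2" by simp
    ultimately have "h1 * h2 + h1 * h3 + h2 * h3 \<le> 0"
      by (metis divide_nonpos_pos neg_le_0_iff_le zero_less_numeral)
    moreover have "0 < 2 * t * a * b * c" using t0 abc by simp
    ultimately have "T y y u \<le> 0" unfolding yy by (meson less_imp_le mult_nonneg_nonpos)
    moreover have "T x x u = T v v u + 2 * T v y u + T y y u"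
    proof -
      have "x = v + y" by (simp add: v_def)
      then show ?thesis using Tsy(1)[of v y u] by (simp add: Ts)
    qed
    ultimately show ?thesis using vv vy by simp
  qed
  moreover have "0 < T u u u" using uuu t0 abc by simp
  ultimately have "lorentz U (\<lambda>x y. T x y u)"
    using uU by (intro lorentz_from_point[OF symm_trilin_symm_bilin(1)[OF T] U, of u]) auto
  then show ?thesis by (simp add: u_def)
qed

text \<open>The cone is kept abstract: for polynomials it is the nonnegative orthant, for Hermitian
  matrices the span of the diagonal units. Nonnegativity on it lets a positive value such as
  \<open>T w w (e j)\<close> survive when \<open>w\<close> grows.\<close>

definition triple_cone :: "('v::real_vector \<Rightarrow> 'v \<Rightarrow> 'v \<Rightarrow> real) \<Rightarrow> 'v set \<Rightarrow> bool" where
  "triple_cone T C \<longleftrightarrow> 0 \<in> C \<and> (\<forall>x\<in>C. \<forall>y\<in>C. x + y \<in> C) \<and> (\<forall>c x. 0 \<le> c \<longrightarrow> x \<in> C \<longrightarrow> c *\<^sub>R x \<in> C) \<and>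
     (\<forall>x\<in>C. \<forall>y\<in>C. \<forall>z\<in>C. 0 \<le> T x y z)"

lemma triple_cone_sum:
  assumes "triple_cone T C" "\<And>j. j \<in> J \<Longrightarrow> e j \<in> C" "\<And>j. j \<in> J \<Longrightarrow> 0 \<le> c j"
  shows "(\<Sum>j\<in>J. c j *\<^sub>R e j) \<in> C"
  using assms(2,3)
proof (induction J rule: infinite_finite_induct)
  case (insert j J)
  then have "c j *\<^sub>R e j \<in> C" "(\<Sum>j\<in>J. c j *\<^sub>R e j) \<in> C" using assms(1) by (auto simp: triple_cone_def)
  then show ?case using assms(1) insert by (auto simp: triple_cone_def)
qed (use assms(1) in \<open>auto simp: triple_cone_def\<close>)

text \<open>Directions are merged one at a time. The linking condition \<open>pos\<close> refers
  only to the initial \<open>w\<close>; the growing sum inherits it because all mixed terms are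
  nonnegative on the cone. A direction with identically zero slice changes nothing.\<close>

lemma lorentz_extend:
  fixes T :: "'v::real_vector \<Rightarrow> 'v \<Rightarrow> 'v \<Rightarrow> real"
  assumes T: "symm_trilin T" and U: "linsub U" and C: "triple_cone T C" and w: "w \<in> U" "w \<in> C"
    and lw: "lorentz U (\<lambda>x y. T x y w)" and J: "finite J"
    and e: "\<And>j. j \<in> J \<Longrightarrow> e j \<in> U" "\<And>j. j \<in> J \<Longrightarrow> e j \<in> C" "\<And>j. j \<in> J \<Longrightarrow> lorentz U (\<lambda>x y. T x y (e j))"
    and c: "\<And>j. j \<in> J \<Longrightarrow> 0 < c j"
    and pos: "\<And>j. j \<in> J \<Longrightarrow> 0 < T w w (e j) \<or> 0 < T w (e j) (e j) \<or> (\<forall>x\<in>U. \<forall>y\<in>U. T x y (e j) = 0)"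
  shows "lorentz U (\<lambda>x y. T x y (w + (\<Sum>j\<in>J. c j *\<^sub>R e j)))"
  using J e c pos
proof (induction J)
  case empty
  then show ?case using lw by simp
next
  case (insert j J)
  note Ts = symm_trilin_simps[OF T] and Tsy = symm_trilin_sym[OF T]
  define S where "S = (\<Sum>j\<in>J. c j *\<^sub>R e j)"
  define v where "v = w + S"
  define h where "h = c j *\<^sub>R e j"
  have lv: "lorentz U (\<lambda>x y. T x y v)" unfolding v_def S_def using insert by auto
  have hU: "h \<in> U" "h \<in> C" using insert.prems U C by (auto simp: h_def subspace_scale triple_cone_def less_imp_le)
  have SU: "S \<in> U" unfolding S_def using insert.prems U by (intro subspace_sum) (auto simp: subspace_scale)
  have SC: "S \<in> C" unfolding S_def using insert.prems C by (intro triple_cone_sum[OF C]) (auto intro: less_imp_le)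
  have vU: "v \<in> U" "v \<in> C" using w SU SC U C by (auto simp: v_def subspace_add triple_cone_def)
  have lh: "lorentz U (\<lambda>x y. T x y h)"
    using lorentz_scale[of "c j" U "\<lambda>x y. T x y (e j)"] insert.prems by (simp add: h_def Ts less_imp_le)
  have nn: "\<And>x y z. x \<in> C \<Longrightarrow> y \<in> C \<Longrightarrow> z \<in> C \<Longrightarrow> 0 \<le> T x y z" using C by (auto simp: triple_cone_def)
  have sum: "w + (\<Sum>j\<in>insert j J. c j *\<^sub>R e j) = v + h"
    using insert by (simp add: v_def h_def S_def algebra_simps)
  have cj: "0 < c j" using insert by auto
  consider "0 < T w w (e j) \<or> 0 < T w (e j) (e j)" | "\<forall>x\<in>U. \<forall>y\<in>U. T x y (e j) = 0"
    using insert.prems(5)[of j] by blast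
  then show ?case
  proof cases
    case 1
    then have "0 < T w w h \<or> 0 < T w h h" using cj by (auto simp: h_def Ts)
    moreover have "T v v h = T w w h + T w S h + T S w h + T S S h" "T v h h = T w h h + T S h h"
      by (simp_all add: v_def Ts)
    ultimately have "0 < T v v h + T v h h"
      using nn[of w w h] nn[of w S h] nn[of S w h] nn[of S S h] nn[of w h h] nn[of S h h] w SC hU by auto
    then show ?thesis unfolding sum
      using nn vU hU by (intro lorentz_merge[OF T U vU(1) hU(1) lv lh]) auto
  next
    case 2
    then have "\<forall>x\<in>U. \<forall>y\<in>U. T x y h = 0" by (simp add: h_def Ts)
    then show ?thesis unfolding sum using lv by (simp add: lorentz_def Ts)
  qed
qed

text \<open>The hub \<open>e i0\<close> starts the merging; \<open>0 < T (e i0) (e i0) (e j)\<close>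
  links it to every other direction.\<close>

lemma lorentz_star:
  fixes T :: "'v::real_vector \<Rightarrow> 'v \<Rightarrow> 'v \<Rightarrow> real"
  assumes T: "symm_trilin T" and U: "linsub U" and C: "triple_cone T C" and I: "finite I" "i0 \<in> I"
    and e: "\<And>j. j \<in> I \<Longrightarrow> e j \<in> U" "\<And>j. j \<in> I \<Longrightarrow> e j \<in> C" "\<And>j. j \<in> I \<Longrightarrow> lorentz U (\<lambda>x y. T x y (e j))"
    and c: "\<And>j. j \<in> I \<Longrightarrow> 0 < c j"
    and pos: "\<And>j. j \<in> I \<Longrightarrow> j \<noteq> i0 \<Longrightarrow> 0 < T (e i0) (e i0) (e j)"
  shows "lorentz U (\<lambda>x y. T x y (\<Sum>j\<in>I. c j *\<^sub>R e j))"
proof -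
  note Ts = symm_trilin_simps[OF T]
  have "lorentz U (\<lambda>x y. T x y (c i0 *\<^sub>R e i0 + (\<Sum>j\<in>I-{i0}. c j *\<^sub>R e j)))"
  proof (rule lorentz_extend[OF T U C])
    show "c i0 *\<^sub>R e i0 \<in> U" "c i0 *\<^sub>R e i0 \<in> C"
      using I e U C c[OF I(2)] by (auto simp: subspace_scale triple_cone_def less_imp_le)
    show "lorentz U (\<lambda>x y. T x y (c i0 *\<^sub>R e i0))"
      using lorentz_scale[of "c i0" U "\<lambda>x y. T x y (e i0)"] e I c[OF I(2)] by (simp add: Ts)
    show "0 < T (c i0 *\<^sub>R e i0) (c i0 *\<^sub>R e i0) (e j) \<or> 0 < T (c i0 *\<^sub>R e i0) (e j) (e j) \<or>
        (\<forall>x\<in>U. \<forall>y\<in>U. T x y (e j) = 0)" if "j \<in> I - {i0}" for j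
      using that pos[of j] c[OF I(2)] by (simp add: Ts)
  qed (use I e c in auto)
  then show ?thesis using I by (simp add: sum.remove)
qed

text \<open>Any three members of \<open>I'\<close> start the merging through
  \<open>lorentz_triple\<close>. Every further member of \<open>I'\<close> is linked to their sum by
  a squarefree term, and the directions outside \<open>I'\<close> have zero slices.\<close>

lemma lorentz_multiaffine:
  fixes T :: "'v::real_vector \<Rightarrow> 'v \<Rightarrow> 'v \<Rightarrow> real"
  assumes T: "symm_trilin T" and U: "linsub U" and C: "triple_cone T C" and I: "finite I" "I' \<subseteq> I" "3 \<le> card I'"
    and e: "\<And>j. j \<in> I \<Longrightarrow> e j \<in> U" "\<And>j. j \<in> I \<Longrightarrow> e j \<in> C" "\<And>j. j \<in> I \<Longrightarrow> lorentz U (\<lambda>x y. T x y (e j))"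
    and c: "\<And>j. j \<in> I \<Longrightarrow> 0 < c j"
    and z: "\<And>i j. i \<in> I' \<Longrightarrow> j \<in> I' \<Longrightarrow> T (e i) (e i) (e j) = 0"
    and pos: "\<And>i j k. i \<in> I' \<Longrightarrow> j \<in> I' \<Longrightarrow> k \<in> I' \<Longrightarrow> i \<noteq> j \<Longrightarrow> i \<noteq> k \<Longrightarrow> j \<noteq> k \<Longrightarrow> 0 < T (e i) (e j) (e k)"
    and out: "\<And>j. j \<in> I - I' \<Longrightarrow> \<forall>x\<in>U. \<forall>y\<in>U. T x y (e j) = 0"
  shows "lorentz U (\<lambda>x y. T x y (\<Sum>j\<in>I. c j *\<^sub>R e j))"
proof -
  note Ts = symm_trilin_simps[OF T] and Tsy = symm_trilin_sym[OF T]
  have "\<exists>B\<subseteq>I'. card B = 3" using obtain_subset_with_card_n[OF I(3)] by metis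
  then obtain B where B: "B \<subseteq> I'" "card B = 3" by blast
  then obtain p q r where pqr: "B = {p, q, r}" "p \<noteq> q" "p \<noteq> r" "q \<noteq> r"
    by (auto simp: card_3_iff)
  have in': "p \<in> I'" "q \<in> I'" "r \<in> I'" using B pqr by auto
  then have inI: "p \<in> I" "q \<in> I" "r \<in> I" using I by auto
  define w where "w = c p *\<^sub>R e p + c q *\<^sub>R e q + c r *\<^sub>R e r"
  have cpos: "0 < c p" "0 < c q" "0 < c r" using c inI by auto
  have nn: "\<And>x y z. x \<in> C \<Longrightarrow> y \<in> C \<Longrightarrow> z \<in> C \<Longrightarrow> 0 \<le> T x y z" using C by (auto simp: triple_cone_def)
  have "lorentz U (\<lambda>x y. T x y (w + (\<Sum>j\<in>I-{p,q,r}. c j *\<^sub>R e j)))"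
  proof (rule lorentz_extend[OF T U C])
    show "w \<in> U" "w \<in> C"
      using inI e U C cpos by (auto simp: w_def subspace_scale subspace_add triple_cone_def less_imp_le)
    show "lorentz U (\<lambda>x y. T x y w)" unfolding w_def
      using inI in' e z pos pqr cpos by (intro lorentz_triple[OF T U]) auto
    show "0 < T w w (e j) \<or> 0 < T w (e j) (e j) \<or> (\<forall>x\<in>U. \<forall>y\<in>U. T x y (e j) = 0)"
      if j: "j \<in> I - {p, q, r}" for j
    proof (cases "j \<in> I'")
      case True
      have "0 < T (e p) (e q) (e j)" using j True in' pqr by (intro pos) auto
      then have "0 < c p * (c q * T (e p) (e q) (e j))" using cpos by simp
      moreover have "T w w (e j) = 2 * (c p * (c q * T (e p) (e q) (e j))) + 2 * (c p * (c r * T (e p) (e r) (e j)))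
          + 2 * (c q * (c r * T (e q) (e r) (e j)))"
        using z in' True Tsy(1)[of "e q" "e p"] Tsy(1)[of "e r" "e p"] Tsy(1)[of "e r" "e q"]
        by (simp add: w_def Ts algebra_simps)
      moreover have "0 \<le> c p * (c r * T (e p) (e r) (e j))" "0 \<le> c q * (c r * T (e q) (e r) (e j))"
        using nn e inI j cpos by simp_all
      ultimately show ?thesis by linarith
    qed (use out j in auto)
  qed (use I e c in auto)
  moreover have "(\<Sum>j\<in>I. c j *\<^sub>R e j) = w + (\<Sum>j\<in>I-{p,q,r}. c j *\<^sub>R e j)"
  proof -
    have "(\<Sum>j\<in>I. c j *\<^sub>R e j) = (\<Sum>j\<in>{p,q,r}. c j *\<^sub>R e j) + (\<Sum>j\<in>I-{p,q,r}. c j *\<^sub>R e j)"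
      using inI I by (subst add.commute, intro sum.subset_diff) auto
    then show ?thesis using pqr by (simp add: w_def add.assoc)
  qed
  ultimately show ?thesis by simp
qed

section \<open>Symmetric multilinear functionals\<close>

text \<open>Lists of every length are allowed, so one functional stands for a family of symmetric
  multilinear forms. Linearity in the head and symmetry together give linearity in every
  place.\<close>

definition symm_multilin :: "('v::real_vector list \<Rightarrow> real) \<Rightarrow> bool" where
  "symm_multilin \<mu> \<longleftrightarrow> (\<forall>xs ys. mset xs = mset ys \<longrightarrow> \<mu> xs = \<mu> ys) \<and> (\<forall>xs. linear (\<lambda>x. \<mu> (x # xs)))"

lemma symm_multilin_mset: "symm_multilin \<mu> \<Longrightarrow> mset xs = mset ys \<Longrightarrow> \<mu> xs = \<mu> ys"
  unfolding symm_multilin_def by blast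

lemma symm_multilin_simps:
  assumes "symm_multilin \<mu>"
  shows "\<mu> ((x + y) # xs) = \<mu> (x # xs) + \<mu> (y # xs)" "\<mu> ((x - y) # xs) = \<mu> (x # xs) - \<mu> (y # xs)"
    "\<mu> ((c *\<^sub>R x) # xs) = c * \<mu> (x # xs)" "\<mu> (0 # xs) = 0"
proof -
  have l: "linear (\<lambda>x. \<mu> (x # xs))" using assms by (auto simp: symm_multilin_def)
  show "\<mu> ((x + y) # xs) = \<mu> (x # xs) + \<mu> (y # xs)" "\<mu> ((x - y) # xs) = \<mu> (x # xs) - \<mu> (y # xs)"
    "\<mu> ((c *\<^sub>R x) # xs) = c * \<mu> (x # xs)" "\<mu> (0 # xs) = 0"
    using linear_add[OF l] linear_diff[OF l] linear_scale[OF l] linear_0[OF l] by simp_all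
qed

lemma symm_multilin_sum:
  assumes "symm_multilin \<mu>"
  shows "\<mu> ((\<Sum>j\<in>J. f j) # xs) = (\<Sum>j\<in>J. \<mu> (f j # xs))"
proof -
  have l: "linear (\<lambda>x. \<mu> (x # xs))" using assms by (auto simp: symm_multilin_def)
  show ?thesis using linear_sum[OF l, of f J] by simp
qed

lemma symm_multilin_append_Cons: "symm_multilin \<mu> \<Longrightarrow> \<mu> (xs @ y # ys) = \<mu> (y # xs @ ys)"
  by (erule symm_multilin_mset) simp

lemma symm_trilin_symm_multilin: assumes "symm_multilin \<mu>" shows "symm_trilin (\<lambda>x y z. \<mu> (x # y # z # zs))"
  unfolding symm_trilin_def
proof (intro conjI allI)
  fix x y z
  show "\<mu> (x # y # z # zs) = \<mu> (y # x # z # zs)" "\<mu> (x # y # z # zs) = \<mu> (x # z # y # zs)"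
    by (rule symm_multilin_mset[OF assms], simp add: add_mset_commute)+
  have "(\<lambda>z. \<mu> (x # y # z # zs)) = (\<lambda>z. \<mu> (z # x # y # zs))"
    by (rule ext, rule symm_multilin_mset[OF assms]) (simp add: add_mset_commute)
  then show "linear (\<lambda>z. \<mu> (x # y # z # zs))" using assms by (simp add: symm_multilin_def)
qed

lemma symm_bilin_symm_multilin: assumes "symm_multilin \<mu>" shows "symm_bilin (\<lambda>x y. \<mu> (x # y # zs))"
  unfolding symm_bilin_def
proof (intro conjI allI)
  fix x y
  show "\<mu> (x # y # zs) = \<mu> (y # x # zs)" by (rule symm_multilin_mset[OF assms]) (simp add: add_mset_commute)
  have "(\<lambda>y. \<mu> (x # y # zs)) = (\<lambda>y. \<mu> (y # x # zs))"
    by (rule ext, rule symm_multilin_mset[OF assms]) (simp add: add_mset_commute)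
  then show "linear (\<lambda>y. \<mu> (x # y # zs))" using assms by (simp add: symm_multilin_def)
qed

text \<open>Swapping the two leading elements and acting below the head generate all permutations.
  The parameter \<open>s\<close> is generalized because the recursions in question change a second
  argument at every step.\<close>

lemma mset_invariantI:
  assumes cons: "\<And>x xs ys s. (\<And>s. g s xs = g s ys) \<Longrightarrow> g s (x # xs) = g s (x # ys)"
    and swap: "\<And>x y xs s. g s (x # y # xs) = g s (y # x # xs)"
    and "mset xs = mset ys"
  shows "g s xs = g s ys"
proof -
  have move: "g s (as @ x # bs) = g s (x # as @ bs)" for s as x bs
  proof (induction as arbitrary: s)
    case (Cons a as)
    have "g s (a # as @ x # bs) = g s (a # x # as @ bs)" by (rule cons) (rule Cons)
    then show ?case by (simp add: swap)
  qed simp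
  show ?thesis using assms(3)
  proof (induction xs arbitrary: ys s)
    case (Cons x xs)
    then have "x \<in> set ys" by (metis list.set_intros(1) set_mset_mset)
    then obtain as bs where ys: "ys = as @ x # bs" by (meson split_list)
    then have "mset xs = mset (as @ bs)" using Cons.prems by simp
    then have "\<And>s. g s xs = g s (as @ bs)" by (rule Cons.IH)
    then have "g s (x # xs) = g s (x # as @ bs)" by (rule cons)
    then show ?case by (simp add: ys move)
  qed simp
qed

lemma symm_multilin_tendsto:
  assumes "symm_multilin \<mu>" and t: "((\<lambda>t. t) \<longlongrightarrow> 0) F"
  shows "((\<lambda>t. \<mu> (map (\<lambda>z. f z + t *\<^sub>R g z) xs @ ys)) \<longlongrightarrow> \<mu> (map f xs @ ys)) F"
proof (induction xs arbitrary: ys)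
  case (Cons x xs)
  have e: "\<mu> (map (\<lambda>z. f z + t *\<^sub>R g z) (x # xs) @ ys)
     = \<mu> (map (\<lambda>z. f z + t *\<^sub>R g z) xs @ f x # ys) + t * \<mu> (map (\<lambda>z. f z + t *\<^sub>R g z) xs @ g x # ys)" for t
    using assms(1) by (simp add: symm_multilin_simps symm_multilin_append_Cons)
  have "((\<lambda>t. \<mu> (map (\<lambda>z. f z + t *\<^sub>R g z) xs @ f x # ys) + t * \<mu> (map (\<lambda>z. f z + t *\<^sub>R g z) xs @ g x # ys))
     \<longlongrightarrow> \<mu> (map f xs @ f x # ys) + 0 * \<mu> (map f xs @ g x # ys)) F"
    by (intro tendsto_intros Cons t)
  then show ?case unfolding e using assms(1) by (simp add: symm_multilin_append_Cons)
qed simp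

text \<open>The product rule: by symmetry each of the \<open>m\<close> equal arguments contributes
  the same term. For \<open>m = 0\<close> the factor \<open>real m\<close> makes the truncated
  \<open>m - 1\<close> harmless.\<close>

lemma symm_multilin_deriv:
  assumes "symm_multilin \<mu>"
  shows "((\<lambda>t. \<mu> (replicate m (x + t *\<^sub>R h) @ ys)) has_real_derivative
      real m * \<mu> (replicate (m - 1) x @ h # ys)) (at 0)"
proof (induction m arbitrary: ys)
  case (Suc m)
  have e: "\<mu> (replicate (Suc m) (x + t *\<^sub>R h) @ ys)
     = \<mu> (replicate m (x + t *\<^sub>R h) @ x # ys) + t * \<mu> (replicate m (x + t *\<^sub>R h) @ h # ys)" for t
    using assms by (simp add: symm_multilin_simps symm_multilin_append_Cons)
  have f: "real m * \<mu> (replicate (m - 1) x @ h # x # ys) + (0 * (real m * \<mu> (replicate (m - 1) x @ h # h # ys))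
      + 1 * \<mu> (replicate m (x + 0 *\<^sub>R h) @ h # ys)) = real (Suc m) * \<mu> (replicate (Suc m - 1) x @ h # ys)"
  proof (cases m)
    case (Suc k)
    have "\<mu> (replicate k x @ h # x # ys) = \<mu> (replicate m x @ h # ys)"
      by (rule symm_multilin_mset[OF assms]) (simp add: Suc)
    then show ?thesis by (simp add: Suc algebra_simps)
  qed simp
  show ?case unfolding e
    by (rule derivative_eq_intros Suc.IH refl)+ (use f in \<open>simp add: algebra_simps\<close>)
qed simp

section \<open>Exponent vectors and contraction of arrays of derivatives\<close>

definition unit_exp :: "nat \<Rightarrow> nat \<Rightarrow>\<^sub>0 nat" where "unit_exp i = Poly_Mapping.single i 1"

definition unit_fun :: "nat \<Rightarrow> nat \<Rightarrow> real" where "unit_fun i = (\<lambda>j. if j = i then 1 else 0)"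

definition exp_degree :: "nat \<Rightarrow> (nat \<Rightarrow>\<^sub>0 nat) \<Rightarrow> nat" where
  "exp_degree n b = (\<Sum>i<n. Poly_Mapping.lookup b i)"

definition supported :: "nat \<Rightarrow> (nat \<Rightarrow>\<^sub>0 nat) \<Rightarrow> bool" where
  "supported n b \<longleftrightarrow> (\<forall>i. Poly_Mapping.lookup b i \<noteq> 0 \<longrightarrow> i < n)"

lemma lookup_unit_exp: "Poly_Mapping.lookup (unit_exp i) j = (if i = j then 1 else 0)"
  by (simp add: unit_exp_def lookup_single when_def)

lemma exp_degree_add: "exp_degree n (a + b) = exp_degree n a + exp_degree n b"
  by (simp add: exp_degree_def lookup_add sum.distrib)

lemma exp_degree_unit_exp [simp]: "i < n \<Longrightarrow> exp_degree n (unit_exp i) = 1"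
  by (simp add: exp_degree_def lookup_unit_exp del: One_nat_def)

lemma exp_degree_0 [simp]: "exp_degree n 0 = 0" by (simp add: exp_degree_def)

lemma supported_add [simp]: "supported n (a + b) \<longleftrightarrow> supported n a \<and> supported n b"
  by (auto simp: supported_def lookup_add)

lemma supported_unit_exp [simp]: "supported n (unit_exp i) \<longleftrightarrow> i < n"
  by (auto simp: supported_def lookup_unit_exp split: if_splits)

lemma supported_0 [simp]: "supported n 0" by (simp add: supported_def)

lemma supported_exp_degree_0: "supported n b \<Longrightarrow> exp_degree n b = 0 \<Longrightarrow> b = 0"
  by (intro poly_mapping_eqI) (auto simp: supported_def exp_degree_def)

lemma unit_exp_split:
  assumes "Poly_Mapping.lookup b i \<noteq> 0"
  obtains b' where "b = b' + unit_exp i"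
proof
  show "b = (b - unit_exp i) + unit_exp i" using assms
    by (intro poly_mapping_eqI) (auto simp: lookup_add lookup_minus lookup_unit_exp)
qed

lemma supported_split:
  assumes "supported n b" "exp_degree n b = Suc k"
  obtains i b' where "i < n" "b = b' + unit_exp i" "supported n b'" "exp_degree n b' = k"
proof -
  have "\<exists>i<n. Poly_Mapping.lookup b i \<noteq> 0"
  proof (rule ccontr)
    assume "\<not> ?thesis"
    then have "exp_degree n b = 0" unfolding exp_degree_def by (intro sum.neutral) auto
    then show False using assms by simp
  qed
  then obtain i where i: "i < n" "Poly_Mapping.lookup b i \<noteq> 0" by blast
  then obtain b' where "b = b' + unit_exp i" using unit_exp_split by blast
  then show ?thesis using that i assms by (auto simp: exp_degree_add)
qed

lemma supported_induct [consumes 1, case_names zero add]: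
  assumes "supported n b" "P 0" "\<And>b i. supported n b \<Longrightarrow> i < n \<Longrightarrow> P b \<Longrightarrow> P (b + unit_exp i)"
  shows "P b"
  using assms(1)
proof (induction "exp_degree n b" arbitrary: b)
  case 0
  then show ?case using supported_exp_degree_0 assms(2) by metis
next
  case (Suc k)
  then obtain i b' where "i < n" "b = b' + unit_exp i" "supported n b'" "exp_degree n b' = k" using supported_split by metis
  then show ?case using Suc assms(3) by auto
qed

text \<open>
  If \<open>F b\<close> is the derivative \<open>\<partial>\<^sup>b f (0)\<close>, then \<open>contract n F vs b\<close> is \<open>\<partial>\<^sup>b D\<^sub>v\<^sub>1 \<dots> D\<^sub>v\<^sub>k f (0)\<close>.
\<close>

fun contract :: "nat \<Rightarrow> ((nat \<Rightarrow>\<^sub>0 nat) \<Rightarrow> real) \<Rightarrow> (nat \<Rightarrow> real) list \<Rightarrow> (nat \<Rightarrow>\<^sub>0 nat) \<Rightarrow> real" where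
  "contract n F [] b = F b"
| "contract n F (v # vs) b = (\<Sum>i<n. v i * contract n F vs (b + unit_exp i))"

lemma symm_multilin_contract: "symm_multilin (\<lambda>vs. contract n F vs b)"
  unfolding symm_multilin_def
proof (intro conjI allI impI)
  fix xs ys :: "(nat \<Rightarrow> real) list" assume "mset xs = mset ys"
  then show "contract n F xs b = contract n F ys b"
  proof (rule mset_invariantI[where g = "\<lambda>b vs. contract n F vs b", rotated 2])
    fix x y :: "nat \<Rightarrow> real" and xs s
    show "contract n F (x # y # xs) s = contract n F (y # x # xs) s"
      by (simp add: sum_distrib_left) (subst sum.swap, simp add: ac_simps)
  qed auto
next
  fix xs
  show "linear (\<lambda>x. contract n F (x # xs) b)"
    by (rule linearI) (simp_all add: sum.distrib sum_distrib_left algebra_simps)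
qed

lemma contract_unit_fun [simp]: "j < n \<Longrightarrow> contract n F (unit_fun j # vs) b = contract n F vs (b + unit_exp j)"
  by (simp add: unit_fun_def if_distrib[of "\<lambda>x. x * _"] cong: if_cong)

lemma contract_eb3: "j < n \<Longrightarrow> contract n F (x # y # unit_fun j # vs) b = contract n F (x # y # vs) (b + unit_exp j)"
proof -
  assume "j < n"
  have "contract n F (x # y # unit_fun j # vs) b = contract n F (unit_fun j # x # y # vs) b"
    by (rule symm_multilin_mset[OF symm_multilin_contract]) (simp add: add_mset_commute)
  also have "\<dots> = contract n F (x # y # vs) (b + unit_exp j)" by (rule contract_unit_fun) fact
  finally show ?thesis .
qed

lemma contract_cong:
  assumes "list_all2 (\<lambda>v w. \<forall>i<n. v i = w i) vs ws" "\<And>d. supported n d \<Longrightarrow> F (b + d) = G (b + d)"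
  shows "contract n F vs b = contract n G ws b"
  using assms
proof (induction arbitrary: b rule: list_all2_induct)
  case Nil
  from Nil[of 0] show ?case by simp
next
  case (Cons v vs w ws)
  have "contract n F vs (b + unit_exp i) = contract n G ws (b + unit_exp i)" if "i < n" for i
    by (rule Cons.IH) (use Cons.prems[of "unit_exp i + d" for d] that in \<open>simp add: add.assoc\<close>)
  then show ?case using Cons by simp
qed

lemma contract_nonneg:
  assumes "\<And>b. 0 \<le> F b" "\<And>v i. v \<in> set vs \<Longrightarrow> i < n \<Longrightarrow> 0 \<le> v i"
  shows "0 \<le> contract n F vs b"
  using assms(2) by (induction vs arbitrary: b) (auto intro!: sum_nonneg assms(1))

lemma contract_pos:
  assumes F: "\<And>b. 0 \<le> F b" and "\<And>v i. v \<in> set vs \<Longrightarrow> i < n \<Longrightarrow> 0 < v i"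
    and "supported n d" "exp_degree n d = length vs" "0 < F (b + d)"
  shows "0 < contract n F vs b"
  using assms(2-)
proof (induction vs arbitrary: b d)
  case Nil
  then have "d = 0" using supported_exp_degree_0 by simp
  with Nil show ?case by simp
next
  case (Cons v vs)
  then obtain i d' where i: "i < n" "d = d' + unit_exp i" "supported n d'" "exp_degree n d' = length vs"
    using supported_split by (metis length_Cons)
  have "0 < contract n F vs (b + unit_exp i)"
    by (rule Cons.IH[of d']) (use i Cons.prems in \<open>auto simp: ac_simps\<close>)
  then have "0 < v i * contract n F vs (b + unit_exp i)" using Cons.prems(1)[of v i] i by simp
  moreover have "0 \<le> v j * contract n F vs (b + unit_exp j)" if "j < n" for j
    using Cons.prems(1) that by (intro mult_nonneg_nonneg contract_nonneg F) (auto intro: less_imp_le)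
  ultimately show ?case using i by (auto intro!: sum_pos2[of _ i])
qed

lemma contract_zero:
  assumes "\<And>d. supported n d \<Longrightarrow> exp_degree n d = length vs \<Longrightarrow> F (b + d) = 0"
  shows "contract n F vs b = 0"
  using assms
proof (induction vs arbitrary: b)
  case Nil
  from Nil[of 0] show ?case by simp
next
  case (Cons v vs)
  have "contract n F vs (b + unit_exp i) = 0" if "i < n" for i
    by (rule Cons.IH) (use Cons.prems[of "unit_exp i + d" for d] that in \<open>auto simp: exp_degree_add add.assoc\<close>)
  then show ?case by simp
qed

lemma contract_tendsto:
  assumes "\<And>d. supported n d \<Longrightarrow> ((\<lambda>e. Fe e (b + d)) \<longlongrightarrow> F (b + d)) net"
  shows "((\<lambda>e. contract n (Fe e) vs b) \<longlongrightarrow> contract n F vs b) net"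
  using assms
proof (induction vs arbitrary: b)
  case Nil
  from Nil[of 0] show ?case by simp
next
  case (Cons v vs)
  have "((\<lambda>e. contract n (Fe e) vs (b + unit_exp i)) \<longlongrightarrow> contract n F vs (b + unit_exp i)) net" if "i < n" for i
    by (rule Cons.IH) (use Cons.prems[of "unit_exp i + d" for d] that in \<open>auto simp: add.assoc\<close>)
  then show ?case by (auto intro!: tendsto_intros)
qed

definition repeat_list :: "nat \<Rightarrow> (nat \<Rightarrow>\<^sub>0 nat) \<Rightarrow> (nat \<Rightarrow> 'v) \<Rightarrow> 'v list" where
  "repeat_list n b cl = concat (map (\<lambda>i. replicate (Poly_Mapping.lookup b i) (cl i)) [0..<n])"

lemma mset_concat_map: "mset (concat (map f [0..<n])) = (\<Sum>i<n. mset (f i))"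
  by (induction n) auto

lemma mset_repeat_list: "mset (repeat_list n b cl) = (\<Sum>i<n. replicate_mset (Poly_Mapping.lookup b i) (cl i))"
  by (simp add: repeat_list_def mset_concat_map)

lemma repeat_list_0 [simp]: "repeat_list n 0 cl = []"
  by (simp add: repeat_list_def)

lemma mset_repeat_list_add:
  assumes "i < n" shows "mset (repeat_list n (b + unit_exp i) cl) = add_mset (cl i) (mset (repeat_list n b cl))"
proof -
  have "replicate_mset (Poly_Mapping.lookup (b + unit_exp i) j) (cl j)
      = replicate_mset (Poly_Mapping.lookup b j) (cl j) + (if j = i then {#cl i#} else {#})" for j
    by (auto simp: lookup_add lookup_unit_exp)
  then show ?thesis using assms by (simp add: mset_repeat_list sum.distrib)
qed

lemma length_repeat_list [simp]: "length (repeat_list n b cl) = exp_degree n b"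
  by (simp add: repeat_list_def exp_degree_def length_concat o_def interv_sum_list_conv_sum_set_nat atLeast0LessThan)

lemma set_repeat_list: "set (repeat_list n b cl) \<subseteq> cl ` {..<n}"
  by (auto simp: repeat_list_def)

lemma symm_multilin_repeat_list_add:
  "symm_multilin \<mu> \<Longrightarrow> i < n \<Longrightarrow> \<mu> (xs @ repeat_list n (b + unit_exp i) cl @ ys) = \<mu> (xs @ cl i # repeat_list n b cl @ ys)"
  by (erule symm_multilin_mset) (simp add: mset_repeat_list_add)

text \<open>The chain rule for a linear substitution: the array belongs to the polynomial obtained
  by inserting the sum of \<open>x_i\<close> times \<open>cl i\<close> into \<open>\<mu>\<close>, so
  differentiating along \<open>v\<close> inserts the sum of \<open>v i *\<^sub>R cl i\<close> into
  one argument.\<close>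

lemma contract_symm_multilin_repeat_list:
  assumes "symm_multilin \<mu>"
  shows "contract n (\<lambda>b. \<mu> (repeat_list n b cl @ ys)) vs b = \<mu> (map (\<lambda>v. \<Sum>i<n. v i *\<^sub>R cl i) vs @ repeat_list n b cl @ ys)"
proof (induction vs arbitrary: b)
  case (Cons v vs)
  have "\<mu> (map (\<lambda>v. \<Sum>i<n. v i *\<^sub>R cl i) vs @ repeat_list n (b + unit_exp i) cl @ ys)
    = \<mu> (cl i # map (\<lambda>v. \<Sum>i<n. v i *\<^sub>R cl i) vs @ repeat_list n b cl @ ys)" if "i < n" for i
    using symm_multilin_repeat_list_add[OF assms that] assms by (simp add: symm_multilin_append_Cons)
  then show ?case using Cons assms by (simp add: symm_multilin_sum symm_multilin_simps)
qed simp

lemma contract_repeat_list_unit_fun: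
  assumes "supported n c" shows "contract n F (repeat_list n c unit_fun @ vs) b = contract n F vs (b + c)"
  using assms
proof (induction arbitrary: b rule: supported_induct)
  case (add c i)
  have "contract n F (repeat_list n (c + unit_exp i) unit_fun @ vs) b = contract n F (unit_fun i # repeat_list n c unit_fun @ vs) b"
    using symm_multilin_repeat_list_add[OF symm_multilin_contract add(2), where xs = "[]"] by simp
  also have "\<dots> = contract n F vs (b + (c + unit_exp i))" using add by (simp add: ac_simps del: contract.simps)
  finally show ?case .
qed simp

text \<open>Induction on the list of fixed directions. A positive direction \<open>u\<close> is a
  positive combination of unit vectors, the slices in these are the same claim for
  \<open>b + unit_exp j\<close>, and \<open>step\<close> supplies the linking needed to merge them:
  a hub \<open>i0\<close>, a squarefree pattern on \<open>I\<close>, or vanishing of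
  everything.\<close>

theorem contract_lorentz:
  assumes F: "\<And>b. 0 \<le> F b"
    and base: "\<And>b. supported n b \<Longrightarrow> exp_degree n b + 2 = k \<Longrightarrow> lorentz UNIV (\<lambda>x y. contract n F [x, y] b)"
    and step: "\<And>b zs. supported n b \<Longrightarrow> exp_degree n b + length zs + 3 = k \<Longrightarrow> (\<And>z i. z \<in> set zs \<Longrightarrow> i < n \<Longrightarrow> 0 < z i) \<Longrightarrow>
       (\<exists>i0<n. \<forall>j<n. 0 < contract n F zs (b + unit_exp i0 + unit_exp i0 + unit_exp j)) \<or>
       (\<exists>I\<subseteq>{..<n}. 3 \<le> card I \<and>
          (\<forall>i\<in>I. \<forall>j\<in>I. contract n F zs (b + unit_exp i + unit_exp i + unit_exp j) = 0) \<and>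
          (\<forall>i\<in>I. \<forall>j\<in>I. \<forall>l\<in>I. i \<noteq> j \<longrightarrow> i \<noteq> l \<longrightarrow> j \<noteq> l \<longrightarrow> 0 < contract n F zs (b + unit_exp i + unit_exp j + unit_exp l)) \<and>
          (\<forall>j<n. j \<notin> I \<longrightarrow> (\<forall>d. F (b + unit_exp j + d) = 0))) \<or> (\<forall>d. F (b + d) = 0)"
    and "supported n b" "exp_degree n b + length zs + 2 = k" "\<And>z i. z \<in> set zs \<Longrightarrow> i < n \<Longrightarrow> 0 < z i"
  shows "lorentz UNIV (\<lambda>x y. contract n F (x # y # zs) b)"
  using assms(4-)
proof (induction zs arbitrary: b)
  case Nil
  then show ?case using base by simp
next
  case (Cons u zs)
  let ?T = "\<lambda>x y z. contract n F (x # y # z # zs) b"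
  let ?C = "{v :: nat \<Rightarrow> real. \<forall>i<n. 0 \<le> v i}"
  have T: "symm_trilin ?T" by (rule symm_trilin_symm_multilin[OF symm_multilin_contract])
  have C: "triple_cone ?T ?C"
    unfolding triple_cone_def
    by (auto simp del: contract.simps intro!: contract_nonneg F dest: Cons.prems(3) less_imp_le)
       (use Cons.prems(3) in \<open>auto intro: less_imp_le\<close>)
  have U: "linsub (UNIV :: (nat \<Rightarrow> real) set)" by simp
  have eC: "unit_fun j \<in> ?C" for j by (simp add: unit_fun_def)
  have le: "lorentz UNIV (\<lambda>x y. ?T x y (unit_fun j))" if "j < n" for j
    unfolding contract_eb3[OF that] using Cons.prems that by (intro Cons.IH) (auto simp: exp_degree_add)
  have upos: "0 < u i" if "i < n" for i using Cons.prems that by auto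
  have Tr: "?T (unit_fun i) (unit_fun j) (unit_fun l) = contract n F zs (b + unit_exp i + unit_exp j + unit_exp l)" if "i < n" "j < n" "l < n" for i j l
    using that by (simp del: contract.simps)
  \<comment> \<open>\<open>contract\<close> reads only the coordinates below \<open>n\<close>, so
    \<open>u\<close> may be replaced by its expansion in unit vectors.\<close>
  have u: "?T x y u = ?T x y (\<Sum>j<n. u j *\<^sub>R unit_fun j)" for x y
  proof (rule contract_cong)
    have *: "(\<Sum>j<n. u j *\<^sub>R unit_fun j) i = (\<Sum>j<n. u j * unit_fun j i)" for i
      by (induction n) (auto simp: zero_fun_def)
    have "(\<Sum>j<n. u j *\<^sub>R unit_fun j) i = u i" if "i < n" for i
      unfolding * using that by (simp add: unit_fun_def if_distrib cong: if_cong)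
    then show "list_all2 (\<lambda>v w. \<forall>i<n. v i = w i) (x # y # u # zs) (x # y # (\<Sum>j<n. u j *\<^sub>R unit_fun j) # zs)"
      by (simp add: list_all2_refl)
  qed simp
  have "exp_degree n b + length zs + 3 = k" using Cons.prems by simp
  from step[OF Cons.prems(1) this] Cons.prems(3)
  consider (star) i0 where "i0 < n" "\<forall>j<n. 0 < contract n F zs (b + unit_exp i0 + unit_exp i0 + unit_exp j)"
    | (multi) I where "I \<subseteq> {..<n}" "3 \<le> card I" "\<forall>i\<in>I. \<forall>j\<in>I. contract n F zs (b + unit_exp i + unit_exp i + unit_exp j) = 0"
      "\<forall>i\<in>I. \<forall>j\<in>I. \<forall>l\<in>I. i \<noteq> j \<longrightarrow> i \<noteq> l \<longrightarrow> j \<noteq> l \<longrightarrow> 0 < contract n F zs (b + unit_exp i + unit_exp j + unit_exp l)"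
      "\<forall>j<n. j \<notin> I \<longrightarrow> (\<forall>d. F (b + unit_exp j + d) = 0)"
    | (zero) "\<forall>d. F (b + d) = 0"
    by (auto 4 4)
  then have "lorentz UNIV (\<lambda>x y. ?T x y (\<Sum>j<n. u j *\<^sub>R unit_fun j))"
  proof cases
    case star
    show ?thesis
      by (rule lorentz_star[OF T U C, of "{..<n}" i0]) (use star Tr le upos eC in \<open>auto simp del: contract.simps\<close>)
  next
    case multi
    have sub: "\<And>i. i \<in> I \<Longrightarrow> i < n" using multi by auto
    show ?thesis
    proof (rule lorentz_multiaffine[OF T U C, of "{..<n}" I])
      show "\<forall>x\<in>UNIV. \<forall>y\<in>UNIV. ?T x y (unit_fun j) = 0" if "j \<in> {..<n} - I" for j
        using that multi(5) by (auto simp: contract_eb3 simp del: contract.simps intro!: contract_zero)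
    qed (use multi sub Tr le upos eC in \<open>auto simp del: contract.simps\<close>)
  next
    case zero
    then have "contract n F vs b = 0" for vs by (intro contract_zero) auto
    then show ?thesis by (simp del: contract.simps)
  qed
  then show ?case by (simp only: u)
qed

section \<open>Lorentzian coefficient functions and polarization\<close>

definition mfact :: "nat \<Rightarrow> (nat \<Rightarrow>\<^sub>0 nat) \<Rightarrow> real" where
  "mfact n b = (\<Prod>i<n. fact (Poly_Mapping.lookup b i))"

lemma mfact_pos: "0 < mfact n b" by (simp add: mfact_def prod_pos)

lemma mfact_add: "i < n \<Longrightarrow> mfact n (b + unit_exp i) = mfact n b * (real (Poly_Mapping.lookup b i) + 1)"
proof -
  assume i: "i < n"
  have "mfact n (b + unit_exp i) = fact (Poly_Mapping.lookup b i + 1) * (\<Prod>j\<in>{..<n}-{i}. fact (Poly_Mapping.lookup b j))"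
    unfolding mfact_def using i by (subst prod.remove[of _ i]) (auto simp: lookup_add lookup_unit_exp intro!: prod.cong)
  also have "\<dots> = (real (Poly_Mapping.lookup b i) + 1) * (fact (Poly_Mapping.lookup b i) * (\<Prod>j\<in>{..<n}-{i}. fact (Poly_Mapping.lookup b j)))"
    by (simp add: algebra_simps)
  also have "fact (Poly_Mapping.lookup b i) * (\<Prod>j\<in>{..<n}-{i}. fact (Poly_Mapping.lookup b j)) = mfact n b"
    unfolding mfact_def using i by (subst (2) prod.remove[of _ i]) auto
  finally show ?thesis by simp
qed

text \<open>\<open>F b\<close> is meant as the derivative of order \<open>b\<close> at 0 of a
  Lorentzian polynomial of degree \<open>k\<close>. Using derivatives instead of coefficients keeps
  \<open>contract\<close> free of factorials.\<close>

definition lorentz_coeff :: "nat \<Rightarrow> nat \<Rightarrow> ((nat \<Rightarrow>\<^sub>0 nat) \<Rightarrow> real) \<Rightarrow> bool" where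
  "lorentz_coeff n k F \<longleftrightarrow> (\<forall>b. 0 \<le> F b) \<and> (\<forall>b. F b \<noteq> 0 \<longrightarrow> supported n b \<and> exp_degree n b = k) \<and>
     (\<forall>zs. length zs + 2 = k \<longrightarrow> (\<forall>z\<in>set zs. \<forall>i<n. 0 \<le> z i) \<longrightarrow> lorentz UNIV (\<lambda>x y. contract n F (x # y # zs) 0))"

text \<open>On polynomials this is antidifferentiation in variable \<open>i\<close> without constant
  term; it sends \<open>N (x^a)\<close> to \<open>N (x_i x^a)\<close>. For duals it amounts to
  enlarging \<open>\<kappa>\<close> by \<open>unit_exp i\<close>.\<close>

definition raise :: "nat \<Rightarrow> ((nat \<Rightarrow>\<^sub>0 nat) \<Rightarrow> real) \<Rightarrow> (nat \<Rightarrow>\<^sub>0 nat) \<Rightarrow> real" where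
  "raise i F b = (if Poly_Mapping.lookup b i = 0 then 0 else F (b - unit_exp i))"

lemma raise_add [simp]: "raise i F (b + unit_exp i) = F b"
  by (simp add: raise_def lookup_add lookup_unit_exp)

lemma raise_0: "Poly_Mapping.lookup b i = 0 \<Longrightarrow> raise i F b = 0"
  by (simp add: raise_def)

text \<open>Substituting these vectors for the variables makes every coefficient of a nonzero
  Lorentzian polynomial in its degree positive, and for \<open>e\<close> tending to 0 the original
  coefficients return.\<close>

definition perturbed :: "real \<Rightarrow> nat \<Rightarrow> nat \<Rightarrow> real" where
  "perturbed e i = unit_fun i + e *\<^sub>R (\<lambda>j. 1)"

lemma perturbed_pos: "0 < e \<Longrightarrow> 0 < perturbed e i j"
  by (simp add: perturbed_def unit_fun_def)

lemma repeat_list_map: "repeat_list n b (\<lambda>i. f (c i)) = map f (repeat_list n b c)"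
  by (simp add: repeat_list_def map_concat o_def)

lemma perturbed_tendsto:
  assumes "supported n b"
  shows "((\<lambda>e. contract n F (repeat_list n b (perturbed e)) c) \<longlongrightarrow> F (c + b)) (at_right 0)"
proof -
  have "((\<lambda>e. contract n F (map (\<lambda>i. unit_fun i + e *\<^sub>R (\<lambda>j. 1)) (repeat_list n b id) @ []) c) \<longlongrightarrow> contract n F (map unit_fun (repeat_list n b id) @ []) c) (at_right 0)"
    by (rule symm_multilin_tendsto[OF symm_multilin_contract]) (simp add: tendsto_ident_at)
  moreover have "contract n F (map unit_fun (repeat_list n b id) @ []) c = F (c + b)"
    using contract_repeat_list_unit_fun[OF assms, of F "[]" c] repeat_list_map[of n b unit_fun id] by simp
  moreover have "map (\<lambda>i. unit_fun i + e *\<^sub>R (\<lambda>j. 1)) (repeat_list n b id) = repeat_list n b (perturbed e)" for e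
    using repeat_list_map[of n b "perturbed e" id] by (simp add: perturbed_def[abs_def])
  ultimately show ?thesis by simp
qed

lemma perturbed_sub_pos:
  assumes "lorentz_coeff n k F" "0 < F b0" "0 < e" "exp_degree n b = k"
  shows "0 < contract n F (repeat_list n b (perturbed e)) 0"
proof (rule contract_pos[of F _ n b0])
  show "0 < v i" if "v \<in> set (repeat_list n b (perturbed e))" for v i
    using that set_repeat_list[of n b "perturbed e"] perturbed_pos[OF assms(3)] by auto
qed (use assms in \<open>auto simp: lorentz_coeff_def\<close>)

lemma perturbed_sub_nonneg:
  assumes "lorentz_coeff n k F" "0 < e"
  shows "0 \<le> contract n F (repeat_list n b (perturbed e)) 0"
proof (rule contract_nonneg)
  show "0 \<le> v i" if "v \<in> set (repeat_list n b (perturbed e))" for v i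
    using that set_repeat_list[of n b "perturbed e"] perturbed_pos[OF assms(2)] by (auto intro: less_imp_le)
qed (use assms in \<open>auto simp: lorentz_coeff_def\<close>)

lemma lorentz_closure:
  assumes "\<And>zs. length zs = l \<Longrightarrow> (\<And>z i. z \<in> set zs \<Longrightarrow> i < n \<Longrightarrow> 0 < z i) \<Longrightarrow> lorentz UNIV (\<lambda>x y. contract n F (x # y # zs) b)"
    and "length zs = l" "\<And>z i. z \<in> set zs \<Longrightarrow> i < n \<Longrightarrow> 0 \<le> z i"
  shows "lorentz UNIV (\<lambda>x y. contract n F (x # y # zs) b)"
proof (rule lorentz_limit[where F = "at_right (0::real)" and B = "\<lambda>e x y. contract n F (x # y # map (\<lambda>z. z + e *\<^sub>R (\<lambda>i. 1)) zs) b"])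
  fix x y
  have m: "\<And>vs. contract n F (x # y # vs) b = contract n F (vs @ [x, y]) b" by (rule symm_multilin_mset[OF symm_multilin_contract]) (simp add: add_mset_commute)
  have "((\<lambda>e. contract n F (map (\<lambda>z. id z + e *\<^sub>R (\<lambda>i. 1)) zs @ [x, y]) b) \<longlongrightarrow> contract n F (map id zs @ [x, y]) b) (at_right 0)"
    by (rule symm_multilin_tendsto[OF symm_multilin_contract]) (simp add: tendsto_ident_at)
  then show "((\<lambda>e. contract n F (x # y # map (\<lambda>z. z + e *\<^sub>R (\<lambda>i. 1)) zs) b) \<longlongrightarrow> contract n F (x # y # zs) b) (at_right 0)"
    unfolding m by simp
  show "\<forall>\<^sub>F e in at_right 0. lorentz UNIV (\<lambda>x y. contract n F (x # y # map (\<lambda>z. z + e *\<^sub>R (\<lambda>i. 1)) zs) b)"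
    using eventually_at_right_less[of 0]
  proof eventually_elim
    case (elim e)
    show ?case by (rule assms(1)) (use assms elim in \<open>auto simp: add_nonneg_pos\<close>)
  qed
qed simp

text \<open>\<open>F\<close> is perturbed so that all its entries of degree \<open>k\<close> are
  positive. Then every entry of degree \<open>Suc k\<close> of \<open>G e\<close> with a positive
  exponent at \<open>i\<close> is positive, so \<open>i\<close> is a hub in the sense of
  \<open>contract_lorentz\<close>, and only the quadratic case needs an argument of its own.\<close>

lemma lorentz_coeff_raise:
  assumes F: "lorentz_coeff n k F" and b0: "0 < F b0" and i: "i < n"
  shows "lorentz_coeff n (Suc k) (raise i F)"
proof -
  have F0: "\<And>b. 0 \<le> F b" and Fs: "\<And>b. F b \<noteq> 0 \<Longrightarrow> supported n b \<and> exp_degree n b = k"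
    and Fl: "\<And>zs. length zs + 2 = k \<Longrightarrow> (\<And>z i. z \<in> set zs \<Longrightarrow> i < n \<Longrightarrow> 0 \<le> z i) \<Longrightarrow> lorentz UNIV (\<lambda>x y. contract n F (x # y # zs) 0)"
    using F by (auto simp: lorentz_coeff_def simp del: contract.simps)
  define Fe where "Fe e b = contract n F (repeat_list n b (perturbed e)) 0" for e b
  define G where "G e = raise i (Fe e)" for e
  have Fe0: "0 \<le> Fe e b" if "0 < e" for e b unfolding Fe_def by (rule perturbed_sub_nonneg[OF F that])
  have Fepos: "0 < Fe e b" if "0 < e" "exp_degree n b = k" for e b
    unfolding Fe_def by (rule perturbed_sub_pos[OF F b0 that])
  have lorG: "lorentz UNIV (\<lambda>x y. contract n (G e) (x # y # zs) 0)"
    if e: "0 < e" and zs: "length zs + 2 = Suc k" "\<And>z i. z \<in> set zs \<Longrightarrow> i < n \<Longrightarrow> 0 < z i" for e zs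
  proof (rule contract_lorentz)
    show "0 \<le> G e b" for b using Fe0[OF e] by (simp add: G_def raise_def)
    show "lorentz UNIV (\<lambda>x y. contract n (G e) [x, y] b)" if b: "supported n b" "exp_degree n b + 2 = Suc k" for b
    proof (cases "Poly_Mapping.lookup b i = 0")
      case True
      \<comment> \<open>As \<open>i\<close> does not occur in \<open>b\<close>, an entry survives
        only if one of the two derivatives is in direction \<open>i\<close>. The form is therefore a
        polarized product of two linear forms; the diagonal entry is halved because it is met
        twice.\<close>
      define h where "h c = (if c = i then 1/2 else 1) * G e (b + unit_exp i + unit_exp c)" for c
      have "contract n (G e) [x, y] b = x i * (\<Sum>c<n. y c * h c) + y i * (\<Sum>c<n. x c * h c)" for x y
      proof -
        have z: "G e (b + unit_exp a + unit_exp c) = 0" if "a \<noteq> i" "c \<noteq> i" for a c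
          unfolding G_def by (rule raise_0) (use that True in \<open>simp add: lookup_add lookup_unit_exp\<close>)
        have sp: "(\<Sum>c<n. f c) = f i + (\<Sum>c\<in>{..<n}-{i}. f c)" for f :: "nat \<Rightarrow> real"
          using i by (subst sum.remove[of _ i]) auto
        have inner: "(\<Sum>c<n. y c * G e (b + unit_exp a + unit_exp c)) = y i * G e (b + unit_exp i + unit_exp a)" if "a \<noteq> i" for a
        proof -
          have "(\<Sum>c\<in>{..<n}-{i}. y c * G e (b + unit_exp a + unit_exp c)) = 0" by (rule sum.neutral) (use z that in auto)
          then show ?thesis unfolding sp[of "\<lambda>c. y c * G e (b + unit_exp a + unit_exp c)"] by (simp add: add.assoc add.commute[of "unit_exp a"])
        qed
        have s: "(\<Sum>c<n. x c * h c) = x i * G e (b + unit_exp i + unit_exp i) / 2 + (\<Sum>c\<in>{..<n}-{i}. x c * G e (b + unit_exp i + unit_exp c))" for x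
          unfolding sp[of "\<lambda>c. x c * h c"] by (auto simp: h_def intro!: sum.cong)
        have "contract n (G e) [x, y] b = x i * (\<Sum>c<n. y c * G e (b + unit_exp i + unit_exp c))
            + (\<Sum>a\<in>{..<n}-{i}. x a * (y i * G e (b + unit_exp i + unit_exp a)))"
          using sp[of "\<lambda>a. x a * (\<Sum>c<n. y c * G e (b + unit_exp a + unit_exp c))"] by (simp add: inner)
        also have "(\<Sum>c<n. y c * G e (b + unit_exp i + unit_exp c)) = y i * G e (b + unit_exp i + unit_exp i) + (\<Sum>c\<in>{..<n}-{i}. y c * G e (b + unit_exp i + unit_exp c))"
          by (rule sp)
        finally show ?thesis unfolding s by (simp add: algebra_simps sum_distrib_left)
      qed
      then show ?thesis by (simp add: lorentz_rank2[of UNIV "\<lambda>x. x i"] del: contract.simps)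
    next
      case False
      then obtain c where c: "b = c + unit_exp i" using unit_exp_split by blast
      have cd: "supported n c" "exp_degree n c + 2 = k" using b i by (auto simp: c exp_degree_add)
      have "contract n (G e) [x, y] b = contract n (Fe e) [x, y] c" for x y
      proof -
        have "G e (b + d) = Fe e (c + d)" for d
        proof -
          have "b + d = (c + d) + unit_exp i" by (simp add: c ac_simps)
          then show ?thesis by (simp only: G_def raise_add)
        qed
        then show ?thesis by (simp add: add.assoc)
      qed
      moreover have "contract n (Fe e) [x, y] c = contract n F (map (\<lambda>v. \<Sum>i<n. v i *\<^sub>R perturbed e i) [x, y] @ repeat_list n c (perturbed e)) 0" for x y
        unfolding Fe_def using contract_symm_multilin_repeat_list[OF symm_multilin_contract[of n F 0], of n "perturbed e" "[]" "[x,y]" c] by (simp del: contract.simps)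
      ultimately have eq: "contract n (G e) [x, y] b = contract n F ((\<Sum>i<n. x i *\<^sub>R perturbed e i) # (\<Sum>i<n. y i *\<^sub>R perturbed e i) # repeat_list n c (perturbed e)) 0" for x y
        by (simp del: contract.simps)
      have "lorentz UNIV (\<lambda>x y. contract n F (x # y # repeat_list n c (perturbed e)) 0)"
      proof (rule Fl)
        show "0 \<le> z i" if "z \<in> set (repeat_list n c (perturbed e))" for z i
          using that set_repeat_list[of n c "perturbed e"] perturbed_pos[OF e] by (auto intro: less_imp_le)
      qed (use cd in auto)
      then show ?thesis unfolding eq by (rule lorentz_pullback) auto
    qed
    show "(\<exists>i0<n. \<forall>j<n. 0 < contract n (G e) ws (b + unit_exp i0 + unit_exp i0 + unit_exp j)) \<or> X \<or> Y"
      if b: "supported n b" "exp_degree n b + length ws + 3 = Suc k" and ws: "\<And>z i. z \<in> set ws \<Longrightarrow> i < n \<Longrightarrow> 0 < z i" for b ws X Y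
    proof (intro disjI1 exI[of _ i] conjI allI impI i)
      fix j assume j: "j < n"
      \<comment> \<open>Any exponent of degree \<open>length ws\<close> serves as witness for
        \<open>contract_pos\<close>; a multiple of \<open>unit_exp i\<close> is at hand.\<close>
      have "supported n (of_nat l * unit_exp i) \<and> exp_degree n (of_nat l * unit_exp i) = l" for l
        using i by (induction l) (auto simp: algebra_simps exp_degree_add)
      then obtain d where d: "supported n d" "exp_degree n d = length ws" by blast
      have "b + unit_exp i + unit_exp i + unit_exp j + d = (b + unit_exp i + unit_exp j + d) + unit_exp i" by (simp add: ac_simps)
      then have "0 < G e (b + unit_exp i + unit_exp i + unit_exp j + d)"
        unfolding G_def by (simp only: raise_add) (rule Fepos[OF e], use b d i j in \<open>simp add: exp_degree_add\<close>)
      then show "0 < contract n (G e) ws (b + unit_exp i + unit_exp i + unit_exp j)"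
        using d ws Fe0[OF e] by (intro contract_pos[of _ _ n d]) (auto simp: G_def raise_def)
    qed
  qed (use zs in auto)
  have lim: "lorentz UNIV (\<lambda>x y. contract n (raise i F) (x # y # zs) 0)"
    if zs: "length zs = Suc k - 2" "2 \<le> Suc k" "\<And>z i. z \<in> set zs \<Longrightarrow> i < n \<Longrightarrow> 0 < z i" for zs
  proof (rule lorentz_limit[where F = "at_right (0::real)" and B = "\<lambda>e x y. contract n (G e) (x # y # zs) 0"])
    fix x y
    show "((\<lambda>e. contract n (G e) (x # y # zs) 0) \<longlongrightarrow> contract n (raise i F) (x # y # zs) 0) (at_right 0)"
    proof (rule contract_tendsto)
      fix d assume d: "supported n d"
      show "((\<lambda>e. G e (0 + d)) \<longlongrightarrow> raise i F (0 + d)) (at_right 0)"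
      proof (cases "Poly_Mapping.lookup d i = 0")
        case False
        then obtain c where c: "d = c + unit_exp i" using unit_exp_split by blast
        then show ?thesis using perturbed_tendsto[of n c F 0] d by (simp add: G_def Fe_def)
      qed (simp add: G_def raise_0)
    qed
    show "\<forall>\<^sub>F e in at_right 0. lorentz UNIV (\<lambda>x y. contract n (G e) (x # y # zs) 0)"
      using eventually_at_right_less[of 0] by eventually_elim (rule lorG, use zs in auto)
  qed simp
  show ?thesis
    unfolding lorentz_coeff_def
  proof (intro conjI allI impI)
    show "0 \<le> raise i F b" for b using F0 by (simp add: raise_def)
    fix b assume "raise i F b \<noteq> 0"
    then have l: "Poly_Mapping.lookup b i \<noteq> 0" by (auto simp: raise_def split: if_splits)
    then obtain c where c: "b = c + unit_exp i" using unit_exp_split by blast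
    then have "F c \<noteq> 0" using \<open>raise i F b \<noteq> 0\<close> by simp
    then show "supported n b" "exp_degree n b = Suc k" using Fs i by (auto simp: c exp_degree_add)
  next
    fix zs :: "(nat \<Rightarrow> real) list" assume zs: "length zs + 2 = Suc k" "\<forall>z\<in>set zs. \<forall>i<n. 0 \<le> z i"
    show "lorentz UNIV (\<lambda>x y. contract n (raise i F) (x # y # zs) 0)"
    proof (rule lorentz_closure[of "length zs"])
      fix ws :: "(nat \<Rightarrow> real) list" assume "length ws = length zs" "\<And>z i. z \<in> set ws \<Longrightarrow> i < n \<Longrightarrow> 0 < z i"
      then show "lorentz UNIV (\<lambda>x y. contract n (raise i F) (x # y # ws) 0)" using zs by (intro lim) linarith+
    qed (use zs in blast)+
  qed
qed


section \<open>Types of index sets, polarization and restriction to equal variables\<close>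

definition type_sum :: "(nat \<Rightarrow> nat) \<Rightarrow> nat set \<Rightarrow> (nat \<Rightarrow>\<^sub>0 nat)" where
  "type_sum \<tau> J = (\<Sum>s\<in>J. unit_exp (\<tau> s))"

lemma type_sum_insert: "finite J \<Longrightarrow> s \<notin> J \<Longrightarrow> type_sum \<tau> (insert s J) = type_sum \<tau> J + unit_exp (\<tau> s)"
  by (simp add: type_sum_def add.commute)

lemma type_sum_remove: "finite J \<Longrightarrow> s \<in> J \<Longrightarrow> type_sum \<tau> J = type_sum \<tau> (J - {s}) + unit_exp (\<tau> s)"
  using type_sum_insert[of "J - {s}" s \<tau>] by (simp add: insert_absorb)

lemma lookup_type_sum: "finite J \<Longrightarrow> Poly_Mapping.lookup (type_sum \<tau> J) i = card {s\<in>J. \<tau> s = i}"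
proof (induction J rule: finite_induct)
  case (insert s J)
  have "{t \<in> insert s J. \<tau> t = i} = (if \<tau> s = i then insert s {t\<in>J. \<tau> t = i} else {t\<in>J. \<tau> t = i})" by auto
  then show ?case using insert by (auto simp: type_sum_insert lookup_add lookup_unit_exp)
qed (simp add: type_sum_def)

lemma supported_type_sum: "finite J \<Longrightarrow> (\<And>s. s \<in> J \<Longrightarrow> \<tau> s < n) \<Longrightarrow> supported n (type_sum \<tau> J) \<and> exp_degree n (type_sum \<tau> J) = card J"
proof (induction J rule: finite_induct)
  case (insert s J)
  then show ?case by (auto simp: type_sum_insert exp_degree_add)
qed (simp add: type_sum_def)

text \<open>
  The coefficients of a multi-affine polynomial in \<open>M\<close> variables, where variable \<open>s\<close> stands for the original variable \<open>\<tau> s\<close>; an exponent is sent to the type of its complement, which dualizes.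
\<close>

definition polarized :: "nat \<Rightarrow> (nat \<Rightarrow> nat) \<Rightarrow> ((nat \<Rightarrow>\<^sub>0 nat) \<Rightarrow> real) \<Rightarrow> (nat \<Rightarrow>\<^sub>0 nat) \<Rightarrow> real" where
  "polarized M \<tau> g b = (if supported M b \<and> (\<forall>s. Poly_Mapping.lookup b s \<le> 1)
     then g (type_sum \<tau> {s. s < M \<and> Poly_Mapping.lookup b s = 0}) else 0)"

definition zero_set :: "nat \<Rightarrow> (nat \<Rightarrow>\<^sub>0 nat) \<Rightarrow> nat set" where
  "zero_set M b = {s. s < M \<and> Poly_Mapping.lookup b s = 0}"

definition squarefree_exp :: "nat \<Rightarrow> (nat \<Rightarrow>\<^sub>0 nat) \<Rightarrow> bool" where
  "squarefree_exp M b \<longleftrightarrow> supported M b \<and> (\<forall>s. Poly_Mapping.lookup b s \<le> 1)"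

lemma polarized_alt: "polarized M \<tau> g b = (if squarefree_exp M b then g (type_sum \<tau> (zero_set M b)) else 0)"
  by (simp add: polarized_def squarefree_exp_def zero_set_def)

lemma finite_zero_set [simp]: "finite (zero_set M b)" by (simp add: zero_set_def)

lemma zero_set_add: "zero_set M (b + unit_exp s) = zero_set M b - {s}"
  by (auto simp: zero_set_def lookup_add lookup_unit_exp)

lemma squarefree_exp_add: "squarefree_exp M (b + unit_exp s) \<longleftrightarrow> squarefree_exp M b \<and> s \<in> zero_set M b"
proof -
  have "Poly_Mapping.lookup (b + unit_exp s) t \<le> 1 \<longleftrightarrow> Poly_Mapping.lookup b t \<le> 1 \<and> (t = s \<longrightarrow> Poly_Mapping.lookup b s = 0)" for t
    by (auto simp: lookup_add lookup_unit_exp)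
  then show ?thesis by (auto simp: squarefree_exp_def zero_set_def)
qed

lemma squarefree_exp_0 [simp]: "squarefree_exp M 0" by (simp add: squarefree_exp_def)

lemma zero_set_0 [simp]: "zero_set M 0 = {..<M}" by (auto simp: zero_set_def)

lemma card_zero_set:
  assumes "squarefree_exp M b" shows "card (zero_set M b) + exp_degree M b = M"
proof -
  have "exp_degree M b = (\<Sum>s\<in>{..<M} - zero_set M b. 1)"
    unfolding exp_degree_def
  proof (rule sum.mono_neutral_cong_right)
    show "Poly_Mapping.lookup b s = 1" if "s \<in> {..<M} - zero_set M b" for s
      using that assms by (auto simp: squarefree_exp_def zero_set_def) (metis One_nat_def le_SucE le_zero_eq less_irrefl)
  qed (auto simp: zero_set_def)
  also have "\<dots> = M - card (zero_set M b)" using card_Diff_subset[of "zero_set M b" "{..<M}"] by (auto simp: zero_set_def)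
  finally show ?thesis using card_mono[of "{..<M}" "zero_set M b"] by (simp add: subset_eq zero_set_def)
qed

lemma not_squarefree_exp_add: "\<not> squarefree_exp M b \<Longrightarrow> \<not> squarefree_exp M (b + d)"
  by (auto simp: squarefree_exp_def lookup_add) (metis add_leD1 One_nat_def)

text \<open>Free variables are added to \<open>b\<close> one by one until exactly \<open>m\<close>
  are left; the type of the complement then has degree \<open>m\<close>, where \<open>g\<close> is
  positive.\<close>

lemma polarized_pos_ext:
  assumes g: "\<And>a. supported n a \<Longrightarrow> exp_degree n a = m \<Longrightarrow> 0 < g a" and \<tau>: "\<And>s. s < M \<Longrightarrow> \<tau> s < n"
    and b: "squarefree_exp M b" and l: "exp_degree M b + l + m = M"
  shows "\<exists>d. supported M d \<and> exp_degree M d = l \<and> 0 < polarized M \<tau> g (b + d)"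
  using b l
proof (induction l arbitrary: b)
  case 0
  then have "card (zero_set M b) = m" using card_zero_set by (metis add.commute add_left_cancel add_0)
  moreover have "\<tau> s < n" if "s \<in> zero_set M b" for s using that \<tau> by (auto simp: zero_set_def)
  ultimately show ?case using g supported_type_sum[of "zero_set M b" \<tau> n] 0 by (intro exI[of _ 0]) (auto simp: polarized_alt)
next
  case (Suc l)
  then have "0 < card (zero_set M b)" using card_zero_set[of M b] by linarith
  then obtain s where s: "s \<in> zero_set M b" by (metis card_gt_0_iff equals0I)
  then have sM: "s < M" by (simp add: zero_set_def)
  have "\<exists>d. supported M d \<and> exp_degree M d = l \<and> 0 < polarized M \<tau> g (b + unit_exp s + d)"
    using Suc.prems s sM by (intro Suc.IH) (auto simp: squarefree_exp_add exp_degree_add)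
  then obtain d where "supported M d" "exp_degree M d = l" "0 < polarized M \<tau> g (b + unit_exp s + d)" by blast
  then show ?case using sM by (intro exI[of _ "unit_exp s + d"]) (auto simp: exp_degree_add add.assoc)
qed

text \<open>These are the quadratic forms left after differentiating
  \<open>polarized M \<tau> g\<close> once in each variable outside \<open>R\<close>. Besides
  positivity they are all that the local-to-global principle asks of \<open>g\<close>.\<close>

definition local_lorentz :: "nat \<Rightarrow> (nat \<Rightarrow> nat) \<Rightarrow> nat \<Rightarrow> ((nat \<Rightarrow>\<^sub>0 nat) \<Rightarrow> real) \<Rightarrow> bool" where
  "local_lorentz M \<tau> m g \<longleftrightarrow> (\<forall>R\<subseteq>{..<M}. card R = m + 2 \<longrightarrow>
     lorentz UNIV (\<lambda>x y :: nat \<Rightarrow> real. \<Sum>s\<in>R. \<Sum>t\<in>R - {s}. x s * y t * g (type_sum \<tau> (R - {s, t}))))"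

lemma polarized_pos:
  assumes g0: "\<And>a. 0 \<le> g a" and g: "\<And>a. supported n a \<Longrightarrow> exp_degree n a = m \<Longrightarrow> 0 < g a" and \<tau>: "\<And>s. s < M \<Longrightarrow> \<tau> s < n"
    and "squarefree_exp M b" "exp_degree M b + length zs + m = M" "\<And>z i. z \<in> set zs \<Longrightarrow> i < M \<Longrightarrow> 0 < z i"
  shows "0 < contract M (polarized M \<tau> g) zs b"
proof -
  obtain d where "supported M d" "exp_degree M d = length zs" "0 < polarized M \<tau> g (b + d)"
    using polarized_pos_ext[of n m g M \<tau> b "length zs"] g \<tau> assms(4,5) by blast
  moreover have "0 \<le> polarized M \<tau> g c" for c using g0 by (simp add: polarized_def)
  ultimately show ?thesis using assms(6) by (intro contract_pos[of "polarized M \<tau> g" zs M d]) auto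
qed

theorem polarized_lorentz:
  assumes g0: "\<And>a. 0 \<le> g a" and g: "\<And>a. supported n a \<Longrightarrow> exp_degree n a = m \<Longrightarrow> 0 < g a" and \<tau>: "\<And>s. s < M \<Longrightarrow> \<tau> s < n"
    and loc: "local_lorentz M \<tau> m g"
    and zs: "length zs + 2 + m = M" "\<And>z i. z \<in> set zs \<Longrightarrow> i < M \<Longrightarrow> 0 < z i"
  shows "lorentz UNIV (\<lambda>x y. contract M (polarized M \<tau> g) (x # y # zs) 0)"
proof (rule contract_lorentz[where k = "M - m"])
  let ?f = "polarized M \<tau> g"
  show "0 \<le> ?f b" for b using g0 by (simp add: polarized_def)
  show "lorentz UNIV (\<lambda>x y. contract M ?f [x, y] b)" if b: "supported M b" "exp_degree M b + 2 = M - m" for b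
  proof (cases "squarefree_exp M b")
    case True
    define R where "R = zero_set M b"
    have R: "R \<subseteq> {..<M}" "card R = m + 2" "finite R" using card_zero_set[OF True] b by (auto simp: R_def zero_set_def)
    have "contract M ?f [x, y] b = (\<Sum>s\<in>R. \<Sum>t\<in>R - {s}. x s * y t * g (type_sum \<tau> (R - {s, t})))" for x y
    proof -
      have f: "?f (b + unit_exp s + unit_exp t) = (if s \<in> R \<and> t \<in> R - {s} then g (type_sum \<tau> (R - {s, t})) else 0)" for s t
      proof -
        have "R - {s} - {t} = R - {s, t}" by auto
        then show ?thesis by (simp add: polarized_alt squarefree_exp_add True zero_set_add R_def[symmetric])
      qed
      have "contract M ?f [x, y] b = (\<Sum>s<M. \<Sum>t<M. x s * (y t * ?f (b + unit_exp s + unit_exp t)))"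
        by (simp add: sum_distrib_left)
      also have "\<dots> = (\<Sum>s\<in>R. \<Sum>t<M. x s * (y t * ?f (b + unit_exp s + unit_exp t)))"
        by (rule sum.mono_neutral_right) (use R f in auto)
      also have "\<dots> = (\<Sum>s\<in>R. \<Sum>t\<in>R - {s}. x s * (y t * ?f (b + unit_exp s + unit_exp t)))"
        by (intro sum.cong refl sum.mono_neutral_right) (use R f in auto)
      also have "\<dots> = (\<Sum>s\<in>R. \<Sum>t\<in>R - {s}. x s * y t * g (type_sum \<tau> (R - {s, t})))"
        by (intro sum.cong refl) (simp add: f)
      finally show ?thesis .
    qed
    then show ?thesis using loc R by (simp add: local_lorentz_def del: contract.simps)
  next
    case False
    then have "contract M ?f [x, y] b = 0" for x y by (intro contract_zero) (auto simp: polarized_alt not_squarefree_exp_add)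
    then show ?thesis by (simp del: contract.simps)
  qed
  show "X \<or> (\<exists>I\<subseteq>{..<M}. 3 \<le> card I \<and>
          (\<forall>i\<in>I. \<forall>j\<in>I. contract M ?f ws (b + unit_exp i + unit_exp i + unit_exp j) = 0) \<and>
          (\<forall>i\<in>I. \<forall>j\<in>I. \<forall>l\<in>I. i \<noteq> j \<longrightarrow> i \<noteq> l \<longrightarrow> j \<noteq> l \<longrightarrow> 0 < contract M ?f ws (b + unit_exp i + unit_exp j + unit_exp l)) \<and>
          (\<forall>j<M. j \<notin> I \<longrightarrow> (\<forall>d. ?f (b + unit_exp j + d) = 0))) \<or> (\<forall>d. ?f (b + d) = 0)"
    if b: "supported M b" "exp_degree M b + length ws + 3 = M - m" and ws: "\<And>z i. z \<in> set ws \<Longrightarrow> i < M \<Longrightarrow> 0 < z i" for b ws X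
  proof (cases "squarefree_exp M b")
    case True
    show ?thesis
    proof (rule disjI2, rule disjI1, intro exI[of _ "zero_set M b"] conjI ballI allI impI)
      show "zero_set M b \<subseteq> {..<M}" by (auto simp: zero_set_def)
      show "3 \<le> card (zero_set M b)" using card_zero_set[OF True] b by linarith
      show "contract M ?f ws (b + unit_exp i + unit_exp i + unit_exp j) = 0" for i j
      proof (rule contract_zero)
        have "\<not> squarefree_exp M (b + unit_exp i + unit_exp i)" by (simp add: squarefree_exp_add zero_set_add)
        then show "?f (b + unit_exp i + unit_exp i + unit_exp j + d) = 0" for d by (simp add: polarized_alt not_squarefree_exp_add)
      qed
      show "0 < contract M ?f ws (b + unit_exp i + unit_exp j + unit_exp l)"
        if "i \<in> zero_set M b" "j \<in> zero_set M b" "l \<in> zero_set M b" "i \<noteq> j" "i \<noteq> l" "j \<noteq> l" for i j l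
      proof (rule polarized_pos[OF g0 g \<tau>])
        have "i < M" "j < M" "l < M" using that by (auto simp: zero_set_def)
        then show "exp_degree M (b + unit_exp i + unit_exp j + unit_exp l) + length ws + m = M" using b by (simp add: exp_degree_add)
      qed (use that True ws in \<open>auto simp: squarefree_exp_add zero_set_add\<close>)
      show "?f (b + unit_exp j + d) = 0" if "j < M" "j \<notin> zero_set M b" for j d
      proof -
        have "\<not> squarefree_exp M (b + unit_exp j)" using that by (simp add: squarefree_exp_add)
        then show ?thesis by (simp add: polarized_alt not_squarefree_exp_add)
      qed
    qed
  qed (auto simp: polarized_alt not_squarefree_exp_add)
qed (use zs in auto)

text \<open>
  If \<open>g a = a! c\<^sub>a\<close> for a polynomial with coefficients \<open>c\<^sub>a\<close>, these are the derivatives at 0 of its dual.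
\<close>

definition dual_coeff :: "nat \<Rightarrow> (nat \<Rightarrow>\<^sub>0 nat) \<Rightarrow> ((nat \<Rightarrow>\<^sub>0 nat) \<Rightarrow> real) \<Rightarrow> (nat \<Rightarrow>\<^sub>0 nat) \<Rightarrow> real" where
  "dual_coeff n k g b = (if \<forall>i. Poly_Mapping.lookup b i \<le> Poly_Mapping.lookup k i then g (k - b) / mfact n (k - b) else 0)"

text \<open>Setting all variables of one type equal turns the polarization into the dual polynomial.
  The factor comes from multiplicities: with \<open>r\<close> the type of the free variables,
  \<open>r_i\<close> of them have type \<open>i\<close>, and \<open>r_i\<close> times the factorial
  of \<open>r - unit_exp i\<close> is the factorial of \<open>r\<close>.\<close>

lemma contract_polarized:
  assumes \<tau>: "\<And>s. s < M \<Longrightarrow> \<tau> s < n" and k: "k = type_sum \<tau> {..<M}"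
    and "squarefree_exp M b" "c + type_sum \<tau> (zero_set M b) = k"
  shows "contract M (polarized M \<tau> g) (map (\<lambda>v s. v (\<tau> s)) vs) b = mfact n (type_sum \<tau> (zero_set M b)) * contract n (dual_coeff n k g) vs c"
  using assms(3,4)
proof (induction vs arbitrary: b c)
  case Nil
  have "k - c = type_sum \<tau> (zero_set M b)" using Nil(2) by (metis add_diff_cancel_left')
  moreover have "Poly_Mapping.lookup c i \<le> Poly_Mapping.lookup k i" for i unfolding Nil(2)[symmetric] by (simp add: lookup_add)
  ultimately show ?case using Nil mfact_pos[of n "type_sum \<tau> (zero_set M b)"] by (simp add: polarized_alt dual_coeff_def)
next
  case (Cons v vs)
  let ?Z = "zero_set M b"
  let ?f = "polarized M \<tau> g" and ?vs = "map (\<lambda>v s. v (\<tau> s)) vs"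
  define r where "r = type_sum \<tau> ?Z"
  have ZM: "s < M" if "s \<in> ?Z" for s using that by (simp add: zero_set_def)
  have 1: "contract M ?f ?vs (b + unit_exp s) = mfact n (type_sum \<tau> (?Z - {s})) * contract n (dual_coeff n k g) vs (c + unit_exp (\<tau> s))" if "s \<in> ?Z" for s
  proof -
    have "c + unit_exp (\<tau> s) + type_sum \<tau> (?Z - {s}) = k"
      using Cons.prems(2) type_sum_remove[OF finite_zero_set that, of \<tau>] by (simp add: ac_simps)
    then show ?thesis using Cons.IH[of "b + unit_exp s" "c + unit_exp (\<tau> s)"] Cons.prems that by (simp add: squarefree_exp_add zero_set_add)
  qed
  have 2: "mfact n (type_sum \<tau> (?Z - {s})) * real (Poly_Mapping.lookup r (\<tau> s)) = mfact n r" if "s \<in> ?Z" for s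
    using type_sum_remove[OF finite_zero_set that, of \<tau>] mfact_add[of "\<tau> s" n "type_sum \<tau> (?Z - {s})"] \<tau>[OF ZM[OF that]]
    by (simp add: r_def lookup_add lookup_unit_exp)
  have "contract M ?f (map (\<lambda>v s. v (\<tau> s)) (v # vs)) b = (\<Sum>s\<in>?Z. v (\<tau> s) * contract M ?f ?vs (b + unit_exp s))"
    unfolding list.map contract.simps
  proof (rule sum.mono_neutral_right)
    show "\<forall>s\<in>{..<M} - ?Z. v (\<tau> s) * contract M ?f ?vs (b + unit_exp s) = 0"
    proof
      fix s assume "s \<in> {..<M} - ?Z"
      then have "\<not> squarefree_exp M (b + unit_exp s)" by (simp add: squarefree_exp_add)
      then have "contract M ?f ?vs (b + unit_exp s) = 0" by (intro contract_zero) (simp add: polarized_alt not_squarefree_exp_add)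
      then show "v (\<tau> s) * contract M ?f ?vs (b + unit_exp s) = 0" by simp
    qed
  qed (auto simp: zero_set_def)
  also have "\<dots> = (\<Sum>s\<in>?Z. v (\<tau> s) * (mfact n (type_sum \<tau> (?Z - {s})) * contract n (dual_coeff n k g) vs (c + unit_exp (\<tau> s))))"
    by (rule sum.cong) (simp_all add: 1)
  also have "\<dots> = (\<Sum>i<n. \<Sum>s\<in>{s\<in>?Z. \<tau> s = i}. v (\<tau> s) * (mfact n (type_sum \<tau> (?Z - {s})) * contract n (dual_coeff n k g) vs (c + unit_exp (\<tau> s))))"
    by (rule sum.group[symmetric]) (use \<tau> ZM in auto)
  also have "\<dots> = (\<Sum>i<n. mfact n r * (v i * contract n (dual_coeff n k g) vs (c + unit_exp i)))"
  proof (rule sum.cong[OF refl])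
    fix i assume "i \<in> {..<n}"
    have l: "Poly_Mapping.lookup r i = card {s\<in>?Z. \<tau> s = i}" by (simp add: r_def lookup_type_sum)
    show "(\<Sum>s\<in>{s\<in>?Z. \<tau> s = i}. v (\<tau> s) * (mfact n (type_sum \<tau> (?Z - {s})) * contract n (dual_coeff n k g) vs (c + unit_exp (\<tau> s)))) = mfact n r * (v i * contract n (dual_coeff n k g) vs (c + unit_exp i))"
    proof (cases "{s\<in>?Z. \<tau> s = i} = {}")
      \<comment> \<open>No free variable of type \<open>i\<close> is left, so \<open>c\<close> has
        exhausted \<open>k\<close> at \<open>i\<close> and a further derivative of the dual is
        0.\<close>
      case True
      then have "Poly_Mapping.lookup r i = 0" using l by simp
      then have ki: "Poly_Mapping.lookup k i = Poly_Mapping.lookup c i" using Cons.prems(2) by (simp add: r_def[symmetric] lookup_add[symmetric]) (metis add.right_neutral lookup_add)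
      have "contract n (dual_coeff n k g) vs (c + unit_exp i) = 0"
      proof (rule contract_zero)
        fix d
        have "\<not> Poly_Mapping.lookup (c + unit_exp i + d) i \<le> Poly_Mapping.lookup k i" by (simp add: ki lookup_add lookup_unit_exp)
        then show "dual_coeff n k g (c + unit_exp i + d) = 0" unfolding dual_coeff_def by presburger
      qed
      then show ?thesis unfolding True by simp
    next
      case False
      then have r0: "real (Poly_Mapping.lookup r i) \<noteq> 0" using l by auto
      have "(\<Sum>s\<in>{s\<in>?Z. \<tau> s = i}. v (\<tau> s) * (mfact n (type_sum \<tau> (?Z - {s})) * contract n (dual_coeff n k g) vs (c + unit_exp (\<tau> s))))
         = (\<Sum>s\<in>{s\<in>?Z. \<tau> s = i}. v i * (mfact n r / real (Poly_Mapping.lookup r i) * contract n (dual_coeff n k g) vs (c + unit_exp i)))"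
        by (rule sum.cong) (use 2 r0 in \<open>auto simp: field_simps\<close>)
      then show ?thesis using r0 unfolding sum_constant l[symmetric] by simp
    qed
  qed
  also have "\<dots> = mfact n r * contract n (dual_coeff n k g) (v # vs) c" by (simp add: sum_distrib_left)
  finally show ?case by (simp add: r_def)
qed

text \<open>By \<open>contract_polarized\<close> the dual is, up to a positive factor, the
  restriction of the polarization to vectors that are constant on types, and Lorentzian forms pull
  back.\<close>

theorem dual_coeff_lorentz:
  assumes g0: "\<And>a. 0 \<le> g a" and g: "\<And>a. supported n a \<Longrightarrow> exp_degree n a = m \<Longrightarrow> 0 < g a" and \<tau>: "\<And>s. s < M \<Longrightarrow> \<tau> s < n"
    and loc: "local_lorentz M \<tau> m g"
    and zs: "length zs + 2 + m = M" "\<And>z i. z \<in> set zs \<Longrightarrow> i < n \<Longrightarrow> 0 < z i"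
  shows "lorentz UNIV (\<lambda>x y. contract n (dual_coeff n (type_sum \<tau> {..<M}) g) (x # y # zs) 0)"
proof -
  let ?k = "type_sum \<tau> {..<M}" and ?L = "\<lambda>(v::nat\<Rightarrow>real) s. v (\<tau> s)"
  have "lorentz UNIV (\<lambda>x y. contract M (polarized M \<tau> g) (x # y # map ?L zs) 0)"
    by (rule polarized_lorentz[OF g0 g \<tau> loc]) (use zs \<tau> in auto)
  then have "lorentz UNIV (\<lambda>x y. contract M (polarized M \<tau> g) (?L x # ?L y # map ?L zs) 0)"
    by (rule lorentz_pullback) simp
  moreover have "contract n (dual_coeff n ?k g) (x # y # zs) 0 = 1 / mfact n ?k * contract M (polarized M \<tau> g) (?L x # ?L y # map ?L zs) 0" for x y
    using contract_polarized[of M \<tau> n ?k 0 0 g "x # y # zs", OF \<tau> refl] mfact_pos[of n ?k] by (simp del: contract.simps add: field_simps)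
  ultimately show ?thesis
    by (intro lorentz_if_nonneg_cong[where c = "1 / mfact n ?k" and B' = "\<lambda>x y. contract n (dual_coeff n ?k g) (x # y # zs) 0"]) (simp_all only: zero_less_divide_1_iff mfact_pos)
qed

section \<open>Quadratic comparison of a polynomial with its polarization\<close>

lemma type_ineq_block:
  fixes x :: "'a \<Rightarrow> real"
  assumes R: "finite R"
  defines "r \<equiv> real (card R)"
  shows "0 \<le> (\<Sum>s\<in>R. \<Sum>t\<in>R. x s * x t * (1 / (r * r) - (if s = t then 0 else 1 / (r * (r - 1)))))"
proof -
  define X P where "X = (\<Sum>s\<in>R. x s)" and "P = (\<Sum>s\<in>R. (x s)\<^sup>2)"
  have XX: "(\<Sum>s\<in>R. \<Sum>t\<in>R. x s * x t) = X\<^sup>2"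
    by (simp add: X_def power2_eq_square sum_product)
  have diag: "(\<Sum>s\<in>R. \<Sum>t\<in>R. x s * x t * (if s = t then 1 else 0)) = P"
    using R by (simp add: P_def power2_eq_square if_distrib cong: if_cong)
  have "(\<Sum>s\<in>R. \<Sum>t\<in>R. x s * x t * (1 / (r * r) - (if s = t then 0 else 1 / (r * (r - 1)))))
      = (\<Sum>s\<in>R. \<Sum>t\<in>R. (x s * x t) * (1 / (r * r) - 1 / (r * (r - 1))) + (x s * x t * (if s = t then 1 else 0)) * (1 / (r * (r - 1))))"
    by (intro sum.cong refl) (auto simp: algebra_simps)
  also have "\<dots> = X\<^sup>2 * (1 / (r * r) - 1 / (r * (r - 1))) + P * (1 / (r * (r - 1)))"
    by (simp only: sum.distrib sum_distrib_right[symmetric] XX diag)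
  also have "0 \<le> \<dots>"
  \<comment> \<open>For \<open>r = 1\<close> the quotient \<open>1 / (r * (r - 1))\<close> is 0 by
    division by zero and only \<open>X^2\<close> is left; for larger \<open>r\<close> the claim is
    the Cauchy-Schwarz inequality \<open>X^2 \<le> r * P\<close>.\<close>
  proof (cases "card R \<le> 1")
    case True
    then have "r = 0 \<or> r = 1" unfolding r_def by (cases "card R") auto
    then show ?thesis by auto
  next
    case False
    then have r: "1 < r" by (simp add: r_def)
    have "X\<^sup>2 \<le> r * P" unfolding X_def P_def r_def
      using sum_squared_le_sum_of_squares[of x R] R by (simp add: mult.commute)
    moreover have "X\<^sup>2 * (1 / (r * r) - 1 / (r * (r - 1))) + P * (1 / (r * (r - 1))) = (r * P - X\<^sup>2) / (r * r * (r - 1))"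
    proof -
      have r0: "r \<noteq> 0" "r - 1 \<noteq> 0" using r by auto
      have 1: "1 / (r * r) = (r - 1) / (r * r * (r - 1))" "1 / (r * (r - 1)) = r / (r * r * (r - 1))"
        using r0 by simp_all
      show ?thesis unfolding 1 by (simp add: diff_divide_distrib[symmetric] add_divide_distrib[symmetric] algebra_simps)
    qed
    ultimately show ?thesis using r by simp
  qed
  finally show ?thesis .
qed

text \<open>After division by \<open>mfact n r\<close> both sides weight the values of
  \<open>q\<close>, and the weights agree for variables of different types. Within a type of size
  \<open>r\<close> the left side puts \<open>1 / (r (r - 1))\<close> on distinct pairs and the right
  side \<open>1 / r^2\<close> on all pairs; \<open>type_ineq_block\<close> compares them, because
  \<open>q i i\<close> is nonnegative.\<close>

lemma type_ineq:
  fixes x :: "nat \<Rightarrow> real"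
  assumes R: "finite R" and \<tau>: "\<And>s. s \<in> R \<Longrightarrow> \<tau> s < n" and q: "\<And>i. i < n \<Longrightarrow> 0 \<le> q i i"
  defines "r \<equiv> type_sum \<tau> R"
  shows "(\<Sum>s\<in>R. \<Sum>t\<in>R - {s}. x s * x t * (mfact n (type_sum \<tau> (R - {s, t})) * q (\<tau> s) (\<tau> t)))
    \<le> mfact n r * (\<Sum>s\<in>R. \<Sum>t\<in>R. x s * x t * (q (\<tau> s) (\<tau> t) / (real (Poly_Mapping.lookup r (\<tau> s)) * real (Poly_Mapping.lookup r (\<tau> t)))))"
proof -
  let ?r = "\<lambda>s. real (Poly_Mapping.lookup r (\<tau> s))"
  define R' where "R' i = {s\<in>R. \<tau> s = i}" for i
  have lr: "Poly_Mapping.lookup r i = card (R' i)" for i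
    using R by (simp add: r_def R'_def lookup_type_sum)
  have rpos: "0 < ?r s" if "s \<in> R" for s
    using that R by (auto simp: lr R'_def card_gt_0_iff)
  \<comment> \<open>The ratio of \<open>mfact\<close> with \<open>s\<close> and \<open>t\<close>
    removed to \<open>mfact n r\<close>, as \<open>c\<close> confirms.\<close>
  define e where "e s t = (if s = t then 0 else if \<tau> s = \<tau> t then 1 / (?r s * (?r s - 1)) else 1 / (?r s * ?r t))" for s t
  have c: "mfact n (type_sum \<tau> (R - {s, t})) = mfact n r * e s t" if "s \<in> R" "t \<in> R" "s \<noteq> t" for s t
  proof -
    define p where "p = type_sum \<tau> (R - {s, t})"
    have "R = insert s (insert t (R - {s, t}))" using that by auto
    then have "r = type_sum \<tau> (insert s (insert t (R - {s, t})))" by (simp add: r_def)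
    also have "\<dots> = p + unit_exp (\<tau> t) + unit_exp (\<tau> s)" using that R by (subst type_sum_insert, simp, simp, subst type_sum_insert) (auto simp: p_def)
    finally have r: "r = p + unit_exp (\<tau> t) + unit_exp (\<tau> s)" .
    have m: "mfact n r = mfact n p * (real (Poly_Mapping.lookup p (\<tau> t)) + 1) * (real (Poly_Mapping.lookup (p + unit_exp (\<tau> t)) (\<tau> s)) + 1)"
      unfolding r using \<tau> that by (simp add: mfact_add)
    show ?thesis
    proof (cases "\<tau> s = \<tau> t")
      case True
      define a where "a = real (Poly_Mapping.lookup p (\<tau> t))"
      have a: "a + 1 \<noteq> 0" "a + 2 \<noteq> 0" by (simp_all add: a_def)
      have r2: "?r s = a + 2" using True by (simp add: r lookup_add lookup_unit_exp a_def)
      have "mfact n r = mfact n p * (a + 1) * (a + 2)" unfolding m using True by (simp add: lookup_add lookup_unit_exp a_def)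
      moreover have "e s t = 1 / ((a + 2) * (a + 1))" 
      proof -
        have "e s t = 1 / (?r s * (?r s - 1))" using that True by (simp add: e_def)
        then show ?thesis unfolding r2 by simp
      qed
      ultimately show ?thesis unfolding p_def[symmetric] using a by simp
    next
      case False
      have "?r s = real (Poly_Mapping.lookup p (\<tau> s)) + 1" "?r t = real (Poly_Mapping.lookup p (\<tau> t)) + 1"
        using False by (auto simp: r lookup_add lookup_unit_exp)
      moreover have "e s t = 1 / (?r s * ?r t)" using that False by (simp add: e_def)
      moreover have "mfact n r = mfact n p * (?r s * ?r t)"
        unfolding m using False by (simp add: r lookup_add lookup_unit_exp algebra_simps)
      moreover have "?r s * ?r t \<noteq> 0" using rpos that by (metis less_irrefl mult_pos_pos)
      ultimately show ?thesis unfolding p_def[symmetric] by simp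
    qed
  qed
  have L: "(\<Sum>s\<in>R. \<Sum>t\<in>R - {s}. x s * x t * (mfact n (type_sum \<tau> (R - {s, t})) * q (\<tau> s) (\<tau> t)))
     = (\<Sum>s\<in>R. \<Sum>t\<in>R. x s * x t * (mfact n r * e s t * q (\<tau> s) (\<tau> t)))"
  proof (rule sum.cong[OF refl])
    fix s assume s: "s \<in> R"
    have "(\<Sum>t\<in>R. x s * x t * (mfact n r * e s t * q (\<tau> s) (\<tau> t))) = (\<Sum>t\<in>R - {s}. x s * x t * (mfact n r * e s t * q (\<tau> s) (\<tau> t)))"
      using R by (intro sum.mono_neutral_right) (auto simp: e_def)
    also have "\<dots> = (\<Sum>t\<in>R - {s}. x s * x t * (mfact n (type_sum \<tau> (R - {s, t})) * q (\<tau> s) (\<tau> t)))"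
      by (intro sum.cong refl) (use s c in auto)
    finally show "(\<Sum>t\<in>R - {s}. x s * x t * (mfact n (type_sum \<tau> (R - {s, t})) * q (\<tau> s) (\<tau> t))) = (\<Sum>t\<in>R. x s * x t * (mfact n r * e s t * q (\<tau> s) (\<tau> t)))" ..
  qed
  define h where "h i s t = x s * x t * (1 / (real (card (R' i)) * real (card (R' i))) - (if s = t then 0 else 1 / (real (card (R' i)) * (real (card (R' i)) - 1))))" for i s t
  have "mfact n r * (\<Sum>s\<in>R. \<Sum>t\<in>R. x s * x t * (q (\<tau> s) (\<tau> t) / (?r s * ?r t)))
      - (\<Sum>s\<in>R. \<Sum>t\<in>R. x s * x t * (mfact n r * e s t * q (\<tau> s) (\<tau> t)))
     = (\<Sum>s\<in>R. \<Sum>t\<in>R. mfact n r * q (\<tau> s) (\<tau> t) * (x s * x t * (1 / (?r s * ?r t) - e s t)))"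
    by (simp add: sum_distrib_left sum_subtractf[symmetric] algebra_simps)
  also have "\<dots> = (\<Sum>s\<in>R. \<Sum>t\<in>R' (\<tau> s). mfact n r * q (\<tau> s) (\<tau> t) * (x s * x t * (1 / (?r s * ?r t) - e s t)))"
    by (intro sum.cong refl sum.mono_neutral_right) (use R in \<open>auto simp: R'_def e_def\<close>)
  also have "\<dots> = (\<Sum>i<n. \<Sum>s\<in>{s\<in>R. \<tau> s = i}. \<Sum>t\<in>R' (\<tau> s). mfact n r * q (\<tau> s) (\<tau> t) * (x s * x t * (1 / (?r s * ?r t) - e s t)))"
    by (rule sum.group[symmetric]) (use R \<tau> in auto)
  also have "\<dots> = (\<Sum>i<n. mfact n r * q i i * (\<Sum>s\<in>R' i. \<Sum>t\<in>R' i. h i s t))"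
    unfolding sum_distrib_left R'_def[symmetric]
  proof (intro sum.cong refl)
    fix i s assume "s \<in> R' i"
    then have s: "\<tau> s = i" by (simp add: R'_def)
    then show "R' (\<tau> s) = R' i" by simp
    fix t assume "t \<in> R' i"
    then have t: "\<tau> t = i" by (simp add: R'_def)
    show "mfact n r * q (\<tau> s) (\<tau> t) * (x s * x t * (1 / (?r s * ?r t) - e s t)) = mfact n r * q i i * h i s t"
      unfolding h_def e_def s t lr by simp
  qed
  also have "0 \<le> \<dots>"
  proof (rule sum_nonneg)
    fix i assume "i \<in> {..<n}"
    then have "0 \<le> mfact n r * q i i" using q mfact_pos[of n r] by simp
    moreover have "finite (R' i)" using R by (simp add: R'_def)
    then have "0 \<le> (\<Sum>s\<in>R' i. \<Sum>t\<in>R' i. h i s t)" unfolding h_def by (rule type_ineq_block)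
    ultimately show "0 \<le> mfact n r * q i i * (\<Sum>s\<in>R' i. \<Sum>t\<in>R' i. h i s t)" by (rule mult_nonneg_nonneg)
  qed
  finally show ?thesis unfolding L by simp
qed

text \<open>Each form of \<open>local_lorentz\<close> is dominated by the pullback along
  \<open>L\<close> of a second derivative \<open>G\<close> of the Lorentzian polynomial. The bound
  \<open>m + 2\<close> on the exponents of \<open>\<kappa>\<close> ensures that the type of any
  \<open>m + 2\<close> variables fits below \<open>\<kappa>\<close>.\<close>

theorem local_lorentz_perturbed:
  fixes e :: real
  assumes F: "lorentz_coeff n k F" and b0: "0 < F b0" and \<kappa>: "supported n \<kappa>" "\<And>i. i < n \<Longrightarrow> m + 2 \<le> Poly_Mapping.lookup \<kappa> i" "k + m = exp_degree n \<kappa>"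
    and e: "0 < e" and \<tau>: "\<And>s. s < M \<Longrightarrow> \<tau> s < n"
  defines "g \<equiv> \<lambda>a. mfact n a * contract n F (repeat_list n (\<kappa> - a) (perturbed e)) 0"
  shows "local_lorentz M \<tau> m g" "0 \<le> g a" "supported n a \<Longrightarrow> exp_degree n a = m \<Longrightarrow> 0 < g a"
proof -
  show "0 \<le> g a" unfolding g_def using mfact_pos[of n a] perturbed_sub_nonneg[OF F e] by simp
  {
    assume a: "supported n a" "exp_degree n a = m"
    have le: "Poly_Mapping.lookup a i \<le> Poly_Mapping.lookup \<kappa> i" for i
    proof (cases "i < n")
      case True
      then have "Poly_Mapping.lookup a i \<le> exp_degree n a" unfolding exp_degree_def by (intro member_le_sum) auto
      then show ?thesis using \<kappa>(2)[OF True] a by linarith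
    next
      case False
      then have "Poly_Mapping.lookup a i = 0" using a(1) unfolding supported_def by blast
      then show ?thesis by simp
    qed
    have "\<kappa> = (\<kappa> - a) + a" using le by (intro poly_mapping_eqI) (simp add: lookup_add lookup_minus)
    then have "exp_degree n \<kappa> = exp_degree n (\<kappa> - a) + m" using a(2) exp_degree_add by metis
    then have "exp_degree n (\<kappa> - a) = k" using \<kappa>(3) by simp
    then show "0 < g a" unfolding g_def using mfact_pos[of n a] perturbed_sub_pos[OF F b0 e] by simp
  }
  show "local_lorentz M \<tau> m g"
    unfolding local_lorentz_def
  proof (intro allI impI)
    fix R assume R: "R \<subseteq> {..<M}" "card R = m + 2"
    then have fR: "finite R" and \<tau>R: "\<And>s. s \<in> R \<Longrightarrow> \<tau> s < n" using \<tau> finite_subset by auto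
    define r where "r = type_sum \<tau> R"
    have sr: "supported n r" "exp_degree n r = m + 2" using supported_type_sum[OF fR \<tau>R] R by (auto simp: r_def)
    have lr: "Poly_Mapping.lookup r i = card {s\<in>R. \<tau> s = i}" for i
      using fR by (simp add: r_def lookup_type_sum)
    have le: "Poly_Mapping.lookup r i \<le> Poly_Mapping.lookup \<kappa> i" for i
    proof (cases "i < n")
      case True
      then have "Poly_Mapping.lookup r i \<le> exp_degree n r" unfolding exp_degree_def by (intro member_le_sum) auto
      then show ?thesis using \<kappa>(2)[OF True] sr by linarith
    next
      case False
      then have "Poly_Mapping.lookup r i = 0" using sr(1) unfolding supported_def by blast
      then show ?thesis by simp
    qed
    define p where "p = \<kappa> - r"
    have \<kappa>p: "\<kappa> = p + r" unfolding p_def using le by (intro poly_mapping_eqI) (simp add: lookup_add lookup_minus)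
    have "exp_degree n p + 2 = k" using \<kappa>(3) sr unfolding \<kappa>p exp_degree_add by simp
    define G where "G = (\<lambda>x y. contract n F (x # y # repeat_list n p (perturbed e)) 0)"
    have "lorentz UNIV G" unfolding G_def
    proof -
      have "\<forall>z\<in>set (repeat_list n p (perturbed e)). \<forall>i<n. 0 \<le> z i"
        using set_repeat_list[of n p "perturbed e"] perturbed_pos[OF e] by (auto intro: less_imp_le)
      then show "lorentz UNIV (\<lambda>x y. contract n F (x # y # repeat_list n p (perturbed e)) 0)"
        using F \<open>exp_degree n p + 2 = k\<close> unfolding lorentz_coeff_def by (simp del: contract.simps)
    qed
    have sG: "symm_bilin G" unfolding G_def by (rule symm_bilin_symm_multilin[OF symm_multilin_contract])
    define q where "q i j = G (perturbed e i) (perturbed e j)" for i j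
    have q0: "0 \<le> q i j" for i j
      unfolding q_def G_def
    proof (rule contract_nonneg)
      show "0 \<le> v l" if "v \<in> set (perturbed e i # perturbed e j # repeat_list n p (perturbed e))" for v l
        using that set_repeat_list[of n p "perturbed e"] perturbed_pos[OF e] by (auto intro: less_imp_le)
    qed (use F in \<open>auto simp: lorentz_coeff_def\<close>)
    have gq: "g (type_sum \<tau> (R - {s, t})) = mfact n (type_sum \<tau> (R - {s, t})) * q (\<tau> s) (\<tau> t)" if "s \<in> R" "t \<in> R - {s}" for s t
    proof -
      have "R = insert s (insert t (R - {s, t}))" using that by auto
      then have "r = type_sum \<tau> (insert s (insert t (R - {s, t})))" by (simp add: r_def)
      also have "\<dots> = type_sum \<tau> (R - {s, t}) + unit_exp (\<tau> t) + unit_exp (\<tau> s)"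
        using that fR by (subst type_sum_insert, simp, simp, subst type_sum_insert) auto
      finally have "\<kappa> = type_sum \<tau> (R - {s, t}) + (p + unit_exp (\<tau> t) + unit_exp (\<tau> s))" unfolding \<kappa>p by (simp add: ac_simps)
      then have "\<kappa> - type_sum \<tau> (R - {s, t}) = p + unit_exp (\<tau> t) + unit_exp (\<tau> s)" by (metis add_diff_cancel_left')
      moreover have "contract n F (repeat_list n (p + unit_exp (\<tau> t) + unit_exp (\<tau> s)) (perturbed e)) 0 = q (\<tau> s) (\<tau> t)"
        unfolding q_def G_def using that \<tau>R by (intro symm_multilin_mset[OF symm_multilin_contract]) (simp add: mset_repeat_list_add)
      ultimately show ?thesis by (simp add: g_def)
    qed
    let ?B = "\<lambda>x y :: nat \<Rightarrow> real. \<Sum>s\<in>R. \<Sum>t\<in>R - {s}. x s * y t * g (type_sum \<tau> (R - {s, t}))"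
    \<comment> \<open>The mean of \<open>x\<close> over the variables of type \<open>i\<close>
      becomes the coefficient of \<open>perturbed e i\<close>, the choice to which
      \<open>type_ineq\<close> is fitted.\<close>
    define L where "L x = (\<Sum>s\<in>R. (x s / real (Poly_Mapping.lookup r (\<tau> s))) *\<^sub>R perturbed e (\<tau> s))" for x :: "nat \<Rightarrow> real"
    have B: "symm_bilin ?B"
      unfolding symm_bilin_def
    proof (intro conjI allI)
      fix x y
      have alt: "?B x y = (\<Sum>s\<in>R. \<Sum>t\<in>R. if s = t then 0 else x s * y t * g (type_sum \<tau> (R - {s, t})))" for x y
        by (intro sum.cong refl sum.mono_neutral_cong_left) (use fR in auto)
      show "?B x y = ?B y x"
        unfolding alt by (subst sum.swap) (intro sum.cong refl, auto simp: insert_commute)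
      show "linear (?B x)"
        by (rule linearI) (simp_all add: sum.distrib sum_distrib_left algebra_simps)
    qed
    show "lorentz UNIV ?B"
    proof (rule lorentz_dom[where B' = "\<lambda>x y. mfact n r * G x y" and L = L and U' = UNIV, OF B])
      show "symm_bilin (\<lambda>x y. mfact n r * G x y)"
        unfolding symm_bilin_def
      proof (intro conjI allI)
        show "mfact n r * G x y = mfact n r * G y x" for x y using symm_bilin_sym[OF sG] by simp
        show "linear (\<lambda>y. mfact n r * G x y)" for x
          by (rule linearI) (simp_all add: symm_bilin_simps[OF sG] algebra_simps)
      qed
      show "linear L"
        by (rule linearI) (simp_all add: L_def sum.distrib scaleR_sum_right add_divide_distrib scaleR_add_left)
      show "lorentz UNIV (\<lambda>x y. mfact n r * G x y)"
        by (rule lorentz_scale) (use \<open>lorentz UNIV G\<close> mfact_pos[of n r] in \<open>auto intro: less_imp_le\<close>)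
      fix x
      have Gs1: "G (\<Sum>j\<in>J. f j) y = (\<Sum>j\<in>J. G (f j) y)" and Gs2: "G y (\<Sum>j\<in>J. f j) = (\<Sum>j\<in>J. G y (f j))"
        for J :: "nat set" and f y
      proof -
        have l: "linear (G y)" using sG by (simp add: symm_bilin_def)
        show "G y (\<Sum>j\<in>J. f j) = (\<Sum>j\<in>J. G y (f j))" by (rule linear_sum[OF l])
        then show "G (\<Sum>j\<in>J. f j) y = (\<Sum>j\<in>J. G (f j) y)" by (simp add: symm_bilin_sym[OF sG, of _ y])
      qed
      have GL: "G (L x) (L x) = (\<Sum>s\<in>R. \<Sum>t\<in>R. x s * x t * (q (\<tau> s) (\<tau> t) / (real (Poly_Mapping.lookup r (\<tau> s)) * real (Poly_Mapping.lookup r (\<tau> t)))))"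
        unfolding L_def Gs1 Gs2 by (subst sum.swap) (simp add: symm_bilin_simps[OF sG] q_def ac_simps)
      have "?B x x = (\<Sum>s\<in>R. \<Sum>t\<in>R - {s}. x s * x t * (mfact n (type_sum \<tau> (R - {s, t})) * q (\<tau> s) (\<tau> t)))"
        by (intro sum.cong refl) (simp add: gq)
      also have "\<dots> \<le> mfact n r * G (L x) (L x)"
        unfolding GL r_def by (rule type_ineq[OF fR \<tau>R q0])
      finally show "?B x x \<le> mfact n r * G (L x) (L x)" .
    qed auto
  qed
qed

section \<open>Polarized determinants of Hermitian matrices\<close>

lemma triple_cone_span:
  assumes T: "symm_trilin T" and I: "finite I" and nn: "\<And>i j k. i \<in> I \<Longrightarrow> j \<in> I \<Longrightarrow> k \<in> I \<Longrightarrow> 0 \<le> T (e i) (e j) (e k)"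
  shows "triple_cone T {x. \<exists>c. (\<forall>j\<in>I. 0 \<le> c j) \<and> x = (\<Sum>j\<in>I. c j *\<^sub>R e j)}"
  unfolding triple_cone_def
proof (intro conjI ballI allI impI)
  let ?C = "{x. \<exists>c. (\<forall>j\<in>I. 0 \<le> c j) \<and> x = (\<Sum>j\<in>I. c j *\<^sub>R e j)}"
  show "0 \<in> ?C" by (intro CollectI exI[of _ "\<lambda>_. 0"]) simp
  {
    fix x y assume "x \<in> ?C" "y \<in> ?C"
    then obtain c d where "\<forall>j\<in>I. 0 \<le> c j" "\<forall>j\<in>I. 0 \<le> d j" "x = (\<Sum>j\<in>I. c j *\<^sub>R e j)" "y = (\<Sum>j\<in>I. d j *\<^sub>R e j)" by blast
    then show "x + y \<in> ?C"
      by (intro CollectI exI[of _ "\<lambda>j. c j + d j"]) (auto simp: scaleR_add_left sum.distrib)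
  next
    fix a :: real and x assume "0 \<le> a" "x \<in> ?C"
    then obtain c where "\<forall>j\<in>I. 0 \<le> c j" "x = (\<Sum>j\<in>I. c j *\<^sub>R e j)" by blast
    then show "a *\<^sub>R x \<in> ?C" using \<open>0 \<le> a\<close>
      by (intro CollectI exI[of _ "\<lambda>j. a * c j"]) (auto simp: scaleR_sum_right)
  next
    fix x y z assume "x \<in> ?C" "y \<in> ?C" "z \<in> ?C"
    then obtain a b c where n: "\<forall>j\<in>I. 0 \<le> a j" "\<forall>j\<in>I. 0 \<le> b j" "\<forall>j\<in>I. 0 \<le> c j"
      and e: "x = (\<Sum>j\<in>I. a j *\<^sub>R e j)" "y = (\<Sum>j\<in>I. b j *\<^sub>R e j)" "z = (\<Sum>j\<in>I. c j *\<^sub>R e j)" by blast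
    have l: "linear (T x y)" for x y using T by (simp add: symm_trilin_def)
    have s3: "T u v (\<Sum>j\<in>I. f j) = (\<Sum>j\<in>I. T u v (f j))" for u v f by (rule linear_sum[OF l])
    have s2: "T u (\<Sum>j\<in>I. f j) v = (\<Sum>j\<in>I. T u (f j) v)" for u v f using s3[of u v f] symm_trilin_sym(2)[OF T] by simp
    have s1: "T (\<Sum>j\<in>I. f j) u v = (\<Sum>j\<in>I. T (f j) u v)" for u v f using s2[of u f v] symm_trilin_sym(1)[OF T] by simp
    show "0 \<le> T x y z"
      unfolding e s1 s2 s3 symm_trilin_simps[OF T] using n nn by (intro sum_nonneg mult_nonneg_nonneg) auto
  }
qed

text \<open>
  Ordered products: each matrix of the list picks a different row \<open>j\<close> and contributes its entry \<open>(j, p j)\<close>.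
\<close>

fun polar_prod :: "(nat \<Rightarrow> nat) \<Rightarrow> (nat \<Rightarrow> nat \<Rightarrow> complex) list \<Rightarrow> nat set \<Rightarrow> complex" where
  "polar_prod p [] J = (if J = {} then 1 else 0)"
| "polar_prod p (X # Xs) J = (\<Sum>j\<in>J. X j (p j) * polar_prod p Xs (J - {j}))"

text \<open>This is \<open>d!\<close> times the mixed discriminant, as
  \<open>polar_det_replicate\<close> shows on equal arguments. Taking the real part gives a real
  multilinear functional on all entry functions.\<close>

definition polar_det :: "nat \<Rightarrow> (nat \<Rightarrow> nat \<Rightarrow> complex) list \<Rightarrow> real" where
  "polar_det d Xs = Re (\<Sum>p | p permutes {0..<d}. signof p * polar_prod p Xs {0..<d})"

lemma polar_prod_swap: "finite J \<Longrightarrow> polar_prod p (X # Y # Xs) J = polar_prod p (Y # X # Xs) J"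
proof -
  assume J: "finite J"
  have e: "polar_prod p (X # Y # Xs) J = (\<Sum>j\<in>J. \<Sum>k\<in>J. if j = k then 0 else X j (p j) * (Y k (p k) * polar_prod p Xs (J - {j} - {k})))" for X Y
    unfolding polar_prod.simps sum_distrib_left
    by (rule sum.cong[OF refl], rule sum.mono_neutral_cong_left) (use J in auto)
  have d: "J - {j} - {k} = J - {k} - {j}" for j k by auto
  show ?thesis
    unfolding e by (subst sum.swap) (intro sum.cong refl, auto simp: d)
qed

lemma polar_prod_scale: "polar_prod p ((r *\<^sub>R X) # Xs) J = of_real r * polar_prod p (X # Xs) J"
  by (simp add: sum_distrib_left scaleR_conv_of_real algebra_simps)

lemma Re_of_real_mult: "Re (of_real r * z) = r * Re z"
  by simp

lemma polar_prod_mset: "finite J \<Longrightarrow> mset Xs = mset Ys \<Longrightarrow> polar_prod p Xs J = polar_prod p Ys J"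
proof -
  assume J: "finite J" and m: "mset Xs = mset Ys"
  have "(if finite J then polar_prod p Xs J else 0) = (if finite J then polar_prod p Ys J else 0)"
  proof (rule mset_invariantI[where g = "\<lambda>J Xs. if finite J then polar_prod p Xs J else 0", OF _ _ m])
    fix x and xs ys :: "(nat \<Rightarrow> nat \<Rightarrow> complex) list" and s
    assume "\<And>s. (if finite s then polar_prod p xs s else 0) = (if finite s then polar_prod p ys s else 0)"
    then have "finite s \<Longrightarrow> polar_prod p xs s = polar_prod p ys s" for s by metis
    then show "(if finite s then polar_prod p (x # xs) s else 0) = (if finite s then polar_prod p (x # ys) s else 0)"
      by simp
  qed (use polar_prod_swap in \<open>simp del: polar_prod.simps\<close>)
  then show ?thesis using J by simp
qed

lemma polar_prod_replicate: "finite J \<Longrightarrow> card J = m \<Longrightarrow> polar_prod p (replicate m X) J = fact m * (\<Prod>j\<in>J. X j (p j))"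
proof (induction m arbitrary: J)
  case (Suc m)
  have "polar_prod p (replicate (Suc m) X) J = (\<Sum>j\<in>J. X j (p j) * (fact m * (\<Prod>j\<in>J - {j}. X j (p j))))"
    using Suc by (auto intro!: sum.cong)
  also have "\<dots> = (\<Sum>j\<in>J. fact m * (\<Prod>j\<in>J. X j (p j)))"
    using Suc.prems by (intro sum.cong refl) (simp add: prod.remove)
  finally show ?case using Suc.prems by (simp add: algebra_simps)
qed simp

lemma symm_multilin_polar_det: "symm_multilin (polar_det d)"
  unfolding symm_multilin_def
proof (intro conjI allI impI)
  fix Xs Ys :: "(nat \<Rightarrow> nat \<Rightarrow> complex) list" assume "mset Xs = mset Ys"
  then show "polar_det d Xs = polar_det d Ys" unfolding polar_det_def
    using polar_prod_mset[of "{0..<d}" Xs Ys] by simp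
next
  fix Xs
  show "linear (\<lambda>X. polar_det d (X # Xs))"
  proof (rule linearI)
    show "polar_det d ((X + Y) # Xs) = polar_det d (X # Xs) + polar_det d (Y # Xs)" for X Y
      by (simp add: polar_det_def sum.distrib algebra_simps sum_distrib_left)
    show "polar_det d ((r *\<^sub>R X) # Xs) = r *\<^sub>R polar_det d (X # Xs)" for r X
    proof -
      have "(\<Sum>p | p permutes {0..<d}. signof p * polar_prod p ((r *\<^sub>R X) # Xs) {0..<d})
         = of_real r * (\<Sum>p | p permutes {0..<d}. signof p * polar_prod p (X # Xs) {0..<d})"
        unfolding polar_prod_scale sum_distrib_left by (intro sum.cong refl) (simp add: ac_simps)
      then show ?thesis unfolding polar_det_def by (simp only: Re_of_real_mult real_scaleR_def)
    qed
  qed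
qed

definition mat_of :: "nat \<Rightarrow> (nat \<Rightarrow> nat \<Rightarrow> complex) \<Rightarrow> complex mat" where
  "mat_of d X = Matrix.mat d d (\<lambda>(i, j). X i j)"

lemma mat_of_carrier [simp]: "mat_of d X \<in> carrier_mat d d" "dim_row (mat_of d X) = d" "dim_col (mat_of d X) = d"
  by (simp_all add: mat_of_def)

lemma polar_det_replicate: "polar_det d (replicate d X) = fact d * Re (Determinant.det (mat_of d X))"
proof -
  have "(\<Sum>p | p permutes {0..<d}. signof p * polar_prod p (replicate d X) {0..<d})
     = (\<Sum>p | p permutes {0..<d}. signof p * (fact d * (\<Prod>j\<in>{0..<d}. X j (p j))))"
    by (simp add: polar_prod_replicate)
  also have "\<dots> = fact d * (\<Sum>p | p permutes {0..<d}. signof p * (\<Prod>j\<in>{0..<d}. mat_of d X $$ (j, p j)))"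
    unfolding sum_distrib_left
  proof (intro sum.cong refl)
    fix p assume "p \<in> {p. p permutes {0..<d}}"
    then have "p j < d" if "j < d" for j using that permutes_in_image[of p "{0..<d}" j] by simp
    then have "(\<Prod>j\<in>{0..<d}. mat_of d X $$ (j, p j)) = (\<Prod>j\<in>{0..<d}. X j (p j))" by (simp add: mat_of_def)
    then show "signof p * (fact d * (\<Prod>j\<in>{0..<d}. X j (p j))) = fact d * (signof p * (\<Prod>j\<in>{0..<d}. mat_of d X $$ (j, p j)))" by simp
  qed
  also have "\<dots> = fact d * Determinant.det (mat_of d X)" by (simp add: Determinant.det_def)
  finally have "polar_det d (replicate d X) = Re (of_real (fact d) * Determinant.det (mat_of d X))" unfolding polar_det_def by simp
  then show ?thesis by (simp only: Re_of_real_mult)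
qed

text \<open>Starting from the diagonal, differentiating at \<open>t = 0\<close> with
  \<open>x + t *\<^sub>R h\<close> in the equal places frees one argument after the other.\<close>

lemma symm_multilin_polarization:
  assumes \<mu>: "symm_multilin \<mu>" and \<nu>: "symm_multilin \<nu>" and eq: "\<And>x. \<mu> (replicate N x) = \<nu> (replicate N x)" and l: "length xs = N"
  shows "\<mu> xs = \<nu> xs"
proof -
  have "\<mu> (replicate (N - r) x @ ys) = \<nu> (replicate (N - r) x @ ys)" if "length ys = r" "r \<le> N" for r x ys
    using that
  proof (induction r arbitrary: x ys)
    case (Suc r)
    then obtain h zs where ys: "ys = h # zs" "length zs = r" by (cases ys) auto
    have "(\<lambda>t. \<mu> (replicate (N - r) (x + t *\<^sub>R h) @ zs)) = (\<lambda>t. \<nu> (replicate (N - r) (x + t *\<^sub>R h) @ zs))"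
      using Suc ys by (intro ext) simp
    then have "real (N - r) * \<mu> (replicate (N - r - 1) x @ h # zs) = real (N - r) * \<nu> (replicate (N - r - 1) x @ h # zs)"
      using symm_multilin_deriv[OF \<mu>, of "N - r" x h zs] symm_multilin_deriv[OF \<nu>, of "N - r" x h zs] DERIV_unique by metis
    then show ?case using Suc.prems ys by simp
  qed (use eq in simp)
  from this[of xs N] l show ?thesis by simp
qed

lemma symm_multilin_map:
  assumes \<mu>: "symm_multilin \<mu>" and L: "linear L" shows "symm_multilin (\<lambda>xs. \<mu> (map L xs))"
  unfolding symm_multilin_def
proof (intro conjI allI impI)
  show "mset xs = mset ys \<Longrightarrow> \<mu> (map L xs) = \<mu> (map L ys)" for xs ys by (rule symm_multilin_mset[OF \<mu>]) simp
  show "linear (\<lambda>x. \<mu> (map L (x # xs)))" for xs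
    by (rule linearI) (simp_all add: linear_add[OF L] linear_scale[OF L] symm_multilin_simps[OF \<mu>])
qed

lemma symm_multilin_Cons: assumes \<mu>: "symm_multilin \<mu>" shows "symm_multilin (\<lambda>xs. \<mu> (z # xs))"
  unfolding symm_multilin_def
proof (intro conjI allI impI)
  show "mset xs = mset ys \<Longrightarrow> \<mu> (z # xs) = \<mu> (z # ys)" for xs ys by (rule symm_multilin_mset[OF \<mu>]) simp
  have s: "\<mu> (z # x # xs) = \<mu> (x # z # xs)" for x xs by (rule symm_multilin_mset[OF \<mu>]) simp
  show "linear (\<lambda>x. \<mu> (z # x # xs))" for xs
    by (rule linearI) (simp_all add: s symm_multilin_simps[OF \<mu>])
qed

lemma symm_multilin_scale: assumes \<mu>: "symm_multilin \<mu>" shows "symm_multilin (\<lambda>xs. c * \<mu> xs)"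
  unfolding symm_multilin_def
proof (intro conjI allI impI)
  show "mset xs = mset ys \<Longrightarrow> c * \<mu> xs = c * \<mu> ys" for xs ys using symm_multilin_mset[OF \<mu>] by metis
  show "linear (\<lambda>x. c * \<mu> (x # xs))" for xs
    by (rule linearI) (simp_all add: symm_multilin_simps[OF \<mu>] algebra_simps)
qed

lemma polar_det_cong:
  assumes "list_all2 (\<lambda>X Y. \<forall>i<d. \<forall>j<d. X i j = Y i j) Xs Ys" shows "polar_det d Xs = polar_det d Ys"
proof -
  have "polar_prod p Xs J = polar_prod p Ys J" if "p permutes {0..<d}" "J \<subseteq> {0..<d}" for p J
    using assms that(2)
  proof (induction arbitrary: J rule: list_all2_induct)
    case (Cons X Xs Y Ys)
    have "p j < d" if "j < d" for j using that permutes_in_image[OF \<open>p permutes {0..<d}\<close>, of j] by simp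
    moreover have "polar_prod p Xs (J - {j}) = polar_prod p Ys (J - {j})" for j by (rule Cons.IH) (use Cons.prems in auto)
    ultimately show ?case using Cons by (auto intro!: sum.cong)
  qed simp
  then show ?thesis unfolding polar_det_def by (intro arg_cong[of _ _ Re] sum.cong) auto
qed

definition diag_unit :: "nat \<Rightarrow> nat \<Rightarrow> nat \<Rightarrow> complex" where
  "diag_unit j = (\<lambda>a b. if a = j \<and> b = j then 1 else 0)"

definition del_index :: "nat \<Rightarrow> (nat \<Rightarrow> nat \<Rightarrow> complex) \<Rightarrow> nat \<Rightarrow> nat \<Rightarrow> complex" where
  "del_index j X = (\<lambda>a b. X (if a < j then a else Suc a) (if b < j then b else Suc b))"

lemma linear_del_index: "linear (del_index j)"
  by (rule linearI) (auto simp: del_index_def fun_eq_iff)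

text \<open>By polarization equal arguments suffice. Laplace expansion along column \<open>j\<close>
  shows that the determinant is affine in the diagonal entry \<open>j\<close>, with the principal
  minor as slope; comparison with \<open>symm_multilin_deriv\<close> cancels the factor
  \<open>Suc d\<close>.\<close>

lemma polar_det_diag_unit:
  assumes j: "j < Suc d" and l: "length Xs = d"
  shows "polar_det (Suc d) (diag_unit j # Xs) = polar_det d (map (del_index j) Xs)"
proof (rule symm_multilin_polarization[OF symm_multilin_Cons[OF symm_multilin_polar_det] symm_multilin_map[OF symm_multilin_polar_det linear_del_index] _ l])
  fix X
  have del: "mat_delete (mat_of (Suc d) (X + t *\<^sub>R diag_unit j)) i j = mat_delete (mat_of (Suc d) X) i j" if "i < Suc d" for t i
    by (rule eq_matI) (use j that in \<open>auto simp: mat_delete_def mat_of_def diag_unit_def\<close>)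
  have min: "mat_delete (mat_of (Suc d) X) j j = mat_of d (del_index j X)"
    by (rule eq_matI) (use j in \<open>auto simp: mat_delete_def mat_of_def del_index_def\<close>)
  have det: "Determinant.det (mat_of (Suc d) (X + t *\<^sub>R diag_unit j)) = Determinant.det (mat_of (Suc d) X) + of_real t * Determinant.det (mat_of d (del_index j X))" for t
  proof -
    let ?A = "mat_of (Suc d) X"
    have "Determinant.det (mat_of (Suc d) (X + t *\<^sub>R diag_unit j)) = (\<Sum>i<Suc d. mat_of (Suc d) (X + t *\<^sub>R diag_unit j) $$ (i, j) * cofactor (mat_of (Suc d) (X + t *\<^sub>R diag_unit j)) i j)"
      by (rule laplace_expansion_column[OF _ j]) simp
    also have "\<dots> = (\<Sum>i<Suc d. ?A $$ (i, j) * cofactor ?A i j + (if i = j then of_real t * cofactor ?A i j else 0))"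
    proof (rule sum.cong[OF refl])
      fix i assume "i \<in> {..<Suc d}"
      then have i: "i < Suc d" by simp
      have c: "cofactor (mat_of (Suc d) (X + t *\<^sub>R diag_unit j)) i j = cofactor ?A i j" by (simp add: cofactor_def del[OF i])
      have e: "mat_of (Suc d) (X + t *\<^sub>R diag_unit j) $$ (i, j) = ?A $$ (i, j) + (if i = j then of_real t else 0)"
        using i j by (simp add: mat_of_def diag_unit_def scaleR_conv_of_real)
      show "mat_of (Suc d) (X + t *\<^sub>R diag_unit j) $$ (i, j) * cofactor (mat_of (Suc d) (X + t *\<^sub>R diag_unit j)) i j
          = ?A $$ (i, j) * cofactor ?A i j + (if i = j then of_real t * cofactor ?A i j else 0)"
        unfolding c e by (simp add: algebra_simps)
    qed
    also have "\<dots> = (\<Sum>i<Suc d. ?A $$ (i, j) * cofactor ?A i j) + of_real t * cofactor ?A j j"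
      using j by (simp add: sum.distrib)
    also have "(\<Sum>i<Suc d. ?A $$ (i, j) * cofactor ?A i j) = Determinant.det ?A"
      by (rule laplace_expansion_column[OF _ j, symmetric]) simp
    also have "cofactor ?A j j = Determinant.det (mat_of d (del_index j X))"
      by (simp add: cofactor_def min flip: power_mult_distrib mult_2)
    finally show ?thesis .
  qed
  have "((\<lambda>t. polar_det (Suc d) (replicate (Suc d) (X + t *\<^sub>R diag_unit j) @ [])) has_real_derivative
      real (Suc d) * polar_det (Suc d) (replicate (Suc d - 1) X @ diag_unit j # [])) (at 0)"
    by (rule symm_multilin_deriv[OF symm_multilin_polar_det])
  then have 1: "((\<lambda>t. polar_det (Suc d) (replicate (Suc d) (X + t *\<^sub>R diag_unit j))) has_real_derivative
      real (Suc d) * polar_det (Suc d) (diag_unit j # replicate d X)) (at 0)"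
    using symm_multilin_append_Cons[OF symm_multilin_polar_det, of "Suc d" "replicate d X" "diag_unit j" "[]"] by simp
  have "polar_det (Suc d) (replicate (Suc d) (X + t *\<^sub>R diag_unit j)) = fact (Suc d) * (Re (Determinant.det (mat_of (Suc d) X)) + t * Re (Determinant.det (mat_of d (del_index j X))))" for t
    unfolding polar_det_replicate det by (simp only: plus_complex.sel Re_of_real_mult)
  moreover have "((\<lambda>t. fact (Suc d) * (Re (Determinant.det (mat_of (Suc d) X)) + t * Re (Determinant.det (mat_of d (del_index j X))))) has_real_derivative
      fact (Suc d) * Re (Determinant.det (mat_of d (del_index j X)))) (at 0)"
    by (rule derivative_eq_intros refl | simp del: fact_Suc)+
  ultimately have "((\<lambda>t. polar_det (Suc d) (replicate (Suc d) (X + t *\<^sub>R diag_unit j))) has_real_derivative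
      fact (Suc d) * Re (Determinant.det (mat_of d (del_index j X)))) (at 0)" by simp
  from DERIV_unique[OF 1 this]
  have "real (Suc d) * polar_det (Suc d) (diag_unit j # replicate d X) = real (Suc d) * polar_det d (map (del_index j) (replicate d X))"
    by (simp add: polar_det_replicate algebra_simps)
  then show "polar_det (Suc d) (diag_unit j # replicate d X) = polar_det d (map (del_index j) (replicate d X))" by simp
qed

section \<open>Congruence, Hermitian entry functions and positive definiteness\<close>

definition congr_mat :: "nat \<Rightarrow> (nat \<Rightarrow> nat \<Rightarrow> complex) \<Rightarrow> (nat \<Rightarrow> nat \<Rightarrow> complex) \<Rightarrow> nat \<Rightarrow> nat \<Rightarrow> complex" where
  "congr_mat d S X = (\<lambda>i j. \<Sum>a<d. \<Sum>b<d. cnj (S a i) * X a b * S b j)"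

lemma linear_congr_mat: "linear (congr_mat d S)"
proof (rule linearI)
  show "congr_mat d S (X + Y) = congr_mat d S X + congr_mat d S Y" for X Y
    by (auto simp: congr_mat_def fun_eq_iff sum.distrib algebra_simps)
  show "congr_mat d S (r *\<^sub>R X) = r *\<^sub>R congr_mat d S X" for r X
    by (auto simp: congr_mat_def fun_eq_iff scaleR_sum_right)
qed

lemma det_cnj: "Determinant.det (mat_of d (\<lambda>i j. cnj (S j i))) = cnj (Determinant.det (mat_of d S))"
proof -
  interpret c: comm_ring_hom cnj by unfold_locales auto
  have "mat_of d (\<lambda>i j. cnj (S j i)) = map_mat cnj (transpose_mat (mat_of d S))"
    by (rule eq_matI) (auto simp: mat_of_def)
  then show ?thesis by (simp add: c.hom_det det_transpose[of _ d])
qed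

lemma mat_of_congr_mat: "mat_of d (congr_mat d S X) = mat_of d (\<lambda>i j. cnj (S j i)) * mat_of d X * mat_of d S"
proof (rule eq_matI)
  fix i j assume "i < dim_row (mat_of d (\<lambda>i j. cnj (S j i)) * mat_of d X * mat_of d S)" "j < dim_col (mat_of d (\<lambda>i j. cnj (S j i)) * mat_of d X * mat_of d S)"
  then have ij: "i < d" "j < d" by auto
  have "(mat_of d (\<lambda>i j. cnj (S j i)) * mat_of d X * mat_of d S) $$ (i, j) = (\<Sum>b<d. (\<Sum>a<d. cnj (S a i) * X a b) * S b j)"
    using ij by (simp add: mat_of_def scalar_prod_def atLeast0LessThan)
  also have "\<dots> = (\<Sum>a<d. \<Sum>b<d. cnj (S a i) * X a b * S b j)"
    unfolding sum_distrib_right by (rule sum.swap)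
  finally show "mat_of d (congr_mat d S X) $$ (i, j) = (mat_of d (\<lambda>i j. cnj (S j i)) * mat_of d X * mat_of d S) $$ (i, j)"
    using ij by (simp add: mat_of_def congr_mat_def)
qed auto

lemma polar_det_congr_mat:
  assumes "length Xs = d"
  shows "polar_det d (map (congr_mat d S) Xs) = (cmod (Determinant.det (mat_of d S)))\<^sup>2 * polar_det d Xs"
proof (rule symm_multilin_polarization[OF symm_multilin_map[OF symm_multilin_polar_det linear_congr_mat] symm_multilin_scale[OF symm_multilin_polar_det] _ assms])
  fix X
  have "Determinant.det (mat_of d (congr_mat d S X)) = cnj (Determinant.det (mat_of d S)) * Determinant.det (mat_of d X) * Determinant.det (mat_of d S)"
    using det_mult[OF mult_carrier_mat[OF mat_of_carrier(1) mat_of_carrier(1)] mat_of_carrier(1), of d "\<lambda>i j. cnj (S j i)" X S]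
      det_mult[OF mat_of_carrier(1) mat_of_carrier(1), of d "\<lambda>i j. cnj (S j i)" X]
    by (simp add: mat_of_congr_mat det_cnj)
  also have "\<dots> = of_real ((cmod (Determinant.det (mat_of d S)))\<^sup>2) * Determinant.det (mat_of d X)"
    unfolding complex_norm_square by (simp add: algebra_simps)
  finally have "Re (Determinant.det (mat_of d (congr_mat d S X))) = (cmod (Determinant.det (mat_of d S)))\<^sup>2 * Re (Determinant.det (mat_of d X))"
    by simp
  then show "polar_det d (map (congr_mat d S) (replicate d X)) = (cmod (Determinant.det (mat_of d S)))\<^sup>2 * polar_det d (replicate d X)"
    by (simp add: polar_det_replicate)
qed

text \<open>Matrices are functions so that they form a real vector space. Entries outside the
  \<open>d\<close> by \<open>d\<close> block are arbitrary, so equality of matrices means equality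
  for indices below \<open>d\<close>.\<close>

definition herm_set :: "nat \<Rightarrow> (nat \<Rightarrow> nat \<Rightarrow> complex) set" where
  "herm_set d = {X. \<forall>i<d. \<forall>j<d. X j i = cnj (X i j)}"

definition quad_form :: "nat \<Rightarrow> (nat \<Rightarrow> nat \<Rightarrow> complex) \<Rightarrow> (nat \<Rightarrow> complex) \<Rightarrow> complex" where
  "quad_form d X v = (\<Sum>i<d. \<Sum>j<d. cnj (v i) * X i j * v j)"

definition posdef :: "nat \<Rightarrow> (nat \<Rightarrow> nat \<Rightarrow> complex) \<Rightarrow> bool" where
  "posdef d X \<longleftrightarrow> X \<in> herm_set d \<and> (\<forall>v. (\<exists>i<d. v i \<noteq> 0) \<longrightarrow> 0 < Re (quad_form d X v))"

definition id_entries :: "nat \<Rightarrow> nat \<Rightarrow> nat \<Rightarrow> complex" where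
  "id_entries d = (\<Sum>j<d. diag_unit j)"

lemma hsetD: "X \<in> herm_set d \<Longrightarrow> i < d \<Longrightarrow> j < d \<Longrightarrow> X j i = cnj (X i j)"
  unfolding herm_set_def by blast

lemma hsetI: "(\<And>i j. i < d \<Longrightarrow> j < d \<Longrightarrow> X j i = cnj (X i j)) \<Longrightarrow> X \<in> herm_set d"
  unfolding herm_set_def by blast

lemma fsum_apply: "(\<Sum>j\<in>J. f j) a = (\<Sum>j\<in>J. f j a)"
  by (induction J rule: infinite_finite_induct) (simp_all add: zero_fun_def plus_fun_def)

lemma id_entries_apply: "id_entries d i j = (if i = j \<and> i < d then 1 else 0)"
  by (auto simp: id_entries_def fsum_apply diag_unit_def sum.If_cases)

lemma subspace_herm_set [simp]: "linsub (herm_set d)"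
  unfolding Real_Vector_Spaces.subspace_def
proof (intro conjI ballI allI)
  show "0 \<in> herm_set d" by (simp add: herm_set_def)
  fix X Y and c :: real assume X: "X \<in> herm_set d"
  show "c *\<^sub>R X \<in> herm_set d"
  proof (rule hsetI)
    fix i j assume "i < d" "j < d"
    then show "(c *\<^sub>R X) j i = cnj ((c *\<^sub>R X) i j)" using hsetD[OF X, of i j] by simp
  qed
  assume Y: "Y \<in> herm_set d"
  show "X + Y \<in> herm_set d"
  proof (rule hsetI)
    fix i j assume "i < d" "j < d"
    then show "(X + Y) j i = cnj ((X + Y) i j)" using hsetD[OF X, of i j] hsetD[OF Y, of i j] by simp
  qed
qed

lemma diag_unit_herm_set [simp]: "diag_unit j \<in> herm_set d" by (auto simp: herm_set_def diag_unit_def)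

lemma id_entries_herm_set [simp]: "id_entries d \<in> herm_set d" by (auto simp: herm_set_def id_entries_apply)

lemma sum4_swap:
  fixes f :: "nat \<Rightarrow> nat \<Rightarrow> nat \<Rightarrow> nat \<Rightarrow> complex"
  shows "(\<Sum>k<d. \<Sum>l<d. \<Sum>a<d. \<Sum>b<d. f k l a b) = (\<Sum>a<d. \<Sum>b<d. \<Sum>k<d. \<Sum>l<d. f k l a b)"
proof -
  have "(\<Sum>k<d. \<Sum>l<d. \<Sum>a<d. \<Sum>b<d. f k l a b) = (\<Sum>k<d. \<Sum>a<d. \<Sum>l<d. \<Sum>b<d. f k l a b)"
    by (intro sum.cong refl sum.swap)
  also have "\<dots> = (\<Sum>a<d. \<Sum>k<d. \<Sum>l<d. \<Sum>b<d. f k l a b)" by (rule sum.swap)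
  also have "\<dots> = (\<Sum>a<d. \<Sum>k<d. \<Sum>b<d. \<Sum>l<d. f k l a b)"
    by (intro sum.cong refl sum.swap)
  also have "\<dots> = (\<Sum>a<d. \<Sum>b<d. \<Sum>k<d. \<Sum>l<d. f k l a b)"
    by (rule sum.cong[OF refl], rule sum.swap)
  finally show ?thesis .
qed

lemma congr_mat_congr_mat: "congr_mat d T (congr_mat d S X) = congr_mat d (\<lambda>a j. \<Sum>k<d. S a k * T k j) X"
proof (intro ext)
  fix i j
  have "congr_mat d T (congr_mat d S X) i j = (\<Sum>k<d. \<Sum>l<d. \<Sum>a<d. \<Sum>b<d. cnj (T k i) * (cnj (S a k) * X a b * S b l) * T l j)"
    by (simp add: congr_mat_def sum_distrib_left sum_distrib_right)
  also have "\<dots> = (\<Sum>a<d. \<Sum>b<d. \<Sum>k<d. \<Sum>l<d. cnj (T k i) * (cnj (S a k) * X a b * S b l) * T l j)"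
    by (rule sum4_swap)
  also have "\<dots> = (\<Sum>a<d. \<Sum>b<d. (\<Sum>k<d. cnj (S a k) * cnj (T k i)) * X a b * (\<Sum>l<d. S b l * T l j))"
    by (intro sum.cong refl) (simp add: sum_distrib_left sum_distrib_right ac_simps)
  also have "\<dots> = congr_mat d (\<lambda>a j. \<Sum>k<d. S a k * T k j) X i j" by (simp add: congr_mat_def)
  finally show "congr_mat d T (congr_mat d S X) i j = congr_mat d (\<lambda>a j. \<Sum>k<d. S a k * T k j) X i j" .
qed

lemma quad_form_congr_mat: "quad_form d (congr_mat d S X) v = quad_form d X (\<lambda>a. \<Sum>j<d. S a j * v j)"
proof -
  have q: "quad_form d X v = congr_mat d (\<lambda>a j. v a) X 0 0" for X v by (simp add: quad_form_def congr_mat_def)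
  show ?thesis unfolding q congr_mat_congr_mat ..
qed

lemma congr_mat_herm_set: "X \<in> herm_set d \<Longrightarrow> congr_mat d S X \<in> herm_set d"
proof (rule hsetI)
  fix i j assume X: "X \<in> herm_set d"
  have "cnj (\<Sum>a<d. \<Sum>b<d. cnj (S a i) * X a b * S b j) = (\<Sum>a<d. \<Sum>b<d. S a i * X b a * cnj (S b j))"
    unfolding cnj_sum
  proof (intro sum.cong refl)
    fix a b assume "a \<in> {..<d}" "b \<in> {..<d}"
    then have "cnj (X a b) = X b a" using hsetD[OF X, of a b] by simp
    then show "cnj (cnj (S a i) * X a b * S b j) = S a i * X b a * cnj (S b j)" by simp
  qed
  also have "\<dots> = (\<Sum>a<d. \<Sum>b<d. cnj (S a j) * X a b * S b i)"
    by (subst sum.swap) (intro sum.cong refl, simp)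
  finally show "congr_mat d S X j i = cnj (congr_mat d S X i j)" unfolding congr_mat_def ..
qed

definition inverse_pair :: "nat \<Rightarrow> (nat \<Rightarrow> nat \<Rightarrow> complex) \<Rightarrow> (nat \<Rightarrow> nat \<Rightarrow> complex) \<Rightarrow> bool" where
  "inverse_pair d S R \<longleftrightarrow> (\<forall>i<d. \<forall>j<d. (\<Sum>k<d. S i k * R k j) = (if i = j then 1 else 0)) \<and>
     (\<forall>i<d. \<forall>j<d. (\<Sum>k<d. R i k * S k j) = (if i = j then 1 else 0))"

lemma inverse_pair_sym: "inverse_pair d S R \<Longrightarrow> inverse_pair d R S" by (simp add: inverse_pair_def)

lemma inverse_pair_exists:
  assumes "Determinant.det (mat_of d S) \<noteq> 0"
  obtains R where "inverse_pair d S R"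
proof -
  have "mat_of d S \<in> Units (ring_mat TYPE(complex) d ())" by (rule det_non_zero_imp_unit[OF _ assms]) simp
  then obtain B where B: "B \<in> carrier_mat d d" "B * mat_of d S = 1\<^sub>m d" "mat_of d S * B = 1\<^sub>m d"
    unfolding Units_def ring_mat_def by auto
  have "inverse_pair d S (\<lambda>i j. B $$ (i, j))"
    unfolding inverse_pair_def
  proof (intro conjI allI impI)
    fix i j assume ij: "i < d" "j < d"
    have "(mat_of d S * B) $$ (i, j) = (\<Sum>k<d. S i k * B $$ (k, j))" "(B * mat_of d S) $$ (i, j) = (\<Sum>k<d. B $$ (i, k) * S k j)"
      using ij B(1) by (simp_all add: scalar_prod_def mat_of_def atLeast0LessThan)
    then show "(\<Sum>k<d. S i k * B $$ (k, j)) = (if i = j then 1 else 0)" "(\<Sum>k<d. B $$ (i, k) * S k j) = (if i = j then 1 else 0)"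
      using ij B by simp_all
  qed
  then show ?thesis using that by blast
qed

lemma congr_mat_inverse_pair:
  assumes "inverse_pair d S R" "i < d" "j < d" shows "congr_mat d S (congr_mat d R X) i j = X i j"
proof -
  have k: "(\<Sum>k<d. R a k * S k l) = (if a = l then 1 else 0)" if "a < d" "l < d" for a l
    using assms(1) that unfolding inverse_pair_def by blast
  have "congr_mat d S (congr_mat d R X) i j = (\<Sum>a<d. \<Sum>b<d. cnj (\<Sum>k<d. R a k * S k i) * X a b * (\<Sum>k<d. R b k * S k j))"
    unfolding congr_mat_congr_mat by (simp add: congr_mat_def)
  also have "\<dots> = (\<Sum>a<d. \<Sum>b<d. if a = i then if b = j then X a b else 0 else 0)"
    by (intro sum.cong refl) (simp add: k assms)
  also have "\<dots> = (\<Sum>a<d. if a = i then X a j else 0)"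
    by (intro sum.cong refl) (use assms in auto)
  also have "\<dots> = X i j" using assms by simp
  finally show ?thesis .
qed

lemma posdef_congr_mat:
  assumes "inverse_pair d S R" "posdef d X" shows "posdef d (congr_mat d S X)"
  unfolding posdef_def
proof (intro conjI allI impI)
  show "congr_mat d S X \<in> herm_set d" using assms by (simp add: posdef_def congr_mat_herm_set)
  fix v :: "nat \<Rightarrow> complex" assume v: "\<exists>i<d. v i \<noteq> 0"
  have "\<exists>a<d. (\<Sum>j<d. S a j * v j) \<noteq> 0"
  proof (rule ccontr)
    assume "\<not> ?thesis"
    then have z: "(\<Sum>j<d. S a j * v j) = 0" if "a < d" for a using that by auto
    have "v i = 0" if i: "i < d" for i
    proof -
      have "(\<Sum>a<d. R i a * (\<Sum>j<d. S a j * v j)) = (\<Sum>j<d. (\<Sum>a<d. R i a * S a j) * v j)"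
        unfolding sum_distrib_left sum_distrib_right by (subst sum.swap) (intro sum.cong refl, simp)
      also have "\<dots> = (\<Sum>j<d. if i = j then v j else 0)"
      proof (rule sum.cong[OF refl])
        fix j assume "j \<in> {..<d}"
        then have "(\<Sum>a<d. R i a * S a j) = (if i = j then 1 else 0)" using assms(1) i unfolding inverse_pair_def by blast
        then show "(\<Sum>a<d. R i a * S a j) * v j = (if i = j then v j else 0)" by simp
      qed
      finally show ?thesis using z i by simp
    qed
    then show False using v by auto
  qed
  then show "0 < Re (quad_form d (congr_mat d S X) v)" unfolding quad_form_congr_mat using assms(2) by (simp add: posdef_def)
qed

lemma sum_skip: "j < Suc d \<Longrightarrow> (\<Sum>a<Suc d. f a) = (f j :: 'a::comm_monoid_add) + (\<Sum>a<d. f (if a < j then a else Suc a))"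
proof -
  assume j: "j < Suc d"
  have "bij_betw (\<lambda>a. if a < j then a else Suc a) {..<d} ({..<Suc d} - {j})"
    by (rule bij_betwI[where g = "\<lambda>a. if a < j then a else a - 1"]) (use j in \<open>auto split: if_splits\<close>)
  then have "(\<Sum>a<d. f (if a < j then a else Suc a)) = (\<Sum>a\<in>{..<Suc d} - {j}. f a)"
    by (rule sum.reindex_bij_betw)
  then show ?thesis using j sum.remove[of "{..<Suc d}" j f] by (simp del: sum.lessThan_Suc)
qed

lemma del_index_herm_set: "j < Suc d \<Longrightarrow> X \<in> herm_set (Suc d) \<Longrightarrow> del_index j X \<in> herm_set d"
  by (rule hsetI) (unfold del_index_def, rule hsetD, auto)

lemma del_index_posdef:
  assumes j: "j < Suc d" and X: "posdef (Suc d) X" shows "posdef d (del_index j X)"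
  unfolding posdef_def
proof (intro conjI allI impI)
  show "del_index j X \<in> herm_set d" using X j by (simp add: posdef_def del_index_herm_set)
  fix v :: "nat \<Rightarrow> complex" assume "\<exists>i<d. v i \<noteq> 0"
  then obtain i where i: "i < d" "v i \<noteq> 0" by blast
  define w where "w a = (if a < j then v a else if a = j then 0 else v (a - 1))" for a
  have w: "w (if a < j then a else Suc a) = v a" "w j = 0" for a by (auto simp: w_def)
  have "quad_form (Suc d) X w = quad_form d (del_index j X) v"
    unfolding quad_form_def sum_skip[OF j] w by (simp add: del_index_def)
  moreover have "0 < Re (quad_form (Suc d) X w)"
  proof -
    have "(if i < j then i else Suc i) < Suc d" using i j by auto
    then have "\<exists>a<Suc d. w a \<noteq> 0" using w(1)[of i] i by metis
    then show ?thesis using X by (simp add: posdef_def)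
  qed
  ultimately show "0 < Re (quad_form d (del_index j X) v)" by simp
qed

text \<open>Induction on the size. Completing \<open>v\<close> by the last coordinate that minimizes
  the quadratic form shows that the Schur complement \<open>Y\<close> of the last diagonal entry is
  positive definite, and a factor of \<open>Y\<close> is then bordered.\<close>

lemma cholesky:
  assumes "posdef d X"
  shows "\<exists>S. Determinant.det (mat_of d S) \<noteq> 0 \<and> (\<forall>i<d. \<forall>j<d. X i j = (\<Sum>k<d. cnj (S k i) * S k j))"
  using assms
proof (induction d arbitrary: X)
  case 0
  then show ?case by (simp add: mat_of_def)
next
  case (Suc d)
  have h: "X j i = cnj (X i j)" if "i < Suc d" "j < Suc d" for i j using Suc.prems that hsetD unfolding posdef_def by blast
  define r where "r = Re (X d d)"
  have Xdd: "X d d = of_real r" using h[of d d] by (simp add: r_def complex_eq_iff)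
  have r: "0 < r"
  proof -
    have "quad_form (Suc d) X (\<lambda>i. if i = d then 1 else 0) = X d d" by (simp add: quad_form_def)
    moreover have "0 < Re (quad_form (Suc d) X (\<lambda>i. if i = d then 1 else 0))"
      using Suc.prems unfolding posdef_def by (metis (mono_tags, lifting) lessI zero_neq_one)
    ultimately show ?thesis by (simp add: r_def)
  qed
  define Y where "Y = (\<lambda>i j. X i j - X i d * X d j / of_real r)"
  have "posdef d Y"
    unfolding posdef_def
  proof (intro conjI allI impI)
    show "Y \<in> herm_set d" unfolding herm_set_def Y_def
    proof (intro CollectI allI impI)
      fix i j assume "i < d" "j < d"
      then show "X j i - X j d * X d i / of_real r = cnj (X i j - X i d * X d j / of_real r)"
        using h[of i j] h[of d j] h[of i d] by simp
    qed
    fix v :: "nat \<Rightarrow> complex" assume "\<exists>i<d. v i \<noteq> 0"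
    then obtain i where i: "i < d" "v i \<noteq> 0" by blast
    define s where "s = (\<Sum>j<d. X d j * v j)"
    define w where "w a = (if a = d then - s / of_real r else v a)" for a
    have cs: "(\<Sum>i<d. cnj (v i) * X i d) = cnj s"
      unfolding s_def using h[of d] by (simp add: ac_simps)
    have "quad_form (Suc d) X w = (\<Sum>i<d. \<Sum>j<d. cnj (v i) * X i j * v j) + (\<Sum>i<d. cnj (v i) * X i d) * w d + cnj (w d) * (\<Sum>j<d. X d j * v j) + cnj (w d) * X d d * w d"
    proof -
      have wi: "w i = v i" if "i < d" for i using that by (simp add: w_def)
      have "quad_form (Suc d) X w = (\<Sum>i<d. \<Sum>j<d. cnj (w i) * X i j * w j) + (\<Sum>i<d. cnj (w i) * X i d) * w d + cnj (w d) * (\<Sum>j<d. X d j * w j) + cnj (w d) * X d d * w d"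
        unfolding quad_form_def by (simp add: sum.distrib sum_distrib_left sum_distrib_right algebra_simps)
      then show ?thesis by (simp add: wi cong: sum.cong_simp)
    qed
    also have "\<dots> = (\<Sum>i<d. \<Sum>j<d. cnj (v i) * X i j * v j) - cnj s * s / of_real r"
      unfolding cs s_def[symmetric] Xdd w_def using r by (simp add: field_simps)
    also have "cnj s * s = (\<Sum>i<d. \<Sum>j<d. cnj (v i) * X i d * (X d j * v j))"
      unfolding cs[symmetric] by (subst s_def) (simp add: sum_product)
    also have "(\<Sum>i<d. \<Sum>j<d. cnj (v i) * X i j * v j) - (\<Sum>i<d. \<Sum>j<d. cnj (v i) * X i d * (X d j * v j)) / of_real r = quad_form d Y v"
    proof -
      have "(\<Sum>i<d. \<Sum>j<d. f i j) - (\<Sum>i<d. \<Sum>j<d. g i j) / r' = (\<Sum>i<d. \<Sum>j<d. f i j - g i j / r')"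
        for f g :: "nat \<Rightarrow> nat \<Rightarrow> complex" and r'
        by (simp add: sum_subtractf sum_divide_distrib)
      then show ?thesis unfolding quad_form_def Y_def by (simp only:) (intro sum.cong refl, simp add: algebra_simps)
    qed
    finally have "quad_form (Suc d) X w = quad_form d Y v" .
    moreover have "\<exists>a<Suc d. w a \<noteq> 0" using i by (intro exI[of _ i]) (auto simp: w_def)
    ultimately show "0 < Re (quad_form d Y v)" using Suc.prems by (metis posdef_def)
  qed
  from Suc.IH[OF this] obtain S' where S': "Determinant.det (mat_of d S') \<noteq> 0"
    "\<And>i j. i < d \<Longrightarrow> j < d \<Longrightarrow> Y i j = (\<Sum>k<d. cnj (S' k i) * S' k j)" by blast
  define q where "q = complex_of_real (sqrt r)"
  have q: "q * q = of_real r" "q \<noteq> 0" "cnj q = q" using r by (auto simp: q_def simp flip: of_real_mult)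
  \<comment> \<open>The new last row is the last row of \<open>X\<close> divided by the root
    \<open>q\<close> of the pivot; the last column is 0 above \<open>q\<close>, so the determinant
    is multiplied by \<open>q\<close>.\<close>
  define S where "S k i = (if k = d then (if i = d then q else X d i / q) else if i = d then 0 else S' k i)" for k i
  have "Determinant.det (mat_of (Suc d) S) = (\<Sum>i<Suc d. mat_of (Suc d) S $$ (i, d) * cofactor (mat_of (Suc d) S) i d)"
    by (rule laplace_expansion_column) auto
  also have "\<dots> = (\<Sum>i<Suc d. if i = d then q * cofactor (mat_of (Suc d) S) i d else 0)"
    by (rule sum.cong) (auto simp: mat_of_def S_def)
  also have "\<dots> = q * cofactor (mat_of (Suc d) S) d d" by simp
  also have "cofactor (mat_of (Suc d) S) d d = Determinant.det (mat_of d S')"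
  proof -
    have "mat_delete (mat_of (Suc d) S) d d = mat_of d S'"
      by (rule eq_matI) (auto simp: mat_delete_def mat_of_def S_def)
    then show ?thesis by (simp add: cofactor_def flip: power_mult_distrib mult_2)
  qed
  finally have "Determinant.det (mat_of (Suc d) S) \<noteq> 0" using S' q by simp
  moreover have "X i j = (\<Sum>k<Suc d. cnj (S k i) * S k j)" if ij: "i < Suc d" "j < Suc d" for i j
  proof -
    have e: "(\<Sum>k<Suc d. cnj (S k i) * S k j) = (\<Sum>k<d. cnj (S k i) * S k j) + cnj (S d i) * S d j" by simp
    have Xid: "cnj (X d i) = X i d" using h[of d i] that by simp
    consider "i < d" "j < d" | "i = d" "j < d" | "i < d" "j = d" | "i = d" "j = d" using ij by linarith
    then show ?thesis
    proof cases
      case 1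
      then have "(\<Sum>k<d. cnj (S k i) * S k j) = Y i j" by (simp add: S_def S')
      moreover have "cnj (S d i) * S d j = X i d * X d j / of_real r"
        using 1 q Xid by (simp add: S_def flip: q(1))
      ultimately show ?thesis unfolding e by (simp add: Y_def)
    next
      case 2
      then show ?thesis unfolding e using q by (simp add: S_def)
    next
      case 3
      then show ?thesis unfolding e using q Xid by (simp add: S_def)
    next
      case 4
      then show ?thesis unfolding e using q by (simp add: S_def Xdd)
    qed
  qed
  ultimately show ?case by blast
qed

text \<open>The Cholesky factor serves as a frame in which \<open>Z\<close> is the identity, hence a
  sum of the rank-one matrices \<open>congr_mat d S (diag_unit j)\<close>. Mixed discriminants
  change only by the factor \<open>c\<close>, so claims about \<open>Z\<close> reduce to claims
  about the identity.\<close>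

lemma posdef_frame:
  assumes Z: "posdef d Z"
  obtains S R c where "inverse_pair d S R" "0 < c" "\<And>i j. i < d \<Longrightarrow> j < d \<Longrightarrow> Z i j = congr_mat d S (id_entries d) i j"
    "\<And>Xs. length Xs = d \<Longrightarrow> polar_det d (map (congr_mat d S) Xs) = c * polar_det d Xs"
proof -
  from cholesky[OF Z] obtain S where S: "Determinant.det (mat_of d S) \<noteq> 0"
    "\<And>i j. i < d \<Longrightarrow> j < d \<Longrightarrow> Z i j = (\<Sum>k<d. cnj (S k i) * S k j)" by blast
  from inverse_pair_exists[OF S(1)] obtain R where R: "inverse_pair d S R" by blast
  have "congr_mat d S (id_entries d) i j = (\<Sum>k<d. cnj (S k i) * S k j)" for i j
  proof -
    have "congr_mat d S (id_entries d) i j = (\<Sum>a<d. \<Sum>b<d. if b = a then cnj (S a i) * S b j else 0)"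
      unfolding congr_mat_def by (intro sum.cong refl) (auto simp: id_entries_apply)
    then show ?thesis by simp
  qed
  then show ?thesis using that[OF R, of "(cmod (Determinant.det (mat_of d S)))\<^sup>2"] S polar_det_congr_mat by auto
qed

lemma polar_det_frame:
  assumes R: "inverse_pair d S R" and Z: "\<And>i j. i < d \<Longrightarrow> j < d \<Longrightarrow> Z i j = congr_mat d S (id_entries d) i j"
    and c: "\<And>Xs. length Xs = d \<Longrightarrow> polar_det d (map (congr_mat d S) Xs) = c * polar_det d Xs"
    and l: "length Xs + length Ys + 1 = d"
  shows "polar_det d (Xs @ Z # Ys) = c * polar_det d (map (congr_mat d R) Xs @ id_entries d # map (congr_mat d R) Ys)"
proof -
  have "polar_det d (Xs @ Z # Ys) = polar_det d (map (congr_mat d S) (map (congr_mat d R) Xs @ id_entries d # map (congr_mat d R) Ys))"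
    by (rule polar_det_cong) (auto simp: list_all2_append list_all2_map2 list_all2_same Z congr_mat_inverse_pair[OF R] intro!: list_all2_appendI)
  then show ?thesis using c[of "map (congr_mat d R) Xs @ id_entries d # map (congr_mat d R) Ys"] l by simp
qed

lemma polar_det_id_entries:
  assumes "length Xs = d" shows "polar_det (Suc d) (id_entries (Suc d) # Xs) = (\<Sum>j<Suc d. polar_det d (map (del_index j) Xs))"
  unfolding id_entries_def symm_multilin_sum[OF symm_multilin_polar_det] by (intro sum.cong refl) (use assms polar_det_diag_unit in auto)

lemma polar_det_0 [simp]: "polar_det 0 [] = 1"
  using polar_det_replicate[of 0 undefined] by (simp add: mat_of_def)

text \<open>In a frame where the first matrix is the identity, the value is a positive multiple of a
  sum over principal compressions of the other matrices, which are positive definite and smaller by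
  one.\<close>

theorem polar_det_pos:
  assumes "length Xs = d" "\<And>X. X \<in> set Xs \<Longrightarrow> posdef d X" shows "0 < polar_det d Xs"
  using assms
proof (induction d arbitrary: Xs)
  case (Suc d)
  then obtain Z Ys where Xs: "Xs = Z # Ys" "length Ys = d" by (cases Xs) auto
  have "posdef (Suc d) Z" using Suc Xs by auto
  from posdef_frame[OF this] obtain S R c where f: "inverse_pair (Suc d) S R" "0 < c"
    "\<And>i j. i < Suc d \<Longrightarrow> j < Suc d \<Longrightarrow> Z i j = congr_mat (Suc d) S (id_entries (Suc d)) i j"
    "\<And>Xs. length Xs = Suc d \<Longrightarrow> polar_det (Suc d) (map (congr_mat (Suc d) S) Xs) = c * polar_det (Suc d) Xs" by blast
  have "polar_det (Suc d) Xs = c * polar_det (Suc d) (id_entries (Suc d) # map (congr_mat (Suc d) R) Ys)"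
    using polar_det_frame[OF f(1,3,4), of "[]" Ys] Xs by simp
  also have "\<dots> = c * (\<Sum>j<Suc d. polar_det d (map (del_index j) (map (congr_mat (Suc d) R) Ys)))"
    using Xs by (subst polar_det_id_entries) auto
  also have "0 < \<dots>"
  proof (intro mult_pos_pos f sum_pos)
    fix j assume "j \<in> {..<Suc d}"
    then show "0 < polar_det d (map (del_index j) (map (congr_mat (Suc d) R) Ys))"
      using Suc.prems Xs posdef_congr_mat[OF inverse_pair_sym[OF f(1)]] by (intro Suc.IH) (auto intro!: del_index_posdef)
  qed auto
  finally show ?case .
qed simp


section \<open>Alexandrov's inequality for mixed discriminants\<close>

lemma det_mt1: "Determinant.det (mat_of (Suc 0) X) = X 0 0" "Determinant.det (mat_of 1 X) = X 0 0"
proof -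
  have "mat_of 1 X \<in> carrier_mat 1 1" by simp
  from det_single[OF this] show "Determinant.det (mat_of 1 X) = X 0 0" by (simp add: mat_of_def)
  then show "Determinant.det (mat_of (Suc 0) X) = X 0 0" by simp
qed

lemma polar_det_1: "polar_det (Suc 0) [X] = Re (X 0 0)"
  using polar_det_replicate[of "Suc 0" X] by (simp add: det_mt1)

lemma polar_det_2: "polar_det 2 [X, X] = 2 * Re (X 0 0 * X 1 1 - X 0 1 * X 1 0)"
proof -
  have "Determinant.det (mat_of 2 X) = (\<Sum>i<2. mat_of 2 X $$ (i, 0) * cofactor (mat_of 2 X) i 0)"
    by (rule laplace_expansion_column) auto
  also have "\<dots> = X 0 0 * cofactor (mat_of 2 X) 0 0 + X 1 0 * cofactor (mat_of 2 X) 1 0"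
    by (simp add: mat_of_def numeral_2_eq_2)
  also have "cofactor (mat_of 2 X) 0 0 = X 1 1"
  proof -
    have "mat_delete (mat_of 2 X) 0 0 = mat_of 1 (\<lambda>a b. X 1 1)" by (rule eq_matI) (simp_all add: mat_delete_def mat_of_def)
    then show ?thesis by (simp add: cofactor_def det_mt1)
  qed
  also have "cofactor (mat_of 2 X) 1 0 = - X 0 1"
  proof -
    have "mat_delete (mat_of 2 X) 1 0 = mat_of 1 (\<lambda>a b. X 0 1)" by (rule eq_matI) (simp_all add: mat_delete_def mat_of_def)
    then show ?thesis by (simp add: cofactor_def det_mt1)
  qed
  finally have "Determinant.det (mat_of 2 X) = X 0 0 * X 1 1 - X 0 1 * X 1 0" by (simp add: algebra_simps)
  then show ?thesis using polar_det_replicate[of 2 X] by (simp add: numeral_2_eq_2)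
qed

text \<open>Orthogonality to the identity means trace 0, and the determinant of a Hermitian 2 by 2
  matrix of trace 0 is minus a sum of squares. All strictness rests on this computation.\<close>

lemma polar_det_2_strict:
  assumes X: "X \<in> herm_set 2" and o: "polar_det 2 [X, id_entries 2] = 0"
  shows "polar_det 2 [X, X] \<le> 0" "polar_det 2 [X, X] = 0 \<Longrightarrow> i < 2 \<Longrightarrow> j < 2 \<Longrightarrow> X i j = 0"
proof -
  have "polar_det 2 [X, id_entries 2] = polar_det 2 [id_entries 2, X]" by (rule symm_multilin_mset[OF symm_multilin_polar_det]) simp
  also have "\<dots> = (\<Sum>j<2. polar_det 1 [del_index j X])" using polar_det_id_entries[of "[X]" 1] by (simp add: numeral_2_eq_2)
  also have "\<dots> = Re (X 1 1) + Re (X 0 0)" by (simp add: numeral_2_eq_2 polar_det_1 del_index_def)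
  finally have t: "Re (X 1 1) = - Re (X 0 0)" using o by simp
  have h: "X 1 0 = cnj (X 0 1)" "X 0 0 = cnj (X 0 0)" "X 1 1 = cnj (X 1 1)"
    by (rule hsetD[OF X], simp_all)+
  have im: "Im (X 0 0) = 0" "Im (X 1 1) = 0" using arg_cong[OF h(2), of Im] arg_cong[OF h(3), of Im] by auto
  have e: "polar_det 2 [X, X] = - 2 * ((Re (X 0 0))\<^sup>2 + (Re (X 0 1))\<^sup>2 + (Im (X 0 1))\<^sup>2)"
    unfolding polar_det_2 h(1) by (simp add: t[unfolded One_nat_def] im im[unfolded One_nat_def] power2_eq_square)
  show "polar_det 2 [X, X] \<le> 0" unfolding e by (rule mult_nonpos_nonneg) auto
  assume "polar_det 2 [X, X] = 0" and ij: "i < 2" "j < 2"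
  then have "(Re (X 0 0))\<^sup>2 + (Re (X 0 1))\<^sup>2 + (Im (X 0 1))\<^sup>2 = 0" unfolding e by simp
  then have "(Re (X 0 0))\<^sup>2 = 0" "(Re (X 0 1))\<^sup>2 = 0" "(Im (X 0 1))\<^sup>2 = 0"
    using zero_le_power2[of "Re (X 0 0)"] zero_le_power2[of "Re (X 0 1)"] zero_le_power2[of "Im (X 0 1)"] by linarith+
  then have "X 0 0 = 0" "X 0 1 = 0" "X 1 1 = 0" "X 1 0 = 0" using t im h(1) by (auto simp: complex_eq_iff)
  then show "X i j = 0" using ij by (auto simp: less_2_cases_iff)
qed

text \<open>Away from \<open>j\<close> this inverts the index map of
  \<open>del_index j\<close>.\<close>

definition shft :: "nat \<Rightarrow> nat \<Rightarrow> nat" where "shft j i = (if i < j then i else i - 1)"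

lemma del_index_diag_unit: "i \<noteq> j \<Longrightarrow> del_index j (diag_unit i) = diag_unit (shft j i)"
  by (auto simp: del_index_def diag_unit_def shft_def fun_eq_iff)

lemma del_index_diag_unit_same: "del_index j (diag_unit j) = 0"
  by (auto simp: del_index_def diag_unit_def fun_eq_iff zero_fun_def)

text \<open>Expanding along the first \<open>diag_unit i\<close> deletes index \<open>i\<close> and
  thereby annihilates the second. The determinant is affine in such a direction.\<close>

lemma polar_det_diag_unit_twice:
  assumes "i < Suc d" "length Xs + 1 = d" shows "polar_det (Suc d) (diag_unit i # diag_unit i # Xs) = 0"
  using assms by (simp add: polar_det_diag_unit del_index_diag_unit_same symm_multilin_simps[OF symm_multilin_polar_det])

text \<open>Each diagonal unit is traded for a compression. The indices being distinct, the other
  units survive with shifted indices until only positive definite matrices remain.\<close>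

lemma polar_det_diag_unit_pos:
  assumes "distinct js" "\<And>j. j \<in> set js \<Longrightarrow> j < d" "length js + length Xs = d" "\<And>X. X \<in> set Xs \<Longrightarrow> posdef d X"
  shows "0 < polar_det d (map diag_unit js @ Xs)"
  using assms
proof (induction "length js" arbitrary: js d Xs)
  case 0
  then show ?case by (simp add: polar_det_pos)
next
  case (Suc l js0)
  then obtain j js where js0: "js0 = j # js" by (cases js0) auto
  note prems = Suc.prems[unfolded js0]
  have ll: "l = length js" using Suc.hyps(2) js0 by simp
  have "j < d" using prems(2) by simp
  then obtain d' where d: "d = Suc d'" "j < Suc d'" by (cases d) auto
  have m: "map (del_index j) (map diag_unit js) = map diag_unit (map (shft j) js)"
    using prems(1) by (auto intro!: del_index_diag_unit)
  have "polar_det d (map diag_unit (j # js) @ Xs) = polar_det d' (map diag_unit (map (shft j) js) @ map (del_index j) Xs)"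
    unfolding d(1) m[symmetric] using polar_det_diag_unit[OF d(2), of "map diag_unit js @ Xs"] prems(3) d by simp
  also have "0 < \<dots>"
  proof (rule Suc.hyps(1))
    show "l = length (map (shft j) js)" by (simp add: ll)
    have "inj_on (shft j) (set js)"
    proof (rule inj_onI)
      fix a b assume "a \<in> set js" "b \<in> set js" "shft j a = shft j b"
      moreover from this have "a \<noteq> j" "b \<noteq> j" using prems(1) by auto
      ultimately show "a = b" by (auto simp: shft_def split: if_splits)
    qed
    then show "distinct (map (shft j) js)" using prems(1) by (simp add: distinct_map)
    show "i < d'" if "i \<in> set (map (shft j) js)" for i
    proof -
      from that obtain a where a: "a \<in> set js" "i = shft j a" by auto
      moreover have "a \<noteq> j" "a < Suc d'" using a prems(1) prems(2)[of a] d by auto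
      ultimately show ?thesis using d by (auto simp: shft_def)
    qed
    show "posdef d' X" if "X \<in> set (map (del_index j) Xs)" for X using that prems(4) d by (auto intro: del_index_posdef)
  qed (use prems d in auto)
  finally show ?case unfolding js0 .
qed

text \<open>The identity is the sum of the diagonal units, in which \<open>T\<close> is squarefree,
  so \<open>lorentz_multiaffine\<close> applies.\<close>

lemma herm_lorentz:
  fixes T :: "(nat \<Rightarrow> nat \<Rightarrow> complex) \<Rightarrow> (nat \<Rightarrow> nat \<Rightarrow> complex) \<Rightarrow> (nat \<Rightarrow> nat \<Rightarrow> complex) \<Rightarrow> real"
  assumes T: "symm_trilin T" and d: "3 \<le> d" and l: "\<And>j. j < d \<Longrightarrow> lorentz (herm_set d) (\<lambda>x y. T x y (diag_unit j))"
    and z: "\<And>i j. i < d \<Longrightarrow> j < d \<Longrightarrow> T (diag_unit i) (diag_unit i) (diag_unit j) = 0"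
    and pos: "\<And>i j k. i < d \<Longrightarrow> j < d \<Longrightarrow> k < d \<Longrightarrow> i \<noteq> j \<Longrightarrow> i \<noteq> k \<Longrightarrow> j \<noteq> k \<Longrightarrow> 0 < T (diag_unit i) (diag_unit j) (diag_unit k)"
  shows "lorentz (herm_set d) (\<lambda>x y. T x y (id_entries d))"
proof -
  have nn: "0 \<le> T (diag_unit i) (diag_unit j) (diag_unit k)" if "i \<in> {..<d}" "j \<in> {..<d}" "k \<in> {..<d}" for i j k
  proof (cases "i \<noteq> j \<and> i \<noteq> k \<and> j \<noteq> k")
    case True
    then show ?thesis using pos that by (auto intro: less_imp_le)
  next
    case False
    then have "T (diag_unit i) (diag_unit j) (diag_unit k) = 0" using z that symm_trilin_sym[OF T] by (metis lessThan_iff)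
    then show ?thesis by simp
  qed
  have "lorentz (herm_set d) (\<lambda>x y. T x y (\<Sum>j\<in>{..<d}. 1 *\<^sub>R diag_unit j))"
  proof (rule lorentz_multiaffine[OF T subspace_herm_set triple_cone_span[OF T, of "{..<d}" diag_unit], where I = "{..<d}" and I' = "{..<d}"])
    show "diag_unit j \<in> {x. \<exists>c. (\<forall>j\<in>{..<d}. 0 \<le> c j) \<and> x = (\<Sum>j\<in>{..<d}. c j *\<^sub>R diag_unit j)}" if "j \<in> {..<d}" for j
      using that by (intro CollectI exI[of _ "\<lambda>i. if i = j then 1 else 0"]) (auto simp: if_distrib[of "\<lambda>c. c *\<^sub>R _"] cong: if_cong)
  qed (use nn d l z pos in auto)
  then show ?thesis by (simp add: id_entries_def)
qed

text \<open>In the frame of the first fixed matrix, the slices in the directions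
  \<open>diag_unit j\<close> are mixed discriminants of compressions, to which the induction
  hypothesis applies; size 2 is the base.\<close>

theorem polar_det_lorentz:
  assumes "length Zs + 2 = d" "\<And>Z. Z \<in> set Zs \<Longrightarrow> posdef d Z"
  shows "lorentz (herm_set d) (\<lambda>x y. polar_det d (x # y # Zs))"
  using assms
proof (induction "length Zs" arbitrary: Zs d)
  case 0
  then have Zs: "Zs = []" by simp
  from 0 have d: "d = 2" by simp
  show ?case unfolding d Zs
  proof (rule lorentz_from_point[OF symm_bilin_symm_multilin[OF symm_multilin_polar_det] subspace_herm_set, of "id_entries 2"])
    have "polar_det 2 [id_entries 2, id_entries 2] = 2" unfolding polar_det_2 by (simp add: id_entries_apply)
    then show "0 < polar_det 2 [id_entries 2, id_entries 2]" by simp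
  qed (use polar_det_2_strict(1) in auto)
next
  case (Suc l Zs0)
  then obtain Z Zs where Zs0: "Zs0 = Z # Zs" by (cases Zs0) auto
  note IH = Suc.hyps(1) and Cons_prems = Suc.prems[unfolded Zs0]
  obtain d' where d: "d = Suc d'" using Suc.prems by (cases d) auto
  have ll: "l = length Zs" using Suc.hyps(2) Zs0 by simp
  have Zp: "posdef d Z" using Cons_prems by auto
  obtain S R c where f: "inverse_pair d S R" "0 < c" "\<And>i j. i < d \<Longrightarrow> j < d \<Longrightarrow> Z i j = congr_mat d S (id_entries d) i j"
    "\<And>Xs. length Xs = d \<Longrightarrow> polar_det d (map (congr_mat d S) Xs) = c * polar_det d Xs" using posdef_frame[OF Zp] by blast
  define Ws where "Ws = map (congr_mat d R) Zs"
  have Wp: "posdef d W" if "W \<in> set Ws" for W using that Cons_prems posdef_congr_mat[OF inverse_pair_sym[OF f(1)]] by (auto simp: Ws_def)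
  have Wl: "length Ws + 2 = d'" using Cons_prems d by (simp add: Ws_def)
  have e: "polar_det d (x # y # Z # Zs) = c * polar_det d (congr_mat d R x # congr_mat d R y # id_entries d # Ws)" for x y
    using polar_det_frame[OF f(1,3,4), of "[x, y]" Zs] Cons_prems by (simp add: Ws_def)
  let ?T = "\<lambda>x y z. polar_det d (x # y # z # Ws)"
  have T: "symm_trilin ?T" by (rule symm_trilin_symm_multilin[OF symm_multilin_polar_det])
  have "lorentz (herm_set d) (\<lambda>x y. ?T x y (id_entries d))"
  proof (rule herm_lorentz[OF T])
    show "3 \<le> d" using Wl d by simp
    show "lorentz (herm_set d) (\<lambda>x y. ?T x y (diag_unit j))" if "j < d" for j
    proof -
      have eq: "?T x y (diag_unit j) = polar_det d' (del_index j x # del_index j y # map (del_index j) Ws)" for x y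
      proof -
        have "?T x y (diag_unit j) = polar_det d (diag_unit j # x # y # Ws)" by (rule symm_multilin_mset[OF symm_multilin_polar_det]) simp
        then show ?thesis using polar_det_diag_unit[of j d' "x # y # Ws"] that Wl d by simp
      qed
      have "lorentz (herm_set d') (\<lambda>x y. polar_det d' (x # y # map (del_index j) Ws))"
        using Wp Wl that d by (intro IH) (auto intro: del_index_posdef simp: ll Ws_def)
      then have "lorentz (herm_set d) (\<lambda>x y. polar_det d' (del_index j x # del_index j y # map (del_index j) Ws))"
        by (rule lorentz_pullback) (use that d del_index_herm_set in blast)
      then show ?thesis unfolding eq .
    qed
    show "?T (diag_unit i) (diag_unit i) (diag_unit j) = 0" if "i < d" "j < d" for i j
      using that polar_det_diag_unit_twice[of i d' "diag_unit j # Ws"] Wl d by simp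
    show "0 < ?T (diag_unit i) (diag_unit j) (diag_unit k)" if "i < d" "j < d" "k < d" "i \<noteq> j" "i \<noteq> k" "j \<noteq> k" for i j k
    proof -
      have "0 < polar_det d (map diag_unit [i, j, k] @ Ws)" by (rule polar_det_diag_unit_pos) (use that Wp Wl d in auto)
      then show ?thesis by simp
    qed
  qed
  then have "lorentz (herm_set d) (\<lambda>x y. ?T (congr_mat d R x) (congr_mat d R y) (id_entries d))"
    by (rule lorentz_pullback) (rule congr_mat_herm_set)
  then show ?case unfolding Zs0 by (rule lorentz_if_nonneg_cong[OF _ f(2)]) (rule e)
qed

section \<open>Polynomials in directional derivatives of the determinant\<close>

text \<open>
  With \<open>g a = a! c\<^sub>a\<close> this is \<open>m!\<close> times \<open>\<Sum>\<^sub>a c\<^sub>a \<mu> (H\<^sup>a, Xs)\<close>, the polynomial with coefficients \<open>c\<^sub>a\<close> of degree \<open>m\<close> evaluated in the directions \<open>H\<close>.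
\<close>

fun polyop :: "nat \<Rightarrow> ('v::real_vector list \<Rightarrow> real) \<Rightarrow> (nat \<Rightarrow> 'v) \<Rightarrow> nat \<Rightarrow> ((nat \<Rightarrow>\<^sub>0 nat) \<Rightarrow> real) \<Rightarrow> 'v list \<Rightarrow> real" where
  "polyop n \<mu> H 0 g Xs = g 0 * \<mu> Xs"
| "polyop n \<mu> H (Suc m) g Xs = (\<Sum>i<n. polyop n \<mu> H m (\<lambda>b. g (b + unit_exp i)) (H i # Xs))"

lemma symm_multilin_add: assumes "symm_multilin \<mu>" "symm_multilin \<nu>" shows "symm_multilin (\<lambda>xs. \<mu> xs + \<nu> xs)"
  unfolding symm_multilin_def
proof (intro conjI allI impI)
  show "mset xs = mset ys \<Longrightarrow> \<mu> xs + \<nu> xs = \<mu> ys + \<nu> ys" for xs ys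
    using symm_multilin_mset[OF assms(1)] symm_multilin_mset[OF assms(2)] by metis
  show "linear (\<lambda>x. \<mu> (x # xs) + \<nu> (x # xs))" for xs
    by (rule linearI) (simp_all add: symm_multilin_simps[OF assms(1)] symm_multilin_simps[OF assms(2)] algebra_simps)
qed

lemma symm_multilin_zero: "symm_multilin (\<lambda>xs. 0)"
  by (auto simp: symm_multilin_def intro!: linearI)

lemma symm_multilin_sumI: assumes "\<And>i. i \<in> I \<Longrightarrow> symm_multilin (\<mu> i)" shows "symm_multilin (\<lambda>xs. \<Sum>i\<in>I. \<mu> i xs)"
  using assms by (induction I rule: infinite_finite_induct) (simp_all add: symm_multilin_zero symm_multilin_add)

lemma symm_multilin_polyop: "symm_multilin \<mu> \<Longrightarrow> symm_multilin (polyop n \<mu> H m g)"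
proof (induction m arbitrary: g)
  case 0
  have "polyop n \<mu> H 0 g = (\<lambda>Xs. g 0 * \<mu> Xs)" by (rule ext) simp
  then show ?case using symm_multilin_scale[OF 0] by simp
next
  case (Suc m)
  have "polyop n \<mu> H (Suc m) g = (\<lambda>Xs. \<Sum>i<n. polyop n \<mu> H m (\<lambda>b. g (b + unit_exp i)) (H i # Xs))" by (rule ext) simp
  then show ?case using Suc by (simp add: symm_multilin_sumI symm_multilin_Cons)
qed

lemma polyop_sum: "polyop n \<mu> H m (\<lambda>b. \<Sum>j\<in>J. a j * g j b) Xs = (\<Sum>j\<in>J. a j * polyop n \<mu> H m (g j) Xs)"
proof (induction m arbitrary: g Xs)
  case (Suc m)
  have "polyop n \<mu> H (Suc m) (\<lambda>b. \<Sum>j\<in>J. a j * g j b) Xs = (\<Sum>i<n. \<Sum>j\<in>J. a j * polyop n \<mu> H m (\<lambda>b. g j (b + unit_exp i)) (H i # Xs))"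
    by (simp only: polyop.simps Suc)
  then show ?case by (subst (asm) sum.swap) (simp add: sum_distrib_left)
qed (simp add: sum_distrib_right mult.assoc)

lemma polyop_zero: "(\<And>Ys. \<mu> (Ys @ Zs) = 0) \<Longrightarrow> polyop n \<mu> H m g (Ys @ Zs) = 0"
proof (induction m arbitrary: g Ys)
  case (Suc m)
  have "polyop n \<mu> H m (\<lambda>b. g (b + unit_exp i)) (H i # Ys @ Zs) = 0" for i
    using Suc.IH[of "\<lambda>b. g (b + unit_exp i)" "H i # Ys"] Suc.prems by simp
  then show ?case by simp
qed simp

text \<open>The derivative in direction \<open>a\<close> of the polynomial behind
  \<open>g\<close>.\<close>

definition shift_sum :: "nat \<Rightarrow> (nat \<Rightarrow> real) \<Rightarrow> ((nat \<Rightarrow>\<^sub>0 nat) \<Rightarrow> real) \<Rightarrow> (nat \<Rightarrow>\<^sub>0 nat) \<Rightarrow> real" where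
  "shift_sum n a g b = (\<Sum>i<n. a i * g (b + unit_exp i))"

lemma polyop_shift_sum: "polyop n \<mu> H m (shift_sum n a g) Xs = (\<Sum>i<n. a i * polyop n \<mu> H m (\<lambda>b. g (b + unit_exp i)) Xs)"
  using polyop_sum[of n \<mu> H m a "\<lambda>i b. g (b + unit_exp i)" "{..<n}" Xs] by (simp add: shift_sum_def[abs_def])

text \<open>As \<open>K\<close> may occur only once, the Taylor expansion in \<open>K\<close> stops
  after the linear term, whose coefficient is the derivative of the polynomial in direction
  \<open>a\<close>. The factor \<open>real m\<close> stems from the normalization by
  \<open>m!\<close>.\<close>

lemma polyop_add_rank1:
  assumes \<mu>: "symm_multilin \<mu>" and K: "\<And>Xs. \<mu> (K # K # Xs) = 0"
  shows "polyop n \<mu> (\<lambda>i. H i + a i *\<^sub>R K) m g Xs = polyop n \<mu> H m g Xs + real m * polyop n \<mu> H (m - 1) (shift_sum n a g) (K # Xs)"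
proof (induction m arbitrary: g Xs)
  case (Suc m)
  note G = symm_multilin_polyop[OF \<mu>]
  have KK: "polyop n \<mu> H m g (K # K # Xs) = 0" for m g Xs
  proof -
    have "\<mu> (Ys @ K # K # Xs) = 0" for Ys
    proof -
      have "\<mu> (Ys @ K # K # Xs) = \<mu> (K # K # Ys @ Xs)" by (rule symm_multilin_mset[OF \<mu>]) simp
      then show ?thesis by (simp add: K)
    qed
    from polyop_zero[where Ys = "[]" and Zs = "K # K # Xs" and \<mu> = \<mu>, OF this] show ?thesis by simp
  qed
  have sh: "shift_sum n a (\<lambda>b. g (b + unit_exp i)) = (\<lambda>b. shift_sum n a g (b + unit_exp i))" for i
    by (auto simp: shift_sum_def fun_eq_iff ac_simps)
  have 1: "polyop n \<mu> (\<lambda>i. H i + a i *\<^sub>R K) m (\<lambda>b. g (b + unit_exp i)) ((H i + a i *\<^sub>R K) # Xs)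
    = polyop n \<mu> H m (\<lambda>b. g (b + unit_exp i)) (H i # Xs) + a i * polyop n \<mu> H m (\<lambda>b. g (b + unit_exp i)) (K # Xs)
      + real m * polyop n \<mu> H (m - 1) (\<lambda>b. shift_sum n a g (b + unit_exp i)) (H i # K # Xs)" for i
  proof -
    have "polyop n \<mu> H (m - 1) g' (K # (H i + a i *\<^sub>R K) # Xs) = polyop n \<mu> H (m - 1) g' ((H i + a i *\<^sub>R K) # K # Xs)" for g'
      by (rule symm_multilin_mset[OF G]) simp
    then show ?thesis unfolding Suc sh by (simp add: symm_multilin_simps[OF G] KK)
  qed
  have "polyop n \<mu> (\<lambda>i. H i + a i *\<^sub>R K) (Suc m) g Xs
    = polyop n \<mu> H (Suc m) g Xs + polyop n \<mu> H m (shift_sum n a g) (K # Xs)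
      + real m * (\<Sum>i<n. polyop n \<mu> H (m - 1) (\<lambda>b. shift_sum n a g (b + unit_exp i)) (H i # K # Xs))"
    unfolding polyop.simps(2) 1 polyop_shift_sum by (simp add: sum.distrib sum_distrib_left)
  also have "real m * (\<Sum>i<n. polyop n \<mu> H (m - 1) (\<lambda>b. shift_sum n a g (b + unit_exp i)) (H i # K # Xs)) = real m * polyop n \<mu> H m (shift_sum n a g) (K # Xs)"
    by (cases m) simp_all
  finally show ?case by (simp add: algebra_simps)
qed simp

text \<open>
  Expansion of \<open>polyop\<close> in directions that are sums of the \<open>K s\<close>, when repeated \<open>K s\<close> contribute nothing.
\<close>

fun subset_sum :: "(nat \<Rightarrow> nat) \<Rightarrow> (nat \<Rightarrow> 'v) \<Rightarrow> ('v list \<Rightarrow> real) \<Rightarrow> nat list \<Rightarrow> nat \<Rightarrow> ((nat \<Rightarrow>\<^sub>0 nat) \<Rightarrow> real) \<Rightarrow> 'v list \<Rightarrow> real" where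
  "subset_sum \<tau> K \<mu> [] m g Xs = (if m = 0 then g 0 * \<mu> Xs else 0)"
| "subset_sum \<tau> K \<mu> (s # us) m g Xs = subset_sum \<tau> K \<mu> us m g Xs +
     (if m = 0 then 0 else subset_sum \<tau> K \<mu> us (m - 1) (\<lambda>b. g (b + unit_exp (\<tau> s))) (K s # Xs))"

text \<open>The list is consumed with \<open>polyop_add_rank1\<close>: each \<open>K s\<close> is
  either left out or used once, and then \<open>g\<close> is differentiated in variable
  \<open>\<tau> s\<close>. The factor \<open>fact m\<close> counts the orders in which the chosen
  elements can appear.\<close>

lemma polyop_subset_sum:
  assumes \<mu>: "symm_multilin \<mu>" and K: "\<And>s Xs. s \<in> set us \<Longrightarrow> \<mu> (K s # K s # Xs) = 0" and \<tau>: "\<And>s. s \<in> set us \<Longrightarrow> \<tau> s < n"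
  shows "polyop n \<mu> (\<lambda>i. \<Sum>s\<leftarrow>us. if \<tau> s = i then K s else 0) m g Xs = fact m * subset_sum \<tau> K \<mu> us m g Xs"
  using K \<tau>
proof (induction us arbitrary: m g Xs)
  case Nil
  show ?case by (cases m) (simp_all add: symm_multilin_simps[OF symm_multilin_polyop[OF \<mu>]])
next
  case (Cons s us)
  define a where "a i = (if i = \<tau> s then 1 else 0 :: real)" for i
  let ?H = "\<lambda>i. \<Sum>s\<leftarrow>us. if \<tau> s = i then K s else 0"
  have H: "(\<lambda>i. \<Sum>s\<leftarrow>(s#us). if \<tau> s = i then K s else 0) = (\<lambda>i. ?H i + a i *\<^sub>R K s)"
    by (auto simp: a_def fun_eq_iff add.commute)
  have sh: "shift_sum n a g = (\<lambda>b. g (b + unit_exp (\<tau> s)))"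
    using Cons.prems(2)[of s] by (auto simp: shift_sum_def a_def fun_eq_iff if_distrib[of "\<lambda>x. x * _"] cong: if_cong)
  have IH: "polyop n \<mu> ?H m g Xs = fact m * subset_sum \<tau> K \<mu> us m g Xs" for m g Xs using Cons by auto
  have "polyop n \<mu> (\<lambda>i. ?H i + a i *\<^sub>R K s) m g Xs = polyop n \<mu> ?H m g Xs + real m * polyop n \<mu> ?H (m - 1) (shift_sum n a g) (K s # Xs)"
    by (rule polyop_add_rank1[OF \<mu>]) (use Cons.prems in auto)
  then show ?case unfolding H IH sh by (cases m) (simp_all add: algebra_simps)
qed

text \<open>With \<open>f\<close> supported on one length this is, up to a positive constant, the
  polarization of a product of two homogeneous polynomials in separate variables: each pair gives
  its first component to \<open>l\<close> or its second to \<open>f\<close>.\<close>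

fun split_sum :: "('w list \<Rightarrow> real) \<Rightarrow> ('v list \<Rightarrow> real) \<Rightarrow> ('w \<times> 'v) list \<Rightarrow> 'w list \<Rightarrow> 'v list \<Rightarrow> real" where
  "split_sum l f [] ws hs = l ws * f hs"
| "split_sum l f (z # zs) ws hs = split_sum l f zs (fst z # ws) hs + split_sum l f zs ws (snd z # hs)"

lemma symm_multilin_pr1:
  assumes "symm_multilin l" shows "symm_multilin (\<lambda>ws. split_sum l f zs ws hs)"
proof (induction zs arbitrary: hs)
  case Nil
  then show ?case using symm_multilin_scale[OF assms, of "f hs"] by (simp add: mult.commute)
next
  case (Cons z zs)
  show ?case using symm_multilin_add[OF symm_multilin_Cons[OF Cons] Cons] by simp
qed

lemma symm_multilin_pr2:
  assumes "symm_multilin f" shows "symm_multilin (\<lambda>hs. split_sum l f zs ws hs)"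
proof (induction zs arbitrary: ws)
  case Nil
  then show ?case using symm_multilin_scale[OF assms, of "l ws"] by simp
next
  case (Cons z zs)
  show ?case using symm_multilin_add[OF Cons symm_multilin_Cons[OF Cons]] by simp
qed

lemma symm_multilin_split_sum:
  assumes "symm_multilin l" "symm_multilin f" shows "symm_multilin (\<lambda>zs. split_sum l f zs ws hs)"
  unfolding symm_multilin_def
proof (intro conjI allI impI)
  fix xs ys :: "('a \<times> 'b) list" assume m: "mset xs = mset ys"
  have "(\<lambda>(ws, hs). split_sum l f xs ws hs) (ws, hs) = (\<lambda>(ws, hs). split_sum l f ys ws hs) (ws, hs)"
  proof (rule mset_invariantI[where g = "\<lambda>s zs. (\<lambda>(ws, hs). split_sum l f zs ws hs) s" and s = "(ws, hs)", OF _ _ m])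
    fix x and xs ys :: "('a \<times> 'b) list" and s
    assume "\<And>s. (\<lambda>(ws, hs). split_sum l f xs ws hs) s = (\<lambda>(ws, hs). split_sum l f ys ws hs) s"
    then have "split_sum l f xs ws hs = split_sum l f ys ws hs" for ws hs by (metis case_prod_conv)
    then show "(\<lambda>(ws, hs). split_sum l f (x # xs) ws hs) s = (\<lambda>(ws, hs). split_sum l f (x # ys) ws hs) s" by (simp split: prod.split)
  next
    fix x y :: "'a \<times> 'b" and xs :: "('a \<times> 'b) list" and s
    have "split_sum l f xs (fst y # fst x # ws) hs = split_sum l f xs (fst x # fst y # ws) hs" for ws hs
      by (rule symm_multilin_mset[OF symm_multilin_pr1[OF assms(1)]]) simp
    moreover have "split_sum l f xs ws (snd y # snd x # hs) = split_sum l f xs ws (snd x # snd y # hs)" for ws hs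
      by (rule symm_multilin_mset[OF symm_multilin_pr2[OF assms(2)]]) simp
    ultimately show "(\<lambda>(ws, hs). split_sum l f (x # y # xs) ws hs) s = (\<lambda>(ws, hs). split_sum l f (y # x # xs) ws hs) s"
      by (simp split: prod.split)
  qed
  then show "split_sum l f xs ws hs = split_sum l f ys ws hs" by simp
next
  fix xs
  show "linear (\<lambda>x. split_sum l f (x # xs) ws hs)"
    by (rule linearI) (simp_all add: symm_multilin_simps[OF symm_multilin_pr1[OF assms(1)]] symm_multilin_simps[OF symm_multilin_pr2[OF assms(2)]] algebra_simps)
qed

text \<open>\<open>f\<close> vanishes off length \<open>d\<close>, and the total length
  \<open>k + d\<close> then forces length \<open>k\<close> on the side of \<open>l\<close>; an
  overfull side leaves no admissible distribution.\<close>

lemma split_sum_zero: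
  assumes f: "\<And>hs. length hs \<noteq> d \<Longrightarrow> f hs = 0" and l: "length zs + length ws + length hs = k + d" and "k < length ws \<or> d < length hs"
  shows "split_sum l f zs ws hs = 0"
  using assms(2,3)
proof (induction zs arbitrary: ws hs)
  case Nil
  then have "length hs \<noteq> d" by auto
  then show ?case by (simp add: f)
next
  case (Cons z zs)
  have "split_sum l f zs (fst z # ws) hs = 0" by (rule Cons.IH) (use Cons.prems in auto)
  moreover have "split_sum l f zs ws (snd z # hs) = 0" by (rule Cons.IH) (use Cons.prems in auto)
  ultimately show ?case by simp
qed

lemma split_sum_pos:
  assumes f: "\<And>hs. length hs \<noteq> d \<Longrightarrow> f hs = 0"
    and lp: "\<And>ws. length ws = k \<Longrightarrow> set ws \<subseteq> A \<Longrightarrow> 0 < l ws" and fp: "\<And>hs. length hs = d \<Longrightarrow> set hs \<subseteq> B \<Longrightarrow> 0 < f hs"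
    and "length zs + length ws + length hs = k + d" "length ws \<le> k" "length hs \<le> d"
    "set ws \<subseteq> A" "set hs \<subseteq> B" "set zs \<subseteq> A \<times> B"
  shows "0 < split_sum l f zs ws hs"
  using assms(4-)
proof (induction zs arbitrary: ws hs)
  case Nil
  then show ?case using lp fp by simp
next
  case (Cons z zs)
  have z: "fst z \<in> A" "snd z \<in> B" using Cons.prems by auto
  consider "length ws < k" "length hs < d" | "length ws = k" "length hs < d" | "length ws < k" "length hs = d"
    using Cons.prems by (cases "length ws = k"; cases "length hs = d") auto
  then show ?case
  proof cases
    case 1
    have "0 < split_sum l f zs (fst z # ws) hs" "0 < split_sum l f zs ws (snd z # hs)" using Cons.prems 1 z by (auto intro!: Cons.IH)
    then show ?thesis by simp
  next
    case 2
    have "0 < split_sum l f zs ws (snd z # hs)" using Cons.prems 2 z by (auto intro!: Cons.IH)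
    moreover have "split_sum l f zs (fst z # ws) hs = 0" using Cons.prems 2 by (intro split_sum_zero[where d = d and k = k]) (auto simp: f)
    ultimately show ?thesis by simp
  next
    case 3
    have "0 < split_sum l f zs (fst z # ws) hs" using Cons.prems 3 z by (auto intro!: Cons.IH)
    moreover have "split_sum l f zs ws (snd z # hs) = 0" using Cons.prems 3 by (intro split_sum_zero[where d = d and k = k]) (auto simp: f)
    ultimately show ?thesis by simp
  qed
qed

text \<open>With no pair left, the form is a positive multiple of a form of one factor, a polarized
  product of two linear forms, or 0, depending on the length of \<open>hs\<close>. A further pair is
  split as \<open>(w, 0) + (0, h)\<close> and treated with \<open>lorentz_merge\<close>.\<close>

theorem split_sum_lorentz:
  assumes l: "symm_multilin l" and f: "symm_multilin f" and f0: "\<And>hs. length hs \<noteq> d \<Longrightarrow> f hs = 0"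
    and lp: "\<And>ws. length ws = k \<Longrightarrow> set ws \<subseteq> A \<Longrightarrow> 0 < l ws" and fp: "\<And>hs. length hs = d \<Longrightarrow> set hs \<subseteq> B \<Longrightarrow> 0 < f hs"
    and ll: "\<And>ws. length ws + 2 = k \<Longrightarrow> set ws \<subseteq> A \<Longrightarrow> lorentz UNIV (\<lambda>x y. l (x # y # ws))"
    and fl: "\<And>hs. length hs + 2 = d \<Longrightarrow> set hs \<subseteq> B \<Longrightarrow> lorentz U (\<lambda>x y. f (x # y # hs))"
    and U: "linsub U" and BU: "B \<subseteq> U"
    and "length zs + length ws + length hs + 2 = k + d"
    "set ws \<subseteq> A" "set hs \<subseteq> B" "set zs \<subseteq> A \<times> B"
  shows "lorentz (UNIV \<times> U) (\<lambda>x y. split_sum l f (x # y # zs) ws hs)"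
  using assms(10-)
proof (induction zs arbitrary: ws hs)
  case Nil
  have e: "split_sum l f [x, y] ws hs = l (fst y # fst x # ws) * f hs + l (fst x # ws) * f (snd y # hs) + l (fst y # ws) * f (snd x # hs)
      + l ws * f (snd y # snd x # hs)" for x y
    by simp
  consider "length hs = d" | "length hs + 1 = d" | "length hs + 2 = d" | "d < length hs \<or> length hs + 2 < d" by linarith
  then show ?case
  proof cases
    case 1
    have "lorentz UNIV (\<lambda>x y. l (x # y # ws))" by (rule ll) (use Nil 1 in auto)
    then have L: "lorentz (UNIV \<times> U) (\<lambda>x y. l (fst x # fst y # ws))" by (rule lorentz_pullback) simp
    have eq: "split_sum l f [x, y] ws hs = f hs * l (fst x # fst y # ws)" for x y
      using 1 symm_multilin_mset[OF l, of "fst x # fst y # ws" "fst y # fst x # ws"] unfolding e by (simp add: f0)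
    show ?thesis by (rule lorentz_if_nonneg_cong[OF L fp[OF 1 Nil.prems(3)] eq])
  next
    case 2
    then have eq: "split_sum l f [x, y] ws hs = l (fst x # ws) * f (snd y # hs) + l (fst y # ws) * f (snd x # hs)" for x y
      unfolding e by (simp add: f0)
    show ?thesis unfolding eq by (rule lorentz_rank2)
  next
    case 3
    have "lorentz U (\<lambda>x y. f (x # y # hs))" by (rule fl) (use Nil 3 in auto)
    then have L: "lorentz (UNIV \<times> U) (\<lambda>x y. f (snd x # snd y # hs))" by (rule lorentz_pullback) auto
    have eq: "split_sum l f [x, y] ws hs = l ws * f (snd x # snd y # hs)" for x y
      using 3 symm_multilin_mset[OF f, of "snd x # snd y # hs" "snd y # snd x # hs"] unfolding e by (simp add: f0)
    have "0 < l ws" by (rule lp) (use Nil 3 in auto)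
    then show ?thesis by (rule lorentz_if_nonneg_cong[OF L _ eq])
  next
    case 4
    then have "split_sum l f [x, y] ws hs = 0" for x y unfolding e by (auto simp: f0)
    then show ?thesis by simp
  qed
next
  case (Cons z zs)
  obtain w h where z: "z = (w, h)" by (cases z)
  have wh: "w \<in> A" "h \<in> B" using Cons.prems z by auto
  let ?T = "\<lambda>x y z. split_sum l f (x # y # z # zs) ws hs"
  let ?W = "(w, 0)" and ?H = "(0, h)"
  have T: "symm_trilin ?T" by (rule symm_trilin_symm_multilin[OF symm_multilin_split_sum[OF l f]])
  have U2: "linsub (UNIV \<times> U)" using U by (simp add: subspace_Times)
  have zW: "z = ?W + ?H" by (simp add: z)
  have move: "?T x y v = split_sum l f (v # x # y # zs) ws hs" for x y v
    by (rule symm_multilin_mset[OF symm_multilin_split_sum[OF l f]]) simp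
  note z1 = symm_multilin_simps(4)[OF symm_multilin_pr1[OF l, where f = f]] and z2 = symm_multilin_simps(4)[OF symm_multilin_pr2[OF f, where l = l]]
  have z1': "split_sum l f zs (a # 0 # ws) hs = 0" "split_sum l f zs (a # b # 0 # ws) hs = 0" for a b zs hs ws
    using z1 symm_multilin_mset[OF symm_multilin_pr1[OF l, where f = f], of "a # 0 # ws" "0 # a # ws"] symm_multilin_mset[OF symm_multilin_pr1[OF l, where f = f], of "a # b # 0 # ws" "0 # a # b # ws"] by auto
  have z2': "split_sum l f zs ws (a # 0 # hs) = 0" "split_sum l f zs ws (a # b # 0 # hs) = 0" for a b zs hs ws
    using z2 symm_multilin_mset[OF symm_multilin_pr2[OF f, where l = l], of "a # 0 # hs" "0 # a # hs"] symm_multilin_mset[OF symm_multilin_pr2[OF f, where l = l], of "a # b # 0 # hs" "0 # a # b # hs"] by auto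
  have TW: "?T x y ?W = split_sum l f (x # y # zs) (w # ws) hs" for x y
  proof -
    have "?T x y ?W = split_sum l f (?W # x # y # zs) ws hs" by (rule move)
    also have "\<dots> = split_sum l f (x # y # zs) (w # ws) hs + split_sum l f (x # y # zs) ws (0 # hs)"
      by (subst split_sum.simps(2)) (simp only: fst_conv snd_conv)
    finally show ?thesis by (simp only: z2 add_0_right)
  qed
  have TH: "?T x y ?H = split_sum l f (x # y # zs) ws (h # hs)" for x y
  proof -
    have "?T x y ?H = split_sum l f (?H # x # y # zs) ws hs" by (rule move)
    also have "\<dots> = split_sum l f (x # y # zs) (0 # ws) hs + split_sum l f (x # y # zs) ws (h # hs)"
      by (subst split_sum.simps(2)) (simp only: fst_conv snd_conv)
    finally show ?thesis by (simp only: z1 add_0_left)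
  qed
  have lW: "lorentz (UNIV \<times> U) (\<lambda>x y. ?T x y ?W)" unfolding TW using Cons.prems wh by (intro Cons.IH) auto
  have lH: "lorentz (UNIV \<times> U) (\<lambda>x y. ?T x y ?H)" unfolding TH using Cons.prems wh by (intro Cons.IH) auto
  have nn: "0 \<le> split_sum l f zs ws' hs'" if "length zs + length ws' + length hs' = k + d" "set ws' \<subseteq> A" "set hs' \<subseteq> B" for ws' hs'
  proof (cases "length ws' \<le> k \<and> length hs' \<le> d")
    case True
    have "0 < split_sum l f zs ws' hs'" using True that Cons.prems by (intro split_sum_pos[OF f0 lp fp]) auto
    then show ?thesis by simp
  next
    case False
    then have "split_sum l f zs ws' hs' = 0" by (intro split_sum_zero[OF f0 that(1)]) auto
    then show ?thesis by simp
  qed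
  have v: "?T ?W ?W ?W = split_sum l f zs (w # w # w # ws) hs" "?T ?W ?W ?H = split_sum l f zs (w # w # ws) (h # hs)"
    "?T ?W ?H ?H = split_sum l f zs (w # ws) (h # h # hs)" "?T ?H ?H ?H = split_sum l f zs ws (h # h # h # hs)"
    by (simp_all add: z1 z2 z1' z2')
  have len: "length zs + length ws + length hs + 3 = k + d" using Cons.prems by simp
  have "lorentz (UNIV \<times> U) (\<lambda>x y. ?T x y (?W + ?H))"
  proof -
    \<comment> \<open>If one factor has no place left, its half of the pair contributes a zero
      slice.\<close>
    consider "k \<le> length ws" | "d \<le> length hs" | "length ws < k" "length hs < d" by linarith
    then show ?thesis
    proof cases
      case 1
      then have "?T x y ?W = 0" for x y unfolding TW using len by (intro split_sum_zero[OF f0, where k = k]) auto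
      then have eq: "?T x y (?W + ?H) = ?T x y ?H" for x y using symm_trilin_simps(3)[OF T] by (metis add_0)
      show ?thesis unfolding eq by (rule lH)
    next
      case 2
      then have "?T x y ?H = 0" for x y unfolding TH using len by (intro split_sum_zero[OF f0, where k = k]) auto
      then have eq: "?T x y (?W + ?H) = ?T x y ?W" for x y using symm_trilin_simps(3)[OF T] by (metis add.right_neutral)
      show ?thesis unfolding eq by (rule lW)
    next
      case 3
      have "0 < ?T ?W ?W ?H + ?T ?W ?H ?H"
      \<comment> \<open>Either two more \<open>w\<close> fit, or only one does and then two more
        \<open>h\<close> fit, since the total length leaves room for three vectors.\<close>
      proof (cases "length ws + 2 \<le> k")
        case True
        have "0 < ?T ?W ?W ?H" unfolding v using True 3 len wh Cons.prems by (intro split_sum_pos[OF f0 lp fp]) auto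
        moreover have "0 \<le> ?T ?W ?H ?H" unfolding v using len wh Cons.prems by (intro nn) auto
        ultimately show ?thesis by linarith
      next
        case False
        have "0 < ?T ?W ?H ?H" unfolding v using False 3 len wh Cons.prems by (intro split_sum_pos[OF f0 lp fp]) auto
        moreover have "0 \<le> ?T ?W ?W ?H" unfolding v using len wh Cons.prems by (intro nn) auto
        ultimately show ?thesis by linarith
      qed
      moreover have "0 \<le> ?T ?W ?W ?W" "0 \<le> ?T ?W ?W ?H" "0 \<le> ?T ?W ?H ?H" "0 \<le> ?T ?H ?H ?H"
        unfolding v using len wh Cons.prems by (auto intro!: nn)
      moreover have "?W \<in> UNIV \<times> U" "?H \<in> UNIV \<times> U" using wh BU U subspace_0 by auto
      ultimately show ?thesis by (intro lorentz_merge[OF T U2 _ _ lW lH])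
    qed
  qed
  then show ?case by (simp only: zW)
qed

section \<open>Pairing the polarized dual with the polarized determinant\<close>

lemma polar_prod_wrong_length: "finite J \<Longrightarrow> card J \<noteq> length Xs \<Longrightarrow> polar_prod p Xs J = 0"
proof (induction Xs arbitrary: J)
  case (Cons X Xs)
  have "polar_prod p Xs (J - {j}) = 0" if "j \<in> J" for j
  proof (rule Cons.IH)
    have "Suc (card (J - {j})) = card J" by (rule card_Suc_Diff1[OF Cons.prems(1) that])
    then show "card (J - {j}) \<noteq> length Xs" using Cons.prems(2) by (metis length_Cons)
  qed (use Cons.prems in simp)
  then show ?case by simp
qed auto

lemma polar_det_wrong_length: "length Xs \<noteq> d \<Longrightarrow> polar_det d Xs = 0"
  by (simp add: polar_det_def polar_prod_wrong_length)

lemma polar_det_rank1_twice: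
  assumes R: "inverse_pair d S R" and c: "\<And>Xs. length Xs = d \<Longrightarrow> polar_det d (map (congr_mat d S) Xs) = c * polar_det d Xs" and i: "i < d"
  shows "polar_det d (congr_mat d S (diag_unit i) # congr_mat d S (diag_unit i) # Xs) = 0"
proof (cases "length Xs + 2 = d")
  case True
  then obtain d' where d: "d = Suc d'" by (cases d) auto
  have "polar_det d (congr_mat d S (diag_unit i) # congr_mat d S (diag_unit i) # Xs) = polar_det d (map (congr_mat d S) (diag_unit i # diag_unit i # map (congr_mat d R) Xs))"
    by (rule polar_det_cong) (auto simp: list_all2_map2 list_all2_same congr_mat_inverse_pair[OF R])
  also have "\<dots> = c * polar_det d (diag_unit i # diag_unit i # map (congr_mat d R) Xs)" using True by (intro c) simp
  also have "polar_det d (diag_unit i # diag_unit i # map (congr_mat d R) Xs) = 0" unfolding d using True i d by (intro polar_det_diag_unit_twice) auto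
  finally show ?thesis by simp
qed (simp add: polar_det_wrong_length)

lemma polyop_polar_det_cong:
  assumes "\<And>i a b. i < n \<Longrightarrow> a < d \<Longrightarrow> b < d \<Longrightarrow> H i a b = H' i a b"
    and "list_all2 (\<lambda>X Y. \<forall>i<d. \<forall>j<d. X i j = Y i j) Xs Ys"
  shows "polyop n (polar_det d) H m g Xs = polyop n (polar_det d) H' m g Ys"
  using assms(2)
proof (induction m arbitrary: g Xs Ys)
  case 0
  then show ?case using polar_det_cong by simp
next
  case (Suc m)
  then show ?case using assms(1) by (auto intro!: sum.cong Suc.IH)
qed


lemma sum_unit_exp_squarefree_exp:
  assumes "distinct ss" "set ss \<subseteq> {..<M}"
  shows "squarefree_exp M (\<Sum>s\<leftarrow>ss. unit_exp s) \<and> zero_set M (\<Sum>s\<leftarrow>ss. unit_exp s) = {..<M} - set ss"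
  using assms
proof (induction ss)
  case (Cons s ss)
  then have "squarefree_exp M (\<Sum>s\<leftarrow>ss. unit_exp s)" "zero_set M (\<Sum>s\<leftarrow>ss. unit_exp s) = {..<M} - set ss" by auto
  then show ?case using Cons.prems by (auto simp: squarefree_exp_add zero_set_add add.commute[of "unit_exp s"])
qed simp

lemma contract_map_unit_fun: "(\<And>s. s \<in> set ss \<Longrightarrow> s < M) \<Longrightarrow> contract M F (map unit_fun ss) b = F (b + (\<Sum>s\<leftarrow>ss. unit_exp s))"
  by (induction ss arbitrary: b) (simp_all add: ac_simps del: contract.simps(2))

text \<open>The indices handed to the polarized side form a squarefree exponent. Its complement,
  which for empty \<open>ss\<close> consists of the indices handed to the determinant and of those
  outside \<open>us\<close>, is where \<open>g\<close> is read. This is why the polarization is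
  defined through complements.\<close>

lemma split_sum_subset_sum:
  assumes "distinct (ss @ us)" "set (ss @ us) \<subseteq> {..<M}" "length hs + q = d"
  shows "split_sum (\<lambda>ws. contract M (polarized M \<tau> g) ws 0) (polar_det d) (map (\<lambda>s. (unit_fun s, K s)) us) (map unit_fun ss) hs
    = subset_sum \<tau> K (polar_det d) us q (\<lambda>b. g (b + type_sum \<tau> ({..<M} - set ss - set us))) hs"
  using assms
proof (induction us arbitrary: ss hs q)
  case Nil
  show ?case
  proof (cases "q = 0")
    case True
    have "contract M (polarized M \<tau> g) (map unit_fun ss) 0 = g (type_sum \<tau> ({..<M} - set ss))"
      using Nil sum_unit_exp_squarefree_exp[of ss M] by (subst contract_map_unit_fun) (auto simp: polarized_alt)
    then show ?thesis using True by simp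
  next
    case False
    then show ?thesis using Nil by (simp add: polar_det_wrong_length)
  qed
next
  case (Cons s us)
  let ?l = "\<lambda>ws. contract M (polarized M \<tau> g) ws 0" and ?zs = "map (\<lambda>s. (unit_fun s, K s)) us"
  have e1: "split_sum ?l (polar_det d) ?zs (map unit_fun (s # ss)) hs = subset_sum \<tau> K (polar_det d) us q (\<lambda>b. g (b + type_sum \<tau> ({..<M} - set ss - set (s # us)))) hs"
  proof -
    have "{..<M} - set (s # ss) - set us = {..<M} - set ss - set (s # us)" by auto
    then show ?thesis using Cons.IH[of "s # ss" hs q] Cons.prems by simp
  qed
  have e2: "split_sum ?l (polar_det d) ?zs (map unit_fun ss) (K s # hs) = (if q = 0 then 0 else
      subset_sum \<tau> K (polar_det d) us (q - 1) (\<lambda>b. g (b + unit_exp (\<tau> s) + type_sum \<tau> ({..<M} - set ss - set (s # us)))) (K s # hs))"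
  proof (cases "q = 0")
    case True
    have "split_sum ?l (polar_det d) ?zs (map unit_fun ss) hs' = 0" if "length hs' > d" for ss :: "nat list" and hs'
    proof -
      have "length ?zs + length (map unit_fun ss) + length hs' = (length us + length ss + (length hs' - d)) + d" using that by simp
      note l = this
      show ?thesis
        by (rule split_sum_zero[where d = d and k = "length us + length ss + (length hs' - d)"])
          (use that l polar_det_wrong_length in simp_all)
    qed
    then show ?thesis using True Cons.prems by simp
  next
    case False
    define B where "B = {..<M} - set ss - set (s # us)"
    have A: "{..<M} - set ss - set us = insert s B" using Cons.prems by (auto simp: B_def)
    have "s \<notin> B" "finite B" by (simp_all add: B_def)
    then have eq: "type_sum \<tau> ({..<M} - set ss - set us) = unit_exp (\<tau> s) + type_sum \<tau> ({..<M} - set ss - set (s # us))"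
      unfolding A B_def[symmetric] using type_sum_insert[of B s \<tau>] by (simp add: add.commute)
    have "split_sum ?l (polar_det d) ?zs (map unit_fun ss) (K s # hs) = subset_sum \<tau> K (polar_det d) us (q - 1) (\<lambda>b. g (b + type_sum \<tau> ({..<M} - set ss - set us))) (K s # hs)"
    proof (rule Cons.IH)
      show "distinct (ss @ us)" "set (ss @ us) \<subseteq> {..<M}" using Cons.prems(1,2) by simp_all
      show "length (K s # hs) + (q - 1) = d" using Cons.prems(3) False by simp
    qed
    then show ?thesis unfolding eq using False by (simp only: add.assoc if_False)
  qed
  show ?case using e1 e2 by simp
qed

lemma posdef_perturb:
  assumes "inverse_pair d S R" "i < d" "0 < (e::real)" shows "posdef d (congr_mat d S (diag_unit i) + e *\<^sub>R id_entries d)"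
  unfolding posdef_def
proof (intro conjI allI impI)
  show "congr_mat d S (diag_unit i) + e *\<^sub>R id_entries d \<in> herm_set d"
    by (intro subspace_add[OF subspace_herm_set] subspace_scale[OF subspace_herm_set] congr_mat_herm_set) simp_all
  fix v :: "nat \<Rightarrow> complex" assume "\<exists>i<d. v i \<noteq> 0"
  then obtain j where j: "j < d" "v j \<noteq> 0" by blast
  have q1: "quad_form d (diag_unit i) w = cnj (w i) * w i" for w
  proof -
    have "quad_form d (diag_unit i) w = (\<Sum>a<d. if a = i then cnj (w a) * w i else 0)"
    proof -
      have "cnj (w a) * diag_unit i a b * w b = (if b = i then (if a = i then cnj (w a) * w i else 0) else 0)" for a b
        by (simp add: diag_unit_def)
      then show ?thesis unfolding quad_form_def using assms by simp
    qed
    then show ?thesis using assms by simp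
  qed
  have q2: "quad_form d (id_entries d) v = (\<Sum>a<d. cnj (v a) * v a)"
  proof -
    have "cnj (v a) * id_entries d a b * v b = (if b = a then (if a < d then cnj (v a) * v a else 0) else 0)" for a b
      by (simp add: id_entries_apply)
    then show ?thesis unfolding quad_form_def by simp
  qed
  have "quad_form d (congr_mat d S (diag_unit i) + e *\<^sub>R id_entries d) v = quad_form d (congr_mat d S (diag_unit i)) v + of_real e * quad_form d (id_entries d) v"
    unfolding quad_form_def by (simp add: sum.distrib sum_distrib_left algebra_simps scaleR_conv_of_real)
  then have "Re (quad_form d (congr_mat d S (diag_unit i) + e *\<^sub>R id_entries d) v) = (cmod (\<Sum>j<d. S i j * v j))\<^sup>2 + e * (\<Sum>a<d. (cmod (v a))\<^sup>2)"
  proof -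
    have c: "cnj z * z = complex_of_real ((cmod z)\<^sup>2)" for z by (metis complex_norm_square mult.commute)
    assume "quad_form d (congr_mat d S (diag_unit i) + e *\<^sub>R id_entries d) v = quad_form d (congr_mat d S (diag_unit i)) v + of_real e * quad_form d (id_entries d) v"
    then show ?thesis unfolding quad_form_congr_mat q1 q2 c by (simp only: plus_complex.sel Re_of_real_mult Re_complex_of_real Re_sum)
  qed
  moreover have "0 < (\<Sum>a<d. (cmod (v a))\<^sup>2)"
    by (rule sum_pos2[of _ j]) (use j in auto)
  ultimately show "0 < Re (quad_form d (congr_mat d S (diag_unit i) + e *\<^sub>R id_entries d) v)" using assms by (simp add: add_nonneg_pos)
qed

text \<open>Each \<open>H i\<close> is cut into \<open>d = m + 2\<close> rank-one pieces
  \<open>K s\<close>, with \<open>s\<close> in the block \<open>s div d = i\<close>. In terms of the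
  pieces the operator is a product of two Lorentzian forms, the polarized dual and the polarized
  determinant, at the pairs \<open>(unit_fun s, K s)\<close>. These are limits of pairs of a
  positive vector and a positive definite matrix.\<close>

theorem polyop_lorentz:
  assumes g0: "\<And>a. 0 \<le> g a" and g: "\<And>a. supported n a \<Longrightarrow> exp_degree n a = m \<Longrightarrow> 0 < g a"
    and loc: "local_lorentz (n * (m + 2)) (\<lambda>s. s div (m + 2)) m g" and H: "\<And>i. i < n \<Longrightarrow> posdef (m + 2) (H i)" and n: "0 < n"
  shows "lorentz (herm_set (m + 2)) (\<lambda>x y. polyop n (polar_det (m + 2)) H m g [x, y])"
proof -
  define d where "d = m + 2"
  define M where "M = n * d"
  define \<tau> where "\<tau> s = s div d" for s
  have d0: "0 < d" by (simp add: d_def)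
  have \<tau>: "\<tau> s < n" if "s < M" for s using that by (simp add: \<tau>_def M_def less_mult_imp_div_less)
  have "\<exists>S. \<forall>i<n. \<exists>R c. inverse_pair d (S i) R \<and> (\<forall>a b. a < d \<longrightarrow> b < d \<longrightarrow> H i a b = congr_mat d (S i) (id_entries d) a b)
      \<and> (\<forall>Xs. length Xs = d \<longrightarrow> polar_det d (map (congr_mat d (S i)) Xs) = c * polar_det d Xs)"
  proof (rule choice, rule allI)
    fix i
    show "\<exists>S. i < n \<longrightarrow> (\<exists>R c. inverse_pair d S R \<and> (\<forall>a b. a < d \<longrightarrow> b < d \<longrightarrow> H i a b = congr_mat d S (id_entries d) a b)
      \<and> (\<forall>Xs. length Xs = d \<longrightarrow> polar_det d (map (congr_mat d S) Xs) = c * polar_det d Xs))"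
    proof (cases "i < n")
      case True
      then have "posdef d (H i)" using H by (simp add: d_def)
      from posdef_frame[OF this] show ?thesis by metis
    qed simp
  qed
  then obtain S where S: "\<And>i. i < n \<Longrightarrow> \<exists>R c. inverse_pair d (S i) R \<and> (\<forall>a b. a < d \<longrightarrow> b < d \<longrightarrow> H i a b = congr_mat d (S i) (id_entries d) a b)
      \<and> (\<forall>Xs. length Xs = d \<longrightarrow> polar_det d (map (congr_mat d (S i)) Xs) = c * polar_det d Xs)" by blast
  define K where "K s = congr_mat d (S (\<tau> s)) (diag_unit (s mod d))" for s
  define us where "us = [0..<M]"
  have us: "distinct us" "set us = {..<M}" "length us = M" by (auto simp: us_def)
  have KK: "polar_det d (K s # K s # Xs) = 0" if "s \<in> set us" for s Xs
  proof -
    have "\<tau> s < n" using that us \<tau> by simp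
    from S[OF this] d0 show ?thesis unfolding K_def by (metis polar_det_rank1_twice mod_less_divisor)
  qed
  have HK: "(\<Sum>s\<leftarrow>us. if \<tau> s = i then K s else 0) = congr_mat d (S i) (id_entries d)" if i: "i < n" for i
  proof -
    let ?f = "\<lambda>s. if \<tau> s = i then K s else 0"
    have "(\<Sum>s\<leftarrow>us. ?f s) = (\<Sum>s<n * d. ?f s)"
      by (simp add: us_def M_def interv_sum_list_conv_sum_set_nat atLeast0LessThan)
    also have "\<dots> = (\<Sum>j<n. sum ?f {j * d..<j * d + d})" by (rule sum.nat_group[symmetric])
    also have "\<dots> = (\<Sum>j<n. if j = i then \<Sum>k<d. congr_mat d (S i) (diag_unit k) else 0)"
    proof (rule sum.cong[OF refl])
      fix j
      have "sum ?f {j * d..<j * d + d} = (\<Sum>k<d. ?f (k + j * d))"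
        using sum.shift_bounds_nat_ivl[of ?f 0 "j * d" d] by (simp only: add.commute[of _ "j * d"] atLeast0LessThan add_0_right)
      also have "\<dots> = (\<Sum>k<d. if j = i then congr_mat d (S i) (diag_unit k) else 0)"
        by (intro sum.cong refl) (auto simp: \<tau>_def K_def)
      finally show "sum ?f {j * d..<j * d + d} = (if j = i then \<Sum>k<d. congr_mat d (S i) (diag_unit k) else 0)" by simp
    qed
    also have "\<dots> = congr_mat d (S i) (id_entries d)" using i unfolding id_entries_def by (simp add: linear_sum[OF linear_congr_mat])
    finally show ?thesis .
  qed
  let ?f = "polarized M \<tau> g"
  let ?l = "\<lambda>ws. contract M ?f ws 0"
  define k where "k = M - m"
  have Mm: "m + 2 \<le> M" using mult_le_mono1[of 1 n "m + 2"] n by (simp add: M_def d_def)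
  let ?A = "{w :: nat \<Rightarrow> real. \<forall>i<M. 0 < w i}" and ?B = "{h. posdef d h}"
  have main: "lorentz (UNIV \<times> herm_set d) (\<lambda>x y. split_sum ?l (polar_det d) (x # y # zs) [] [])" if "length zs = M" "set zs \<subseteq> ?A \<times> ?B" for zs
  proof (rule split_sum_lorentz[OF symm_multilin_contract symm_multilin_polar_det polar_det_wrong_length, where k = k and A = ?A and B = ?B])
    show "0 < contract M ?f ws 0" if "length ws = k" "set ws \<subseteq> ?A" for ws
      by (rule polarized_pos[OF g0 g, where m = m and n = n]) (use that \<tau> Mm k_def in auto)
    show "0 < polar_det d hs" if "length hs = d" "set hs \<subseteq> ?B" for hs using that by (intro polar_det_pos) auto
    show "lorentz UNIV (\<lambda>x y. contract M ?f (x # y # ws) 0)" if "length ws + 2 = k" "set ws \<subseteq> ?A" for ws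
    proof (rule polarized_lorentz[OF g0 g, where m = m and n = n])
      show "local_lorentz M \<tau> m g" using loc by (simp add: M_def d_def \<tau>_def[abs_def])
    qed (use that \<tau> Mm k_def in auto)
    show "lorentz (herm_set d) (\<lambda>x y. polar_det d (x # y # hs))" if "length hs + 2 = d" "set hs \<subseteq> ?B" for hs
      using that by (intro polar_det_lorentz) auto
    show "?B \<subseteq> herm_set d" by (auto simp: posdef_def)
    show "length zs + length ([] :: (nat \<Rightarrow> real) list) + length ([] :: (nat \<Rightarrow> nat \<Rightarrow> complex) list) + 2 = k + d"
      using that Mm by (simp add: k_def d_def)
  qed (use that in auto)
  let ?pt = "\<lambda>e s. (unit_fun s, K s) + e *\<^sub>R (\<lambda>i. 1, id_entries d)"
  have lim: "lorentz (UNIV \<times> herm_set d) (\<lambda>x y. split_sum ?l (polar_det d) (x # y # map (\<lambda>s. (unit_fun s, K s)) us) [] [])"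
  proof (rule lorentz_limit[where F = "at_right (0::real)" and B = "\<lambda>e x y. split_sum ?l (polar_det d) (x # y # map (?pt e) us) [] []"])
    fix x y
    note sp = symm_multilin_split_sum[OF symm_multilin_contract symm_multilin_polar_det]
    have mv: "split_sum ?l (polar_det d) (x # y # zs) [] [] = split_sum ?l (polar_det d) (zs @ [x, y]) [] []" for zs
      by (rule symm_multilin_mset[OF sp]) (simp add: add_mset_commute)
    show "((\<lambda>e. split_sum ?l (polar_det d) (x # y # map (?pt e) us) [] []) \<longlongrightarrow> split_sum ?l (polar_det d) (x # y # map (\<lambda>s. (unit_fun s, K s)) us) [] []) (at_right 0)"
      unfolding mv by (rule symm_multilin_tendsto[OF sp]) (simp add: tendsto_ident_at)
    show "\<forall>\<^sub>F e in at_right 0. lorentz (UNIV \<times> herm_set d) (\<lambda>x y. split_sum ?l (polar_det d) (x # y # map (?pt e) us) [] [])"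
      using eventually_at_right_less[of 0]
    proof eventually_elim
      case (elim e)
      show ?case
      proof (rule main)
        have "posdef d (K s + e *\<^sub>R id_entries d)" if "s < M" for s
        proof -
          from S[OF \<tau>[OF that]] obtain R where "inverse_pair d (S (\<tau> s)) R" by blast
          then show ?thesis unfolding K_def using d0 elim by (intro posdef_perturb) auto
        qed
        moreover have "0 < (unit_fun s + e *\<^sub>R (\<lambda>i. 1)) i" for s i using elim by (simp add: unit_fun_def)
        ultimately show "set (map (?pt e) us) \<subseteq> ?A \<times> ?B" using us by auto
      qed (simp add: us)
    qed
  qed simp
  have p: "linear (\<lambda>X. (0, X) :: (nat \<Rightarrow> real) \<times> (nat \<Rightarrow> nat \<Rightarrow> complex))" by (rule linearI) auto
  have "lorentz (herm_set d) (\<lambda>x y. split_sum ?l (polar_det d) ((0, x) # (0, y) # map (\<lambda>s. (unit_fun s, K s)) us) [] [])"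
    by (rule lorentz_pullback[OF lim]) simp
  moreover have "polyop n (polar_det d) H m g [x, y] = fact m * split_sum ?l (polar_det d) ((0, x) # (0, y) # map (\<lambda>s. (unit_fun s, K s)) us) [] []" for x y
  proof -
    have z: "split_sum ?l (polar_det d) zs (0 # ws) hs = 0" "split_sum ?l (polar_det d) zs (a # 0 # ws) hs = 0" for zs ws hs a
      using symm_multilin_simps(4)[OF symm_multilin_pr1[OF symm_multilin_contract, where f = "polar_det d"]]
        symm_multilin_mset[OF symm_multilin_pr1[OF symm_multilin_contract, where f = "polar_det d"], of "a # 0 # ws" "0 # a # ws"] by auto
    have "polyop n (polar_det d) H m g [x, y] = polyop n (polar_det d) (\<lambda>i. \<Sum>s\<leftarrow>us. if \<tau> s = i then K s else 0) m g [x, y]"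
      by (rule polyop_polar_det_cong) (use HK S in auto)
    also have "\<dots> = fact m * subset_sum \<tau> K (polar_det d) us m g [x, y]"
      by (rule polyop_subset_sum[OF symm_multilin_polar_det KK]) (use us \<tau> in auto)
    also have "subset_sum \<tau> K (polar_det d) us m g [x, y] = split_sum ?l (polar_det d) (map (\<lambda>s. (unit_fun s, K s)) us) [] [x, y]"
      using split_sum_subset_sum[of "[]" us M "[x, y]" m d \<tau> g K] us by (simp add: d_def type_sum_def)
    also have "\<dots> = split_sum ?l (polar_det d) (map (\<lambda>s. (unit_fun s, K s)) us) [] [y, x]"
      by (rule symm_multilin_mset[OF symm_multilin_pr2[OF symm_multilin_polar_det]]) simp
    also have "\<dots> = split_sum ?l (polar_det d) ((0, x) # (0, y) # map (\<lambda>s. (unit_fun s, K s)) us) [] []"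
      by (simp add: z)
    finally show ?thesis .
  qed
  ultimately have "lorentz (herm_set d) (\<lambda>x y. polyop n (polar_det d) H m g [x, y])"
    by (intro lorentz_if_nonneg_cong[where c = "fact m" and B' = "\<lambda>x y. polyop n (polar_det d) H m g [x, y]"]) auto
  then show ?thesis by (simp only: d_def)
qed

section \<open>Strictness\<close>

text \<open>The non-strict inequality together with nonnegative coefficients: the property that
  nonnegative derivatives of \<open>g\<close> inherit and that carries the induction.\<close>

definition md_lorentz :: "nat \<Rightarrow> nat \<Rightarrow> ((nat \<Rightarrow>\<^sub>0 nat) \<Rightarrow> real) \<Rightarrow> bool" where
  "md_lorentz n m g \<longleftrightarrow> (\<forall>a. 0 \<le> g a) \<and>
     (\<forall>H. (\<forall>i<n. posdef (m + 2) (H i)) \<longrightarrow> lorentz (herm_set (m + 2)) (\<lambda>x y. polyop n (polar_det (m + 2)) H m g [x, y]))"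

definition nontriv :: "nat \<Rightarrow> nat \<Rightarrow> ((nat \<Rightarrow>\<^sub>0 nat) \<Rightarrow> real) \<Rightarrow> bool" where
  "nontriv n m g \<longleftrightarrow> (\<exists>a. supported n a \<and> exp_degree n a = m \<and> 0 < g a)"

lemma wkD:
  "md_lorentz n m g \<Longrightarrow> (\<And>i. i < n \<Longrightarrow> posdef (m + 2) (H i)) \<Longrightarrow> lorentz (herm_set (m + 2)) (\<lambda>x y. polyop n (polar_det (m + 2)) H m g [x, y])"
  by (simp add: md_lorentz_def)

lemma nontriv_Suc:
  assumes "nontriv n (Suc m) g" obtains i where "i < n" "nontriv n m (\<lambda>b. g (b + unit_exp i))"
proof -
  from assms obtain a where a: "supported n a" "exp_degree n a = Suc m" "0 < g a" by (auto simp: nontriv_def)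
  then obtain i b where "i < n" "a = b + unit_exp i" "supported n b" "exp_degree n b = m" using supported_split by metis
  then show ?thesis using that a by (auto simp: nontriv_def)
qed

lemma polyop_nonneg:
  assumes "\<And>a. 0 \<le> g a" "\<And>i. i < n \<Longrightarrow> H i \<in> A" "\<And>Ys. length Ys = m \<Longrightarrow> set Ys \<subseteq> A \<Longrightarrow> 0 \<le> \<mu> (Ys @ Zs)"
  shows "0 \<le> polyop n \<mu> H m g Zs"
  using assms
proof (induction m arbitrary: g Zs)
  case (Suc m)
  have "0 \<le> polyop n \<mu> H m (\<lambda>b. g (b + unit_exp i)) (H i # Zs)" if "i < n" for i
  proof (rule Suc.IH)
    show "0 \<le> \<mu> (Ys @ H i # Zs)" if "length Ys = m" "set Ys \<subseteq> A" for Ys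
      using Suc.prems(3)[of "Ys @ [H i]"] Suc.prems(2)[OF \<open>i < n\<close>] that by simp
  qed (use Suc.prems in auto)
  then show ?case by (auto intro!: sum_nonneg)
qed (use assms(3)[of "[]"] in simp)

lemma polyop_pos:
  assumes "\<And>a. 0 \<le> g a" "nontriv n m g" "\<And>i. i < n \<Longrightarrow> H i \<in> A" "\<And>Ys. length Ys = m \<Longrightarrow> set Ys \<subseteq> A \<Longrightarrow> 0 < \<mu> (Ys @ Zs)"
  shows "0 < polyop n \<mu> H m g Zs"
  using assms
proof (induction m arbitrary: g Zs)
  case 0
  then have "0 < g 0" by (auto simp: nontriv_def dest: supported_exp_degree_0)
  then show ?case using 0(4)[of "[]"] by simp
next
  case (Suc m)
  from nontriv_Suc[OF Suc.prems(2)] obtain i where i: "i < n" "nontriv n m (\<lambda>b. g (b + unit_exp i))" .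
  have p: "0 < \<mu> (Ys @ H j # Zs)" if "length Ys = m" "set Ys \<subseteq> A" "j < n" for Ys j
    using Suc.prems(4)[of "Ys @ [H j]"] Suc.prems(3)[OF \<open>j < n\<close>] that by simp
  have "0 < polyop n \<mu> H m (\<lambda>b. g (b + unit_exp i)) (H i # Zs)"
    by (rule Suc.IH) (use Suc.prems(1,3) i p in auto)
  moreover have "0 \<le> polyop n \<mu> H m (\<lambda>b. g (b + unit_exp j)) (H j # Zs)" if "j < n" for j
    by (rule polyop_nonneg[where A = A]) (use Suc.prems(1,3) that p in \<open>auto intro: less_imp_le\<close>)
  ultimately show ?case using i by (auto intro!: sum_pos2[of _ i])
qed

lemma polyop_zero_coeffs:
  assumes "\<And>b. supported n b \<Longrightarrow> exp_degree n b = m \<Longrightarrow> g b = 0" shows "polyop n \<mu> H m g Xs = 0"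
  using assms
proof (induction m arbitrary: g Xs)
  case (Suc m)
  have "polyop n \<mu> H m (\<lambda>b. g (b + unit_exp i)) (H i # Xs) = 0" if "i < n" for i
    by (rule Suc.IH) (use that in \<open>auto intro!: Suc.prems simp: exp_degree_add\<close>)
  then show ?case by simp
qed simp

section \<open>The positive definite cone is convex and open\<close>

lemma posdef_add: "posdef d X \<Longrightarrow> posdef d Y \<Longrightarrow> posdef d (X + Y)"
  unfolding posdef_def
proof (intro conjI allI impI)
  assume X: "X \<in> herm_set d \<and> (\<forall>v. (\<exists>i<d. v i \<noteq> 0) \<longrightarrow> 0 < Re (quad_form d X v))"
    and Y: "Y \<in> herm_set d \<and> (\<forall>v. (\<exists>i<d. v i \<noteq> 0) \<longrightarrow> 0 < Re (quad_form d Y v))"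
  show "X + Y \<in> herm_set d" using X Y by (simp add: subspace_add)
  fix v :: "nat \<Rightarrow> complex" assume v: "\<exists>i<d. v i \<noteq> 0"
  have "quad_form d (X + Y) v = quad_form d X v + quad_form d Y v"
    unfolding quad_form_def by (simp add: sum.distrib algebra_simps)
  then show "0 < Re (quad_form d (X + Y) v)" using X Y v by (simp add: add_pos_pos)
qed

lemma posdef_scale: "0 < (c::real) \<Longrightarrow> posdef d X \<Longrightarrow> posdef d (c *\<^sub>R X)"
  unfolding posdef_def
proof (intro conjI allI impI)
  assume c: "0 < c" and X: "X \<in> herm_set d \<and> (\<forall>v. (\<exists>i<d. v i \<noteq> 0) \<longrightarrow> 0 < Re (quad_form d X v))"
  show "c *\<^sub>R X \<in> herm_set d" using X by (simp add: subspace_scale)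
  fix v :: "nat \<Rightarrow> complex" assume v: "\<exists>i<d. v i \<noteq> 0"
  have "quad_form d (c *\<^sub>R X) v = of_real c * quad_form d X v"
    unfolding quad_form_def by (simp add: sum_distrib_left algebra_simps scaleR_conv_of_real)
  then have "Re (quad_form d (c *\<^sub>R X) v) = c * Re (quad_form d X v)" by (simp only: Re_of_real_mult)
  then show "0 < Re (quad_form d (c *\<^sub>R X) v)" using X v c by simp
qed

lemma posdef_cong: "(\<And>i j. i < d \<Longrightarrow> j < d \<Longrightarrow> X i j = Y i j) \<Longrightarrow> posdef d X \<Longrightarrow> posdef d Y"
  unfolding posdef_def
proof (intro conjI allI impI)
  assume e: "\<And>i j. i < d \<Longrightarrow> j < d \<Longrightarrow> X i j = Y i j"
    and X: "X \<in> herm_set d \<and> (\<forall>v. (\<exists>i<d. v i \<noteq> 0) \<longrightarrow> 0 < Re (quad_form d X v))"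
  show "Y \<in> herm_set d" by (rule hsetI) (metis e X hsetD)
  fix v :: "nat \<Rightarrow> complex" assume v: "\<exists>i<d. v i \<noteq> 0"
  have "quad_form d Y v = quad_form d X v" unfolding quad_form_def by (intro sum.cong refl) (simp add: e)
  then show "0 < Re (quad_form d Y v)" using X v by simp
qed

lemma posdef_id_entries [simp]: "posdef d (id_entries d)"
  unfolding posdef_def
proof (intro conjI allI impI)
  fix v :: "nat \<Rightarrow> complex" assume "\<exists>i<d. v i \<noteq> 0"
  then obtain j where j: "j < d" "v j \<noteq> 0" by blast
  have c: "cnj z * z = complex_of_real ((cmod z)\<^sup>2)" for z by (metis complex_norm_square mult.commute)
  have "cnj (v a) * id_entries d a b * v b = (if b = a then (if a < d then complex_of_real ((cmod (v a))\<^sup>2) else 0) else 0)" for a b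
    unfolding c[symmetric] by (simp add: id_entries_apply)
  then have "quad_form d (id_entries d) v = (\<Sum>a<d. complex_of_real ((cmod (v a))\<^sup>2))" unfolding quad_form_def by simp
  then have "Re (quad_form d (id_entries d) v) = (\<Sum>a<d. (cmod (v a))\<^sup>2)" by (simp only: Re_sum Re_complex_of_real)
  then show "0 < Re (quad_form d (id_entries d) v)" using j by (auto intro!: sum_pos2[of _ j])
qed simp

text \<open>The sum \<open>B\<close> of the moduli of the entries bounds the form of
  \<open>Z\<close> by \<open>B * N\<close>, with \<open>N\<close> the squared length of
  \<open>v\<close>; \<open>\<delta>\<close> keeps the perturbation at most half of
  \<open>N\<close>.\<close>

lemma posdef_open_id_entries:
  assumes Z: "Z \<in> herm_set d"
  obtains \<delta> where "0 < \<delta>" "\<And>t::real. \<bar>t\<bar> \<le> \<delta> \<Longrightarrow> posdef d (id_entries d + t *\<^sub>R Z)"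
proof -
  define B where "B = (\<Sum>i<d. \<Sum>j<d. cmod (Z i j))"
  have B0: "0 \<le> B" by (simp add: B_def sum_nonneg)
  define \<delta> where "\<delta> = 1 / (2 * (B + 1))"
  have \<delta>: "0 < \<delta>" using B0 by (simp add: \<delta>_def)
  have "posdef d (id_entries d + t *\<^sub>R Z)" if t: "\<bar>t\<bar> \<le> \<delta>" for t :: real
    unfolding posdef_def
  proof (intro conjI allI impI)
    show "id_entries d + t *\<^sub>R Z \<in> herm_set d" using Z by (simp add: subspace_add subspace_scale)
    fix v :: "nat \<Rightarrow> complex" assume "\<exists>i<d. v i \<noteq> 0"
    then obtain j where j: "j < d" "v j \<noteq> 0" by blast
    define N where "N = (\<Sum>a<d. (cmod (v a))\<^sup>2)"
    have N: "0 < N" unfolding N_def using j by (auto intro!: sum_pos2[of _ j])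
    have c: "cnj z * z = complex_of_real ((cmod z)\<^sup>2)" for z by (metis complex_norm_square mult.commute)
    have "cnj (v a) * id_entries d a b * v b = (if b = a then (if a < d then complex_of_real ((cmod (v a))\<^sup>2) else 0) else 0)" for a b
      unfolding c[symmetric] by (simp add: id_entries_apply)
    then have "quad_form d (id_entries d) v = (\<Sum>a<d. complex_of_real ((cmod (v a))\<^sup>2))" unfolding quad_form_def by simp
    then have 1: "Re (quad_form d (id_entries d) v) = N" by (simp only: Re_sum Re_complex_of_real N_def)
    have "cmod (quad_form d Z v) \<le> (\<Sum>a<d. \<Sum>b<d. cmod (cnj (v a) * Z a b * v b))"
      unfolding quad_form_def by (rule order_trans[OF norm_sum]) (intro sum_mono norm_sum)
    also have "\<dots> \<le> (\<Sum>a<d. \<Sum>b<d. cmod (Z a b) * N)"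
    proof (intro sum_mono)
      fix a b assume ab: "a \<in> {..<d}" "b \<in> {..<d}"
      have "(cmod (v a))\<^sup>2 \<le> N" "(cmod (v b))\<^sup>2 \<le> N" unfolding N_def
        using ab by (auto intro!: member_le_sum[of _ _ "\<lambda>a. (cmod (v a))\<^sup>2"])
      moreover have "2 * (cmod (v a) * cmod (v b)) \<le> (cmod (v a))\<^sup>2 + (cmod (v b))\<^sup>2"
        using sum_squares_bound[of "cmod (v a)" "cmod (v b)"] by simp
      ultimately have "cmod (v a) * cmod (v b) \<le> N" by linarith
      then have "cmod (Z a b) * (cmod (v a) * cmod (v b)) \<le> cmod (Z a b) * N" by (intro mult_left_mono) auto
      then show "cmod (cnj (v a) * Z a b * v b) \<le> cmod (Z a b) * N" by (simp add: norm_mult ac_simps)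
    qed
    also have "\<dots> = B * N" by (simp add: B_def sum_distrib_right)
    finally have 2: "cmod (quad_form d Z v) \<le> B * N" .
    have "\<bar>t * Re (quad_form d Z v)\<bar> \<le> \<delta> * (B * N)"
      unfolding abs_mult using t 2 abs_Re_le_cmod[of "quad_form d Z v"] \<delta> by (intro mult_mono) auto
    also have "\<dots> \<le> N / 2"
    proof -
      have "\<delta> * B \<le> 1 / 2" using B0 by (simp add: \<delta>_def field_simps)
      then have "\<delta> * B * N \<le> 1 / 2 * N" using N by (intro mult_right_mono) auto
      then show ?thesis by simp
    qed
    finally have 3: "\<bar>t * Re (quad_form d Z v)\<bar> \<le> N / 2" .
    have "quad_form d (id_entries d + t *\<^sub>R Z) v = quad_form d (id_entries d) v + of_real t * quad_form d Z v"
      unfolding quad_form_def by (simp add: sum.distrib sum_distrib_left algebra_simps scaleR_conv_of_real)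
    then have "Re (quad_form d (id_entries d + t *\<^sub>R Z) v) = N + t * Re (quad_form d Z v)"
      using 1 by (simp only: plus_complex.sel Re_of_real_mult)
    then show "0 < Re (quad_form d (id_entries d + t *\<^sub>R Z) v)" using 3 N by linarith
  qed
  then show ?thesis using that \<delta> by blast
qed

lemma posdef_open:
  assumes H: "posdef d H" and Z: "Z \<in> herm_set d"
  obtains \<delta> where "0 < \<delta>" "\<And>t::real. \<bar>t\<bar> \<le> \<delta> \<Longrightarrow> posdef d (H + t *\<^sub>R Z)"
proof -
  obtain S R c where f: "inverse_pair d S R" "\<And>i j. i < d \<Longrightarrow> j < d \<Longrightarrow> H i j = congr_mat d S (id_entries d) i j"
    using posdef_frame[OF H] by metis
  have "congr_mat d R Z \<in> herm_set d" using Z by (rule congr_mat_herm_set)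
  then obtain \<delta> where \<delta>: "0 < \<delta>" "\<And>t::real. \<bar>t\<bar> \<le> \<delta> \<Longrightarrow> posdef d (id_entries d + t *\<^sub>R congr_mat d R Z)" using posdef_open_id_entries by metis
  have "posdef d (H + t *\<^sub>R Z)" if "\<bar>t\<bar> \<le> \<delta>" for t
  proof (rule posdef_cong)
    show "posdef d (congr_mat d S (id_entries d + t *\<^sub>R congr_mat d R Z))" using \<delta>(2)[OF that] f(1) by (intro posdef_congr_mat)
    fix i j assume "i < d" "j < d"
    then show "congr_mat d S (id_entries d + t *\<^sub>R congr_mat d R Z) i j = (H + t *\<^sub>R Z) i j"
      using f congr_mat_inverse_pair[OF f(1), of i j Z] by (simp add: linear_add[OF linear_congr_mat] linear_scale[OF linear_congr_mat])
  qed
  then show ?thesis using that \<delta>(1) by blast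
qed

section \<open>Change of frame, compression and differentiation of operators\<close>

lemma polyop_transform:
  assumes R: "inverse_pair d S R" and c: "\<And>Xs. length Xs = d \<Longrightarrow> polar_det d (map (congr_mat d S) Xs) = c * polar_det d Xs"
    and "length Xs + m = d"
  shows "polyop n (polar_det d) H m g Xs = c * polyop n (polar_det d) (\<lambda>i. congr_mat d R (H i)) m g (map (congr_mat d R) Xs)"
  using assms(3)
proof (induction m arbitrary: g Xs)
  case 0
  have "polar_det d Xs = polar_det d (map (congr_mat d S) (map (congr_mat d R) Xs))"
    by (rule polar_det_cong) (auto simp: list_all2_map2 list_all2_same congr_mat_inverse_pair[OF R])
  then show ?case using c[of "map (congr_mat d R) Xs"] 0 by simp
next
  case (Suc m)
  have "polyop n (polar_det d) H m (\<lambda>b. g (b + unit_exp i)) (H i # Xs)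
      = c * polyop n (polar_det d) (\<lambda>i. congr_mat d R (H i)) m (\<lambda>b. g (b + unit_exp i)) (map (congr_mat d R) (H i # Xs))" for i
    using Suc.prems by (intro Suc.IH) simp
  then show ?case by (simp add: sum_distrib_left)
qed

lemma polyop_diag_unit:
  assumes "j < Suc d" "length Ys + length Zs + m = d"
  shows "polyop n (polar_det (Suc d)) H m g (Ys @ diag_unit j # Zs) = polyop n (polar_det d) (\<lambda>i. del_index j (H i)) m g (map (del_index j) (Ys @ Zs))"
  using assms(2)
proof (induction m arbitrary: g Ys)
  case 0
  have "polar_det (Suc d) (Ys @ diag_unit j # Zs) = polar_det (Suc d) (diag_unit j # Ys @ Zs)" by (rule symm_multilin_mset[OF symm_multilin_polar_det]) simp
  then show ?case using polar_det_diag_unit[OF assms(1), of "Ys @ Zs"] 0 by simp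
next
  case (Suc m)
  have "polyop n (polar_det (Suc d)) H m (\<lambda>b. g (b + unit_exp i)) (H i # Ys @ diag_unit j # Zs)
      = polyop n (polar_det d) (\<lambda>i. del_index j (H i)) m (\<lambda>b. g (b + unit_exp i)) (del_index j (H i) # map (del_index j) (Ys @ Zs))" for i
    using Suc.IH[of "H i # Ys" "\<lambda>b. g (b + unit_exp i)"] Suc.prems by simp
  then show ?case by simp
qed

lemma shift_sum_scale: "shift_sum n (\<lambda>i. t * a i) g = (\<lambda>b. t * shift_sum n a g b)"
  by (auto simp: shift_sum_def fun_eq_iff sum_distrib_left ac_simps)

lemma polyop_scale: "polyop n \<mu> H m (\<lambda>b. c * g b) Xs = c * polyop n \<mu> H m g Xs"
  using polyop_sum[of n \<mu> H m "\<lambda>_. c" "\<lambda>_. g" "{()}" Xs] by simp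

text \<open>The matrices get one more diagonal position, with entry \<open>1 + a i / s\<close> in
  the \<open>i\<close>-th. The determinant is affine in it, so \<open>s\<close> times the form is
  \<open>s * ?Q x y + real (Suc m) * ?Q' x y\<close>. As \<open>s\<close> tends to 0 only the
  derivative of \<open>g\<close> remains, and deleting the extra index returns to size
  \<open>d\<close>.\<close>

lemma md_lorentz_shift_sum:
  assumes w: "md_lorentz n (Suc m) g" and a: "\<And>i. i < n \<Longrightarrow> 0 \<le> a i"
  shows "md_lorentz n m (shift_sum n a g)"
  unfolding md_lorentz_def
proof (intro conjI allI impI)
  show "0 \<le> shift_sum n a g b" for b using w a by (auto simp: shift_sum_def md_lorentz_def intro!: sum_nonneg)
  fix H assume H: "\<forall>i<n. posdef (m + 2) (H i)"
  define d where "d = m + 2"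
  define L where "L X = (\<lambda>p q. if p < d \<and> q < d then X p q else 0)" for X :: "nat \<Rightarrow> nat \<Rightarrow> complex"
  have mL: "del_index d (L X) p q = X p q" if "p < d" "q < d" for X p q using that by (simp add: del_index_def L_def)
  have LU: "L X \<in> herm_set (Suc d)" if "X \<in> herm_set d" for X
    by (rule hsetI) (auto simp: L_def intro: hsetD[OF that])
  define Hl where "Hl i = L (H i) + diag_unit d" for i
  have Hl: "posdef (Suc d) (Hl i + t *\<^sub>R diag_unit d)" if i: "i < n" and t: "0 \<le> t" for i t
    unfolding posdef_def
  proof (intro conjI allI impI)
    have h: "posdef d (H i)" using H i by (simp add: d_def)
    then show "Hl i + t *\<^sub>R diag_unit d \<in> herm_set (Suc d)" unfolding Hl_def
      by (intro subspace_add[OF subspace_herm_set] subspace_scale[OF subspace_herm_set] LU diag_unit_herm_set) (simp add: posdef_def)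
    fix v :: "nat \<Rightarrow> complex" assume v: "\<exists>i<Suc d. v i \<noteq> 0"
    have c: "cnj z * z = complex_of_real ((cmod z)\<^sup>2)" for z by (metis complex_norm_square mult.commute)
    have e: "(Hl i + t *\<^sub>R diag_unit d) p q = (if p < d \<and> q < d then H i p q else if p = d \<and> q = d then of_real (1 + t) else 0)" if "p < Suc d" "q < Suc d" for p q
      using that by (auto simp: Hl_def L_def diag_unit_def scaleR_conv_of_real)
    define G where "G = Hl i + t *\<^sub>R diag_unit d"
    have "quad_form (Suc d) G v = quad_form d (H i) v + cnj (v d) * of_real (1 + t) * v d"
      unfolding quad_form_def by (simp add: e[folded G_def])
    then have "quad_form (Suc d) (Hl i + t *\<^sub>R diag_unit d) v = quad_form d (H i) v + cnj (v d) * of_real (1 + t) * v d"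
      by (simp only: G_def)
    also have "cnj (v d) * of_real (1 + t) * v d = of_real ((1 + t) * (cmod (v d))\<^sup>2)"
      unfolding of_real_mult c[symmetric] by simp
    finally have q: "Re (quad_form (Suc d) (Hl i + t *\<^sub>R diag_unit d) v) = Re (quad_form d (H i) v) + (1 + t) * (cmod (v d))\<^sup>2"
      by (simp only: plus_complex.sel Re_complex_of_real)
    show "0 < Re (quad_form (Suc d) (Hl i + t *\<^sub>R diag_unit d) v)"
    proof (cases "\<exists>i<d. v i \<noteq> 0")
      case True
      then have "0 < Re (quad_form d (H i) v)" using h by (simp add: posdef_def)
      then show ?thesis unfolding q using t by (simp add: add_pos_nonneg)
    next
      case False
      then have "quad_form d (H i) v = 0" unfolding quad_form_def by (intro sum.neutral ballI) auto
      moreover have "v d \<noteq> 0" using False v less_Suc_eq by auto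
      ultimately show ?thesis unfolding q using t by (simp add: add_pos_nonneg)
    qed
  qed
  let ?Q = "\<lambda>x y. polyop n (polar_det (Suc d)) Hl (Suc m) g [x, y]"
  let ?Q' = "\<lambda>x y. polyop n (polar_det (Suc d)) Hl m (shift_sum n a g) [diag_unit d, x, y]"
  have "lorentz (herm_set (Suc d)) (\<lambda>x y. real (Suc m) * ?Q' x y)"
  proof (rule lorentz_limit[where F = "at_right (0::real)" and B = "\<lambda>s x y. s * ?Q x y + real (Suc m) * ?Q' x y"])
    fix x y
    have "((\<lambda>s. s * ?Q x y + real (Suc m) * ?Q' x y) \<longlongrightarrow> 0 * ?Q x y + real (Suc m) * ?Q' x y) (at_right 0)"
      by (intro tendsto_intros tendsto_ident_at)
    then show "((\<lambda>s. s * ?Q x y + real (Suc m) * ?Q' x y) \<longlongrightarrow> real (Suc m) * ?Q' x y) (at_right 0)" by simp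
    show "\<forall>\<^sub>F s in at_right 0. lorentz (herm_set (Suc d)) (\<lambda>x y. s * ?Q x y + real (Suc m) * ?Q' x y)"
      using eventually_at_right_less[of 0]
    proof eventually_elim
      case (elim s)
      define b where "b i = 1 / s * a i" for i
      have "posdef (Suc m + 2) (Hl i + b i *\<^sub>R diag_unit d)" if "i < n" for i
        using Hl[OF that, of "b i"] a[OF that] elim by (simp add: b_def d_def)
      then have "lorentz (herm_set (Suc m + 2)) (\<lambda>x y. polyop n (polar_det (Suc m + 2)) (\<lambda>i. Hl i + b i *\<^sub>R diag_unit d) (Suc m) g [x, y])"
        by (rule wkD[OF w])
      moreover have "polyop n (polar_det (Suc d)) (\<lambda>i. Hl i + b i *\<^sub>R diag_unit d) (Suc m) g [x, y]
         = ?Q x y + real (Suc m) * (1 / s * ?Q' x y)" for x y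
      proof -
        have "polar_det (Suc d) (diag_unit d # diag_unit d # Xs) = 0" for Xs
          by (cases "length Xs + 1 = d") (simp_all add: polar_det_diag_unit_twice polar_det_wrong_length)
        from polyop_add_rank1[OF symm_multilin_polar_det this, of n Hl b "Suc m" g "[x, y]"]
        have "polyop n (polar_det (Suc d)) (\<lambda>i. Hl i + b i *\<^sub>R diag_unit d) (Suc m) g [x, y]
            = ?Q x y + real (Suc m) * polyop n (polar_det (Suc d)) Hl m (shift_sum n b g) [diag_unit d, x, y]" by (simp only: diff_Suc_1)
        moreover have "shift_sum n b g = (\<lambda>c. 1 / s * shift_sum n a g c)" unfolding b_def[abs_def] by (rule shift_sum_scale)
        ultimately show ?thesis by (simp only: polyop_scale)
      qed
      ultimately have L0: "lorentz (herm_set (Suc d)) (\<lambda>x y. ?Q x y + real (Suc m) * (1 / s * ?Q' x y))" by (simp add: d_def del: polyop.simps)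
      have eq: "s * ?Q x y + real (Suc m) * ?Q' x y = s * (?Q x y + real (Suc m) * (1 / s * ?Q' x y))" for x y
      proof -
        have "s * u + r * v = s * (u + r * (1 / s * v))" for u r v using elim by (simp add: field_simps)
        then show ?thesis .
      qed
      show ?case by (rule lorentz_if_nonneg_cong[OF L0 elim eq])
    qed
  qed simp
  then have "lorentz (herm_set d) (\<lambda>x y. real (Suc m) * ?Q' (L x) (L y))"
    by (rule lorentz_pullback) (rule LU)
  moreover have "?Q' (L x) (L y) = polyop n (polar_det d) H m (shift_sum n a g) [x, y]" for x y
  proof -
    have "?Q' (L x) (L y) = polyop n (polar_det d) (\<lambda>i. del_index d (Hl i)) m (shift_sum n a g) (map (del_index d) [L x, L y])"
      using polyop_diag_unit[of d d "[]" "[L x, L y]" m n Hl "shift_sum n a g"] by (simp add: d_def)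
    also have "\<dots> = polyop n (polar_det d) H m (shift_sum n a g) [x, y]"
    proof (rule polyop_polar_det_cong)
      show "del_index d (Hl i) p q = H i p q" if "p < d" "q < d" for i p q
        using that by (simp add: Hl_def del_index_def L_def diag_unit_def)
    qed (simp add: mL)
    finally show ?thesis .
  qed
  ultimately have L1: "lorentz (herm_set d) (\<lambda>x y. real (Suc m) * polyop n (polar_det d) H m (shift_sum n a g) [x, y])" by simp
  have "lorentz (herm_set d) (\<lambda>x y. polyop n (polar_det d) H m (shift_sum n a g) [x, y])"
    by (rule lorentz_if_nonneg_cong[OF L1, of "1 / real (Suc m)"]) simp_all
  then show "lorentz (herm_set (m + 2)) (\<lambda>x y. polyop n (polar_det (m + 2)) H m (shift_sum n a g) [x, y])" by (simp only: d_def)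
qed


lemma polyop_unit_direction:
  assumes "i < n"
  shows "polyop n \<mu> H m (shift_sum n (\<lambda>j. if j = i then 1 else 0) g) Xs = polyop n \<mu> H m (\<lambda>b. g (b + unit_exp i)) Xs"
proof -
  have "shift_sum n (\<lambda>j. if j = i then 1 else 0) g = (\<lambda>b. g (b + unit_exp i))"
    using assms by (auto simp: shift_sum_def fun_eq_iff if_distrib[of "\<lambda>x. x * _"] cong: if_cong)
  then show ?thesis by simp
qed

text \<open>Moving \<open>H i\<close> along \<open>K\<close> changes the form to
  \<open>q0 + t q1\<close>, which stays Lorentzian for small \<open>t\<close> of either sign. At a
  null vector \<open>X\<close> orthogonal to \<open>P\<close>, the left side of the inequality is of
  first order in \<open>t\<close> and the right side of second order, so \<open>q1 X X\<close> has
  to vanish.\<close>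

lemma null_second_derivative:
  assumes w: "md_lorentz n (Suc m) g" and H: "\<And>i. i < n \<Longrightarrow> posdef (m + 3) (H i)" and P: "P \<in> herm_set (m + 3)" and X: "X \<in> herm_set (m + 3)"
    and o: "polyop n (polar_det (m + 3)) H (Suc m) g [X, P] = 0" and z: "polyop n (polar_det (m + 3)) H (Suc m) g [X, X] = 0"
    and PP: "0 < polyop n (polar_det (m + 3)) H (Suc m) g [P, P]"
    and K: "\<And>Xs. polar_det (m + 3) (K # K # Xs) = 0" "K \<in> herm_set (m + 3)" and i: "i < n"
  shows "polyop n (polar_det (m + 3)) H m (\<lambda>b. g (b + unit_exp i)) [K, X, X] = 0"
proof -
  let ?G = "\<lambda>H m. polyop n (polar_det (m + 3)) H m"
  let ?\<phi> = "polar_det (m + 3)"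
  define a where "a j = (if j = i then 1 else 0 :: real)" for j
  define q0 where "q0 x y = polyop n ?\<phi> H (Suc m) g [x, y]" for x y
  define q1 where "q1 x y = real (Suc m) * polyop n ?\<phi> H m (\<lambda>b. g (b + unit_exp i)) [K, x, y]" for x y
  have q: "polyop n ?\<phi> (\<lambda>j. H j + (t * a j) *\<^sub>R K) (Suc m) g [x, y] = q0 x y + t * q1 x y" for t x y
    using polyop_add_rank1[OF symm_multilin_polar_det K(1), of n H "\<lambda>j. t * a j" "Suc m" g "[x, y]"]
      polyop_unit_direction[OF i, of ?\<phi> H m g "[K, x, y]"]
    by (simp only: q0_def q1_def diff_Suc_1 shift_sum_scale polyop_scale a_def) (simp add: mult.left_commute)
  obtain \<delta> where \<delta>: "0 < \<delta>" "\<And>t::real. \<bar>t\<bar> \<le> \<delta> \<Longrightarrow> posdef (m + 3) (H i + t *\<^sub>R K)"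
    using posdef_open[OF H[OF i] K(2)] by metis
  have c0: "0 < q0 P P" using PP by (simp add: q0_def)
  have ineq: "(t * q1 X X) * (q0 P P + t * q1 P P) \<le> (t * q1 X P)\<^sup>2" if t: "\<bar>t\<bar> \<le> \<delta>" "0 < q0 P P + t * q1 P P" for t
  proof -
    let ?H = "\<lambda>j. H j + (t * a j) *\<^sub>R K"
    have "posdef (Suc m + 2) (?H j)" if "j < n" for j
      using H[OF that] \<delta>(2)[OF t(1)] by (cases "j = i") (simp_all add: a_def eval_nat_numeral)
    then have "lorentz (herm_set (Suc m + 2)) (\<lambda>x y. polyop n (polar_det (Suc m + 2)) ?H (Suc m) g [x, y])"
      by (rule wkD[OF w])
    then have "lorentz (herm_set (m + 3)) (\<lambda>x y. q0 x y + t * q1 x y)"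
      unfolding q[symmetric] by (simp add: eval_nat_numeral del: polyop.simps)
    from lorD[where B = "\<lambda>x y. q0 x y + t * q1 x y", OF this P X t(2)] show ?thesis using o z by (simp add: q0_def)
  qed
  have "q1 X X = 0"
  proof (rule ccontr)
    assume n: "q1 X X \<noteq> 0"
    \<comment> \<open>For \<open>t\<close> up to \<open>e\<close> the value at \<open>P\<close>
      stays at least half of \<open>q0 P P\<close>; the smaller bound \<open>r\<close> makes the
      second-order right side lose against the first-order left side.\<close>
    define e where "e = min \<delta> (q0 P P / (2 * (\<bar>q1 P P\<bar> + 1)))"
    have e: "0 < e" "e \<le> \<delta>" using \<delta>(1) c0 by (auto simp: e_def)
    have eq: "e * (2 * (\<bar>q1 P P\<bar> + 1)) \<le> q0 P P"
    proof -
      have "e \<le> q0 P P / (2 * (\<bar>q1 P P\<bar> + 1))" by (simp add: e_def)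
      then show ?thesis by (subst (asm) pos_le_divide_eq) auto
    qed
    define r where "r = min e (q0 P P * \<bar>q1 X X\<bar> / (2 * ((q1 X P)\<^sup>2 + 1)) / 2)"
    have "0 < 2 * ((q1 X P)\<^sup>2 + 1)" by (simp add: add_nonneg_pos)
    then have "0 < q0 P P * \<bar>q1 X X\<bar> / (2 * ((q1 X P)\<^sup>2 + 1)) / 2"
      using c0 n by (intro divide_pos_pos mult_pos_pos) auto
    then have r: "0 < r" "r \<le> e" using e unfolding r_def by linarith+
    have r2: "r * (2 * (2 * ((q1 X P)\<^sup>2 + 1))) \<le> q0 P P * \<bar>q1 X X\<bar>"
    proof -
      have "r \<le> q0 P P * \<bar>q1 X X\<bar> / (2 * ((q1 X P)\<^sup>2 + 1)) / 2" by (simp add: r_def)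
      then have "r * 2 \<le> q0 P P * \<bar>q1 X X\<bar> / (2 * ((q1 X P)\<^sup>2 + 1))" by (subst (asm) pos_le_divide_eq) auto
      then have "r * 2 * (2 * ((q1 X P)\<^sup>2 + 1)) \<le> q0 P P * \<bar>q1 X X\<bar>"
        by (subst (asm) pos_le_divide_eq) (auto simp: add_nonneg_pos)
      then show ?thesis by (simp only: mult.assoc)
    qed
    \<comment> \<open>The sign is chosen to make the left side of \<open>ineq\<close>
      positive.\<close>
    define t where "t = sgn (q1 X X) * r"
    have ta: "\<bar>t\<bar> = r" using n r by (simp add: t_def abs_mult abs_sgn_eq)
    have tq: "t * q1 X X = r * \<bar>q1 X X\<bar>" by (simp add: t_def abs_sgn ac_simps)
    have half: "q0 P P \<le> 2 * (q0 P P + t * q1 P P)"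
    proof -
      have "\<bar>t * q1 P P\<bar> \<le> e * (\<bar>q1 P P\<bar> + 1)"
        unfolding abs_mult ta using r e by (intro mult_mono) auto
      then show ?thesis using eq by (simp add: algebra_simps abs_le_iff)
    qed
    then have "0 < q0 P P + t * q1 P P" using c0 by simp
    from ineq[OF _ this] have 1: "(r * \<bar>q1 X X\<bar>) * (q0 P P + t * q1 P P) \<le> (t * q1 X P)\<^sup>2"
      using ta r e by (simp add: tq)
    have "(t * q1 X P)\<^sup>2 = r\<^sup>2 * (q1 X P)\<^sup>2" by (metis ta power2_abs power_mult_distrib)
    then have 2: "r * (\<bar>q1 X X\<bar> * (q0 P P + t * q1 P P)) \<le> r * (r * (q1 X P)\<^sup>2)"
      using 1 by (simp only: power2_eq_square[of r] mult.assoc)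
    then have "\<bar>q1 X X\<bar> * (q0 P P + t * q1 P P) \<le> r * (q1 X P)\<^sup>2"
      using r by (simp only: mult_le_cancel_left_pos)
    moreover have "\<bar>q1 X X\<bar> * q0 P P \<le> 2 * (\<bar>q1 X X\<bar> * (q0 P P + t * q1 P P))"
      using mult_left_mono[OF half, of "\<bar>q1 X X\<bar>"] by (simp only: mult.left_commute abs_ge_zero)
    ultimately have "\<bar>q1 X X\<bar> * q0 P P \<le> 2 * (r * (q1 X P)\<^sup>2)" by linarith
    moreover have "4 * (r * (q1 X P)\<^sup>2) + 4 * r \<le> \<bar>q1 X X\<bar> * q0 P P" using r2 by (simp add: algebra_simps)
    moreover have "0 \<le> r * (q1 X P)\<^sup>2" using r by simp
    ultimately show False using r by linarith
  qed
  then show ?thesis by (simp add: q1_def)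
qed

text \<open>Among three indices one differs from both \<open>p\<close> and \<open>q\<close>, and
  deleting it keeps the entry. Size 2 has no such index and is the base of the induction.\<close>

lemma del_index_zero_all:
  assumes d: "3 \<le> Suc d" and z: "\<And>j p q. j < Suc d \<Longrightarrow> p < d \<Longrightarrow> q < d \<Longrightarrow> del_index j X p q = 0" and "p < Suc d" "q < Suc d"
  shows "X p q = 0"
proof -
  have "card ({0, 1, 2} - {p, q}) \<noteq> 0"
  proof -
    have "card {0, 1, 2 :: nat} - card {p, q} \<le> card ({0, 1, 2} - {p, q})" by (rule diff_card_le_card_Diff) simp
    moreover have "card {p, q} \<le> 2" by (simp add: card_insert_if)
    moreover have "card {0, 1, 2 :: nat} = 3" by simp
    ultimately show ?thesis by linarith
  qed
  then have "{0, 1, 2} - {p, q} \<noteq> {}" by (metis card.empty)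
  then obtain j where j: "j \<in> {0, 1, 2}" "j \<noteq> p" "j \<noteq> q" by blast
  then have jd: "j < Suc d" using d by auto
  have s: "shft j a < d" "(if shft j a < j then shft j a else Suc (shft j a)) = a" if "a < Suc d" "a \<noteq> j" for a
    using that jd by (auto simp: shft_def)
  have "del_index j X (shft j p) (shft j q) = X p q" unfolding del_index_def using s assms(3,4) j by simp
  then show ?thesis using z[OF jd, of "shft j p" "shft j q"] s assms(3,4) j by simp
qed


text \<open>
  The form obtained by fixing one extra positive definite direction \<open>Z\<close> is Lorentzian because all
  its compressions are. A vector that is null for all rank-one directions and orthogonal to a
  positive vector then lies in the kernel of every compression.
\<close>

lemma strict_step:
  assumes IH: "\<And>H P X. (\<And>i. i < n \<Longrightarrow> posdef (m + 2) (H i)) \<Longrightarrow> posdef (m + 2) P \<Longrightarrow> X \<in> herm_set (m + 2) \<Longrightarrow>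
      polyop n (polar_det (m + 2)) H m g [X, P] = 0 \<Longrightarrow> 0 \<le> polyop n (polar_det (m + 2)) H m g [X, X] \<Longrightarrow> (\<forall>p<m+2. \<forall>q<m+2. X p q = 0)"
    and w: "md_lorentz n m g" and g: "nontriv n m g"
    and H: "\<And>i. i < n \<Longrightarrow> posdef (m + 3) (H i)" and P: "posdef (m + 3) P" and Z: "posdef (m + 3) Z" and X: "X \<in> herm_set (m + 3)"
    and null: "\<And>S R c j. inverse_pair (m + 3) S R \<Longrightarrow> (\<And>Xs. length Xs = m + 3 \<Longrightarrow> polar_det (m + 3) (map (congr_mat (m + 3) S) Xs) = c * polar_det (m + 3) Xs) \<Longrightarrow> j < m + 3 \<Longrightarrow>
       polyop n (polar_det (m + 3)) H m g [congr_mat (m + 3) S (diag_unit j), X, X] = 0"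
    and o: "polyop n (polar_det (m + 3)) H m g [Z, X, P] = 0"
  shows "\<forall>p<m+3. \<forall>q<m+3. X p q = 0"
proof -
  define d' where "d' = m + 2"
  define d where "d = Suc d'"
  have dm: "m + 3 = d" "m + 2 = d'" by (simp_all add: d_def d'_def)
  note H = H[unfolded dm] and P = P[unfolded dm] and Z = Z[unfolded dm] and X = X[unfolded dm] and null = null[unfolded dm] and o = o[unfolded dm]
    and IH = IH[unfolded dm]
  obtain S R c where f: "inverse_pair d S R" "0 < c" "\<And>i j. i < d \<Longrightarrow> j < d \<Longrightarrow> Z i j = congr_mat d S (id_entries d) i j"
    "\<And>Xs. length Xs = d \<Longrightarrow> polar_det d (map (congr_mat d S) Xs) = c * polar_det d Xs" using posdef_frame[OF Z] by blast
  have fR: "inverse_pair d R S" by (rule inverse_pair_sym[OF f(1)])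
  have g0: "0 \<le> g a" for a using w by (simp add: md_lorentz_def)
  define H' where "H' i = congr_mat d R (H i)" for i
  have H': "posdef d (H' i)" if "i < n" for i unfolding H'_def by (rule posdef_congr_mat[OF fR H[OF that]])
  define X' where "X' = congr_mat d R X"
  define P' where "P' = congr_mat d R P"
  have P': "posdef d P'" unfolding P'_def by (rule posdef_congr_mat[OF fR P])
  have X': "X' \<in> herm_set d" unfolding X'_def by (rule congr_mat_herm_set[OF X])
  define T where "T x y z = polyop n (polar_det d) H' m g [x, y, z]" for x y z
  have T: "symm_trilin T" unfolding T_def[abs_def] by (rule symm_trilin_symm_multilin[OF symm_multilin_polyop[OF symm_multilin_polar_det]])
  have tr: "polyop n (polar_det d) H m g [x, y, z] = c * T (congr_mat d R x) (congr_mat d R y) (congr_mat d R z)" for x y z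
    unfolding T_def H'_def[abs_def] using polyop_transform[OF f(1,4), of "[x, y, z]" m n H g] by (simp add: d_def d'_def)
  have RZ: "congr_mat d R Z i j = id_entries d i j" if "i < d" "j < d" for i j
  proof -
    have "congr_mat d R Z i j = congr_mat d R (congr_mat d S (id_entries d)) i j" unfolding congr_mat_def[of d R] using f(3) by simp
    then show ?thesis using congr_mat_inverse_pair[OF fR that] by simp
  qed
  have RE: "congr_mat d R (congr_mat d S (diag_unit k)) i j = diag_unit k i j" if "i < d" "j < d" for i j k by (rule congr_mat_inverse_pair[OF fR that])
  have Tcong: "T x y z = T x' y' z'" if "\<And>i j. i < d \<Longrightarrow> j < d \<Longrightarrow> x i j = x' i j \<and> y i j = y' i j \<and> z i j = z' i j" for x y z x' y' z'
    unfolding T_def by (rule polyop_polar_det_cong) (use that in auto)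
  have TX: "T X' X' (diag_unit j) = 0" if "j < d" for j
  proof -
    have "c * T (congr_mat d R (congr_mat d S (diag_unit j))) X' X' = 0" unfolding X'_def tr[symmetric] by (rule null[OF f(1,4) that])
    moreover have "T (congr_mat d R (congr_mat d S (diag_unit j))) X' X' = T (diag_unit j) X' X'" by (rule Tcong) (simp add: RE)
    ultimately show ?thesis using f(2) symm_trilin_sym(3)[OF T] by (metis less_irrefl mult_eq_0_iff)
  qed
  have To: "T X' P' (id_entries d) = 0"
  proof -
    have "c * T (congr_mat d R Z) X' P' = 0" unfolding X'_def P'_def tr[symmetric] by (rule o)
    moreover have "T (congr_mat d R Z) X' P' = T (id_entries d) X' P'" by (rule Tcong) (simp add: RZ)
    ultimately have "T (id_entries d) X' P' = 0" using f(2) by simp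
    then show ?thesis using symm_trilin_sym[OF T] by metis
  qed
  have gp: "0 < polyop n (polar_det d) H' m g Zs" if "\<And>Ys. length Ys = m \<Longrightarrow> set Ys \<subseteq> {Y. posdef d Y} \<Longrightarrow> 0 < polar_det d (Ys @ Zs)" for Zs
    by (rule polyop_pos[where A = "{Y. posdef d Y}"]) (use g0 g H' that in auto)
  define Hj where "Hj j i = del_index j (H' i)" for j i
  have Hj: "posdef d' (Hj j i)" if "j < d" "i < n" for j i using del_index_posdef[of j d' "H' i"] H'[OF that(2)] that by (simp add: Hj_def d_def)
  have TE: "T x y (diag_unit j) = polyop n (polar_det d') (Hj j) m g [del_index j x, del_index j y]" if "j < d" for x y j
    using polyop_diag_unit[of j d' "[x, y]" "[]" m n H' g] that by (simp add: T_def Hj_def[abs_def] d_def d'_def)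
  have lT: "lorentz (herm_set d) (\<lambda>x y. T x y (id_entries d))"
  proof (rule herm_lorentz[OF T])
    show "3 \<le> d" by (simp add: d_def d'_def)
    show "lorentz (herm_set d) (\<lambda>x y. T x y (diag_unit j))" if j: "j < d" for j
    proof -
      have "lorentz (herm_set d') (\<lambda>x y. polyop n (polar_det d') (Hj j) m g [x, y])"
        unfolding dm(2)[symmetric] by (rule wkD[OF w]) (use Hj j dm in simp)
      then have "lorentz (herm_set d) (\<lambda>x y. polyop n (polar_det d') (Hj j) m g [del_index j x, del_index j y])"
        by (rule lorentz_pullback) (use j del_index_herm_set in \<open>simp add: d_def\<close>)
      then show ?thesis unfolding TE[OF j] .
    qed
    show "T (diag_unit i) (diag_unit i) (diag_unit j) = 0" if "i < d" "j < d" for i j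
    proof -
      have "polar_det d (Ys @ [diag_unit i, diag_unit i, diag_unit j]) = 0" for Ys
      proof -
        have "polar_det d (Ys @ [diag_unit i, diag_unit i, diag_unit j]) = polar_det d (diag_unit i # diag_unit i # diag_unit j # Ys)" by (rule symm_multilin_mset[OF symm_multilin_polar_det]) simp
        also have "\<dots> = 0" by (cases "length Ys + 2 = d'") (use that in \<open>simp_all add: polar_det_diag_unit_twice polar_det_wrong_length d_def\<close>)
        finally show ?thesis .
      qed
      from polyop_zero[where Ys = "[]" and Zs = "[diag_unit i, diag_unit i, diag_unit j]" and \<mu> = "polar_det d", OF this] show ?thesis by (simp add: T_def)
    qed
    show "0 < T (diag_unit i) (diag_unit j) (diag_unit k)" if "i < d" "j < d" "k < d" "i \<noteq> j" "i \<noteq> k" "j \<noteq> k" for i j k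
      unfolding T_def
    proof (rule gp)
      fix Ys assume Ys: "length Ys = m" "set Ys \<subseteq> {Y. posdef d Y}"
      have "0 < polar_det d (map diag_unit [i, j, k] @ Ys)" by (rule polar_det_diag_unit_pos) (use that Ys in \<open>auto simp: d_def d'_def\<close>)
      also have "polar_det d (map diag_unit [i, j, k] @ Ys) = polar_det d (Ys @ [diag_unit i, diag_unit j, diag_unit k])" by (rule symm_multilin_mset[OF symm_multilin_polar_det]) simp
      finally show "0 < polar_det d (Ys @ [diag_unit i, diag_unit j, diag_unit k])" .
    qed
  qed
  have TXX: "T X' X' (id_entries d) = 0"
  proof -
    have l: "linear (T X' X')" using T by (simp add: symm_trilin_def)
    show ?thesis unfolding id_entries_def by (simp add: linear_sum[OF l] TX)
  qed
  have TPP: "0 < T P' P' (id_entries d)" unfolding T_def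
    by (rule gp, rule polar_det_pos) (use P' in \<open>auto simp: d_def d'_def\<close>)
  have ker: "T X' y (id_entries d) = 0" if "y \<in> herm_set d" for y
    by (rule lorentz_ker[OF symm_trilin_symm_bilin(1)[OF T] subspace_herm_set lT _ TPP X' To _ that]) (use P' TXX in \<open>auto simp: posdef_def\<close>)
  have mz: "del_index j X' p q = 0" if j: "j < d" and pq: "p < d'" "q < d'" for j p q
  proof -
    \<comment> \<open>Testing the kernel with \<open>diag_unit j\<close> says that the compression
      of \<open>X'\<close> is orthogonal to the compressed identity, the positive definite matrix
      that the induction hypothesis asks for.\<close>
    have "T X' (id_entries d) (diag_unit j) = 0" using ker[of "diag_unit j"] symm_trilin_sym(2)[OF T] by simp
    then have 1: "polyop n (polar_det d') (Hj j) m g [del_index j X', del_index j (id_entries d)] = 0" unfolding TE[OF j] .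
    have 2: "polyop n (polar_det d') (Hj j) m g [del_index j X', del_index j X'] = 0" using TX[OF j] unfolding TE[OF j] .
    have "\<forall>p<d'. \<forall>q<d'. del_index j X' p q = 0"
    proof (rule IH)
      show "posdef d' (Hj j i)" if "i < n" for i by (rule Hj[OF j that])
      show "posdef d' (del_index j (id_entries d))" unfolding d_def by (rule del_index_posdef) (use j in \<open>simp_all add: d_def\<close>)
      show "del_index j X' \<in> herm_set d'" by (rule del_index_herm_set) (use j X' in \<open>simp_all add: d_def\<close>)
    qed (use 1 2 in simp_all)
    then show ?thesis using pq by blast
  qed
  have X0: "X' p q = 0" if "p < d" "q < d" for p q
    by (rule del_index_zero_all[of d' X']) (use mz that in \<open>auto simp: d_def d'_def\<close>)
  have "X p q = 0" if "p < d" "q < d" for p q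
  proof -
    have "X p q = congr_mat d S X' p q" unfolding X'_def by (rule congr_mat_inverse_pair[OF f(1) that, symmetric])
    also have "\<dots> = 0" unfolding congr_mat_def using X0 by simp
    finally show ?thesis .
  qed
  then show ?thesis unfolding dm by blast
qed


lemma polar_det_transform:
  assumes R: "inverse_pair d S R" and c: "\<And>Xs. length Xs = d \<Longrightarrow> polar_det d (map (congr_mat d S) Xs) = c * polar_det d Xs" and l: "length Xs = d"
  shows "polar_det d Xs = c * polar_det d (map (congr_mat d R) Xs)"
proof -
  have "polar_det d Xs = polar_det d (map (congr_mat d S) (map (congr_mat d R) Xs))"
    by (rule polar_det_cong) (auto simp: list_all2_map2 list_all2_same congr_mat_inverse_pair[OF R])
  then show ?thesis using c[of "map (congr_mat d R) Xs"] l by simp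
qed

lemma strict_2:
  assumes P: "posdef 2 P" and X: "X \<in> herm_set 2" and o: "polar_det 2 [X, P] = 0" and nn: "0 \<le> polar_det 2 [X, X]" and pq: "p < 2" "q < 2"
  shows "X p q = 0"
proof -
  obtain S R c where f: "inverse_pair 2 S R" "0 < c" "\<And>i j. i < 2 \<Longrightarrow> j < 2 \<Longrightarrow> P i j = congr_mat 2 S (id_entries 2) i j"
    "\<And>Xs. length Xs = 2 \<Longrightarrow> polar_det 2 (map (congr_mat 2 S) Xs) = c * polar_det 2 Xs" using posdef_frame[OF P] by blast
  have fR: "inverse_pair 2 R S" by (rule inverse_pair_sym[OF f(1)])
  define X' where "X' = congr_mat 2 R X"
  have X': "X' \<in> herm_set 2" unfolding X'_def by (rule congr_mat_herm_set[OF X])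
  have "polar_det 2 [X, P] = c * polar_det 2 [X', id_entries 2]"
    using polar_det_frame[OF f(1,3,4), of "[X]" "[]"] by (simp add: X'_def)
  then have o': "polar_det 2 [X', id_entries 2] = 0" using o f(2) by simp
  have "polar_det 2 [X, X] = c * polar_det 2 [X', X']" using polar_det_transform[OF f(1,4), of "[X, X]"] by (simp add: X'_def)
  then have "0 \<le> polar_det 2 [X', X']" using nn f(2) by (simp add: zero_le_mult_iff)
  then have "polar_det 2 [X', X'] = 0" using polar_det_2_strict(1)[OF X' o'] by simp
  then have X0: "X' a b = 0" if "a < 2" "b < 2" for a b using polar_det_2_strict(2)[OF X' o'] that by blast
  have "X p q = congr_mat 2 S X' p q" unfolding X'_def by (rule congr_mat_inverse_pair[OF f(1) pq, symmetric])
  also have "\<dots> = 0" unfolding congr_mat_def using X0 by simp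
  finally show ?thesis .
qed

text \<open>Turns a change of sign of a linear function on a convex cone into a zero at a positive
  combination.\<close>

lemma crossing:
  fixes u v :: real
  assumes "u * v < 0" obtains s t where "0 < s" "0 < t" "s * u + t * v = 0"
proof (cases "u < 0")
  case True
  then have "0 < v" using assms by (simp add: mult_less_0_iff)
  then show ?thesis using that[of v "- u"] True by simp
next
  case False
  then have "0 < u" "v < 0" using assms by (auto simp: mult_less_0_iff)
  then show ?thesis using that[of "- v" u] by simp
qed

text \<open>The pairing of \<open>X\<close> and \<open>P\<close> is the sum over \<open>i\<close> of
  \<open>s (e i) (H i)\<close>. If \<open>X\<close> is nonzero on the block,
  \<open>strict_step\<close> shows \<open>s a Z \<noteq> 0\<close> for positive definite
  \<open>Z\<close> and nonnegative \<open>a\<close> with nontrivial derivative. By convexity the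
  nontrivial terms have a common sign, so the sum is not 0.\<close>

theorem md_lorentz_strict:
  assumes "md_lorentz n m g" "nontriv n m g" "\<And>i. i < n \<Longrightarrow> posdef (m + 2) (H i)" "posdef (m + 2) P" "X \<in> herm_set (m + 2)"
    "polyop n (polar_det (m + 2)) H m g [X, P] = 0" "0 \<le> polyop n (polar_det (m + 2)) H m g [X, X]"
  shows "\<forall>p<m+2. \<forall>q<m+2. X p q = 0"
  using assms
proof (induction m arbitrary: g H P X)
  case 0
  then have "0 < g 0" by (auto simp: nontriv_def dest: supported_exp_degree_0)
  moreover have "g 0 * polar_det 2 [X, P] = 0" "0 \<le> g 0 * polar_det 2 [X, X]" using 0(6,7) by (simp_all add: numeral_2_eq_2)
  ultimately have "polar_det 2 [X, P] = 0" "0 \<le> polar_det 2 [X, X]" by (simp_all add: zero_le_mult_iff)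
  then show ?case using strict_2[of P X] 0(4,5) by (simp add: numeral_2_eq_2)
next
  case (Suc m)
  have m3: "Suc m + 2 = m + 3" by simp
  note w = Suc.prems(1) and H = Suc.prems(3)[unfolded m3] and P = Suc.prems(4)[unfolded m3] and X = Suc.prems(5)[unfolded m3]
    and o = Suc.prems(6)[unfolded m3] and nn = Suc.prems(7)[unfolded m3]
  have g0: "0 \<le> g a" for a using w by (simp add: md_lorentz_def)
  have PU: "P \<in> herm_set (m + 3)" using P by (simp add: posdef_def)
  let ?G = "polyop n (polar_det (m + 3)) H"
  define s where "s a Z = ?G m (shift_sum n a g) [Z, X, P]" for a Z
  have lQ: "lorentz (herm_set (m + 3)) (\<lambda>x y. ?G (Suc m) g [x, y])"
    unfolding m3[symmetric] by (rule wkD[OF w]) (use Suc.prems(3) in simp)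
  have PP: "0 < ?G (Suc m) g [P, P]"
    by (rule polyop_pos[where A = "{Y. posdef (m + 3) Y}"]) (use g0 Suc.prems(2) H P in \<open>auto intro!: polar_det_pos\<close>)
  have XX: "?G (Suc m) g [X, X] = 0"
    using lorD_orth[where B = "\<lambda>x y. ?G (Suc m) g [x, y]", OF lQ PU X PP o] nn by linarith
  show ?case
  proof (rule ccontr)
    assume not0: "\<not> ?case"
    \<comment> \<open>The rank-one directions of a frame are admissible in
      \<open>null_second_derivative\<close>, since a repeated one annihilates the
      determinant.\<close>
    have null: "?G m (shift_sum n a g) [congr_mat (m + 3) S (diag_unit j), X, X] = 0"
      if S: "inverse_pair (m + 3) S R" "\<And>Xs. length Xs = m + 3 \<Longrightarrow> polar_det (m + 3) (map (congr_mat (m + 3) S) Xs) = c * polar_det (m + 3) Xs" "j < m + 3" for a S R c j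
      unfolding polyop_shift_sum
    proof (rule sum.neutral, rule ballI)
      fix i assume "i \<in> {..<n}"
      then have i: "i < n" by simp
      have "?G m (\<lambda>b. g (b + unit_exp i)) [congr_mat (m + 3) S (diag_unit j), X, X] = 0"
        by (rule null_second_derivative[OF w H PU X o XX PP _ _ i])
          (simp_all add: polar_det_rank1_twice[OF S] congr_mat_herm_set)
      then show "a i * ?G m (\<lambda>b. g (b + unit_exp i)) [congr_mat (m + 3) S (diag_unit j), X, X] = 0" by simp
    qed
    have sn: "s a Z \<noteq> 0" if a: "\<And>i. i < n \<Longrightarrow> 0 \<le> a i" and nza: "nontriv n m (shift_sum n a g)" and Z: "posdef (m + 3) Z" for a Z
    proof
      assume "s a Z = 0"
      then have z: "?G m (shift_sum n a g) [Z, X, P] = 0" by (simp only: s_def)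
      have wa: "md_lorentz n m (shift_sum n a g)" using w a by (rule md_lorentz_shift_sum)
      have "\<forall>p<m+3. \<forall>q<m+3. X p q = 0"
      proof (rule strict_step[OF _ wa nza H P Z X _ z])
        show "\<forall>p<m+2. \<forall>q<m+2. Y p q = 0"
          if "\<And>i. i < n \<Longrightarrow> posdef (m + 2) (H' i)" "posdef (m + 2) P'" "Y \<in> herm_set (m + 2)"
            "polyop n (polar_det (m + 2)) H' m (shift_sum n a g) [Y, P'] = 0" "0 \<le> polyop n (polar_det (m + 2)) H' m (shift_sum n a g) [Y, Y]" for H' P' Y
          by (rule Suc.IH[OF wa nza that])
        show "?G m (shift_sum n a g) [congr_mat (m + 3) S (diag_unit j), X, X] = 0"
          if "inverse_pair (m + 3) S R" "\<And>Xs. length Xs = m + 3 \<Longrightarrow> polar_det (m + 3) (map (congr_mat (m + 3) S) Xs) = c * polar_det (m + 3) Xs" "j < m + 3" for S R c j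
          using that by (rule null)
      qed
      then show False using not0 by (simp add: eval_nat_numeral)
    qed
    define e where "e i j = (if j = i then 1 else 0 :: real)" for i j :: nat
    have se: "s (e i) Z = ?G m (\<lambda>b. g (b + unit_exp i)) [Z, X, P]" if "i < n" for i Z
      unfolding s_def e_def by (rule polyop_unit_direction[OF that])
    have s_add1: "s (\<lambda>j. u * a j + v * b j) Z = u * s a Z + v * s b Z" for u v a b Z
    proof -
      have "s (\<lambda>j. u * a j + v * b j) Z = (\<Sum>i<n. (u * a i + v * b i) * ?G m (\<lambda>b. g (b + unit_exp i)) [Z, X, P])"
        unfolding s_def polyop_shift_sum ..
      also have "\<dots> = u * s a Z + v * s b Z"
        unfolding s_def polyop_shift_sum by (simp add: sum_distrib_left sum.distrib algebra_simps)
      finally show ?thesis .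
    qed
    have s_add2: "s a (u *\<^sub>R Y + v *\<^sub>R Z) = u * s a Y + v * s a Z" for u v a Y Z
      unfolding s_def by (simp add: symm_multilin_simps[OF symm_multilin_polyop[OF symm_multilin_polar_det]])
    define I where "I = {i. i < n \<and> nontriv n m (\<lambda>b. g (b + unit_exp i))}"
    have nzc: "nontriv n m (shift_sum n (\<lambda>j. u * e i j + v * e i' j) g)" if "i \<in> I" "i' < n" "0 < u" "0 \<le> v" for u v i i'
    proof -
      from that obtain b where b: "supported n b" "exp_degree n b = m" "0 < g (b + unit_exp i)" "i < n" by (auto simp: I_def nontriv_def)
      have "0 < (u * e i i + v * e i' i) * g (b + unit_exp i)" using that b by (simp add: e_def)
      moreover have "0 \<le> (u * e i j + v * e i' j) * g (b + unit_exp j)" for j using that g0 by (simp add: e_def)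
      ultimately have "0 < shift_sum n (\<lambda>j. u * e i j + v * e i' j) g b"
        unfolding shift_sum_def using b(4) by (intro sum_pos2[of _ i]) auto
      then show ?thesis using b by (auto simp: nontriv_def)
    qed
    have ne: "s (\<lambda>j. u * e i j + v * e i' j) Z \<noteq> 0" if "i \<in> I" "i' < n" "0 < u" "0 \<le> v" "posdef (m + 3) Z" for u v i i' Z
      by (rule sn[OF _ nzc[OF that(1-4)] that(5)]) (use that in \<open>simp add: e_def\<close>)
    \<comment> \<open>Signs are compared between two matrices for one index, then between two
      indices for one matrix; a change of sign would give a zero at a positive combination.\<close>
    have same: "0 < s (e i) Y * s (e i') Z" if ii: "i \<in> I" "i' \<in> I" and YZ: "posdef (m + 3) Y" "posdef (m + 3) Z" for i i' Y Z
    proof -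
      have lt: "i < n" "i' < n" using ii by (auto simp: I_def)
      have n1: "s (e k) W \<noteq> 0" if "k \<in> I" "posdef (m + 3) W" for k W
        using ne[of k k 1 0 W] that by (auto simp: I_def)
      have 1: "0 < s (e i) Y * s (e i) Z"
      proof (rule ccontr)
        assume "\<not> ?thesis"
        then have "s (e i) Y * s (e i) Z < 0" using n1[OF ii(1) YZ(1)] n1[OF ii(1) YZ(2)] by (simp add: less_le)
        then obtain u v where unit_exp: "0 < u" "0 < v" "u * s (e i) Y + v * s (e i) Z = 0" by (rule crossing)
        then have "s (e i) (u *\<^sub>R Y + v *\<^sub>R Z) = 0" by (simp add: s_add2)
        moreover have "posdef (m + 3) (u *\<^sub>R Y + v *\<^sub>R Z)" using unit_exp YZ by (intro posdef_add posdef_scale)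
        ultimately show False using n1[OF ii(1)] by blast
      qed
      have 2: "0 < s (e i) Z * s (e i') Z"
      proof (rule ccontr)
        assume "\<not> ?thesis"
        then have "s (e i) Z * s (e i') Z < 0" using n1[OF ii(1) YZ(2)] n1[OF ii(2) YZ(2)] by (simp add: less_le)
        then obtain u v where unit_exp: "0 < u" "0 < v" "u * s (e i) Z + v * s (e i') Z = 0" by (rule crossing)
        then have "s (\<lambda>j. u * e i j + v * e i' j) Z = 0" by (simp add: s_add1)
        then show False using ne[OF ii(1) lt(2) unit_exp(1) _ YZ(2), of v] unit_exp by simp
      qed
      show ?thesis using 1 2 by (auto simp: zero_less_mult_iff)
    qed
    obtain k where k: "k \<in> I" using nontriv_Suc[OF Suc.prems(2)] unfolding I_def by blast
    have kn: "k < n" using k by (simp add: I_def)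
    have trm: "0 \<le> s (e i) (H i) * s (e k) (H k)" if "i < n" for i
    proof (cases "i \<in> I")
      case True
      then show ?thesis using same[OF True k H[OF that] H[OF kn]] by simp
    next
      case False
      have "g (b + unit_exp i) = 0" if "supported n b" "exp_degree n b = m" for b
      proof -
        have "\<not> 0 < g (b + unit_exp i)" using False \<open>i < n\<close> that unfolding I_def nontriv_def by blast
        then show ?thesis using g0[of "b + unit_exp i"] by linarith
      qed
      then have "s (e i) (H i) = 0" unfolding se[OF that] by (rule polyop_zero_coeffs)
      then show ?thesis by simp
    qed
    have "0 < (\<Sum>i<n. s (e i) (H i) * s (e k) (H k))"
      by (rule sum_pos2[of _ k]) (use kn same[OF k k H[OF kn] H[OF kn]] trm in auto)
    also have "\<dots> = (\<Sum>i<n. s (e i) (H i)) * s (e k) (H k)" by (simp add: sum_distrib_right)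
    also have "(\<Sum>i<n. s (e i) (H i)) = ?G (Suc m) g [X, P]" by (simp add: se)
    finally show False using o by simp
  qed
qed

section \<open>Diagonal directions\<close>

lemma polar_prod_map_diag_unit:
  "finite J \<Longrightarrow> polar_prod p (map diag_unit js) J = (if distinct js \<and> set js = J \<and> (\<forall>s\<in>J. p s = s) then 1 else 0)"
proof (induction js arbitrary: J)
  case (Cons s js)
  have "polar_prod p (map diag_unit (s # js)) J = (\<Sum>j\<in>J. if j = s then (if p s = s then polar_prod p (map diag_unit js) (J - {s}) else 0) else 0)"
    unfolding list.map polar_prod.simps by (intro sum.cong refl) (auto simp: diag_unit_def)
  also have "\<dots> = (if s \<in> J \<and> p s = s then polar_prod p (map diag_unit js) (J - {s}) else 0)"
    using Cons.prems by simp
  also have "\<dots> = (if distinct (s # js) \<and> set (s # js) = J \<and> (\<forall>s\<in>J. p s = s) then 1 else 0)"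
    using Cons by auto
  finally show ?case .
qed simp

lemma polar_det_map_diag_unit: "polar_det d (map diag_unit js) = (if distinct js \<and> set js = {..<d} then 1 else 0)"
proof -
  have "(\<Sum>p | p permutes {0..<d}. signof p * polar_prod p (map diag_unit js) {0..<d})
     = (\<Sum>p | p permutes {0..<d}. if p = id then (if distinct js \<and> set js = {..<d} then 1 else 0) else (0::complex))"
  proof (intro sum.cong refl)
    fix p assume "p \<in> {p. p permutes {0..<d}}"
    then have p: "p permutes {0..<d}" by simp
    have "(\<forall>s\<in>{0..<d}. p s = s) \<longleftrightarrow> p = id"
      using permutes_not_in[OF p] by (auto simp: fun_eq_iff)
    then show "signof p * polar_prod p (map diag_unit js) {0..<d} = (if p = id then (if distinct js \<and> set js = {..<d} then 1 else 0) else 0)"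
      by (auto simp: polar_prod_map_diag_unit atLeast0LessThan)
  qed
  also have "\<dots> = (if distinct js \<and> set js = {..<d} then 1 else 0)"
    by (simp add: finite_permutations permutes_id)
  finally show ?thesis unfolding polar_det_def by simp
qed

text \<open>On diagonal units the polarized determinant is 1 for a complete list of distinct indices
  and 0 otherwise, so a single subset can survive in the expansion, the complement of
  \<open>js\<close>.\<close>

lemma subset_sum_diag_unit:
  assumes "distinct us"
  shows "subset_sum \<tau> diag_unit (polar_det d) us q g (map diag_unit js) =
    (if distinct js \<and> set js \<subseteq> {..<d} \<and> {..<d} - set js \<subseteq> set us \<and> card ({..<d} - set js) = q
     then g (type_sum \<tau> ({..<d} - set js)) else 0)"
  using assms
proof (induction us arbitrary: q g js)
  case Nil
  show ?case
  proof (cases "distinct js \<and> set js = {..<d}")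
    case True
    then show ?thesis by (simp add: polar_det_map_diag_unit type_sum_def)
  next
    case False
    then have "\<not> (distinct js \<and> set js \<subseteq> {..<d} \<and> {..<d} - set js \<subseteq> set [])" by auto
    then have r: "(if distinct js \<and> set js \<subseteq> {..<d} \<and> {..<d} - set js \<subseteq> set [] \<and> card ({..<d} - set js) = q
     then g (type_sum \<tau> ({..<d} - set js)) else 0) = 0" by meson
    have "polar_det d (map diag_unit js) = 0" unfolding polar_det_map_diag_unit using False by meson
    then have "subset_sum \<tau> diag_unit (polar_det d) [] q g (map diag_unit js) = 0" by simp
    then show ?thesis unfolding r .
  qed
next
  case (Cons s us)
  define D where "D = {..<d} - set js"
  have fD: "finite D" by (simp add: D_def)
  have IH1: "subset_sum \<tau> diag_unit (polar_det d) us q g (map diag_unit js) = (if distinct js \<and> set js \<subseteq> {..<d} \<and> D \<subseteq> set us \<and> card D = q then g (type_sum \<tau> D) else 0)"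
    unfolding D_def by (rule Cons.IH) (use Cons.prems in simp)
  have IH2: "subset_sum \<tau> diag_unit (polar_det d) us (q - 1) (\<lambda>b. g (b + unit_exp (\<tau> s))) (map diag_unit (s # js)) =
    (if distinct (s # js) \<and> set (s # js) \<subseteq> {..<d} \<and> {..<d} - set (s # js) \<subseteq> set us \<and> card ({..<d} - set (s # js)) = q - 1
     then g (type_sum \<tau> ({..<d} - set (s # js)) + unit_exp (\<tau> s)) else 0)"
    by (rule Cons.IH) (use Cons.prems in simp)
  have D': "{..<d} - set (s # js) = D - {s}" by (auto simp: D_def)
  have subset_sum: "subset_sum \<tau> diag_unit (polar_det d) (s # us) q g (map diag_unit js) = subset_sum \<tau> diag_unit (polar_det d) us q g (map diag_unit js) +
     (if q = 0 then 0 else subset_sum \<tau> diag_unit (polar_det d) us (q - 1) (\<lambda>b. g (b + unit_exp (\<tau> s))) (map diag_unit (s # js)))" by simp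
  show ?case
  proof (cases "s \<in> D")
    case True
    then have s: "s < d" "s \<notin> set js" "s \<notin> set us" using Cons.prems by (auto simp: D_def)
    have "\<not> D \<subseteq> set us" using True s by auto
    moreover have "D - {s} \<subseteq> set us \<longleftrightarrow> D \<subseteq> set (s # us)" by auto
    moreover have "type_sum \<tau> (D - {s}) + unit_exp (\<tau> s) = type_sum \<tau> D" using type_sum_remove[OF fD True, of \<tau>] by simp
    moreover have "Suc (card (D - {s})) = card D" by (rule card_Suc_Diff1[OF fD True])
    then have "q \<noteq> 0 \<and> card (D - {s}) = q - 1 \<longleftrightarrow> card D = q" by auto
    ultimately show ?thesis unfolding subset_sum IH1 IH2 D' D_def[symmetric] using s by auto
  next
    case False
    then have "\<not> (distinct (s # js) \<and> set (s # js) \<subseteq> {..<d})" by (auto simp: D_def)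
    moreover have "D \<subseteq> set us \<longleftrightarrow> D \<subseteq> set (s # us)" using False by auto
    ultimately show ?thesis unfolding subset_sum IH1 IH2 D_def[symmetric] by auto
  qed
qed

text \<open>
  Diagonal 0/1 matrices with disjoint supports, the \<open>s\<close>-th diagonal position belonging to variable \<open>\<tau> s\<close>.
\<close>

definition diag_group :: "nat \<Rightarrow> (nat \<Rightarrow> nat) \<Rightarrow> nat \<Rightarrow> nat \<Rightarrow> nat \<Rightarrow> complex" where
  "diag_group d \<tau> i = (\<Sum>s\<leftarrow>[0..<d]. if \<tau> s = i then diag_unit s else 0)"

lemma polar_det_diag_unit_diag_unit: "i < d \<Longrightarrow> polar_det d (diag_unit i # diag_unit i # Xs) = 0"
proof -
  assume i: "i < d"
  then obtain d' where d: "d = Suc d'" by (cases d) auto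
  show ?thesis unfolding d by (cases "length Xs + 1 = d'") (use i d in \<open>simp_all add: polar_det_diag_unit_twice polar_det_wrong_length\<close>)
qed

text \<open>Only the positions other than \<open>s\<close> and \<open>t\<close> can be filled by the
  operator, and their type is the exponent at which \<open>g\<close> is read off. So diagonal
  directions make single coefficients visible.\<close>

lemma polyop_diag_group:
  assumes \<tau>: "\<And>s. s < m + 2 \<Longrightarrow> \<tau> s < n" and "s < m + 2" "t < m + 2"
  shows "polyop n (polar_det (m + 2)) (diag_group (m + 2) \<tau>) m g [diag_unit s, diag_unit t] = (if s = t then 0 else fact m * g (type_sum \<tau> ({..<m+2} - {s, t})))"
proof -
  have "polyop n (polar_det (m + 2)) (diag_group (m + 2) \<tau>) m g [diag_unit s, diag_unit t] = fact m * subset_sum \<tau> diag_unit (polar_det (m + 2)) [0..<m+2] m g (map diag_unit [s, t])"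
    unfolding diag_group_def[abs_def] list.map by (rule polyop_subset_sum[OF symm_multilin_polar_det]) (use \<tau> polar_det_diag_unit_diag_unit in auto)
  also have "\<dots> = (if s = t then 0 else fact m * g (type_sum \<tau> ({..<m+2} - {s, t})))"
  proof (subst subset_sum_diag_unit)
    have "card ({..<m+2} - {s, t}) = m" if "s \<noteq> t"
      using that assms(2,3) by (subst card_Diff_subset) auto
    then show "fact m * (if distinct [s, t] \<and> set [s, t] \<subseteq> {..<m + 2} \<and> {..<m + 2} - set [s, t] \<subseteq> set [0..<m + 2] \<and> card ({..<m + 2} - set [s, t]) = m
        then g (type_sum \<tau> ({..<m + 2} - set [s, t])) else 0) = (if s = t then 0 else fact m * g (type_sum \<tau> ({..<m+2} - {s, t})))"
      using assms(2,3) by auto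
  qed simp
  finally show ?thesis .
qed

section \<open>Limits and linear substitutions in operators\<close>

lemma polyop_tendsto:
  assumes "symm_multilin \<mu>" and t: "((\<lambda>t. t) \<longlongrightarrow> 0) F"
  shows "((\<lambda>t. polyop n \<mu> (\<lambda>i. H i + t *\<^sub>R K i) m g Xs) \<longlongrightarrow> polyop n \<mu> H m g Xs) F"
proof (induction m arbitrary: g Xs)
  case (Suc m)
  have e: "polyop n \<mu> (\<lambda>i. H i + t *\<^sub>R K i) (Suc m) g Xs = (\<Sum>i<n. polyop n \<mu> (\<lambda>i. H i + t *\<^sub>R K i) m (\<lambda>b. g (b + unit_exp i)) (H i # Xs)
      + t * polyop n \<mu> (\<lambda>i. H i + t *\<^sub>R K i) m (\<lambda>b. g (b + unit_exp i)) (K i # Xs))" for t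
    by (simp add: symm_multilin_simps[OF symm_multilin_polyop[OF assms(1)]])
  have "((\<lambda>t. \<Sum>i<n. polyop n \<mu> (\<lambda>i. H i + t *\<^sub>R K i) m (\<lambda>b. g (b + unit_exp i)) (H i # Xs)
      + t * polyop n \<mu> (\<lambda>i. H i + t *\<^sub>R K i) m (\<lambda>b. g (b + unit_exp i)) (K i # Xs)) \<longlongrightarrow>
      (\<Sum>i<n. polyop n \<mu> H m (\<lambda>b. g (b + unit_exp i)) (H i # Xs) + 0 * polyop n \<mu> H m (\<lambda>b. g (b + unit_exp i)) (K i # Xs))) F"
    by (intro tendsto_intros Suc t)
  then show ?case unfolding e by simp
qed simp

lemma polyop_tendsto_coeffs:
  assumes "\<And>b. supported n b \<Longrightarrow> exp_degree n b = m \<Longrightarrow> ((\<lambda>e. ge e b) \<longlongrightarrow> g b) F"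
  shows "((\<lambda>e. polyop n \<mu> H m (ge e) Xs) \<longlongrightarrow> polyop n \<mu> H m g Xs) F"
  using assms
proof (induction m arbitrary: ge g Xs)
  case 0
  from 0[of 0] show ?case by (auto intro!: tendsto_intros)
next
  case (Suc m)
  have "((\<lambda>e. polyop n \<mu> H m (\<lambda>b. ge e (b + unit_exp i)) (H i # Xs)) \<longlongrightarrow> polyop n \<mu> H m (\<lambda>b. g (b + unit_exp i)) (H i # Xs)) F" if "i < n" for i
    by (rule Suc.IH) (use that in \<open>auto intro!: Suc.prems simp: exp_degree_add\<close>)
  then show ?case by (auto intro!: tendsto_intros)
qed

lemma contract_shift: "contract n g vs (b + c) = contract n (\<lambda>b. g (b + c)) vs b"
proof (induction vs arbitrary: b)
  case (Cons v vs)
  have "contract n g (v # vs) (b + c) = (\<Sum>i<n. v i * contract n g vs ((b + unit_exp i) + c))"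
  proof -
    have "b + c + unit_exp i = b + unit_exp i + c" for i by (simp add: ac_simps)
    then show ?thesis by simp
  qed
  then show ?case by (simp add: Cons)
qed simp

text \<open>Moves a perturbation of the coefficients into the directions, where a hypothesis about
  all positive definite directions can be applied.\<close>

lemma polyop_subst:
  assumes \<mu>: "symm_multilin \<mu>"
  shows "polyop n \<mu> H m (\<lambda>b. contract n g (repeat_list n b c) 0) Xs = polyop n \<mu> (\<lambda>j. \<Sum>i<n. c i j *\<^sub>R H i) m g Xs"
proof (induction m arbitrary: g Xs)
  case (Suc m)
  note G = symm_multilin_polyop[OF \<mu>]
  have sh: "contract n g (repeat_list n (b + unit_exp i) c) 0 = (\<Sum>j<n. c i j * contract n (\<lambda>b. g (b + unit_exp j)) (repeat_list n b c) 0)" if "i < n" for b i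
  proof -
    have "contract n g (repeat_list n (b + unit_exp i) c) 0 = contract n g (c i # repeat_list n b c) 0"
      using symm_multilin_repeat_list_add[OF symm_multilin_contract[of n g 0] that, of "[]" b c "[]"] by (simp del: contract.simps)
    then show ?thesis using contract_shift[of n g "repeat_list n b c" 0] by simp
  qed
  have "polyop n \<mu> H (Suc m) (\<lambda>b. contract n g (repeat_list n b c) 0) Xs
     = (\<Sum>i<n. polyop n \<mu> H m (\<lambda>b. \<Sum>j<n. c i j * contract n (\<lambda>b. g (b + unit_exp j)) (repeat_list n b c) 0) (H i # Xs))"
    unfolding polyop.simps by (intro sum.cong refl) (simp add: sh)
  also have "\<dots> = (\<Sum>i<n. \<Sum>j<n. c i j * polyop n \<mu> (\<lambda>j. \<Sum>i<n. c i j *\<^sub>R H i) m (\<lambda>b. g (b + unit_exp j)) (H i # Xs))"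
    by (simp only: polyop_sum Suc)
  also have "\<dots> = (\<Sum>j<n. \<Sum>i<n. c i j * polyop n \<mu> (\<lambda>j. \<Sum>i<n. c i j *\<^sub>R H i) m (\<lambda>b. g (b + unit_exp j)) (H i # Xs))"
    by (rule sum.swap)
  also have "\<dots> = polyop n \<mu> (\<lambda>j. \<Sum>i<n. c i j *\<^sub>R H i) (Suc m) g Xs"
    by (simp add: symm_multilin_sum[OF G] symm_multilin_simps[OF G])
  finally show ?case .
qed simp

lemma type_sum_exists:
  assumes "supported n a" "0 < n" shows "\<exists>\<tau>. (\<forall>s. \<tau> s < n) \<and> type_sum \<tau> {..<exp_degree n a} = a"
  using assms(1)
proof (induction rule: supported_induct)
  case zero
  then show ?case using assms(2) by (intro exI[of _ "\<lambda>_. 0"]) (simp add: type_sum_def)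
next
  case (add b i)
  then obtain \<tau> where \<tau>: "\<forall>s. \<tau> s < n" "type_sum \<tau> {..<exp_degree n b} = b" by blast
  let ?t = "\<tau>(exp_degree n b := i)"
  have "type_sum ?t {..<exp_degree n (b + unit_exp i)} = type_sum ?t (insert (exp_degree n b) {..<exp_degree n b})"
    using add by (simp add: exp_degree_add lessThan_Suc)
  also have "\<dots> = type_sum ?t {..<exp_degree n b} + unit_exp i" by (simp add: type_sum_insert)
  also have "type_sum ?t {..<exp_degree n b} = type_sum \<tau> {..<exp_degree n b}" unfolding type_sum_def by (intro sum.cong) auto
  finally show ?case using \<tau> add by (intro exI[of _ ?t]) auto
qed

lemma diag_group_eq: "diag_group d \<tau> i = (\<Sum>s<d. (if \<tau> s = i then 1 else 0 :: real) *\<^sub>R diag_unit s)"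
  unfolding diag_group_def by (simp add: interv_sum_list_conv_sum_set_nat atLeast0LessThan if_distrib[of "\<lambda>c. c *\<^sub>R _"] cong: if_cong)

lemma posdef_diag:
  assumes "\<And>s. s < d \<Longrightarrow> 0 \<le> a s" "0 < (e::real)" shows "posdef d ((\<Sum>s<d. a s *\<^sub>R diag_unit s) + e *\<^sub>R id_entries d)"
proof -
  have ap: "((\<Sum>s<d. a s *\<^sub>R diag_unit s) + e *\<^sub>R id_entries d) p q = (if p = q then of_real (a p + e) else 0)" if "p < d" "q < d" for p q
  proof -
    have "(\<Sum>s<d. a s *\<^sub>R diag_unit s) p q = (\<Sum>s<d. if s = p then (if p = q then of_real (a p) else 0) else 0)"
      unfolding fsum_apply by (intro sum.cong refl) (auto simp: diag_unit_def scaleR_conv_of_real)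
    then show ?thesis using that by (simp add: id_entries_apply scaleR_conv_of_real)
  qed
  define G where "G = (\<Sum>s<d. a s *\<^sub>R diag_unit s) + e *\<^sub>R id_entries d"
  have "posdef d G" unfolding posdef_def
  proof (intro conjI allI impI)
    show "G \<in> herm_set d" by (rule hsetI) (simp add: ap[folded G_def])
    fix v :: "nat \<Rightarrow> complex" assume "\<exists>i<d. v i \<noteq> 0"
    then obtain j where j: "j < d" "v j \<noteq> 0" by blast
    have c: "cnj z * of_real r * z = complex_of_real (r * (cmod z)\<^sup>2)" for z r
      by (simp add: complex_norm_square mult.commute mult.left_commute del: of_real_power)
    have "quad_form d G v = (\<Sum>i<d. \<Sum>k<d. if k = i then complex_of_real ((a i + e) * (cmod (v i))\<^sup>2) else 0)"
      unfolding quad_form_def by (intro sum.cong refl) (auto simp: ap[folded G_def] c simp del: of_real_add)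
    then have "Re (quad_form d G v) = (\<Sum>i<d. (a i + e) * (cmod (v i))\<^sup>2)" by (simp del: of_real_add of_real_mult of_real_power)
    also have "0 < \<dots>" using j assms by (intro sum_pos2[of _ j]) (auto simp: add_nonneg_pos intro!: mult_nonneg_nonneg add_nonneg_nonneg less_imp_le[OF assms(2)])
    finally show "0 < Re (quad_form d G v)" .
  qed
  then show ?thesis by (simp only: G_def)
qed


text \<open>Nonnegative diagonal matrices are limits of positive definite ones.\<close>

theorem diag_lorentz:
  assumes W: "\<And>H. (\<And>i. i < n \<Longrightarrow> posdef d (H i)) \<Longrightarrow> lorentz (herm_set d) (\<lambda>x y. polyop n (polar_det d) H m g [x, y])"
    and a: "\<And>i s. i < n \<Longrightarrow> s < d \<Longrightarrow> 0 \<le> a i s"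
  shows "lorentz (herm_set d) (\<lambda>x y. polyop n (polar_det d) (\<lambda>i. \<Sum>s<d. a i s *\<^sub>R diag_unit s) m g [x, y])"
proof (rule lorentz_limit[where F = "at_right (0::real)" and B = "\<lambda>e x y. polyop n (polar_det d) (\<lambda>i. (\<Sum>s<d. a i s *\<^sub>R diag_unit s) + e *\<^sub>R id_entries d) m g [x, y]"])
  show "((\<lambda>e. polyop n (polar_det d) (\<lambda>i. (\<Sum>s<d. a i s *\<^sub>R diag_unit s) + e *\<^sub>R id_entries d) m g [x, y]) \<longlongrightarrow>
      polyop n (polar_det d) (\<lambda>i. \<Sum>s<d. a i s *\<^sub>R diag_unit s) m g [x, y]) (at_right 0)" for x y
    by (rule polyop_tendsto[OF symm_multilin_polar_det tendsto_ident_at])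
  show "\<forall>\<^sub>F e in at_right 0. lorentz (herm_set d) (\<lambda>x y. polyop n (polar_det d) (\<lambda>i. (\<Sum>s<d. a i s *\<^sub>R diag_unit s) + e *\<^sub>R id_entries d) m g [x, y])"
    using eventually_at_right_less[of 0] by eventually_elim (rule W, rule posdef_diag, use a in auto)
qed simp

text \<open>The exponent \<open>a\<close> is spread over the first \<open>m\<close> diagonal
  positions and \<open>P\<close> occupies the last two. In the limit of diagonal matrices the form
  at \<open>P\<close> is \<open>2 * fact m * g a\<close>; the 2 counts the orders of the last two
  positions.\<close>

theorem coeff_nonneg:
  assumes W: "\<And>H P. (\<And>i. i < n \<Longrightarrow> posdef (m + 2) (H i)) \<Longrightarrow> posdef (m + 2) P \<Longrightarrow> 0 \<le> polyop n (polar_det (m + 2)) H m g [P, P]"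
    and a: "supported n a" "exp_degree n a = m" and n: "0 < n"
  shows "0 \<le> g a"
proof -
  obtain \<tau> where \<tau>: "\<And>s. \<tau> s < n" "type_sum \<tau> {..<m} = a" using type_sum_exists[OF a(1) n] a(2) by auto
  let ?d = "m + 2"
  let ?H = "diag_group ?d \<tau>"
  let ?P = "diag_unit m + diag_unit (Suc m)"
  let ?G = "\<lambda>H X Y. polyop n (polar_det ?d) H m g [X, Y]"
  define b where "b i s = (if \<tau> s = i then 1 else 0 :: real)" for i s
  have H: "?H i = (\<Sum>s<?d. b i s *\<^sub>R diag_unit s)" for i unfolding b_def by (rule diag_group_eq)
  have P: "?P = (\<Sum>s<?d. (if s = m \<or> s = Suc m then 1 else 0 :: real) *\<^sub>R diag_unit s)"
  proof -
    have "(\<Sum>s<?d. (if s = m \<or> s = Suc m then 1 else 0 :: real) *\<^sub>R diag_unit s) = (\<Sum>s\<in>{m, Suc m}. diag_unit s)"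
      by (rule sum.mono_neutral_cong_right) auto
    then show ?thesis by simp
  qed
  have G: "symm_multilin (polyop n (polar_det ?d) H m g)" for H by (rule symm_multilin_polyop[OF symm_multilin_polar_det])
  have e: "?G (\<lambda>i. ?H i + e *\<^sub>R id_entries ?d) (?P + e *\<^sub>R id_entries ?d) (?P + e *\<^sub>R id_entries ?d)
     = ?G (\<lambda>i. ?H i + e *\<^sub>R id_entries ?d) ?P ?P + e * ?G (\<lambda>i. ?H i + e *\<^sub>R id_entries ?d) (id_entries ?d) ?P
       + e * (?G (\<lambda>i. ?H i + e *\<^sub>R id_entries ?d) ?P (id_entries ?d) + e * ?G (\<lambda>i. ?H i + e *\<^sub>R id_entries ?d) (id_entries ?d) (id_entries ?d))" for e
    using symm_bilin_simps(1,2,5,6)[OF symm_bilin_symm_multilin[OF G], where zs1 = "[]"] by (simp add: algebra_simps del: polyop.simps)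
  have "((\<lambda>e. ?G (\<lambda>i. ?H i + e *\<^sub>R id_entries ?d) (?P + e *\<^sub>R id_entries ?d) (?P + e *\<^sub>R id_entries ?d)) \<longlongrightarrow>
      ?G ?H ?P ?P + 0 * ?G ?H (id_entries ?d) ?P + 0 * (?G ?H ?P (id_entries ?d) + 0 * ?G ?H (id_entries ?d) (id_entries ?d))) (at_right 0)"
    unfolding e by (intro tendsto_intros polyop_tendsto[OF symm_multilin_polar_det] tendsto_ident_at)
  moreover have "\<forall>\<^sub>F e in at_right 0. 0 \<le> ?G (\<lambda>i. ?H i + e *\<^sub>R id_entries ?d) (?P + e *\<^sub>R id_entries ?d) (?P + e *\<^sub>R id_entries ?d)"
    using eventually_at_right_less[of 0]
  proof eventually_elim
    case (elim e)
    show ?case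
    proof (rule W)
      show "posdef ?d (?H i + e *\<^sub>R id_entries ?d)" for i unfolding H by (rule posdef_diag) (use elim in \<open>auto simp: b_def\<close>)
      show "posdef ?d (?P + e *\<^sub>R id_entries ?d)" unfolding P by (rule posdef_diag) (use elim in auto)
    qed
  qed
  ultimately have "0 \<le> ?G ?H ?P ?P + 0 * ?G ?H (id_entries ?d) ?P + 0 * (?G ?H ?P (id_entries ?d) + 0 * ?G ?H (id_entries ?d) (id_entries ?d))"
    by (intro tendsto_lowerbound) auto
  then have "0 \<le> ?G ?H ?P ?P" by simp
  also have "?G ?H ?P ?P = 2 * fact m * g a"
  proof -
    have S: "{..<?d} - {m, Suc m} = {..<m}" "{..<?d} - {Suc m, m} = {..<m}" by auto
    have "?G ?H ?P ?P = ?G ?H (diag_unit m) (diag_unit m) + ?G ?H (diag_unit m) (diag_unit (Suc m)) + ?G ?H (diag_unit (Suc m)) (diag_unit m) + ?G ?H (diag_unit (Suc m)) (diag_unit (Suc m))"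
      using symm_bilin_simps(1,2)[OF symm_bilin_symm_multilin[OF G], where zs1 = "[]"] by (simp del: polyop.simps)
    also have "\<dots> = 2 * fact m * g a"
      using polyop_diag_group[of m \<tau> n m m g] polyop_diag_group[of m \<tau> n m "Suc m" g] polyop_diag_group[of m \<tau> n "Suc m" m g] polyop_diag_group[of m \<tau> n "Suc m" "Suc m" g] \<tau> S
      by (simp del: polyop.simps)
    finally show ?thesis .
  qed
  finally have "(2 * fact m) * 0 \<le> (2 * fact m) * g a" by simp
  moreover have "(0::real) < 2 * fact m" by simp
  ultimately show ?thesis by (simp only: mult_le_cancel_left_pos)
qed

text \<open>The members of \<open>R\<close> are numbered by \<open>m + 2\<close> diagonal positions
  through \<open>f\<close>, and \<open>x\<close> becomes the diagonal matrix \<open>L x\<close>. The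
  operator at diagonal directions is then \<open>fact m\<close> times the required form, and
  \<open>polyop_subst\<close> shifts the substitution \<open>c\<close> into these
  directions.\<close>

theorem local_lorentz_subst:
  assumes W: "\<And>H. (\<And>i. i < n \<Longrightarrow> posdef (m + 2) (H i)) \<Longrightarrow> lorentz (herm_set (m + 2)) (\<lambda>x y. polyop n (polar_det (m + 2)) H m g [x, y])"
    and \<tau>: "\<And>s. s < M \<Longrightarrow> \<tau> s < n" and c: "\<And>i j. 0 \<le> c i j"
  shows "local_lorentz M \<tau> m (\<lambda>b. contract n g (repeat_list n b c) 0)"
  unfolding local_lorentz_def
proof (intro allI impI)
  fix R assume R: "R \<subseteq> {..<M}" "card R = m + 2"
  let ?d = "m + 2"
  define gA where "gA b = contract n g (repeat_list n b c) 0" for b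
  have fR: "finite R" using R finite_subset by auto
  obtain f where f: "bij_betw f {..<?d} R"
    using ex_bij_betw_nat_finite[OF fR] R(2) by (auto simp: atLeast0LessThan)
  define t where "t s = \<tau> (f s)" for s
  have tn: "t s < n" if "s < ?d" for s using that f R \<tau> by (auto simp: t_def bij_betw_def)
  define a where "a j s = (\<Sum>i<n. c i j * (if t s = i then 1 else 0))" for j s
  have H': "(\<lambda>j. \<Sum>i<n. c i j *\<^sub>R diag_group ?d t i) = (\<lambda>j. \<Sum>s<?d. a j s *\<^sub>R diag_unit s)"
  proof
    fix j
    have "(\<Sum>i<n. c i j *\<^sub>R diag_group ?d t i) = (\<Sum>i<n. \<Sum>s<?d. (c i j * (if t s = i then 1 else 0)) *\<^sub>R diag_unit s)"
      unfolding diag_group_eq scaleR_sum_right scaleR_scaleR ..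
    also have "\<dots> = (\<Sum>s<?d. \<Sum>i<n. (c i j * (if t s = i then 1 else 0)) *\<^sub>R diag_unit s)" by (rule sum.swap)
    also have "\<dots> = (\<Sum>s<?d. a j s *\<^sub>R diag_unit s)" unfolding a_def scaleR_sum_left ..
    finally show "(\<Sum>i<n. c i j *\<^sub>R diag_group ?d t i) = (\<Sum>s<?d. a j s *\<^sub>R diag_unit s)" .
  qed
  let ?Q = "\<lambda>x y. polyop n (polar_det ?d) (diag_group ?d t) m gA [x, y]"
  have Q: "polyop n (polar_det ?d) (\<lambda>j. \<Sum>s<?d. a j s *\<^sub>R diag_unit s) m g [x, y] = ?Q x y" for x y
    unfolding gA_def[abs_def] polyop_subst[OF symm_multilin_polar_det] H' ..
  have "lorentz (herm_set ?d) (\<lambda>x y. polyop n (polar_det ?d) (\<lambda>j. \<Sum>s<?d. a j s *\<^sub>R diag_unit s) m g [x, y])"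
    by (rule diag_lorentz[OF W]) (use c in \<open>auto simp: a_def intro!: sum_nonneg\<close>)
  then have L0: "lorentz (herm_set ?d) ?Q" unfolding Q .
  define L where "L x = (\<Sum>s<?d. x (f s) *\<^sub>R diag_unit s)" for x :: "nat \<Rightarrow> real"
  have "lorentz UNIV (\<lambda>x y. ?Q (L x) (L y))"
    by (rule lorentz_pullback[OF L0]) (unfold L_def, intro subspace_sum[OF subspace_herm_set] subspace_scale[OF subspace_herm_set] diag_unit_herm_set)
  moreover have "(\<Sum>s\<in>R. \<Sum>t\<in>R - {s}. x s * y t * gA (type_sum \<tau> (R - {s, t}))) = 1 / fact m * ?Q (L x) (L y)" for x y
  proof -
    have B: "symm_bilin ?Q" by (rule symm_bilin_symm_multilin[OF symm_multilin_polyop[OF symm_multilin_polar_det]])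
    have l: "linear (?Q u)" for u using B unfolding symm_bilin_def by blast
    have s2: "?Q u (\<Sum>j\<in>J. h j) = (\<Sum>j\<in>J. ?Q u (h j))" for u and J :: "nat set" and h by (rule linear_sum[OF l])
    have s1: "?Q (\<Sum>j\<in>J. h j) u = (\<Sum>j\<in>J. ?Q (h j) u)" for u and J :: "nat set" and h
      unfolding symm_bilin_sym[OF B, of _ u] by (rule s2)
    have ts: "type_sum t ({..<?d} - {p, q}) = type_sum \<tau> (R - {f p, f q})" if "p < ?d" "q < ?d" for p q
    proof -
      have "bij_betw f ({..<?d} - {p, q}) (R - {f p, f q})"
        using bij_betw_subset[OF f, of "{..<?d} - {p, q}"] f that
        by (auto simp: bij_betw_def inj_on_image_set_diff[of f "{..<?d}"])
      then show ?thesis unfolding type_sum_def t_def by (rule sum.reindex_bij_betw)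
    qed
    have "?Q (L x) (L y) = (\<Sum>p<?d. \<Sum>q<?d. x (f p) * (y (f q) * ?Q (diag_unit p) (diag_unit q)))"
      unfolding L_def s1 s2 symm_bilin_simps(5,6)[OF B] sum_distrib_left
      by (subst sum.swap) (intro sum.cong refl mult.left_commute)
    also have "\<dots> = (\<Sum>p<?d. \<Sum>q<?d. x (f p) * (y (f q) * (if f p = f q then 0 else fact m * gA (type_sum \<tau> (R - {f p, f q})))))"
    proof (intro sum.cong refl)
      fix p q assume pq: "p \<in> {..<?d}" "q \<in> {..<?d}"
      then have "f p = f q \<longleftrightarrow> p = q" using f by (auto simp: bij_betw_def inj_on_def)
      moreover have "?Q (diag_unit p) (diag_unit q) = (if p = q then 0 else fact m * gA (type_sum t ({..<?d} - {p, q})))"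
        by (rule polyop_diag_group) (use tn pq in auto)
      ultimately show "x (f p) * (y (f q) * ?Q (diag_unit p) (diag_unit q)) = x (f p) * (y (f q) * (if f p = f q then 0 else fact m * gA (type_sum \<tau> (R - {f p, f q}))))"
        using ts pq by (simp del: polyop.simps)
    qed
    also have "\<dots> = (\<Sum>p<?d. \<Sum>v\<in>R. x (f p) * (y v * (if f p = v then 0 else fact m * gA (type_sum \<tau> (R - {f p, v})))))"
      by (intro sum.cong refl sum.reindex_bij_betw[OF f])
    also have "\<dots> = (\<Sum>u\<in>R. \<Sum>v\<in>R. x u * (y v * (if u = v then 0 else fact m * gA (type_sum \<tau> (R - {u, v})))))"
      by (rule sum.reindex_bij_betw[OF f])
    also have "\<dots> = (\<Sum>u\<in>R. \<Sum>v\<in>R - {u}. fact m * (x u * y v * gA (type_sum \<tau> (R - {u, v}))))"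
      by (intro sum.cong refl sum.mono_neutral_cong_right) (use fR in auto)
    finally show ?thesis by (simp add: sum_distrib_left[symmetric] del: polyop.simps)
  qed
  ultimately have "lorentz UNIV (\<lambda>x y. \<Sum>s\<in>R. \<Sum>t\<in>R - {s}. x s * y t * gA (type_sum \<tau> (R - {s, t})))"
    by (intro lorentz_if_nonneg_cong[where c = "1 / fact m" and B' = "\<lambda>x y. \<Sum>s\<in>R. \<Sum>t\<in>R - {s}. x s * y t * gA (type_sum \<tau> (R - {s, t}))"]) auto
  then show "lorentz UNIV (\<lambda>x y. \<Sum>s\<in>R. \<Sum>t\<in>R - {s}. x s * y t * contract n g (repeat_list n (type_sum \<tau> (R - {s, t})) c) 0)"
    by (simp only: gA_def)
qed


section \<open>Passing between \<open>\<kappa>\<close> and the polarization with equally many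
  copies\<close>

definition const_exp :: "nat \<Rightarrow> nat \<Rightarrow> (nat \<Rightarrow>\<^sub>0 nat)" where
  "const_exp n d = type_sum (\<lambda>s. s div d) {..<n * d}"

lemma lookup_const_exp: "i < n \<Longrightarrow> Poly_Mapping.lookup (const_exp n d) i = d"
proof (cases "d = 0")
  case False
  assume i: "i < n"
  have "i * d + d \<le> n * d" using mult_le_mono1[of "Suc i" n d] i by (simp add: add.commute)
  then have "{s\<in>{..<n * d}. s div d = i} = {i * d..<i * d + d}"
    using False by (auto simp: div_nat_eqI add.commute mult.commute dividend_less_div_times times_div_less_eq_dividend)
       (metis add.commute dividend_less_times_div mult.commute neq0_conv)
  then show ?thesis by (simp add: const_exp_def lookup_type_sum)
qed (simp add: const_exp_def type_sum_def)

lemma supported_const_exp: "0 < d \<Longrightarrow> supported n (const_exp n d)" "0 < d \<Longrightarrow> exp_degree n (const_exp n d) = n * d"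
  using supported_type_sum[of "{..<n * d}" "\<lambda>s. s div d" n] by (auto simp: const_exp_def less_mult_imp_div_less)

lemma supported_minus: "supported n a \<Longrightarrow> supported n (a - b)"
  by (auto simp: supported_def lookup_minus)

text \<open>The coefficients of \<open>g\<close> are perturbed to be positive, as the
  local-to-global principle requires; diagonal directions give the quadratic case, and the dual
  arises from the polarization with \<open>m + 2\<close> copies of each variable.\<close>

theorem lk_from_weak:
  assumes W: "\<And>H. (\<And>i. i < n \<Longrightarrow> posdef (m + 2) (H i)) \<Longrightarrow> lorentz (herm_set (m + 2)) (\<lambda>x y. polyop n (polar_det (m + 2)) H m g [x, y])"
    and g0: "\<And>a. 0 \<le> g a" and g: "nontriv n m g"
    and zs: "length zs + 2 + m = n * (m + 2)" "\<And>z i. z \<in> set zs \<Longrightarrow> i < n \<Longrightarrow> 0 \<le> z i"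
  shows "lorentz UNIV (\<lambda>x y. contract n (dual_coeff n (const_exp n (m + 2)) g) (x # y # zs) 0)"
proof (rule lorentz_closure[of "length zs"])
  fix ws :: "(nat \<Rightarrow> real) list" assume ws: "length ws = length zs" "\<And>z i. z \<in> set ws \<Longrightarrow> i < n \<Longrightarrow> 0 < z i"
  let ?d = "m + 2" and ?k = "const_exp n (m + 2)" and ?\<tau> = "\<lambda>s. s div (m + 2)"
  define ge where "ge e b = contract n g (repeat_list n b (perturbed e)) 0" for e b
  have ge0: "0 \<le> ge e b" if "0 < e" for e b
    unfolding ge_def
  proof (rule contract_nonneg[OF g0])
    show "0 \<le> v i" if "v \<in> set (repeat_list n b (perturbed e))" for v i
      using that set_repeat_list[of n b "perturbed e"] perturbed_pos[OF \<open>0 < e\<close>] by (auto intro: less_imp_le)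
  qed
  have gep: "0 < ge e b" if "0 < e" "exp_degree n b = m" for e b
  proof -
    from g obtain a where "supported n a" "exp_degree n a = m" "0 < g a" by (auto simp: nontriv_def)
    then show ?thesis unfolding ge_def
    proof (intro contract_pos[where d = a, OF g0])
      show "0 < v i" if "v \<in> set (repeat_list n b (perturbed e))" for v i
        using that set_repeat_list[of n b "perturbed e"] perturbed_pos[OF \<open>0 < e\<close>] by auto
    qed (use that in auto)
  qed
  show "lorentz UNIV (\<lambda>x y. contract n (dual_coeff n ?k g) (x # y # ws) 0)"
  proof (rule lorentz_limit[where F = "at_right (0::real)" and B = "\<lambda>e x y. contract n (dual_coeff n ?k (ge e)) (x # y # ws) 0"])
    show "((\<lambda>e. contract n (dual_coeff n ?k (ge e)) (x # y # ws) 0) \<longlongrightarrow> contract n (dual_coeff n ?k g) (x # y # ws) 0) (at_right 0)" for x y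
    proof (rule contract_tendsto)
      fix b assume "supported n b"
      have "supported n (?k - b)" using supported_const_exp(1)[of ?d n] by (intro supported_minus) simp
      from perturbed_tendsto[OF this, of g 0] have "((\<lambda>e. ge e (?k - b)) \<longlongrightarrow> g (?k - b)) (at_right 0)" by (simp add: ge_def)
      moreover have "mfact n (?k - b) \<noteq> 0" using mfact_pos[of n "?k - b"] by simp
      ultimately show "((\<lambda>e. dual_coeff n ?k (ge e) (0 + b)) \<longlongrightarrow> dual_coeff n ?k g (0 + b)) (at_right 0)"
      proof (cases "\<forall>i. Poly_Mapping.lookup b i \<le> Poly_Mapping.lookup ?k i")
        case True
        then have "dual_coeff n ?k h b = h (?k - b) / mfact n (?k - b)" for h by (simp add: dual_coeff_def)
        moreover assume "((\<lambda>e. ge e (?k - b)) \<longlongrightarrow> g (?k - b)) (at_right 0)" "mfact n (?k - b) \<noteq> 0"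
        ultimately show ?thesis by (simp add: tendsto_divide)
      next
        case False
        then have "dual_coeff n ?k h b = 0" for h unfolding dual_coeff_def by presburger
        then show ?thesis by simp
      qed
    qed
    show "\<forall>\<^sub>F e in at_right 0. lorentz UNIV (\<lambda>x y. contract n (dual_coeff n ?k (ge e)) (x # y # ws) 0)"
      using eventually_at_right_less[of 0]
    proof eventually_elim
      case (elim e)
      have \<tau>: "?\<tau> s < n" if "s < n * ?d" for s using that by (rule less_mult_imp_div_less)
      have "local_lorentz (n * ?d) ?\<tau> m (ge e)"
        unfolding ge_def[abs_def] by (rule local_lorentz_subst[OF W \<tau>]) (use perturbed_pos[OF elim] in \<open>auto intro: less_imp_le\<close>)
      from dual_coeff_lorentz[OF ge0[OF elim] gep[OF elim] \<tau> this]
      show ?case unfolding const_exp_def using ws zs by simp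
    qed
  qed simp
qed (use zs in auto)

text \<open>For exponent 0 at \<open>i\<close> the right side reads \<open>g\<close> at an exponent
  exceeding \<open>k\<close> in \<open>i\<close>, where it vanishes by assumption; otherwise both
  sides read \<open>g\<close> at the same place.\<close>

lemma raise_dual_coeff:
  assumes g: "\<And>a. g a \<noteq> 0 \<Longrightarrow> Poly_Mapping.lookup a i \<le> Poly_Mapping.lookup k i"
  shows "raise i (dual_coeff n k g) = dual_coeff n (k + unit_exp i) g"
proof
  fix b
  show "raise i (dual_coeff n k g) b = dual_coeff n (k + unit_exp i) g b"
  proof (cases "Poly_Mapping.lookup b i = 0")
    case True
    have "Poly_Mapping.lookup (k + unit_exp i - b) i = Poly_Mapping.lookup k i + 1"
      using True by (simp add: lookup_minus lookup_add lookup_unit_exp)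
    then have "g (k + unit_exp i - b) = 0" using g[of "k + unit_exp i - b"] by linarith
    then show ?thesis using True by (simp add: raise_0 dual_coeff_def)
  next
    case False
    then obtain c where c: "b = c + unit_exp i" using unit_exp_split by blast
    have "k + unit_exp i - b = k - c" unfolding c by (metis add.commute add_diff_cancel_right diff_diff_add)
    moreover have "(\<forall>j. Poly_Mapping.lookup b j \<le> Poly_Mapping.lookup (k + unit_exp i) j) \<longleftrightarrow> (\<forall>j. Poly_Mapping.lookup c j \<le> Poly_Mapping.lookup k j)"
      by (simp add: c lookup_add)
    ultimately show ?thesis by (simp add: c dual_coeff_def[of n k g c] dual_coeff_def[of n "k + unit_exp i" g] del: add_diff_cancel_right)
  qed
qed

text \<open>To meet the lower bound of \<open>local_lorentz_perturbed\<close>,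
  \<open>\<kappa>\<close> is raised by \<open>m + 2\<close> in every variable, which keeps the dual
  Lorentzian. The perturbed coefficients \<open>ge e\<close> tend to \<open>g\<close>. The case
  \<open>n = 0\<close> is a multiple of the polarized 2 by 2 determinant and is settled first, as
  \<open>polyop_lorentz\<close> assumes a variable.\<close>

theorem weak_from_strong:
  assumes g0: "\<And>a. 0 \<le> g a" and g: "nontriv n m g" and gs: "\<And>a i. g a \<noteq> 0 \<Longrightarrow> Poly_Mapping.lookup a i \<le> Poly_Mapping.lookup \<kappa> i"
    and \<kappa>: "supported n \<kappa>" "k + m = exp_degree n \<kappa>" and F: "lorentz_coeff n k (dual_coeff n \<kappa> g)"
  shows "md_lorentz n m g"
proof (cases "n = 0")
  case True
  then have m: "m = 0" using g by (auto simp: nontriv_def exp_degree_def)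
  have "lorentz (herm_set 2) (\<lambda>x y. polar_det 2 [x, y])" using polar_det_lorentz[of "[]" 2] by simp
  then have "lorentz (herm_set 2) (\<lambda>x y. g 0 * polar_det 2 [x, y])" by (rule lorentz_scale[OF g0])
  then show ?thesis using g0 by (simp add: md_lorentz_def m numeral_2_eq_2)
next
  case False
  then have n: "0 < n" by simp
  obtain a where a: "supported n a" "exp_degree n a = m" "0 < g a" using g by (auto simp: nontriv_def)
  have Lpos: "0 < dual_coeff n (\<kappa> + \<delta>) g (\<kappa> + \<delta> - a)" for \<delta>
  proof -
    have "Poly_Mapping.lookup a i \<le> Poly_Mapping.lookup (\<kappa> + \<delta>) i" for i using gs[of a i] a by (simp add: lookup_add trans_le_add1)
    then have "\<kappa> + \<delta> - (\<kappa> + \<delta> - a) = a" by (intro poly_mapping_eqI) (simp add: lookup_minus)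
    then show ?thesis using a mfact_pos[of n a] by (simp add: dual_coeff_def lookup_minus)
  qed
  have st: "lorentz_coeff n (k + exp_degree n \<delta>) (dual_coeff n (\<kappa> + \<delta>) g)" if "supported n \<delta>" for \<delta>
    using that
  proof (induction rule: supported_induct)
    case (add b i)
    have "lorentz_coeff n (Suc (k + exp_degree n b)) (raise i (dual_coeff n (\<kappa> + b) g))"
      by (rule lorentz_coeff_raise[OF add(3) Lpos add(2)])
    moreover have "raise i (dual_coeff n (\<kappa> + b) g) = dual_coeff n (\<kappa> + b + unit_exp i) g"
      by (rule raise_dual_coeff) (use gs in \<open>simp add: lookup_add trans_le_add1\<close>)
    ultimately show ?case using add by (simp add: exp_degree_add add.assoc)
  qed (use F in simp)
  define d where "d = m + 2"
  define \<kappa>' where "\<kappa>' = \<kappa> + const_exp n d"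
  have d0: "0 < d" by (simp add: d_def)
  have \<kappa>': "supported n \<kappa>'" "\<And>i. i < n \<Longrightarrow> m + 2 \<le> Poly_Mapping.lookup \<kappa>' i" "(k + exp_degree n (const_exp n d)) + m = exp_degree n \<kappa>'"
    using \<kappa> supported_const_exp[OF d0] by (auto simp: \<kappa>'_def lookup_add lookup_const_exp exp_degree_add d_def)
  have F': "lorentz_coeff n (k + exp_degree n (const_exp n d)) (dual_coeff n \<kappa>' g)" unfolding \<kappa>'_def by (rule st[OF supported_const_exp(1)[OF d0]])
  have b0: "0 < dual_coeff n \<kappa>' g (\<kappa>' - a)" unfolding \<kappa>'_def by (rule Lpos)
  define ge where "ge e a = mfact n a * contract n (dual_coeff n \<kappa>' g) (repeat_list n (\<kappa>' - a) (perturbed e)) 0" for e a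
  have \<tau>: "s div (m + 2) < n" if "s < n * (m + 2)" for s using that by (rule less_mult_imp_div_less)
  show ?thesis
    unfolding md_lorentz_def
  proof (intro conjI allI impI g0)
    fix H assume H: "\<forall>i<n. posdef (m + 2) (H i)"
    show "lorentz (herm_set (m + 2)) (\<lambda>x y. polyop n (polar_det (m + 2)) H m g [x, y])"
    proof (rule lorentz_limit[where F = "at_right (0::real)" and B = "\<lambda>e x y. polyop n (polar_det (m + 2)) H m (ge e) [x, y]"])
      show "((\<lambda>e. polyop n (polar_det (m + 2)) H m (ge e) [x, y]) \<longlongrightarrow> polyop n (polar_det (m + 2)) H m g [x, y]) (at_right 0)" for x y
      proof (rule polyop_tendsto_coeffs)
        fix b assume b: "supported n b" "exp_degree n b = m"
        have "supported n (\<kappa>' - b)" using \<kappa>'(1) by (rule supported_minus)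
        from perturbed_tendsto[OF this, of "dual_coeff n \<kappa>' g" 0]
        have "((\<lambda>e. ge e b) \<longlongrightarrow> mfact n b * dual_coeff n \<kappa>' g (\<kappa>' - b)) (at_right 0)"
          unfolding ge_def by (intro tendsto_intros) simp
        moreover have "mfact n b * dual_coeff n \<kappa>' g (\<kappa>' - b) = g b"
        proof -
          have "Poly_Mapping.lookup b i \<le> Poly_Mapping.lookup \<kappa>' i" for i
          proof (cases "i < n")
            case True
            then have "Poly_Mapping.lookup b i \<le> exp_degree n b" unfolding exp_degree_def by (intro member_le_sum) auto
            then show ?thesis using \<kappa>'(2)[OF True] b by linarith
          next
            case False
            then have "Poly_Mapping.lookup b i = 0" using b(1) unfolding supported_def by blast
            then show ?thesis by simp
          qed
          then have "\<kappa>' - (\<kappa>' - b) = b" by (intro poly_mapping_eqI) (simp add: lookup_minus)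
          then show ?thesis using mfact_pos[of n b] by (simp add: dual_coeff_def lookup_minus)
        qed
        ultimately show "((\<lambda>e. ge e b) \<longlongrightarrow> g b) (at_right 0)" by simp
      qed
      show "\<forall>\<^sub>F e in at_right 0. lorentz (herm_set (m + 2)) (\<lambda>x y. polyop n (polar_det (m + 2)) H m (ge e) [x, y])"
        using eventually_at_right_less[of 0]
      proof eventually_elim
        case (elim e)
        note lp = local_lorentz_perturbed[OF F' b0 \<kappa>' elim \<tau>, folded ge_def[abs_def]]
        show ?case
          by (rule polyop_lorentz) (use lp H n in \<open>auto simp: ge_def[abs_def]\<close>)
      qed
    qed simp
  qed
qed

section \<open>Symmetric matrices with at most one positive eigenvalue\<close>

definition inner_prod :: "nat \<Rightarrow> (nat \<Rightarrow> real) \<Rightarrow> (nat \<Rightarrow> real) \<Rightarrow> real" where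
  "inner_prod n x y = (\<Sum>i<n. x i * y i)"

definition bilin_form :: "nat \<Rightarrow> (nat \<Rightarrow> nat \<Rightarrow> real) \<Rightarrow> (nat \<Rightarrow> real) \<Rightarrow> (nat \<Rightarrow> real) \<Rightarrow> real" where
  "bilin_form n a x y = (\<Sum>i<n. \<Sum>j<n. a i j * x i * y j)"

lemma symm_bilin_inner_prod: "symm_bilin (inner_prod n)"
  unfolding symm_bilin_def inner_prod_def
  by (auto intro!: linearI simp: mult.commute sum.distrib sum_distrib_left algebra_simps)

lemma symm_bilin_bilin_form: "(\<And>i j. i < n \<Longrightarrow> j < n \<Longrightarrow> a i j = a j i) \<Longrightarrow> symm_bilin (bilin_form n a)"
  unfolding symm_bilin_def
proof (intro conjI allI)
  assume a: "\<And>i j. i < n \<Longrightarrow> j < n \<Longrightarrow> a i j = a j i"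
  show "bilin_form n a x y = bilin_form n a y x" for x y
    unfolding bilin_form_def by (subst sum.swap) (intro sum.cong refl, simp add: a)
  show "linear (bilin_form n a x)" for x
    unfolding bilin_form_def by (rule linearI) (simp_all add: sum.distrib sum_distrib_left algebra_simps)
qed

lemma bilin_form_cong: "(\<And>i. i < n \<Longrightarrow> x i = x' i) \<Longrightarrow> (\<And>i. i < n \<Longrightarrow> y i = y' i) \<Longrightarrow> bilin_form n a x y = bilin_form n a x' y'"
  unfolding bilin_form_def by (intro sum.cong refl) auto

lemma inner_prod_cong: "(\<And>i. i < n \<Longrightarrow> x i = x' i) \<Longrightarrow> (\<And>i. i < n \<Longrightarrow> y i = y' i) \<Longrightarrow> inner_prod n x y = inner_prod n x' y'"
  unfolding inner_prod_def by (intro sum.cong refl) auto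

lemma inner_prod_nonneg: "0 \<le> inner_prod n x x" unfolding inner_prod_def by (simp add: sum_nonneg)

lemma inner_prod_zeroD: "inner_prod n x x = 0 \<Longrightarrow> i < n \<Longrightarrow> x i = 0"
  unfolding inner_prod_def using sum_nonneg_eq_0_iff[of "{..<n}" "\<lambda>i. x i * x i"] by simp

lemma inner_prod_unit_fun: "i < n \<Longrightarrow> inner_prod n x (unit_fun i) = x i"
  unfolding inner_prod_def unit_fun_def by (simp add: if_distrib[of "\<lambda>t. _ * t"] cong: if_cong)

lemma bilin_form_unit_fun: "i < n \<Longrightarrow> bilin_form n a x (unit_fun i) = (\<Sum>p<n. a p i * x p)"
  unfolding bilin_form_def unit_fun_def by (simp add: if_distrib[of "\<lambda>t. _ * t"] cong: if_cong)

text \<open>\<open>inner_prod n\<close> and \<open>bilin_form n\<close> read only coordinates below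
  \<open>n\<close>, so vectors can be truncated by \<open>tr\<close>. The admissible ones are then a
  closed part of a product of intervals, compact in the product topology.\<close>

lemma sphere_max:
  assumes w: "inner_prod n w w = 1" "\<And>j. j < k \<Longrightarrow> inner_prod n (v j) w = 0"
  shows "\<exists>u. inner_prod n u u = 1 \<and> (\<forall>j<k. inner_prod n (v j) u = 0) \<and>
    (\<forall>x. inner_prod n x x = 1 \<longrightarrow> (\<forall>j<k. inner_prod n (v j) x = 0) \<longrightarrow> bilin_form n a x x \<le> bilin_form n a u u)"
proof -
  define S where "S i = (if i < n then {-1..1::real} else {0})" for i
  define K where "K = PiE UNIV S"
  define C where "C = {x. inner_prod n x x = 1} \<inter> (\<Inter>j\<in>{..<k}. {x. inner_prod n (v j) x = 0})"
  define tr where "tr x = (\<lambda>i. if i < n then x i else (0::real))" for x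
  have t: "inner_prod n (tr x) y = inner_prod n x y" "inner_prod n y (tr x) = inner_prod n y x" "bilin_form n a (tr x) (tr x) = bilin_form n a x x" for x y
    by (auto simp: tr_def intro!: inner_prod_cong bilin_form_cong)
  have K: "compact K"
    using compactin_PiE[of "\<lambda>_. euclidean" UNIV S]
    unfolding K_def euclidean_product_topology compactin_euclidean_iff by (auto simp: S_def)
  have cl: "closed C" unfolding C_def inner_prod_def
    by (intro closed_Int closed_INT ballI closed_Collect_eq continuous_intros continuous_on_product_coordinates)
  have sq: "x i * x i \<le> inner_prod n x x" if "i < n" for x i
    unfolding inner_prod_def using that by (intro member_le_sum) auto
  have mem: "tr x \<in> K \<inter> C" if "inner_prod n x x = 1" "\<forall>j<k. inner_prod n (v j) x = 0" for x
  proof -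
    have "\<bar>x i\<bar> \<le> 1" if "i < n" for i
      using sq[OF that, of x] \<open>inner_prod n x x = 1\<close> by (simp add: abs_le_square_iff[of "x i" 1, simplified] power2_eq_square)
    then have "tr x \<in> K" by (auto simp: K_def S_def tr_def abs_le_iff minus_le_iff)
    then show ?thesis using that by (auto simp: C_def t)
  qed
  have "continuous_on (K \<inter> C) (\<lambda>x. bilin_form n a x x)" unfolding bilin_form_def
    by (intro continuous_intros continuous_on_subset[OF continuous_on_product_coordinates]) auto
  then obtain u where u: "u \<in> K \<inter> C" "\<And>x. x \<in> K \<inter> C \<Longrightarrow> bilin_form n a x x \<le> bilin_form n a u u"
    using continuous_attains_sup[OF compact_Int_closed[OF K cl], of "\<lambda>x. bilin_form n a x x"] mem w by blast
  show ?thesis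
    using u mem t by (intro exI[of _ u]) (metis (mono_tags, lifting) C_def INT_E IntD2 lessThan_iff mem_Collect_eq IntD1)
qed

lemma psd_kernel:
  assumes "\<And>t::real. 0 \<le> 2 * t * c + t\<^sup>2 * q" shows "c = (0::real)"
proof -
  have q: "0 \<le> q" using assms[of 1] assms[of "-1"] by simp
  define t where "t = - c / (q + 1)"
  have c: "c = - t * (q + 1)" using q by (simp add: t_def)
  have "0 \<le> 2 * t * c + t\<^sup>2 * q" by (rule assms)
  also have "\<dots> = - (t\<^sup>2 * (q + 2))" unfolding c by (simp add: power2_eq_square algebra_simps)
  finally have "t = 0" using q by (simp add: mult_le_0_iff)
  then show ?thesis using c by simp
qed

text \<open>A maximizer \<open>u\<close> of the Rayleigh quotient on the complement of the earlier
  eigenvectors is a null vector of the form \<open>D\<close>, which is positive semidefinite there,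
  hence \<open>D u\<close> vanishes on the complement. It vanishes on the earlier eigenvectors too,
  so \<open>u\<close> is an eigenvector.\<close>

lemma eigen_step:
  assumes a: "\<And>i j. i < n \<Longrightarrow> j < n \<Longrightarrow> a i j = a j i" and k: "k < n"
    and on: "\<And>i j. i < k \<Longrightarrow> j < k \<Longrightarrow> inner_prod n (v i) (v j) = (if i = j then 1 else 0)"
    and ev: "\<And>i j. i < k \<Longrightarrow> j < n \<Longrightarrow> (\<Sum>p<n. a p j * v i p) = l i * v i j"
  shows "\<exists>u e. inner_prod n u u = 1 \<and> (\<forall>j<k. inner_prod n (v j) u = 0) \<and> (\<forall>j<n. (\<Sum>p<n. a p j * u p) = e * u j)"
proof -
  note I = symm_bilin_inner_prod[of n] and B = symm_bilin_bilin_form[of n a, OF a]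
  \<comment> \<open>Projections of the coordinate vectors to the complement of the
    \<open>v j\<close>. Their squared lengths add up to \<open>n - k > 0\<close>, so one of them is
    nonzero.\<close>
  define w where "w i = unit_fun i - (\<Sum>j<k. v j i *\<^sub>R v j)" for i
  have lin: "linear (inner_prod n x)" for x using I by (simp add: symm_bilin_def)
  have vw: "inner_prod n (v j) (w i) = 0" if "j < k" "i < n" for i j
    unfolding w_def symm_bilin_simps[OF I] linear_sum[OF lin]
    using that by (simp add: inner_prod_unit_fun on if_distrib[of "\<lambda>t. _ * t"] cong: if_cong)
  have ww: "inner_prod n (w i) (w i) = 1 - (\<Sum>j<k. v j i * v j i)" if "i < n" for i
  proof -
    have "inner_prod n (w i) (w i) = inner_prod n (w i) (unit_fun i) - (\<Sum>j<k. v j i * inner_prod n (w i) (v j))"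
      by (subst (2) w_def) (simp add: symm_bilin_simps[OF I] linear_sum[OF lin])
    also have "(\<Sum>j<k. v j i * inner_prod n (w i) (v j)) = 0" using vw that by (intro sum.neutral) (simp add: symm_bilin_sym[OF I, of "w i"])
    finally have "inner_prod n (w i) (w i) = w i i" using that by (simp add: inner_prod_unit_fun)
    then show ?thesis by (simp add: w_def unit_fun_def fsum_apply)
  qed
  have "(\<Sum>i<n. inner_prod n (w i) (w i)) = real n - (\<Sum>i<n. \<Sum>j<k. v j i * v j i)" by (simp add: ww sum_subtractf)
  also have "(\<Sum>i<n. \<Sum>j<k. v j i * v j i) = (\<Sum>j<k. inner_prod n (v j) (v j))" unfolding inner_prod_def by (rule sum.swap)
  also have "\<dots> = real k" by (simp add: on)
  finally have "\<not> (\<Sum>i<n. inner_prod n (w i) (w i)) \<le> 0" using k by simp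
  then obtain i where i: "i < n" "inner_prod n (w i) (w i) > 0"
    using sum_nonpos[of "{..<n}" "\<lambda>i. inner_prod n (w i) (w i)"] by force
  define c where "c = 1 / sqrt (inner_prod n (w i) (w i))"
  have "inner_prod n (c *\<^sub>R w i) (c *\<^sub>R w i) = 1" using i by (simp add: symm_bilin_simps[OF I] c_def field_simps)
  moreover have "inner_prod n (v j) (c *\<^sub>R w i) = 0" if "j < k" for j using vw that i by (simp add: symm_bilin_simps[OF I])
  ultimately obtain u where u: "inner_prod n u u = 1" "\<And>j. j < k \<Longrightarrow> inner_prod n (v j) u = 0"
    "\<And>x. inner_prod n x x = 1 \<Longrightarrow> \<forall>j<k. inner_prod n (v j) x = 0 \<Longrightarrow> bilin_form n a x x \<le> bilin_form n a u u"
    using sphere_max[of n "c *\<^sub>R w i" k v a] by blast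
  define e where "e = bilin_form n a u u"
  define D where "D x y = e * inner_prod n x y - bilin_form n a x y" for x y
  have D: "symm_bilin D" unfolding D_def[abs_def] symm_bilin_def
    using symm_bilin_sym[OF I] symm_bilin_sym[OF B] by (auto intro!: linearI simp: symm_bilin_simps[OF I] symm_bilin_simps[OF B] algebra_simps)
  have psd: "0 \<le> D x x" if x: "\<And>j. j < k \<Longrightarrow> inner_prod n (v j) x = 0" for x
  proof (cases "inner_prod n x x = 0")
    case True
    then have "bilin_form n a x x = bilin_form n a 0 0" by (intro bilin_form_cong) (auto dest: inner_prod_zeroD)
    then show ?thesis using True by (simp add: D_def symm_bilin_simps[OF B])
  next
    case False
    then have pos: "0 < inner_prod n x x" using inner_prod_nonneg[of n x] by linarith
    define s where "s = 1 / sqrt (inner_prod n x x)"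
    have s: "s * (s * inner_prod n x x) = 1" using pos by (simp add: s_def field_simps)
    have "bilin_form n a (s *\<^sub>R x) (s *\<^sub>R x) \<le> e" unfolding e_def
      by (rule u(3)) (use x s in \<open>simp_all add: symm_bilin_simps[OF I]\<close>)
    then have "s * (s * bilin_form n a x x) \<le> e * (s * (s * inner_prod n x x))" using s by (simp add: symm_bilin_simps[OF B])
    then have "0 \<le> (s * s) * D x x" by (simp add: D_def algebra_simps)
    moreover have "0 < s * s" using pos by (simp add: s_def)
    ultimately show ?thesis by (simp add: zero_le_mult_iff)
  qed
  have Du: "D u y = 0" if y: "\<And>j. j < k \<Longrightarrow> inner_prod n (v j) y = 0" for y
  proof (rule psd_kernel[where q = "D y y"])
    fix t :: real
    have "0 \<le> D (u + t *\<^sub>R y) (u + t *\<^sub>R y)" by (rule psd) (simp add: symm_bilin_simps[OF I] u y)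
    also have "\<dots> = D u u + 2 * t * D u y + t\<^sup>2 * D y y"
      using symm_bilin_sym[OF D, of y u] by (simp add: symm_bilin_simps[OF D] power2_eq_square algebra_simps)
    also have "D u u = 0" by (simp add: D_def u e_def)
    finally show "0 \<le> 2 * t * D u y + t\<^sup>2 * D y y" by simp
  qed
  have Dv: "D u (v j) = 0" if j: "j < k" for j
  proof -
    have "bilin_form n a u (v j) = bilin_form n a (v j) u" by (rule symm_bilin_sym[OF B])
    also have "\<dots> = (\<Sum>q<n. (\<Sum>p<n. a p q * v j p) * u q)"
      unfolding bilin_form_def sum_distrib_right by (rule sum.swap)
    also have "\<dots> = l j * inner_prod n (v j) u" using ev[OF j] by (simp add: inner_prod_def sum_distrib_left mult.assoc)
    finally show ?thesis using u(2)[OF j] symm_bilin_sym[OF I, of u "v j"] by (simp add: D_def)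
  qed
  have "(\<Sum>p<n. a p j * u p) = e * u j" if j: "j < n" for j
  proof -
    have "unit_fun j = w j + (\<Sum>i<k. v i j *\<^sub>R v i)" by (simp add: w_def)
    then have "D u (unit_fun j) = D u (w j) + (\<Sum>i<k. v i j * D u (v i))"
      using D by (simp add: symm_bilin_simps[OF D] linear_sum[of "D u"] symm_bilin_def)
    also have "\<dots> = 0" using Du[of "w j"] vw j Dv by simp
    finally show ?thesis using j by (simp add: D_def inner_prod_unit_fun bilin_form_unit_fun)
  qed
  then show ?thesis using u by blast
qed

lemma eigenbasis:
  assumes a: "\<And>i j. i < n \<Longrightarrow> j < n \<Longrightarrow> a i j = a j i"
  shows "k \<le> n \<Longrightarrow> \<exists>v l. (\<forall>i<k. \<forall>j<k. inner_prod n (v i) (v j) = (if i = j then 1 else 0)) \<and>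
    (\<forall>i<k. \<forall>j<n. (\<Sum>p<n. a p j * v i p) = l i * v i j)"
proof (induction k)
  case (Suc k)
  then obtain v l where vl: "\<forall>i<k. \<forall>j<k. inner_prod n (v i) (v j) = (if i = j then 1 else 0)"
    "\<forall>i<k. \<forall>j<n. (\<Sum>p<n. a p j * v i p) = l i * v i j" by auto
  obtain u e where u: "inner_prod n u u = 1" "\<forall>j<k. inner_prod n (v j) u = 0" "\<forall>j<n. (\<Sum>p<n. a p j * u p) = e * u j"
    using eigen_step[of n a k v l] a Suc.prems vl by auto
  show ?case
    by (rule exI[of _ "v(k := u)"], rule exI[of _ "l(k := e)"])
      (use vl u symm_bilin_sym[OF symm_bilin_inner_prod] in \<open>auto simp: less_Suc_eq\<close>)
qed simp

text \<open>Orthonormality makes \<open>W\<close> the inverse of \<open>V\<close>, so the matrix is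
  similar to the diagonal matrix \<open>E\<close>. This gives the characteristic polynomial, and
  \<open>A = V * E * W\<close> gives the shape of the form.\<close>

lemma spectral:
  assumes a: "\<And>i j. i < n \<Longrightarrow> j < n \<Longrightarrow> a i j = a j i"
  obtains v l where "\<forall>i<n. \<forall>j<n. inner_prod n (v i) (v j) = (if i = j then 1 else 0)"
    "\<forall>x y. bilin_form n a x y = (\<Sum>k<n. l k * inner_prod n (v k) x * inner_prod n (v k) y)"
    "char_poly (Matrix.mat n n (\<lambda>(i, j). a i j)) = (\<Prod>k<n. [:- l k, 1:])"
proof -
  obtain v l where vl: "\<forall>i<n. \<forall>j<n. inner_prod n (v i) (v j) = (if i = j then 1 else 0)"
    "\<forall>i<n. \<forall>j<n. (\<Sum>p<n. a p j * v i p) = l i * v i j"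
    using eigenbasis[where a=a and n=n and k=n] a by auto
  have on: "\<And>i j. i < n \<Longrightarrow> j < n \<Longrightarrow> inner_prod n (v i) (v j) = (if i = j then 1 else 0)"
    and ev: "\<And>i j. i < n \<Longrightarrow> j < n \<Longrightarrow> (\<Sum>p<n. a p j * v i p) = l i * v i j" using vl by auto
  note [simp] = scalar_prod_def
  define A where "A = Matrix.mat n n (\<lambda>(i, j). a i j)"
  define V where "V = Matrix.mat n n (\<lambda>(i, k). v k i)"
  define W where "W = Matrix.mat n n (\<lambda>(k, i). v k i)"
  define E where "E = Matrix.mat n n (\<lambda>(k, i). if k = i then l k else 0)"
  have C: "A \<in> carrier_mat n n" "V \<in> carrier_mat n n" "W \<in> carrier_mat n n" "E \<in> carrier_mat n n"
    by (simp_all add: A_def V_def W_def E_def)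
  have WV: "W * V = 1\<^sub>m n"
    by (rule eq_matI) (auto simp: W_def V_def on[unfolded inner_prod_def] lessThan_atLeast0[symmetric])
  then have VW: "V * W = 1\<^sub>m n" using mat_mult_left_right_inverse[OF C(3,2)] by simp
  have AV: "A * V = V * E"
  proof (rule eq_matI)
    fix i j assume "i < dim_row (V * E)" "j < dim_col (V * E)"
    then have ij: "i < n" "j < n" using C by auto
    have "(A * V) $$ (i, j) = (\<Sum>p<n. a i p * v j p)" using ij by (simp add: A_def V_def lessThan_atLeast0)
    also have "\<dots> = (\<Sum>p<n. a p i * v j p)" using a ij by (intro sum.cong refl) auto
    also have "\<dots> = l j * v j i" using ev ij by simp
    also have "\<dots> = (V * E) $$ (i, j)" using ij
      by (simp add: V_def E_def if_distrib[of "\<lambda>t. _ * t"] cong: if_cong)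
    finally show "(A * V) $$ (i, j) = (V * E) $$ (i, j)" .
  qed (use C in auto)
  have AE: "A = V * E * W"
    using C VW AV by (metis assoc_mult_mat right_mult_one_mat)
  have "similar_mat A E" by (rule similar_matI[where P = V and Q = W]) (use C VW WV AE in auto)
  then have "char_poly A = char_poly E" by (rule char_poly_similar)
  also have "\<dots> = (\<Prod>x\<leftarrow>diag_mat E. [:- x, 1:])"
    by (rule char_poly_upper_triangular[OF C(4)]) (auto simp: E_def)
  also have "diag_mat E = map l [0..<n]" by (auto simp: diag_mat_def E_def intro!: nth_equalityI)
  also have "(\<Prod>x\<leftarrow>map l [0..<n]. [:- x, 1:]) = (\<Prod>k<n. [:- l k, 1:])"
    by (simp add: prod.distinct_set_conv_list[symmetric] o_def lessThan_atLeast0)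
  finally have cp: "char_poly A = (\<Prod>k<n. [:- l k, 1:])" .
  have aij: "a i j = (\<Sum>k<n. l k * v k i * v k j)" if ij: "i < n" "j < n" for i j
  proof -
    have "a i j = (V * E * W) $$ (i, j)" unfolding AE[symmetric] A_def using ij by simp
    also have "\<dots> = (\<Sum>k<n. l k * v k i * v k j)" using ij
      by (simp add: V_def E_def W_def if_distrib[of "\<lambda>t. _ * t"] lessThan_atLeast0 mult.commute cong: if_cong)
    finally show ?thesis .
  qed
  have "bilin_form n a x y = (\<Sum>k<n. l k * inner_prod n (v k) x * inner_prod n (v k) y)" for x y
  proof -
    have "bilin_form n a x y = (\<Sum>i<n. \<Sum>j<n. \<Sum>k<n. l k * (v k i * x i) * (v k j * y j))"
      unfolding bilin_form_def
    proof (intro sum.cong refl)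
      fix i j assume "i \<in> {..<n}" "j \<in> {..<n}"
      then show "a i j * x i * y j = (\<Sum>k<n. l k * (v k i * x i) * (v k j * y j))"
        by (simp only: aij lessThan_iff sum_distrib_right) (simp add: mult.assoc mult.left_commute)
    qed
    also have "\<dots> = (\<Sum>i<n. \<Sum>k<n. \<Sum>j<n. l k * (v k i * x i) * (v k j * y j))"
      by (intro sum.cong refl sum.swap)
    also have "\<dots> = (\<Sum>k<n. \<Sum>i<n. \<Sum>j<n. l k * (v k i * x i) * (v k j * y j))" by (rule sum.swap)
    also have "\<dots> = (\<Sum>k<n. l k * inner_prod n (v k) x * inner_prod n (v k) y)"
    proof (intro sum.cong refl)
      fix k
      have "l k * (inner_prod n (v k) x * inner_prod n (v k) y) = (\<Sum>i<n. \<Sum>j<n. l k * (v k i * x i) * (v k j * y j))"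
        unfolding inner_prod_def sum_product by (simp only: sum_distrib_left mult.assoc)
      then show "(\<Sum>i<n. \<Sum>j<n. l k * (v k i * x i) * (v k j * y j)) = l k * inner_prod n (v k) x * inner_prod n (v k) y"
        by (simp add: mult.assoc)
    qed
    finally show ?thesis .
  qed
  then show ?thesis using that vl(1) cp unfolding A_def by blast
qed

text \<open>Two positive eigenvalues would give two orthogonal positive vectors. If there is at most
  one, dropping the nonpositive terms dominates the form by a multiple of the square of a linear
  form.\<close>

lemma num_pos_eigenvalues_le_1_iff:
  assumes a: "\<And>i j. i < n \<Longrightarrow> j < n \<Longrightarrow> a i j = a j i"
  shows "num_pos_eigenvalues (Matrix.mat n n (\<lambda>(i, j). a i j)) \<le> 1 \<longleftrightarrow> lorentz UNIV (bilin_form n a)"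
proof -
  obtain v l where on: "\<forall>i<n. \<forall>j<n. inner_prod n (v i) (v j) = (if i = j then 1 else 0)"
    and b: "\<forall>x y. bilin_form n a x y = (\<Sum>k<n. l k * inner_prod n (v k) x * inner_prod n (v k) y)"
    and cp: "char_poly (Matrix.mat n n (\<lambda>(i, j). a i j)) = (\<Prod>k<n. [:- l k, 1:])"
    by (rule spectral[where a = a and n = n]) ((rule a; assumption) | (rule that; assumption))+
  define P where "P = {k\<in>{..<n}. 0 < l k}"
  have "proots (char_poly (Matrix.mat n n (\<lambda>(i, j). a i j))) = (\<Sum>k<n. {#l k#})"
    unfolding cp by (subst proots_prod) auto
  then have "num_pos_eigenvalues (Matrix.mat n n (\<lambda>(i, j). a i j)) = size (filter_mset (\<lambda>x. 0 < x) (\<Sum>k<n. {#l k#}))"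
    by (simp add: num_pos_eigenvalues_def)
  also have "\<dots> = card P"
  proof -
    have "size (filter_mset (\<lambda>x. 0 < x) (\<Sum>k<m. {#l k#})) = card {k\<in>{..<m}. 0 < l k}" for m
    proof (induction m)
      case (Suc m)
      have "{k\<in>{..<Suc m}. 0 < l k} = (if 0 < l m then insert m {k\<in>{..<m}. 0 < l k} else {k\<in>{..<m}. 0 < l k})"
        by (auto simp: less_Suc_eq)
      then show ?case using Suc by simp
    qed simp
    then show ?thesis by (simp add: P_def)
  qed
  finally have np: "num_pos_eigenvalues (Matrix.mat n n (\<lambda>(i, j). a i j)) = card P" .
  have B: "symm_bilin (bilin_form n a)" by (rule symm_bilin_bilin_form) (rule a; assumption)
  have bv: "bilin_form n a (v i) (v j) = (if i = j then l i else 0)" if "i < n" "j < n" for i j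
    unfolding b[rule_format] using that by (auto simp: on if_distrib[of "\<lambda>t. _ * t"] cong: if_cong)
  have fP: "finite P" by (simp add: P_def)
  show ?thesis unfolding np
  proof
    assume l1: "lorentz UNIV (bilin_form n a)"
    have "i = j" if ij: "i \<in> P" "j \<in> P" for i j
    proof (rule ccontr)
      assume "i \<noteq> j"
      then have "bilin_form n a (v j) (v j) \<le> 0"
        using lorD_orth[OF l1, of "v i" "v j"] bv[of i i] bv[of j i] ij by (simp add: P_def)
      then show False using bv[of j j] ij by (simp add: P_def)
    qed
    then show "card P \<le> 1" using fP card_le_Suc0_iff_eq[of P] by auto
  next
    assume c1: "card P \<le> 1"
    then have eq: "i = j" if "i \<in> P" "j \<in> P" for i j using fP card_le_Suc0_iff_eq[of P] that by auto
    show "lorentz UNIV (bilin_form n a)"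
    proof (cases "P = {}")
      case True
      then have "bilin_form n a x x \<le> 0" for x unfolding b[rule_format]
        by (intro sum_nonpos) (use True in \<open>auto simp: P_def mult.assoc not_less intro!: mult_nonpos_nonneg\<close>, meson not_less)
      then show ?thesis by (auto simp: lorentz_def not_less[symmetric])
    next
      case False
      then obtain k where k: "k \<in> P" by auto
      have sB': "symm_bilin (\<lambda>x y. l k * inner_prod n (v k) x * inner_prod n (v k) y)"
        unfolding symm_bilin_def by (auto intro!: linearI simp: symm_bilin_simps[OF symm_bilin_inner_prod] algebra_simps)
      show ?thesis
      proof (rule lorentz_dom[OF B sB', of UNIV UNIV "\<lambda>x. x"])
        show "lorentz UNIV (\<lambda>x y. l k * inner_prod n (v k) x * inner_prod n (v k) y)"
          by (auto simp: lorentz_def power2_eq_square algebra_simps)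
        fix x
        have "(\<Sum>i\<in>{..<n}-{k}. l i * inner_prod n (v i) x * inner_prod n (v i) x) \<le> 0"
        proof (intro sum_nonpos)
          fix i assume i: "i \<in> {..<n} - {k}"
          then have "l i \<le> 0" using eq[of i k] k by (cases "0 < l i") (auto simp: P_def)
          then show "l i * inner_prod n (v i) x * inner_prod n (v i) x \<le> 0" by (simp add: mult.assoc mult_nonpos_nonneg)
        qed
        then show "bilin_form n a x x \<le> l k * inner_prod n (v k) x * inner_prod n (v k) x"
          unfolding b[rule_format] using k by (subst sum.remove[of _ k]) (auto simp: P_def)
      qed (auto simp: linear_id[unfolded id_def])
    qed
  qed
qed

section \<open>Directional derivatives of polynomials\<close>

lemma lookup_partial_deriv:
  "Poly_Mapping.lookup (partial_deriv i f) \<alpha> = (real (Poly_Mapping.lookup \<alpha> i) + 1) * Poly_Mapping.lookup f (\<alpha> + unit_exp i)"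
proof -
  have "Poly_Mapping.lookup (partial_deriv i f) \<alpha>
      = (\<Sum>\<beta>\<in>Poly_Mapping.keys f. if \<beta> = \<alpha> + unit_exp i then real (Poly_Mapping.lookup \<beta> i) * Poly_Mapping.lookup f \<beta> else 0)"
    unfolding partial_deriv_def lookup_sum
  proof (intro sum.cong refl)
    fix \<beta>
    have e: "\<beta> = \<alpha> + unit_exp i" if "\<beta> - unit_exp i = \<alpha>" "Poly_Mapping.lookup \<beta> i \<noteq> 0"
      unfolding that(1)[symmetric]
    proof (rule poly_mapping_eqI)
      fix j show "Poly_Mapping.lookup \<beta> j = Poly_Mapping.lookup (\<beta> - unit_exp i + unit_exp i) j"
        using that(2) by (auto simp: lookup_add lookup_minus lookup_unit_exp)
    qed
    show "Poly_Mapping.lookup (Poly_Mapping.single (\<beta> - Poly_Mapping.single i 1)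
        (real (Poly_Mapping.lookup \<beta> i) * Poly_Mapping.lookup f \<beta>)) \<alpha>
      = (if \<beta> = \<alpha> + unit_exp i then real (Poly_Mapping.lookup \<beta> i) * Poly_Mapping.lookup f \<beta> else 0)"
    \<comment> \<open>For exponent 0 the truncated subtraction leaves \<open>\<beta>\<close>
      unchanged, but then the factor \<open>real (Poly_Mapping.lookup \<beta> i)\<close> is
      0.\<close>
    proof (cases "Poly_Mapping.lookup \<beta> i = 0")
      case False
      have "\<beta> - unit_exp i = \<alpha> \<longleftrightarrow> \<beta> = \<alpha> + unit_exp i" using e[OF _ False] by (metis add_diff_cancel_right')
      then show ?thesis unfolding unit_exp_def[symmetric] by (simp only: lookup_single when_def)
    qed (auto simp: lookup_add lookup_unit_exp)
  qed
  also have "\<dots> = (real (Poly_Mapping.lookup \<alpha> i) + 1) * Poly_Mapping.lookup f (\<alpha> + unit_exp i)"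
    by (auto simp: lookup_add lookup_unit_exp in_keys_iff add.commute)
  finally show ?thesis .
qed

lemma lookup_poly_dir_deriv:
  "Poly_Mapping.lookup (poly_dir_deriv v f) \<alpha> =
    (\<Sum>i<dim_vec v. vec_index v i * ((real (Poly_Mapping.lookup \<alpha> i) + 1) * Poly_Mapping.lookup f (\<alpha> + unit_exp i)))"
  unfolding poly_dir_deriv_def lookup_sum
  by (intro sum.cong refl)
    (auto simp: mult_map_scale_conv_mult[symmetric] Poly_Mapping.map.rep_eq lookup_partial_deriv when_def)

text \<open>The derivative of order \<open>b\<close> at 0, the normalization in which
  \<open>contract\<close> computes directional derivatives.\<close>

definition deriv_coeff :: "nat \<Rightarrow> mpoly \<Rightarrow> (nat \<Rightarrow>\<^sub>0 nat) \<Rightarrow> real" where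
  "deriv_coeff n f b = mfact n b * Poly_Mapping.lookup f b"

lemma lookup_foldr_poly_dir_deriv:
  assumes "set vs \<subseteq> carrier_vec n"
  shows "mfact n \<alpha> * Poly_Mapping.lookup (foldr poly_dir_deriv vs f) \<alpha> = contract n (deriv_coeff n f) (map vec_index vs) \<alpha>"
  using assms
proof (induction vs arbitrary: \<alpha>)
  case (Cons v vs)
  have "mfact n \<alpha> * Poly_Mapping.lookup (foldr poly_dir_deriv (v # vs) f) \<alpha>
      = (\<Sum>i<n. vec_index v i * (mfact n (\<alpha> + unit_exp i) * Poly_Mapping.lookup (foldr poly_dir_deriv vs f) (\<alpha> + unit_exp i)))"
    using Cons.prems by (simp add: lookup_poly_dir_deriv sum_distrib_left)
      (intro sum.cong refl, auto simp: mfact_add algebra_simps)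
  also have "\<dots> = contract n (deriv_coeff n f) (map vec_index (v # vs)) \<alpha>"
    using Cons by simp
  finally show ?case .
qed (simp add: deriv_coeff_def)

lemma full_dir_deriv_contract:
  "set vs \<subseteq> carrier_vec n \<Longrightarrow> full_dir_deriv vs f = contract n (deriv_coeff n f) (map vec_index vs) 0"
  using lookup_foldr_poly_dir_deriv[of vs n 0 f] by (simp add: full_dir_deriv_def mfact_def)

lemma in_vars_iff: "in_vars n f \<longleftrightarrow> (\<forall>b. Poly_Mapping.lookup f b \<noteq> 0 \<longrightarrow> supported n b)"
  by (auto simp: in_vars_def supported_def in_keys_iff subset_iff)

lemma exp_degree_keys: "supported n b \<Longrightarrow> (\<Sum>i\<in>Poly_Mapping.keys b. Poly_Mapping.lookup b i) = exp_degree n b"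
  unfolding exp_degree_def by (intro sum.mono_neutral_left) (auto simp: supported_def in_keys_iff)

lemma multi_fact_mfact: "supported n b \<Longrightarrow> multi_fact b = mfact n b"
  unfolding multi_fact_def mfact_def by (intro prod.mono_neutral_left) (auto simp: supported_def in_keys_iff)

lemma homogeneous_iff: "in_vars n f \<Longrightarrow> homogeneous k f \<longleftrightarrow> (\<forall>b. Poly_Mapping.lookup f b \<noteq> 0 \<longrightarrow> exp_degree n b = k)"
proof -
  assume "in_vars n f"
  then have "(\<Sum>i\<in>Poly_Mapping.keys b. Poly_Mapping.lookup b i) = exp_degree n b" if "Poly_Mapping.lookup f b \<noteq> 0" for b
    using that exp_degree_keys by (simp add: in_vars_iff)
  then show ?thesis unfolding homogeneous_def Ball_def in_keys_iff[of _ f] by auto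
qed

lemma bilin_form_contract: "bilin_form n (\<lambda>i j. contract n F (unit_fun i # unit_fun j # zs) 0) x y = contract n F (x # y # zs) 0"
proof -
  have "contract n F (unit_fun i # unit_fun j # zs) 0 = contract n F zs (unit_exp i + unit_exp j)" if "i < n" "j < n" for i j
    using that by (simp del: contract.simps)
  then show ?thesis unfolding bilin_form_def by (simp add: sum_distrib_left mult_ac)
qed

lemma gram_contract:
  assumes "set vs \<subseteq> carrier_vec n"
  shows "gram_matrix n (\<lambda>x y. full_dir_deriv (x # y # vs) f)
    = Matrix.mat n n (\<lambda>(i, j). contract n (deriv_coeff n f) (unit_fun i # unit_fun j # map vec_index vs) 0)"
proof -
  have l: "list_all2 (\<lambda>v w. \<forall>i<n. v i = w i) zs zs" for zs :: "(nat \<Rightarrow> real) list" by (simp add: list_all2_same)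
  have "full_dir_deriv (unit_vec n i # unit_vec n j # vs) f = contract n (deriv_coeff n f) (unit_fun i # unit_fun j # map vec_index vs) 0"
    if "i < n" "j < n" for i j
    using assms that by (subst full_dir_deriv_contract[of _ n])
      (auto intro!: contract_cong simp: l unit_fun_def unit_vec_def simp del: contract.simps)
  then show ?thesis by (auto simp: gram_matrix_def intro!: eq_matI simp del: contract.simps)
qed

lemma num_pos_gram:
  assumes "set vs \<subseteq> carrier_vec n"
  shows "num_pos_eigenvalues (gram_matrix n (\<lambda>x y. full_dir_deriv (x # y # vs) f)) \<le> 1
    \<longleftrightarrow> lorentz UNIV (\<lambda>x y. contract n (deriv_coeff n f) (x # y # map vec_index vs) 0)"
proof -
  have "lorentz UNIV (bilin_form n (\<lambda>i j. contract n (deriv_coeff n f) (unit_fun i # unit_fun j # map vec_index vs) 0))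
      = lorentz UNIV (\<lambda>x y. contract n (deriv_coeff n f) (x # y # map vec_index vs) 0)"
    unfolding bilin_form_contract[abs_def] ..
  moreover have "num_pos_eigenvalues (gram_matrix n (\<lambda>x y. full_dir_deriv (x # y # vs) f)) \<le> 1
      \<longleftrightarrow> lorentz UNIV (bilin_form n (\<lambda>i j. contract n (deriv_coeff n f) (unit_fun i # unit_fun j # map vec_index vs) 0))"
    unfolding gram_contract[OF assms]
    by (rule num_pos_eigenvalues_le_1_iff, rule symm_multilin_mset[OF symm_multilin_contract]) (simp add: add_mset_commute)
  ultimately show ?thesis by simp
qed

lemma nonneg_carrier: "set vs \<subseteq> nonneg_nonzero_vecs n \<Longrightarrow> set vs \<subseteq> carrier_vec n"
  by (auto simp: nonneg_nonzero_vecs_def)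

lemma lorentzian_imp_lorentz_coeff:
  assumes "lorentzian n f" shows "\<exists>k. lorentz_coeff n k (deriv_coeff n f)"
proof -
  obtain k where iv: "in_vars n f" and h: "homogeneous k f"
    and nn: "\<And>vs. length vs = k \<Longrightarrow> set vs \<subseteq> nonneg_nonzero_vecs n \<Longrightarrow> 0 \<le> full_dir_deriv vs f"
    and np: "\<And>vs. length vs + 2 = k \<Longrightarrow> set vs \<subseteq> nonneg_nonzero_vecs n \<Longrightarrow>
        num_pos_eigenvalues (gram_matrix n (\<lambda>x y. full_dir_deriv (x # y # vs) f)) \<le> 1"
    using assms unfolding lorentzian_def by auto
  have sd: "supported n b" "exp_degree n b = k" if "deriv_coeff n f b \<noteq> 0" for b
    using that iv h homogeneous_iff[OF iv] by (auto simp: deriv_coeff_def in_vars_iff)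
  have l: "list_all2 (\<lambda>v w. \<forall>i<n. v i = w i) zs (map vec_index (map (Matrix.vec n) zs))" for zs :: "(nat \<Rightarrow> real) list"
    by (auto simp: list_all2_conv_all_nth)
  have pos: "0 \<le> deriv_coeff n f b" for b
  proof (cases "deriv_coeff n f b = 0")
    case False
    \<comment> \<open>Differentiating along unit vectors, repeated according to \<open>b\<close>,
      isolates the coefficient at \<open>b\<close>.\<close>
    define vs where "vs = map (Matrix.vec n) (repeat_list n b unit_fun)"
    have "v \<in> nonneg_nonzero_vecs n" if v: "v \<in> set vs" for v
    proof -
      obtain i where i: "i < n" "v = Matrix.vec n (unit_fun i)" using v set_repeat_list[of n b unit_fun] by (auto simp: vs_def)
      then have "v \<noteq> 0\<^sub>v n" by (auto simp: vec_eq_iff unit_fun_def)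
      then show ?thesis using i by (auto simp: nonneg_nonzero_vecs_def unit_fun_def)
    qed
    then have vs: "set vs \<subseteq> nonneg_nonzero_vecs n" by blast
    have "0 \<le> contract n (deriv_coeff n f) (map vec_index vs) 0"
      using nn[OF _ vs] sd[OF False] full_dir_deriv_contract[OF nonneg_carrier[OF vs]] by (simp add: vs_def)
    also have "\<dots> = contract n (deriv_coeff n f) (repeat_list n b unit_fun @ []) 0" unfolding vs_def
      by (rule contract_cong[symmetric]) (use l[of "repeat_list n b unit_fun"] in simp_all)
    finally show ?thesis using contract_repeat_list_unit_fun[OF sd(1)[OF False], of "deriv_coeff n f" "[]" 0] by simp
  qed simp
  have "lorentz UNIV (\<lambda>x y. contract n (deriv_coeff n f) (x # y # zs) 0)" if z: "length zs + 2 = k" "\<forall>z\<in>set zs. \<forall>i<n. 0 \<le> z i" for zs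
  \<comment> \<open>\<open>lorentzian\<close> speaks of nonzero directions only; a direction that
    vanishes below \<open>n\<close> makes the form identically 0.\<close>
  proof (cases "\<exists>z\<in>set zs. \<forall>i<n. z i = 0")
    case True
    then obtain z xs ys where zs: "zs = xs @ z # ys" "\<forall>i<n. z i = 0" by (meson split_list)
    have "contract n (deriv_coeff n f) (x # y # zs) 0 = 0" for x y
    proof -
      have "contract n (deriv_coeff n f) (x # y # zs) 0 = contract n (deriv_coeff n f) (z # x # y # xs @ ys) 0"
        by (rule symm_multilin_mset[OF symm_multilin_contract]) (simp add: zs)
      then show ?thesis using zs by simp
    qed
    then show ?thesis by simp
  next
    case False
    define vs where "vs = map (Matrix.vec n) zs"
    have vs: "set vs \<subseteq> nonneg_nonzero_vecs n" using False z by (fastforce simp: nonneg_nonzero_vecs_def vs_def vec_eq_iff)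
    have "lorentz UNIV (\<lambda>x y. contract n (deriv_coeff n f) (x # y # map vec_index vs) 0)"
      using np[OF _ vs] z num_pos_gram[OF nonneg_carrier[OF vs]] by (simp add: vs_def)
    then show ?thesis
    proof (rule lorentz_if_nonneg_cong[where c = 1])
      show "contract n (deriv_coeff n f) (x # y # zs) 0 = 1 * contract n (deriv_coeff n f) (x # y # map vec_index vs) 0" for x y
        unfolding mult_1 vs_def by (rule contract_cong) (use l[of zs] in simp_all)
    qed simp
  qed
  then have "lorentz_coeff n k (deriv_coeff n f)" unfolding lorentz_coeff_def using pos sd by blast
  then show ?thesis ..
qed

lemma lorentz_coeff_imp_lorentzian:
  assumes "lorentz_coeff n k (deriv_coeff n f)" shows "lorentzian n f"
proof -
  have nontriv: "deriv_coeff n f b \<noteq> 0 \<longleftrightarrow> Poly_Mapping.lookup f b \<noteq> 0" for b using mfact_pos[of n b] by (simp add: deriv_coeff_def)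
  have iv: "in_vars n f" using assms by (simp add: in_vars_iff lorentz_coeff_def nontriv)
  have nn: "0 \<le> vec_index v i" if "v \<in> set vs" "set vs \<subseteq> nonneg_nonzero_vecs n" "i < n" for v vs i
    using that by (auto simp: nonneg_nonzero_vecs_def)
  show ?thesis unfolding lorentzian_def
  proof (intro conjI exI[of _ k] allI impI iv; (elim conjE)?)
    show "homogeneous k f" unfolding homogeneous_iff[OF iv] using assms by (simp add: lorentz_coeff_def nontriv)
    show "0 \<le> full_dir_deriv vs f" if vs: "set vs \<subseteq> nonneg_nonzero_vecs n" for vs
      unfolding full_dir_deriv_contract[OF nonneg_carrier[OF vs]]
      by (rule contract_nonneg) (use assms nn[OF _ vs] in \<open>auto simp: lorentz_coeff_def\<close>)
    fix vs assume k: "2 \<le> k" and l: "length vs = k - 2" and vs: "set vs \<subseteq> nonneg_nonzero_vecs n"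
    have "lorentz UNIV (\<lambda>x y. contract n (deriv_coeff n f) (x # y # map vec_index vs) 0)"
      using assms nn[OF _ vs] k l by (simp add: lorentz_coeff_def del: contract.simps)
    then show "num_pos_eigenvalues (gram_matrix n (\<lambda>x y. full_dir_deriv (x # y # vs) f)) \<le> 1"
      using num_pos_gram[OF nonneg_carrier[OF vs]] by blast
  qed
qed

text \<open>On exponents bounded by \<open>\<kappa>\<close> the truncated subtraction from
  \<open>\<kappa>\<close> is injective, so no two terms of the defining sum collide.\<close>

lemma lookup_reciprocal:
  assumes "\<And>a i. Poly_Mapping.lookup g a \<noteq> 0 \<Longrightarrow> Poly_Mapping.lookup a i \<le> Poly_Mapping.lookup \<kappa> i"
  shows "Poly_Mapping.lookup (reciprocal \<kappa> g) b =
    (if \<forall>i. Poly_Mapping.lookup b i \<le> Poly_Mapping.lookup \<kappa> i then Poly_Mapping.lookup g (\<kappa> - b) else 0)"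
proof -
  have e: "\<kappa> - a = b \<longleftrightarrow> (\<forall>i. Poly_Mapping.lookup b i \<le> Poly_Mapping.lookup \<kappa> i) \<and> a = \<kappa> - b"
    if "Poly_Mapping.lookup g a \<noteq> 0" for a
    using assms[OF that] by (fastforce simp: poly_mapping_eq_iff fun_eq_iff lookup_minus)
  have "Poly_Mapping.lookup (reciprocal \<kappa> g) b =
    (\<Sum>a\<in>Poly_Mapping.keys g. if a = \<kappa> - b then (if \<forall>i. Poly_Mapping.lookup b i \<le> Poly_Mapping.lookup \<kappa> i then Poly_Mapping.lookup g a else 0) else 0)"
    unfolding reciprocal_def lookup_sum
    by (intro sum.cong refl) (use e in \<open>auto simp: lookup_single when_def in_keys_iff\<close>)
  then show ?thesis by (auto simp: in_keys_iff)
qed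

text \<open>Normalization divides by the factorial of \<open>b\<close> that
  \<open>deriv_coeff\<close> multiplies with; what remains is a coefficient of \<open>g\<close>,
  which is its derivative divided by the factorial of \<open>\<kappa> - b\<close>.\<close>

lemma deriv_coeff_dual:
  assumes b: "bounded_degrees n \<kappa> g"
  shows "deriv_coeff n (normalization_op (reciprocal \<kappa> g)) = dual_coeff n \<kappa> (deriv_coeff n g)"
proof
  fix b
  have le: "Poly_Mapping.lookup g a \<noteq> 0 \<Longrightarrow> Poly_Mapping.lookup a i \<le> Poly_Mapping.lookup \<kappa> i" for a i
    using assms by (auto simp: bounded_degrees_def in_keys_iff)
  have s: "supported n b" if "\<forall>i. Poly_Mapping.lookup b i \<le> Poly_Mapping.lookup \<kappa> i"
    unfolding supported_def
  proof (intro allI impI)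
    fix i assume "Poly_Mapping.lookup b i \<noteq> 0"
    then have "Poly_Mapping.lookup \<kappa> i \<noteq> 0" using that[rule_format, of i] by simp
    then show "i < n" using assms by (auto simp: bounded_degrees_def in_keys_iff subset_iff)
  qed
  have "deriv_coeff n (normalization_op (reciprocal \<kappa> g)) b = mfact n b * (Poly_Mapping.lookup (reciprocal \<kappa> g) b / multi_fact b)"
    by (auto simp: deriv_coeff_def normalization_op_def lookup_mapp when_def in_keys_iff)
  also have "\<dots> = dual_coeff n \<kappa> (deriv_coeff n g) b"
    using mfact_pos[of n b] mfact_pos[of n "\<kappa> - b"] s
    by (auto simp: lookup_reciprocal[OF le] dual_coeff_def deriv_coeff_def multi_fact_mfact)
  finally show "deriv_coeff n (normalization_op (reciprocal \<kappa> g)) b = dual_coeff n \<kappa> (deriv_coeff n g) b" .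
qed

lemma dually_lorentzian_iff:
  "dually_lorentzian n g \<longleftrightarrow> (\<exists>\<kappa> k. bounded_degrees n \<kappa> g \<and> lorentz_coeff n k (dual_coeff n \<kappa> (deriv_coeff n g)))"
  unfolding dually_lorentzian_def using deriv_coeff_dual lorentzian_imp_lorentz_coeff lorentz_coeff_imp_lorentzian by metis

section \<open>Directional derivatives of the determinant\<close>

definition entries :: "nat \<Rightarrow> complex mat \<Rightarrow> nat \<Rightarrow> nat \<Rightarrow> complex" where
  "entries d X i j = (if i < d \<and> j < d then X $$ (i, j) else 0)"

lemma entries_line:
  "X \<in> carrier_mat d d \<Longrightarrow> H \<in> carrier_mat d d \<Longrightarrow> entries d (X + complex_of_real t \<cdot>\<^sub>m H) = entries d X + t *\<^sub>R entries d H"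
  by (auto simp: entries_def fun_eq_iff scaleR_conv_of_real)

text \<open>
  \<open>F\<close> is homogeneous of degree \<open>r\<close> in the entries, with polarization \<open>\<mu>\<close>.
\<close>

definition represents :: "nat \<Rightarrow> nat \<Rightarrow> ((nat \<Rightarrow> nat \<Rightarrow> complex) list \<Rightarrow> real) \<Rightarrow> (complex mat \<Rightarrow> real) \<Rightarrow> bool" where
  "represents d r \<mu> F \<longleftrightarrow> symm_multilin \<mu> \<and> (\<forall>X\<in>carrier_mat d d. F X = \<mu> (replicate r (entries d X)) / fact r)"

text \<open>One of the \<open>Suc r\<close> equal arguments becomes the direction, and the factor
  \<open>Suc r\<close> turns \<open>1 / fact (Suc r)\<close> into \<open>1 / fact r\<close>.\<close>

lemma represents_dir_deriv:
  assumes "represents d (Suc r) \<mu> F" "H \<in> carrier_mat d d"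
  shows "represents d r (\<lambda>xs. \<mu> (entries d H # xs)) (dir_deriv H F)"
  unfolding represents_def
proof (intro conjI ballI)
  have s: "symm_multilin \<mu>" using assms(1) by (simp add: represents_def)
  then show "symm_multilin (\<lambda>xs. \<mu> (entries d H # xs))" by (rule symm_multilin_Cons)
  fix X :: "complex mat" assume X: "X \<in> carrier_mat d d"
  have "(\<lambda>t. F (X + complex_of_real t \<cdot>\<^sub>m H)) = (\<lambda>t. \<mu> (replicate (Suc r) (entries d X + t *\<^sub>R entries d H) @ []) / fact (Suc r))"
    using assms X by (simp add: represents_def entries_line[symmetric])
  moreover have "((\<lambda>t. \<mu> (replicate (Suc r) (entries d X + t *\<^sub>R entries d H) @ []) / fact (Suc r)) has_real_derivative
      real (Suc r) * \<mu> (replicate (Suc r - 1) (entries d X) @ entries d H # []) / fact (Suc r)) (at 0)"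
    by (rule DERIV_cdivide[OF symm_multilin_deriv[OF s]])
  ultimately have "dir_deriv H F X = real (Suc r) * \<mu> (replicate r (entries d X) @ [entries d H]) / fact (Suc r)"
    unfolding dir_deriv_def by (simp add: DERIV_imp_deriv del: replicate_Suc fact_Suc)
  also have "\<mu> (replicate r (entries d X) @ [entries d H]) = \<mu> (entries d H # replicate r (entries d X))"
    by (rule symm_multilin_mset[OF s]) simp
  also have "real (Suc r) * \<mu> (entries d H # replicate r (entries d X)) / fact (Suc r) = \<mu> (entries d H # replicate r (entries d X)) / fact r"
    by (simp del: of_nat_Suc)
  finally show "dir_deriv H F X = \<mu> (entries d H # replicate r (entries d X)) / fact r" .
qed

lemma represents_funpow:
  assumes "H \<in> carrier_mat d d"
  shows "represents d (k + r) \<mu> F \<Longrightarrow> represents d r (\<lambda>xs. \<mu> (replicate k (entries d H) @ xs)) ((dir_deriv H ^^ k) F)"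
proof (induction k arbitrary: r)
  case (Suc k)
  then have "represents d (Suc r) (\<lambda>xs. \<mu> (replicate k (entries d H) @ xs)) ((dir_deriv H ^^ k) F)" by simp
  from represents_dir_deriv[OF this assms] show ?case by (simp add: replicate_app_Cons_same)
qed simp

lemma represents_foldr:
  assumes "\<And>i. i \<in> set js \<Longrightarrow> Hs i \<in> carrier_mat d d" "represents d ((\<Sum>i\<leftarrow>js. p i) + r) \<mu> F"
  shows "represents d r (\<lambda>xs. \<mu> (concat (map (\<lambda>i. replicate (p i) (entries d (Hs i))) js) @ xs))
    (foldr (\<lambda>i. dir_deriv (Hs i) ^^ p i) js F)"
  using assms
proof (induction js arbitrary: r)
  case (Cons i js)
  have "represents d (p i + r) (\<lambda>xs. \<mu> (concat (map (\<lambda>i. replicate (p i) (entries d (Hs i))) js) @ xs))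
      (foldr (\<lambda>i. dir_deriv (Hs i) ^^ p i) js F)"
    using Cons by (simp add: ac_simps)
  from represents_funpow[OF _ this, of "Hs i"] Cons.prems(1)
  have r: "represents d r (\<lambda>xs. \<mu> (concat (map (\<lambda>i. replicate (p i) (entries d (Hs i))) js) @ replicate (p i) (entries d (Hs i)) @ xs))
      (foldr (\<lambda>i. dir_deriv (Hs i) ^^ p i) (i # js) F)" by simp
  have s: "symm_multilin \<mu>" using Cons.prems by (simp add: represents_def)
  have "\<mu> (concat (map (\<lambda>i. replicate (p i) (entries d (Hs i))) js) @ replicate (p i) (entries d (Hs i)) @ xs)
      = \<mu> (concat (map (\<lambda>i. replicate (p i) (entries d (Hs i))) (i # js)) @ xs)" for xs
    by (rule symm_multilin_mset[OF s]) simp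
  then show ?case using r by simp
qed simp

lemma represents_det: "represents d d (polar_det d) (\<lambda>X. Re (Determinant.det X))"
  unfolding represents_def
proof (intro conjI ballI)
  show "symm_multilin (polar_det d)" by (rule symm_multilin_polar_det)
  fix X :: "complex mat" assume "X \<in> carrier_mat d d"
  then have "mat_of d (entries d X) = X" by (auto simp: mat_of_def entries_def intro!: eq_matI)
  then show "Re (Determinant.det X) = polar_det d (replicate d (entries d X)) / fact d" by (simp add: polar_det_replicate)
qed

text \<open>Lowering \<open>C\<close> in variable \<open>i\<close> produces the factor
  \<open>Poly_Mapping.lookup C i\<close>; these factors add up to the degree, so they build up
  \<open>fact m\<close>.\<close>

lemma polyop_monom:
  assumes \<mu>: "symm_multilin \<mu>"
  shows "supported n C \<Longrightarrow> exp_degree n C = m \<Longrightarrow>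
    polyop n \<mu> h m (\<lambda>b. if b = C then mfact n C else 0) Xs = fact m * \<mu> (repeat_list n C h @ Xs)"
proof (induction m arbitrary: C Xs)
  case 0
  then have "C = 0" by (rule supported_exp_degree_0)
  then show ?case by (simp add: mfact_def)
next
  case (Suc m)
  have "polyop n \<mu> h m (\<lambda>b. if b + unit_exp i = C then mfact n C else 0) (h i # Xs)
      = real (Poly_Mapping.lookup C i) * (fact m * \<mu> (repeat_list n C h @ Xs))" if i: "i < n" for i
  proof (cases "Poly_Mapping.lookup C i = 0")
    case True
    have "b + unit_exp i \<noteq> C" for b using True by (auto simp: lookup_add lookup_unit_exp)
    then show ?thesis using True by (simp add: polyop_zero_coeffs)
  next
    case False
    define D where "D = C - unit_exp i"
    have C: "C = D + unit_exp i"
      by (rule poly_mapping_eqI) (use False in \<open>auto simp: D_def lookup_add lookup_minus lookup_unit_exp\<close>)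
    have D: "supported n D" "exp_degree n D = m" using Suc.prems i by (auto simp: C exp_degree_add supported_def lookup_add)
    have e: "(\<lambda>b. if b + unit_exp i = C then mfact n C else 0) = (\<lambda>b. real (Poly_Mapping.lookup C i) * (if b = D then mfact n D else 0))"
      using i by (auto simp: C mfact_add lookup_add lookup_unit_exp)
    have "\<mu> (repeat_list n C h @ Xs) = \<mu> (h i # repeat_list n D h @ Xs)"
      unfolding C using symm_multilin_repeat_list_add[OF \<mu> i, of "[]" D h Xs] by simp
    also have "\<dots> = \<mu> (repeat_list n D h @ h i # Xs)" by (rule symm_multilin_mset[OF \<mu>]) simp
    finally show ?thesis unfolding e polyop_scale using Suc.IH[OF D] by simp
  qed
  then have "polyop n \<mu> h (Suc m) (\<lambda>b. if b = C then mfact n C else 0) Xs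
      = (\<Sum>i<n. real (Poly_Mapping.lookup C i) * (fact m * \<mu> (repeat_list n C h @ Xs)))" by simp
  also have "\<dots> = real (exp_degree n C) * (fact m * \<mu> (repeat_list n C h @ Xs))" by (simp add: exp_degree_def sum_distrib_right)
  finally show ?case using Suc.prems by simp
qed

lemma polyop_poly:
  assumes \<mu>: "symm_multilin \<mu>" and g: "\<And>b. Poly_Mapping.lookup g b \<noteq> 0 \<Longrightarrow> supported n b \<and> exp_degree n b = m"
  shows "polyop n \<mu> h m (deriv_coeff n g) Xs
    = fact m * (\<Sum>C\<in>Poly_Mapping.keys g. Poly_Mapping.lookup g C * \<mu> (repeat_list n C h @ Xs))"
proof -
  have "deriv_coeff n g = (\<lambda>b. \<Sum>C\<in>Poly_Mapping.keys g. Poly_Mapping.lookup g C * (if b = C then mfact n C else 0))"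
    by (auto simp: deriv_coeff_def fun_eq_iff in_keys_iff if_distrib[of "\<lambda>t. _ * t"] cong: if_cong)
  then have "polyop n \<mu> h m (deriv_coeff n g) Xs
      = (\<Sum>C\<in>Poly_Mapping.keys g. Poly_Mapping.lookup g C * polyop n \<mu> h m (\<lambda>b. if b = C then mfact n C else 0) Xs)"
    by (simp only: polyop_sum)
  also have "\<dots> = (\<Sum>C\<in>Poly_Mapping.keys g. Poly_Mapping.lookup g C * (fact m * \<mu> (repeat_list n C h @ Xs)))"
    by (intro sum.cong refl) (use g polyop_monom[OF \<mu>] in \<open>simp add: in_keys_iff\<close>)
  finally show ?thesis by (simp add: sum_distrib_left mult.left_commute)
qed

text \<open>Every directional derivative fixes one argument of the polarized determinant. The factor
  \<open>fact (m + 2)\<close> clears the denominator in \<open>MD\<close>, and \<open>fact m\<close>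
  is the normalization of \<open>polyop\<close>.\<close>

lemma MD_polyop:
  assumes g: "\<And>b. Poly_Mapping.lookup g b \<noteq> 0 \<Longrightarrow> supported n b \<and> exp_degree n b = m"
    and H: "H \<in> carrier_mat (m + 2) (m + 2)" "H' \<in> carrier_mat (m + 2) (m + 2)"
      "\<And>i. i < n \<Longrightarrow> Hs i \<in> carrier_mat (m + 2) (m + 2)"
  shows "fact (m + 2) * fact m * MD (m + 2) n H H' g Hs
    = polyop n (polar_det (m + 2)) (\<lambda>i. entries (m + 2) (Hs i)) m (deriv_coeff n g) [entries (m + 2) H, entries (m + 2) H']"
proof -
  define d where "d = m + 2"
  note H = H[folded d_def]
  let ?h = "\<lambda>i. entries d (Hs i)"
  define \<mu> where "\<mu> xs = (\<Sum>C\<in>Poly_Mapping.keys g. Poly_Mapping.lookup g C * polar_det d (repeat_list n C ?h @ xs))" for xs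
  have r: "represents d 2 (\<lambda>xs. polar_det d (repeat_list n C ?h @ xs)) (monom_dir_deriv n Hs C (\<lambda>X. Re (Determinant.det X)))"
    if "C \<in> Poly_Mapping.keys g" for C
  proof -
    have "(\<Sum>i\<leftarrow>[0..<n]. Poly_Mapping.lookup C i) + 2 = d"
      using g[of C] that by (simp add: exp_degree_def d_def in_keys_iff interv_sum_list_conv_sum_set_nat atLeast0LessThan)
    then show ?thesis unfolding monom_dir_deriv_def repeat_list_def
      using represents_foldr[where js = "[0..<n]" and Hs = Hs and d = d and r = 2 and p = "Poly_Mapping.lookup C", OF _ ]
        represents_det[of d] H by simp
  qed
  have "symm_multilin \<mu>" unfolding \<mu>_def[abs_def] by (intro symm_multilin_sumI symm_multilin_scale) (use r in \<open>auto simp: represents_def\<close>)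
  then have "represents d (Suc (Suc 0)) \<mu> (mpoly_dir_deriv n g Hs (\<lambda>X. Re (Determinant.det X)))"
    using r unfolding represents_def mpoly_dir_deriv_def \<mu>_def sum_divide_distrib numeral_2_eq_2
    by (auto intro!: sum.cong simp: field_simps)
  from represents_dir_deriv[OF represents_dir_deriv[OF this H(2)] H(1)]
  have "MD d n H H' g Hs = 1 / fact d * \<mu> [entries d H', entries d H]" by (simp add: represents_def MD_def)
  moreover have "\<mu> [entries d H', entries d H] = \<mu> [entries d H, entries d H']" by (rule symm_multilin_mset[OF \<open>symm_multilin \<mu>\<close>]) simp
  moreover have "polyop n (polar_det d) ?h m (deriv_coeff n g) [entries d H, entries d H'] = fact m * \<mu> [entries d H, entries d H']"
    unfolding \<mu>_def by (rule polyop_poly[OF symm_multilin_polar_det g])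
  ultimately show ?thesis by (simp add: d_def)
qed

section \<open>Hermitian and positive definite matrices as entry functions\<close>

lemma index_mat_adjoint: "i < dim_col A \<Longrightarrow> j < dim_row A \<Longrightarrow> mat_adjoint A $$ (i, j) = conjugate (A $$ (j, i))"
  by (simp add: mat_adjoint_def mat_of_rows_def)

lemma dim_mat_adjoint: "dim_row (mat_adjoint A) = dim_col A" "dim_col (mat_adjoint A) = dim_row A"
  by (simp_all add: mat_adjoint_def mat_of_rows_def)

lemma Herm_iff: "A \<in> Herm d \<longleftrightarrow> A \<in> carrier_mat d d \<and> (\<forall>i<d. \<forall>j<d. cnj (A $$ (j, i)) = A $$ (i, j))"
  by (auto simp: Herm_def mat_eq_iff dim_mat_adjoint index_mat_adjoint)

lemma herm_set_entries: "A \<in> Herm d \<Longrightarrow> entries d A \<in> herm_set d"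
  by (intro hsetI) (auto simp: Herm_iff entries_def)

lemma Herm_mat_of: "X \<in> herm_set d \<Longrightarrow> mat_of d X \<in> Herm d"
  by (auto simp: Herm_iff mat_of_def dest: hsetD)

lemma entries_mat_of: "i < d \<Longrightarrow> j < d \<Longrightarrow> entries d (mat_of d X) i j = X i j"
  by (simp add: entries_def mat_of_def)

lemma pos_def_iff:
  assumes "A \<in> carrier_mat d d"
  shows "pos_def A \<longleftrightarrow> (\<forall>v. (\<exists>i<d. v i \<noteq> 0) \<longrightarrow> 0 < Re (quad_form d (entries d A) v))"
proof -
  have q: "(A *\<^sub>v v) \<bullet>c v = quad_form d (entries d A) (vec_index v)" if "v \<in> carrier_vec d" for v
    unfolding quad_form_def using assms that
    by (simp add: scalar_prod_def entries_def sum_distrib_right sum_distrib_left lessThan_atLeast0 mult_ac)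
  have c: "quad_form d (entries d A) (vec_index (Matrix.vec d v)) = quad_form d (entries d A) v" for v by (simp add: quad_form_def)
  have nontriv: "v \<noteq> 0\<^sub>v d \<longleftrightarrow> (\<exists>i<d. vec_index v i \<noteq> 0)" if "v \<in> carrier_vec d" for v
    using that by (auto simp: vec_eq_iff)
  show ?thesis
  proof
    assume p: "pos_def A"
    show "\<forall>v. (\<exists>i<d. v i \<noteq> 0) \<longrightarrow> 0 < Re (quad_form d (entries d A) v)"
    proof (intro allI impI)
      fix v :: "nat \<Rightarrow> complex" assume "\<exists>i<d. v i \<noteq> 0"
      then have "Matrix.vec d v \<noteq> 0\<^sub>v d" by (auto simp: vec_eq_iff)
      then show "0 < Re (quad_form d (entries d A) v)"
        using p assms q[of "Matrix.vec d v"] c[of v] by (auto simp: pos_def_def dest!: bspec[of _ _ "Matrix.vec d v"])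
    qed
  next
    assume "\<forall>v. (\<exists>i<d. v i \<noteq> 0) \<longrightarrow> 0 < Re (quad_form d (entries d A) v)"
    then have "0 < Re ((A *\<^sub>v v) \<bullet>c v)" if "v \<in> carrier_vec d" "v \<noteq> 0\<^sub>v d" for v
      using q[OF that(1)] nontriv[OF that(1)] that(2) by metis
    then show "pos_def A" using assms by (auto simp: pos_def_def)
  qed
qed

lemma posdef_entries: "A \<in> Herm d \<Longrightarrow> posdef d (entries d A) \<longleftrightarrow> pos_def A"
  using pos_def_iff[of A d] herm_set_entries[of A d] by (auto simp: posdef_def Herm_iff)

lemma pos_def_mat_of:
  assumes "posdef d X" shows "pos_def (mat_of d X)"
proof -
  have "quad_form d (entries d (mat_of d X)) v = quad_form d X v" for v unfolding quad_form_def by (intro sum.cong refl) (simp add: entries_mat_of)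
  then show ?thesis using assms by (subst pos_def_iff[of _ d]) (auto simp: posdef_def mat_of_def)
qed

section \<open>The equivalence\<close>

lemma lookup_le_exp_degree: "supported n a \<Longrightarrow> Poly_Mapping.lookup a i \<le> exp_degree n a"
proof (cases "i < n")
  case True
  then show ?thesis unfolding exp_degree_def by (intro member_le_sum) auto
next
  case False
  moreover assume "supported n a"
  ultimately have "Poly_Mapping.lookup a i = 0" unfolding supported_def by blast
  then show ?thesis by simp
qed

lemma exp_degree_minus:
  assumes "\<And>i. Poly_Mapping.lookup b i \<le> Poly_Mapping.lookup k i"
  shows "exp_degree n (k - b) + exp_degree n b = exp_degree n k"
proof -
  have "k = (k - b) + b" by (rule poly_mapping_eqI) (simp add: lookup_add lookup_minus assms)
  then show ?thesis by (metis exp_degree_add)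
qed

lemma minus_minus_le:
  assumes "\<And>i. Poly_Mapping.lookup b i \<le> Poly_Mapping.lookup k i" shows "k - (k - b) = (b :: nat \<Rightarrow>\<^sub>0 nat)"
  by (rule poly_mapping_eqI) (simp add: lookup_minus assms)

lemma deriv_coeff_pos_nontriv:
  assumes "\<And>b. Poly_Mapping.lookup g b \<noteq> 0 \<Longrightarrow> supported n b \<and> exp_degree n b = m" "g \<noteq> 0" "\<And>a. 0 \<le> deriv_coeff n g a"
  shows "nontriv n m (deriv_coeff n g)"
proof -
  obtain a where a: "Poly_Mapping.lookup g a \<noteq> 0" using assms(2) by (metis lookup_zero poly_mapping_eqI)
  then have "deriv_coeff n g a \<noteq> 0" using mfact_pos[of n a] by (simp add: deriv_coeff_def)
  then have "0 < deriv_coeff n g a" using assms(3)[of a] by linarith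
  then show ?thesis using assms(1)[OF a] by (auto simp: nontriv_def)
qed

text \<open>Write \<open>Y = c *\<^sub>R P + X\<close> with \<open>X\<close> orthogonal to
  \<open>P\<close>. Then \<open>Q P P * Q Y Y - (Q P Y)^2\<close> equals
  \<open>Q P P * Q X X\<close>, and \<open>md_lorentz_strict\<close> makes it negative unless
  \<open>X\<close> vanishes on the block, that is, unless \<open>Y\<close> is a multiple of
  \<open>P\<close> there.\<close>

lemma strict_of_dually_lorentzian:
  assumes g: "\<And>b. Poly_Mapping.lookup g b \<noteq> 0 \<Longrightarrow> supported n b \<and> exp_degree n b = m" "g \<noteq> 0"
    and dl: "dually_lorentzian n g"
    and h: "\<And>i. i < n \<Longrightarrow> posdef (m + 2) (h i)" and P: "posdef (m + 2) P" and Y: "Y \<in> herm_set (m + 2)"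
    and ne: "\<And>c. \<exists>p<m+2. \<exists>q<m+2. Y p q \<noteq> complex_of_real c * P p q"
  defines "Q \<equiv> \<lambda>x y. polyop n (polar_det (m + 2)) h m (deriv_coeff n g) [x, y]"
  shows "0 < Q P P \<and> Q P P * Q Y Y < (Q P Y)\<^sup>2"
proof -
  obtain \<kappa> k where b: "bounded_degrees n \<kappa> g" and s: "lorentz_coeff n k (dual_coeff n \<kappa> (deriv_coeff n g))"
    using dl unfolding dually_lorentzian_iff by blast
  have le: "Poly_Mapping.lookup a i \<le> Poly_Mapping.lookup \<kappa> i" if "deriv_coeff n g a \<noteq> 0" for a i
    using b that by (auto simp: bounded_degrees_def in_keys_iff deriv_coeff_def)
  have L: "dual_coeff n \<kappa> (deriv_coeff n g) (\<kappa> - a) = deriv_coeff n g a / mfact n a" if "deriv_coeff n g a \<noteq> 0" for a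
    using minus_minus_le[OF le[OF that]] by (simp add: dual_coeff_def lookup_minus)
  have g0: "0 \<le> deriv_coeff n g a" for a
  proof (cases "deriv_coeff n g a = 0")
    case False
    have "0 \<le> dual_coeff n \<kappa> (deriv_coeff n g) (\<kappa> - a)" using s by (simp add: lorentz_coeff_def)
    then show ?thesis using L[OF False] mfact_pos[of n a] by (simp add: zero_le_divide_iff)
  qed simp
  have nzg: "nontriv n m (deriv_coeff n g)" by (rule deriv_coeff_pos_nontriv[OF g(1,2) g0])
  then obtain a where a: "exp_degree n a = m" "0 < deriv_coeff n g a" by (auto simp: nontriv_def)
  have "dual_coeff n \<kappa> (deriv_coeff n g) (\<kappa> - a) \<noteq> 0" using L[of a] a mfact_pos[of n a] by simp
  then have "exp_degree n (\<kappa> - a) = k" using s by (simp add: lorentz_coeff_def)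
  then have km: "k + m = exp_degree n \<kappa>" using exp_degree_minus[of a \<kappa> n, OF le] a by auto
  have sk: "supported n \<kappa>" using b by (auto simp: bounded_degrees_def supported_def in_keys_iff subset_iff)
  have w: "md_lorentz n m (deriv_coeff n g)" by (rule weak_from_strong[OF g0 nzg le sk km s])
  have B: "symm_bilin Q" unfolding Q_def by (rule symm_bilin_symm_multilin[OF symm_multilin_polyop[OF symm_multilin_polar_det]])
  have pos: "0 < Q P P" unfolding Q_def
    by (rule polyop_pos[OF g0 nzg, where A = "Collect (posdef (m + 2))"]) (use h P in \<open>auto intro!: polar_det_pos\<close>)
  define c where "c = Q Y P / Q P P"
  define X where "X = Y - c *\<^sub>R P"
  have XP: "Q X P = 0" using pos by (simp add: X_def c_def symm_bilin_simps[OF B])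
  have "Q P P * Q Y Y < (Q P Y)\<^sup>2"
  proof (rule ccontr)
    assume "\<not> ?thesis"
    then have "(Q Y P)\<^sup>2 \<le> Q P P * Q Y Y" using symm_bilin_sym[OF B, of P Y] by simp
    moreover have "Q P P * Q X X = Q P P * Q Y Y - (Q Y P)\<^sup>2"
    proof -
      have "Q X X = Q Y Y - c * Q Y P" using XP symm_bilin_sym[OF B, of X P] symm_bilin_sym[OF B, of Y P]
        by (subst (2) X_def) (simp add: symm_bilin_simps[OF B], simp add: X_def symm_bilin_simps[OF B])
      moreover have "Q P P * c = Q Y P" using pos by (simp add: c_def)
      ultimately show ?thesis by (simp add: right_diff_distrib mult.assoc[symmetric] power2_eq_square)
    qed
    ultimately have "0 \<le> Q P P * Q X X" by linarith
    then have "0 \<le> Q X X" using pos by (simp add: zero_le_mult_iff)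
    moreover have "X \<in> herm_set (m + 2)" unfolding X_def using Y P
      by (intro subspace_diff[OF subspace_herm_set] subspace_scale[OF subspace_herm_set]) (auto simp: posdef_def)
    ultimately have "\<forall>p<m + 2. \<forall>q<m + 2. X p q = 0"
      using md_lorentz_strict[OF w nzg, of h P X] h P XP unfolding Q_def by blast
    then show False using ne[of c] by (auto simp: X_def scaleR_conv_of_real)
  qed
  then show ?thesis using pos by simp
qed

lemma dually_lorentzian_of_strict:
  assumes g: "\<And>b. Poly_Mapping.lookup g b \<noteq> 0 \<Longrightarrow> supported n b \<and> exp_degree n b = m" "g \<noteq> 0"
  defines "Q \<equiv> \<lambda>h x y. polyop n (polar_det (m + 2)) h m (deriv_coeff n g) [x, y]"
  assumes st: "\<And>h P Y. \<forall>i<n. posdef (m + 2) (h i) \<Longrightarrow> posdef (m + 2) P \<Longrightarrow> Y \<in> herm_set (m + 2) \<Longrightarrow>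
      (\<And>c. \<exists>p<m+2. \<exists>q<m+2. Y p q \<noteq> complex_of_real c * P p q) \<Longrightarrow>
      0 < Q h P P \<and> Q h P P * Q h Y Y < (Q h P Y)\<^sup>2"
  shows "dually_lorentzian n g"
proof -
  let ?d = "m + 2"
  have B: "symm_bilin (Q h)" for h unfolding Q_def by (rule symm_bilin_symm_multilin[OF symm_multilin_polyop[OF symm_multilin_polar_det]])
  \<comment> \<open>The hypothesis yields positivity only in the presence of a \<open>Y\<close> that
    is no multiple of \<open>P\<close>. One of \<open>diag_unit 0\<close> and
    \<open>diag_unit 1\<close> qualifies, because the size is at least 2.\<close>
  have pos: "0 < Q h P P" if h: "\<forall>i<n. posdef ?d (h i)" and P: "posdef ?d P" for h P
  proof (cases "\<forall>c. \<exists>p<?d. \<exists>q<?d. diag_unit 0 p q \<noteq> complex_of_real c * P p q")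
    case True
    then show ?thesis using st[where h = h and P = P and Y = "diag_unit 0"] h P True by (simp add: diag_unit_herm_set)
  next
    case False
    then obtain c where "\<forall>p<?d. \<forall>q<?d. diag_unit 0 p q = complex_of_real c * P p q" by blast
    from this[rule_format, of 0 0] have P0: "P 0 0 \<noteq> 0" by (auto simp: diag_unit_def)
    have "\<exists>p<?d. \<exists>q<?d. diag_unit 1 p q \<noteq> complex_of_real c * P p q" for c
    proof (cases "c = 0")
      case True
      then show ?thesis by (intro exI[of _ 1] conjI) (auto simp: diag_unit_def)
    next
      case False
      then show ?thesis using P0 by (intro exI[of _ 0] conjI) (auto simp: diag_unit_def)
    qed
    then show ?thesis using st[where h = h and P = P and Y = "diag_unit 1"] h P by (simp add: diag_unit_herm_set)
  qed
  have lorQ: "lorentz (herm_set ?d) (Q h)" if h: "\<forall>i<n. posdef ?d (h i)" for h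
  proof (rule lorentz_from_point[OF B subspace_herm_set, of "id_entries ?d"])
    show p: "0 < Q h (id_entries ?d) (id_entries ?d)" using pos h by simp
    fix x assume x: "x \<in> herm_set ?d" "Q h x (id_entries ?d) = 0"
    show "Q h x x \<le> 0"
    proof (cases "\<forall>c. \<exists>p<?d. \<exists>q<?d. x p q \<noteq> complex_of_real c * id_entries ?d p q")
      case True
      then have "Q h (id_entries ?d) (id_entries ?d) * Q h x x < 0"
        using st[OF h posdef_id_entries x(1) True[rule_format]] x(2) symm_bilin_sym[OF B, of h x "id_entries ?d"] by simp
      then show ?thesis using p by (simp add: mult_less_0_iff)
    next
      case False
      then obtain c where c: "\<forall>p<?d. \<forall>q<?d. x p q = complex_of_real c * id_entries ?d p q" by blast
      have e: "Q h x x' = c * Q h (id_entries ?d) y" if "\<forall>p<?d. \<forall>q<?d. x' p q = y p q" for x' y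
      proof -
        have "Q h x x' = Q h (c *\<^sub>R id_entries ?d) y" unfolding Q_def
          by (rule polyop_polar_det_cong) (use c that in \<open>auto simp: scaleR_conv_of_real\<close>)
        then show ?thesis by (simp add: symm_bilin_simps[OF B])
      qed
      have "c = 0" using e[of "id_entries ?d" "id_entries ?d"] x p by simp
      then show ?thesis using e[of x x] by simp
    qed
  qed (simp add: id_entries_herm_set)
  have z: "deriv_coeff n g a = 0" if "\<not> (supported n a \<and> exp_degree n a = m)" for a using g(1)[of a] that by (auto simp: deriv_coeff_def)
  have g0: "0 \<le> deriv_coeff n g a" for a
  proof (cases "supported n a \<and> exp_degree n a = m")
    case True
    show ?thesis
    proof (cases "n = 0")
      case False
      show ?thesis
        by (rule coeff_nonneg) (use pos True False in \<open>auto simp: Q_def intro: less_imp_le\<close>)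
    next
      case n: True
      then have m: "m = 0" "a = 0" using True supported_exp_degree_0[of n a] by (auto simp: exp_degree_def)
      have "0 < deriv_coeff n g 0 * polar_det 2 [id_entries 2, id_entries 2]" using pos[of undefined "id_entries 2"] posdef_id_entries[of 2] n m
        by (simp add: Q_def numeral_2_eq_2)
      moreover have "0 < polar_det 2 [id_entries 2, id_entries 2]" by (rule polar_det_pos) auto
      ultimately show ?thesis using m by (simp add: zero_less_mult_iff)
    qed
  qed (simp add: z)
  have nzg: "nontriv n m (deriv_coeff n g)" by (rule deriv_coeff_pos_nontriv[OF g g0])
  \<comment> \<open>The exponents of \<open>g\<close> are at most \<open>m\<close>, so the constant
    exponent \<open>m + 2\<close> is admissible; the dual then has degree
    \<open>n * (m + 2) - m\<close>.\<close>
  define \<kappa> where "\<kappa> = const_exp n ?d"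
  have sk: "supported n \<kappa>" "exp_degree n \<kappa> = n * ?d" by (simp_all add: \<kappa>_def supported_const_exp)
  have lk: "i < n \<Longrightarrow> Poly_Mapping.lookup \<kappa> i = ?d" for i by (simp add: \<kappa>_def lookup_const_exp)
  have bd: "bounded_degrees n \<kappa> g" unfolding bounded_degrees_def
  proof (intro conjI ballI allI)
    show "Poly_Mapping.keys \<kappa> \<subseteq> {..<n}" using sk by (auto simp: supported_def in_keys_iff)
    fix a i assume "a \<in> Poly_Mapping.keys g"
    then have a: "supported n a" "exp_degree n a = m" using g by (auto simp: in_keys_iff)
    show "Poly_Mapping.lookup a i \<le> Poly_Mapping.lookup \<kappa> i"
    proof (cases "i < n")
      case True
      then show ?thesis using lookup_le_exp_degree[OF a(1), of i] a lk by simp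
    next
      case False
      then have "Poly_Mapping.lookup a i = 0" using a(1) unfolding supported_def by blast
      then show ?thesis by simp
    qed
  qed
  have "lorentz_coeff n (n * ?d - m) (dual_coeff n \<kappa> (deriv_coeff n g))" unfolding lorentz_coeff_def
  proof (intro conjI allI impI)
    show "0 \<le> dual_coeff n \<kappa> (deriv_coeff n g) b" for b using g0 mfact_pos[of n "\<kappa> - b"] by (simp add: dual_coeff_def)
    show "lorentz UNIV (\<lambda>x y. contract n (dual_coeff n \<kappa> (deriv_coeff n g)) (x # y # zs) 0)"
      if "length zs + 2 = n * ?d - m" "\<forall>z\<in>set zs. \<forall>i<n. 0 \<le> z i" for zs
      unfolding \<kappa>_def
    proof (rule lk_from_weak[OF _ g0 nzg])
      show "lorentz (herm_set ?d) (\<lambda>x y. polyop n (polar_det ?d) h m (deriv_coeff n g) [x, y])" if "\<And>i. i < n \<Longrightarrow> posdef ?d (h i)" for h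
        using lorQ[of h] that unfolding Q_def by blast
    qed (use that in auto)
    fix b assume "dual_coeff n \<kappa> (deriv_coeff n g) b \<noteq> 0"
    then have b: "Poly_Mapping.lookup b i \<le> Poly_Mapping.lookup \<kappa> i" and nb: "deriv_coeff n g (\<kappa> - b) \<noteq> 0" for i
      by (auto simp: dual_coeff_def split: if_splits)
    show "supported n b" unfolding supported_def
    proof (intro allI impI)
      fix i assume "Poly_Mapping.lookup b i \<noteq> 0"
      then have "Poly_Mapping.lookup \<kappa> i \<noteq> 0" using b[of i] by simp
      then show "i < n" using sk(1) by (simp add: supported_def)
    qed
    have "exp_degree n (\<kappa> - b) = m" using z[of "\<kappa> - b"] nb by blast
    then show "exp_degree n b = n * ?d - m" using exp_degree_minus[of b \<kappa> n, OF b] sk by simp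
  qed
  then show ?thesis using bd unfolding dually_lorentzian_iff by blast
qed

theorem corollary6p21:
  fixes n d :: nat and g :: mpoly
  assumes "2 \<le> d"
    and "in_vars n g"
    and "g \<noteq> 0"
    and "homogeneous (d - 2) g"
  shows "dually_lorentzian n g \<longleftrightarrow>
    (\<forall>H H' Hs.
       H \<in> Herm d \<and> H' \<in> Herm d \<and> (\<forall>i<n. Hs i \<in> Herm d) \<and>
       pos_def H \<and> (\<forall>i<n. pos_def (Hs i)) \<and>
       (\<forall>c::real. H' \<noteq> complex_of_real c \<cdot>\<^sub>m H) \<longrightarrow>
         0 < MD d n H H g Hs \<and>
         MD d n H H g Hs * MD d n H' H' g Hs < (MD d n H H' g Hs)\<^sup>2)"
proof -
  define m where "m = d - 2"
  have d: "d = m + 2" using assms(1) by (simp add: m_def)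
  have g: "supported n b \<and> exp_degree n b = m" if "Poly_Mapping.lookup g b \<noteq> 0" for b
    using assms that homogeneous_iff[OF assms(2)] by (auto simp: in_vars_iff m_def)
  define K :: real where "K = fact d * fact m"
  have K: "0 < K" by (simp add: K_def)
  define Q where "Q h x y = polyop n (polar_det d) h m (deriv_coeff n g) [x, y]" for h x y
  have MD: "Q (\<lambda>i. entries d (Hs i)) (entries d H) (entries d H') = K * MD d n H H' g Hs"
    if "H \<in> carrier_mat d d" "H' \<in> carrier_mat d d" "\<And>i. i < n \<Longrightarrow> Hs i \<in> carrier_mat d d" for H H' Hs
    using MD_polyop[where g = g and H = H and H' = H' and n = n and Hs = Hs and m = m, OF g] that by (simp add: Q_def K_def d)
  \<comment> \<open>Both inequalities are homogeneous, so the positive constant \<open>K\<close>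
    between \<open>Q\<close> and \<open>MD\<close> cancels.\<close>
  have S: "(0 < K * a \<and> (K * a) * (K * b) < (K * c)\<^sup>2) \<longleftrightarrow> (0 < a \<and> a * b < c\<^sup>2)" for a b c :: real
  proof -
    have "(K * a) * (K * b) < (K * c)\<^sup>2 \<longleftrightarrow> K\<^sup>2 * (a * b) < K\<^sup>2 * c\<^sup>2"
      by (simp add: power2_eq_square mult_ac)
    then show ?thesis using K by (simp add: zero_less_mult_iff)
  qed
  have C: "A \<in> carrier_mat d d" if "A \<in> Herm d" for A using that by (simp add: Herm_def)
  show ?thesis
  proof (intro iffI allI impI; (elim conjE)?)
    fix H H' Hs
    assume dl: "dually_lorentzian n g" and H: "H \<in> Herm d" "H' \<in> Herm d" "\<forall>i<n. Hs i \<in> Herm d"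
      and p: "pos_def H" "\<forall>i<n. pos_def (Hs i)" and ne: "\<forall>c::real. H' \<noteq> complex_of_real c \<cdot>\<^sub>m H"
    have ne': "\<exists>p<d. \<exists>q<d. entries d H' p q \<noteq> complex_of_real c * entries d H p q" for c
    proof (rule ccontr)
      assume "\<not> ?thesis"
      then have "H' = complex_of_real c \<cdot>\<^sub>m H" using C[OF H(1)] C[OF H(2)]
        by (intro eq_matI) (auto simp: entries_def)
      then show False using ne by blast
    qed
    have "0 < Q (\<lambda>i. entries d (Hs i)) (entries d H) (entries d H) \<and>
      Q (\<lambda>i. entries d (Hs i)) (entries d H) (entries d H) * Q (\<lambda>i. entries d (Hs i)) (entries d H') (entries d H')
        < (Q (\<lambda>i. entries d (Hs i)) (entries d H) (entries d H'))\<^sup>2"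
      unfolding Q_def d
      by (rule strict_of_dually_lorentzian[OF g assms(3) dl], unfold d[symmetric])
        (use H p ne' posdef_entries herm_set_entries in simp_all)
    then show "0 < MD d n H H g Hs \<and> MD d n H H g Hs * MD d n H' H' g Hs < (MD d n H H' g Hs)\<^sup>2"
      using C H by (simp add: MD S)
  next
    assume R: "\<forall>H H' Hs.
       H \<in> Herm d \<and> H' \<in> Herm d \<and> (\<forall>i<n. Hs i \<in> Herm d) \<and>
       pos_def H \<and> (\<forall>i<n. pos_def (Hs i)) \<and>
       (\<forall>c::real. H' \<noteq> complex_of_real c \<cdot>\<^sub>m H) \<longrightarrow>
         0 < MD d n H H g Hs \<and>
         MD d n H H g Hs * MD d n H' H' g Hs < (MD d n H H' g Hs)\<^sup>2"
    show "dually_lorentzian n g"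
    proof (rule dually_lorentzian_of_strict[OF g assms(3)], unfold d[symmetric])
      fix h P Y
      assume h: "\<forall>i<n. posdef d (h i)" and P: "posdef d P" and Y: "Y \<in> herm_set d"
        and ne: "\<And>c. \<exists>p<d. \<exists>q<d. Y p q \<noteq> complex_of_real c * P p q"
      have ne': "mat_of d Y \<noteq> complex_of_real c \<cdot>\<^sub>m mat_of d P" for c
        using ne[of c] by (auto simp: mat_eq_iff mat_of_def)
      have E: "Q h x y = K * MD d n (mat_of d x) (mat_of d y) g (\<lambda>i. mat_of d (h i))" for x y
      proof -
        have "Q h x y = Q (\<lambda>i. entries d (mat_of d (h i))) (entries d (mat_of d x)) (entries d (mat_of d y))"
          unfolding Q_def by (rule polyop_polar_det_cong) (simp_all add: entries_mat_of)
        then show ?thesis by (simp add: MD)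
      qed
      have "0 < MD d n (mat_of d P) (mat_of d P) g (\<lambda>i. mat_of d (h i)) \<and>
        MD d n (mat_of d P) (mat_of d P) g (\<lambda>i. mat_of d (h i)) * MD d n (mat_of d Y) (mat_of d Y) g (\<lambda>i. mat_of d (h i))
          < (MD d n (mat_of d P) (mat_of d Y) g (\<lambda>i. mat_of d (h i)))\<^sup>2"
        by (rule R[rule_format]) (use ne' h P Y pos_def_mat_of in \<open>auto simp: posdef_def intro!: Herm_mat_of\<close>)
      then have "0 < Q h P P \<and> Q h P P * Q h Y Y < (Q h P Y)\<^sup>2" unfolding E S .
      then show "0 < polyop n (polar_det d) h m (deriv_coeff n g) [P, P] \<and>
        polyop n (polar_det d) h m (deriv_coeff n g) [P, P] * polyop n (polar_det d) h m (deriv_coeff n g) [Y, Y] < (polyop n (polar_det d) h m (deriv_coeff n g) [P, Y])\<^sup>2"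
        unfolding Q_def .
    qed
  qed
qed

end
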